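(* Let $N\in\mathbb N_+$, let $\boldsymbol{\bar\jmath}=(j_1,\dots,j_N)$ be an $N$-tuple of spins in $\frac12\mathbb N_+$ and $v_1,\dots,v_N\in\mathbb C^*$. The transfer matrices satisfy, for all $j\in\frac12\mathbb N_+$, $$\boldsymbol t^{j,\boldsymbol{\bar\jmath}}(u)=\boldsymbol t^{j-\frac12,\boldsymbol{\bar\jmath}}(uq^{-\frac12})\,\boldsymbol t^{\frac12,\boldsymbol{\bar\jmath}}(uq^{j-\frac12})+\Big[\prod_{n=1}^N\beta^{(j_n)}(uq^{j-\frac12}v_n)\beta^{(j_n)}(uq^{j-\frac12}v_n^{-1})\Big]\frac{\Gamma_-(uq^{j-\frac32})\Gamma_+(uq^{j-\frac32})}{c(u^2q^{2j})c(u^2q^{2j-2})}\,\boldsymbol t^{j-1,\boldsymbol{\bar\jmath}}(uq^{-1}),$$ with $\boldsymbol t^{0,\boldsymbol{\bar\jmath}}(u)=1$ (and $\boldsymbol t^{-\frac12,\boldsymbol{\bar\jmath}}=0$).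
   Context: **Conventions.** $q\in\mathbb C^*$ is not a root of unity, $[n]_q=\frac{q^n-q^{-n}}{q-q^{-1}}$, $c(u)=u-u^{-1}$, $X_1=X\otimes\mathbb I$, $X_2=\mathbb I\otimes X$. Boundary parameters: $k_\pm\in\mathbb C^*$, $\varepsilon_\pm,\bar\varepsilon_\pm,\bar k_\pm\in\mathbb C$. **Fusion.** $B_{j,j'}=\sqrt{[j+j']_q[j-j'+1]_q}$; spin-$j$ matrices $(S_+)_{mn}=B_{j,j+1-m}\delta_{m,n-1}$, $(S_-)_{mn}=B_{j,j+1-n}\delta_{m-1,n}$, $(S_3)_{mn}=2(j+1-n)\delta_{mn}$. $\mathcal E^{(j)}:\mathbb C^{2j+1}\to\mathbb C^2\otimes\mathbb C^{2j}$ has nonzero entries $\mathcal E_{1,1}=1$, $\mathcal E_{1+n,1+n}=\prod_{p=0}^{n-1}\frac{B_{j-1/2,j-p-1/2}}{B_{j,j-p}}$ ($1\le n\le2j-1$), $\mathcal E_{2j+m,1+m}=[m]_q\mathcal E_{m,m}/B_{j,j+1-m}$ ($1\le m\le2j$). $\mathcal F^{(j)}:\mathbb C^2\otimes\mathbb C^{2j}\to\mathbb C^{2j+1}$ has nonzero entries $\mathcal F_{1,1}=1$, $\mathcal F_{n,n+2j-1}=\frac{\mathcal E_{n+2j-1,n}}{\mathcal E_{n,n}^2+\mathcal E_{n+2j-1,n}^2}$, $\mathcal F_{n,n}=\frac{1-\mathcal F_{n,n+2j-1}\mathcal E_{n+2j-1,n}}{\mathcal E_{n,n}}$ ($2\le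 n\le2j$), $\mathcal F_{2j+1,4j}=\mathcal E_{4j,2j+1}^{-1}$. **R-matrices.** $R^{(\frac12,0)}=\mathbb I_2$, $R^{(0,j)}=\mathbb I$, $R^{(\frac12,j)}(u)=\prod_{k=0}^{2j-2}c(uq^{j-\frac12-k})\Big((q-q^{-1})(\sigma_+\otimes S_-+\sigma_-\otimes S_+)+uq^{\frac12(\mathbb I+\sigma_z\otimes S_3)}-u^{-1}q^{-\frac12(\mathbb I+\sigma_z\otimes S_3)}\Big)$ on $\mathbb C^2\otimes\mathbb C^{2j+1}$, and $R^{(j_1,j_2)}(u)=\mathcal F^{(j_1)}_{\langle12\rangle}R_{13}^{(\frac12,j_2)}(uq^{-j_1+\frac12})R_{23}^{(j_1-\frac12,j_2)}(uq^{\frac12})\mathcal E^{(j_1)}_{\langle12\rangle}$ ($\langle12\rangle$: the maps act between space $\mathbb C^{2j_1+1}$ and the first two tensor factors). **K-matrices.** $K^{(0)}=1$, $K^{(\frac12)}(u)=\begin{pmatrix}u\varepsilon_++u^{-1}\varepsilon_-&k_+c(u^2)/(q-q^{-1})\\k_-c(u^2)/(q-q^{-1})&u\varepsilon_-+u^{-1}\varepsilon_+\end{pmatrix}$, $K^{(j)}(u)=\mathcal F^{(j)}K_1^{(\frac12)}(uq^{-j+\frac12})R^{(\frac12,j-\frac12)}(u^2q^{-j+1})K_2^{(j-\frac12)}(uq^{\frac12})\mathcal E^{(j)}$; $K^{+(j)}(u)=\frac1{f^{(j)}(u)}\big(K^{(j)}(u^{-1}q^{-1})\big)^t$ with $\varepsilon_\pm\to\bar\varepsilon_\mp$,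 $k_\pm\to-\bar k_\mp$, where $f^{(j)}(u)=\prod_{k=1}^{2j-1}\prod_{\ell=1}^kc(u^2q^{k+\ell+2-2j})c(u^{-2}q^{-k-\ell+2j})$ ($f^{(0)}=f^{(1/2)}=1$). **Transfer matrix.** $\boldsymbol t^{j,\boldsymbol{\bar\jmath}}(u)=\mathrm{tr}_{\mathbb C^{2j+1}}\big(K_a^{+(j)}(u)T_{a,N}(u)K_a^{(j)}(u)\hat T_{a,N}(u)\big)$, an operator on $\mathbb C^{2j_N+1}\otimes\dots\otimes\mathbb C^{2j_1+1}$, with $T_{a,N}(u)=R_{Na}^{(j_N,j)}(uv_N)\cdots R_{1a}^{(j_1,j)}(uv_1)$, $\hat T_{a,N}(u)=R_{1a}^{(j_1,j)}(uv_1^{-1})\cdots R_{Na}^{(j_N,j)}(uv_N^{-1})$, $a$ denoting the auxiliary space $\mathbb C^{2j+1}$ over which the trace is taken. **Scalars.** $\beta^{(j)}(u)=\prod_{k=0}^{2j-1}\big(-c(uq^{j+\frac12-k})c(uq^{-j-\frac12+k})\big)$; $\Gamma_-(u)=c(u^2)\Big(\varepsilon_+^2+\varepsilon_-^2+\varepsilon_+\varepsilon_-(u^2q^2+u^{-2}q^{-2})-k_+k_-\frac{c(u^2q^2)^2}{(q-q^{-1})^2}\Big)$; $\Gamma_+(u)=c(u^{-2}q^{-4})\Big(\bar\varepsilon_+^2+\bar\varepsilon_-^2+\bar\varepsilon_+\bar\varepsilon_-(u^2q^2+u^{-2}q^{-2})-\bar k_+\bar k_-\frac{c(u^2q^2)^2}{(q-q^{-1})^2}\Big)$.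 *)

theory Defs
  imports Complex_Main "Jordan_Normal_Form.Matrix"
begin

text \<open>
  Spins are encoded by their doubles: a spin \<open>j\<close> is represented by the natural number \<open>d = 2 j\<close>,
  so \<open>C^(2j+1)\<close> has dimension \<open>d + 1\<close>.  Half-integer powers of \<open>q\<close> are taken with respect to a
  chosen square root \<open>h\<close> of \<open>q\<close>, which is a parameter of all definitions: \<open>q = h^2\<close> and
  \<open>q^(m/2) = h powi m\<close>.
\<close>

section \<open>Matrices on tensor products\<close>

text \<open>Matrices specified by entries whose row and column numbers start at 1.\<close>

definition mat1 :: "nat \<Rightarrow> nat \<Rightarrow> (nat \<Rightarrow> nat \<Rightarrow> 'a) \<Rightarrow> 'a mat" where
  "mat1 nr nc f = mat nr nc (\<lambda>(i, k). f (i + 1) (k + 1))"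

definition kron :: "'a::times mat \<Rightarrow> 'a mat \<Rightarrow> 'a mat" (infixl "\<otimes>\<^sub>m" 80) where
  "A \<otimes>\<^sub>m B = mat (dim_row A * dim_row B) (dim_col A * dim_col B)
     (\<lambda>(i, k). A $$ (i div dim_row B, k div dim_col B) * B $$ (i mod dim_row B, k mod dim_col B))"

text \<open>
  A basis vector of the tensor product of spaces of dimensions \<open>ds ! 0, ds ! 1, \<dots>\<close> is numbered
  lexicographically, the leftmost factor being the most significant; this agrees with \<^const>\<open>kron\<close>.
  \<open>digit ds p i\<close> is the component of the \<open>i\<close>-th basis vector in factor \<open>p\<close> (counted from 0).
\<close>

definition digit :: "nat list \<Rightarrow> nat \<Rightarrow> nat \<Rightarrow> nat" where
  "digit ds p i = i div prod_list (drop (Suc p) ds) mod (ds ! p)"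

text \<open>
  The operator \<open>A\<^bsub>p p'\<^esub>\<close>: \<open>A\<close> acts on factor \<open>p\<close> (as its first space) and factor \<open>p'\<close> (as its
  second space), and as the identity on all other factors.
\<close>

definition embed2 :: "nat list \<Rightarrow> nat \<Rightarrow> nat \<Rightarrow> 'a::zero mat \<Rightarrow> 'a mat" where
  "embed2 ds p p' A = mat (prod_list ds) (prod_list ds) (\<lambda>(i, k).
     if \<forall>r < length ds. r \<noteq> p \<and> r \<noteq> p' \<longrightarrow> digit ds r i = digit ds r k
     then A $$ (digit ds p i * ds ! p' + digit ds p' i, digit ds p k * ds ! p' + digit ds p' k)
     else 0)"

text \<open>Partial trace over the last tensor factor, of dimension \<open>m\<close>.\<close>

definition ptrace_last :: "nat \<Rightarrow> nat \<Rightarrow> 'a::comm_monoid_add mat \<Rightarrow> 'a mat" where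
  "ptrace_last D m A = mat D D (\<lambda>(i, k). \<Sum>a<m. A $$ (i * m + a, k * m + a))"

definition mat_prod_list :: "nat \<Rightarrow> 'a::semiring_1 mat list \<Rightarrow> 'a mat" where
  "mat_prod_list D As = foldr (*) As (1\<^sub>m D)"


section \<open>Spin matrices and fusion\<close>

definition qc :: "complex \<Rightarrow> complex" where
  "qc u = u - inverse u"

text \<open>The \<open>q\<close>-number \<open>[m/2]\<^sub>q\<close>.\<close>

definition qnum :: "complex \<Rightarrow> int \<Rightarrow> complex" where
  "qnum h m = (h powi m - h powi (- m)) / qc (h^2)"

text \<open>\<open>B_coef h a b\<close> is \<open>B\<^bsub>j,j'\<^esub>\<close> for \<open>a = 2 j\<close> and \<open>b = 2 j'\<close>.\<close>

definition B_coef :: "complex \<Rightarrow> int \<Rightarrow> int \<Rightarrow> complex" where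
  "B_coef h a b = csqrt (qnum h (a + b) * qnum h (a - b + 2))"

definition S_plus :: "complex \<Rightarrow> nat \<Rightarrow> complex mat" where
  "S_plus h d = mat1 (d + 1) (d + 1)
     (\<lambda>m n. if n = m + 1 then B_coef h (int d) (int d + 2 - 2 * int m) else 0)"

definition S_minus :: "complex \<Rightarrow> nat \<Rightarrow> complex mat" where
  "S_minus h d = mat1 (d + 1) (d + 1)
     (\<lambda>m n. if m = n + 1 then B_coef h (int d) (int d + 2 - 2 * int n) else 0)"

text \<open>
  The diagonal matrices occurring in exponents of \<open>q\<close> have integer entries and are kept as integer
  matrices.
\<close>

definition S_3 :: "nat \<Rightarrow> int mat" where
  "S_3 d = mat1 (d + 1) (d + 1) (\<lambda>m n. if m = n then int d + 2 - 2 * int n else 0)"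

definition sigma_plus :: "complex mat" where
  "sigma_plus = mat_of_rows_list 2 [[0, 1], [0, 0]]"

definition sigma_minus :: "complex mat" where
  "sigma_minus = mat_of_rows_list 2 [[0, 0], [1, 0]]"

definition sigma_z :: "int mat" where
  "sigma_z = mat_of_rows_list 2 [[1, 0], [0, -1]]"

text \<open>\<open>E_diag h d n\<close> and \<open>E_low h d n\<close> are the entries \<open>(n, n)\<close> and \<open>(n + 2j - 1, n)\<close> of \<open>\<E>\<^sup>(\<^sup>j\<^sup>)\<close>.\<close>

definition E_diag :: "complex \<Rightarrow> nat \<Rightarrow> nat \<Rightarrow> complex" where
  "E_diag h d n = (\<Prod>p<n - 1.
     B_coef h (int d - 1) (int d - 2 * int p - 1) / B_coef h (int d) (int d - 2 * int p))"

definition E_low :: "complex \<Rightarrow> nat \<Rightarrow> nat \<Rightarrow> complex" where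
  "E_low h d n = (let m = n - 1 in
     qnum h (2 * int m) * E_diag h d m / B_coef h (int d) (int d + 2 - 2 * int m))"

definition fus_E :: "complex \<Rightarrow> nat \<Rightarrow> complex mat" where
  "fus_E h d = mat1 (2 * d) (d + 1) (\<lambda>r n.
     if r = n \<and> 1 \<le> n \<and> n \<le> d then E_diag h d n
     else if r = n + d - 1 \<and> 2 \<le> n \<and> n \<le> d + 1 then E_low h d n
     else 0)"

definition F_upp :: "complex \<Rightarrow> nat \<Rightarrow> nat \<Rightarrow> complex" where
  "F_upp h d n = E_low h d n / ((E_diag h d n)^2 + (E_low h d n)^2)"

definition fus_F :: "complex \<Rightarrow> nat \<Rightarrow> complex mat" where
  "fus_F h d = mat1 (d + 1) (2 * d) (\<lambda>n r.
     if n = 1 \<and> r = 1 then 1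
     else if 2 \<le> n \<and> n \<le> d \<and> r = n + d - 1 then F_upp h d n
     else if 2 \<le> n \<and> n \<le> d \<and> r = n then (1 - F_upp h d n * E_low h d n) / E_diag h d n
     else if n = d + 1 \<and> r = 2 * d then inverse (E_low h d (d + 1))
     else 0)"


section \<open>R-matrices\<close>

text \<open>\<open>q\<^bsup>M/2\<^esup>\<close> for a diagonal integer matrix \<open>M\<close>.\<close>

definition qpow_half :: "complex \<Rightarrow> int mat \<Rightarrow> complex mat" where
  "qpow_half h M = mat (dim_row M) (dim_col M) (\<lambda>(i, k). if i = k then h powi (M $$ (i, i)) else 0)"

text \<open>\<open>R\<^sup>(\<^sup>1\<^sup>/\<^sup>2\<^sup>,\<^sup>j\<^sup>)(u)\<close>; the case \<open>j = 0\<close> is the identity by convention, not by the general formula.\<close>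

definition R_half :: "complex \<Rightarrow> nat \<Rightarrow> complex \<Rightarrow> complex mat" where
  "R_half h d u = (if d = 0 then 1\<^sub>m 2 else
     (let M = 1\<^sub>m (2 * (d + 1)) + sigma_z \<otimes>\<^sub>m S_3 d in
      (\<Prod>k<d - 1. qc (u * h powi (int d - 1 - 2 * int k))) \<cdot>\<^sub>m
        (qc (h^2) \<cdot>\<^sub>m (sigma_plus \<otimes>\<^sub>m S_minus h d + sigma_minus \<otimes>\<^sub>m S_plus h d)
         + u \<cdot>\<^sub>m qpow_half h M
         - inverse u \<cdot>\<^sub>m qpow_half h (- M))))"

fun R_mat :: "complex \<Rightarrow> nat \<Rightarrow> nat \<Rightarrow> complex \<Rightarrow> complex mat" where
  "R_mat h 0 d2 u = 1\<^sub>m (d2 + 1)"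
| "R_mat h (Suc 0) d2 u = R_half h d2 u"
| "R_mat h (Suc (Suc n)) d2 u = (let d1 = Suc (Suc n) in
     (fus_F h d1 \<otimes>\<^sub>m 1\<^sub>m (d2 + 1))
     * embed2 [2, d1, d2 + 1] 0 2 (R_half h d2 (u * h powi (1 - int d1)))
     * (1\<^sub>m 2 \<otimes>\<^sub>m R_mat h (Suc n) d2 (u * h))
     * (fus_E h d1 \<otimes>\<^sub>m 1\<^sub>m (d2 + 1)))"


section \<open>K-matrices\<close>

record boundary =
  eps_plus :: complex
  eps_minus :: complex
  k_plus :: complex
  k_minus :: complex

definition K_half :: "complex \<Rightarrow> boundary \<Rightarrow> complex \<Rightarrow> complex mat" where
  "K_half h b u = mat_of_rows_list 2
     [[u * eps_plus b + inverse u * eps_minus b, k_plus b * qc (u^2) / qc (h^2)],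
      [k_minus b * qc (u^2) / qc (h^2), u * eps_minus b + inverse u * eps_plus b]]"

fun K_mat :: "complex \<Rightarrow> boundary \<Rightarrow> nat \<Rightarrow> complex \<Rightarrow> complex mat" where
  "K_mat h b 0 u = 1\<^sub>m 1"
| "K_mat h b (Suc 0) u = K_half h b u"
| "K_mat h b (Suc (Suc n)) u = (let d = Suc (Suc n) in
     fus_F h d
     * (K_half h b (u * h powi (1 - int d)) \<otimes>\<^sub>m 1\<^sub>m d)
     * R_half h (Suc n) (u^2 * h powi (2 - int d))
     * (1\<^sub>m 2 \<otimes>\<^sub>m K_mat h b (Suc n) (u * h))
     * fus_E h d)"

text \<open>
  For \<open>d \<ge> 2\<close>, the factors of \<open>f_norm h d u\<close> include, up to sign, those of
  \<open>f_norm h (d - 1) (u q^(-1/2))\<close> and \<open>f_norm h (d - 2) (u q^(-1))\<close> as well as \<open>qc (u^2 q^d)\<close> and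
  \<open>qc (u^2 q^(d - 2))\<close>; hence \<open>f_norm h d u \<noteq> 0\<close> excludes every pole in the recursion of the
  transfer matrices.
\<close>

definition f_norm :: "complex \<Rightarrow> nat \<Rightarrow> complex \<Rightarrow> complex" where
  "f_norm h d u = (\<Prod>k = 1..d - 1. \<Prod>l = 1..k.
     qc (u^2 * (h^2) powi (int k + int l + 2 - int d))
     * qc (u powi (-2) * (h^2) powi (- int k - int l + int d)))"

text \<open>The argument of \<open>K_dual\<close> holds the barred parameters.\<close>

definition K_dual :: "complex \<Rightarrow> boundary \<Rightarrow> nat \<Rightarrow> complex \<Rightarrow> complex mat" where
  "K_dual h b d u = (1 / f_norm h d u) \<cdot>\<^sub>m transpose_mat
     (K_mat h \<lparr>eps_plus = eps_minus b, eps_minus = eps_plus b, k_plus = - k_minus b, k_minus = - k_plus b\<rparr>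
        d (inverse u * inverse (h^2)))"


section \<open>Transfer matrix\<close>

text \<open>
  The sites are \<open>1, \<dots>, N\<close>, with spins \<open>J n / 2\<close>.  The tensor factors are ordered as
  \<open>V\<^sub>N \<otimes> \<dots> \<otimes> V\<^sub>1 \<otimes> V\<^sub>a\<close>: site \<open>n\<close> is factor \<open>N - n\<close> and the auxiliary space is factor \<open>N\<close>.
\<close>

definition site_dim :: "nat \<Rightarrow> (nat \<Rightarrow> nat) \<Rightarrow> nat" where
  "site_dim N J = (\<Prod>n = 1..N. J n + 1)"

definition R_site :: "complex \<Rightarrow> nat \<Rightarrow> (nat \<Rightarrow> nat) \<Rightarrow> nat \<Rightarrow> nat \<Rightarrow> complex \<Rightarrow> complex mat" where
  "R_site h N J d n u =
     embed2 (map (\<lambda>n. J n + 1) (rev [1..<N + 1]) @ [d + 1]) (N - n) N (R_mat h (J n) d u)"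

definition T_mat :: "complex \<Rightarrow> nat \<Rightarrow> (nat \<Rightarrow> nat) \<Rightarrow> (nat \<Rightarrow> complex) \<Rightarrow> nat \<Rightarrow> complex \<Rightarrow> complex mat" where
  "T_mat h N J v d u = mat_prod_list (site_dim N J * (d + 1))
     (map (\<lambda>n. R_site h N J d n (u * v n)) (rev [1..<N + 1]))"

definition T_hat :: "complex \<Rightarrow> nat \<Rightarrow> (nat \<Rightarrow> nat) \<Rightarrow> (nat \<Rightarrow> complex) \<Rightarrow> nat \<Rightarrow> complex \<Rightarrow> complex mat" where
  "T_hat h N J v d u = mat_prod_list (site_dim N J * (d + 1))
     (map (\<lambda>n. R_site h N J d n (u * inverse (v n))) [1..<N + 1])"

text \<open>
  The doubled auxiliary spin is an integer so that the convention \<open>t = 0\<close> for spin \<open>-1/2\<close> can be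
  included.
\<close>

definition transfer :: "complex \<Rightarrow> boundary \<Rightarrow> boundary \<Rightarrow> nat \<Rightarrow> (nat \<Rightarrow> nat) \<Rightarrow> (nat \<Rightarrow> complex)
    \<Rightarrow> int \<Rightarrow> complex \<Rightarrow> complex mat" where
  "transfer h b b' N J v a u = (let D = site_dim N J; d = nat a in
     if a < 0 then 0\<^sub>m D D
     else ptrace_last D (d + 1)
       ((1\<^sub>m D \<otimes>\<^sub>m K_dual h b' d u) * T_mat h N J v d u * (1\<^sub>m D \<otimes>\<^sub>m K_mat h b d u) * T_hat h N J v d u))"


section \<open>Scalars\<close>

definition beta :: "complex \<Rightarrow> nat \<Rightarrow> complex \<Rightarrow> complex" where
  "beta h d u = (\<Prod>k<d.
     - qc (u * h powi (int d + 1 - 2 * int k)) * qc (u * h powi (- int d - 1 + 2 * int k)))"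

definition Gamma_minus :: "complex \<Rightarrow> boundary \<Rightarrow> complex \<Rightarrow> complex" where
  "Gamma_minus h b u = (let q = h^2 in qc (u^2) *
     ((eps_plus b)^2 + (eps_minus b)^2
      + eps_plus b * eps_minus b * (u^2 * q^2 + u powi (-2) * q powi (-2))
      - k_plus b * k_minus b * (qc (u^2 * q^2))^2 / (q - inverse q)^2))"

definition Gamma_plus :: "complex \<Rightarrow> boundary \<Rightarrow> complex \<Rightarrow> complex" where
  "Gamma_plus h b u = (let q = h^2 in qc (u powi (-2) * q powi (-4)) *
     ((eps_plus b)^2 + (eps_minus b)^2
      + eps_plus b * eps_minus b * (u^2 * q^2 + u powi (-2) * q powi (-2))
      - k_plus b * k_minus b * (qc (u^2 * q^2))^2 / (q - inverse q)^2))"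

end

theory Submission
  imports Defs
begin

text \<open>
  Tensor products of all lengths are realised in one ring \<open>mx\<close>: a basis state assigns an index to each
  of countably many legs, and a leg of dimension 1 is the same as a leg with index 0.  So the fusion
  maps \<open>\<E>\<close> and \<open>\<F>\<close> are ring elements, and operators on disjoint legs commute.

  By the Yang-Baxter and reflection equations, \<open>\<E>\<close> intertwines the product
  \<open>M = U\<^sup>(\<^sup>1\<^sup>/\<^sup>2\<^sup>) R U\<^sup>(\<^sup>j\<^sup>-\<^sup>1\<^sup>/\<^sup>2\<^sup>)\<close> of double-row operators \<open>U = T K T\<close> with \<open>U\<^sup>(\<^sup>j\<^sup>)\<close>, and the projection onto the
  complementary spin \<open>j - 1\<close> intertwines \<open>M\<close> with \<open>U\<^sup>(\<^sup>j\<^sup>-\<^sup>1\<^sup>)\<close> up to quantum determinants, which are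
  computed by fusing a singlet.  The dual K-matrices behave in the same way.  Splitting the trace over
  \<open>C\<^sup>2 \<otimes> C\<^sup>2\<^sup>j\<close> along the two spins gives the transfer matrices of spins \<open>j\<close> and \<open>j - 1\<close>, whereas
  crossing unitarity of \<open>R\<close> factorises the same trace into those of spins \<open>1/2\<close> and \<open>j - 1/2\<close>.
  This is a recursion with the spin \<open>1/2\<close> factor on the left; as a continuant can be expanded from either
  end, it implies the recursion with that factor on the right.
\<close>

section \<open>Row- and column-finite matrices\<close>

text \<open>The R-matrices of higher spin are fused in their first space, the site, whereas the
  recursion fuses the auxiliary space. Relations for the auxiliary space are therefore proved by
  induction on the site spin (\<open>site_relations\<close>), from the explicit spin 1/2 matrices.
  Since \<open>EE\<close> is not an isometry, its left inverse \<open>FF\<close> is not its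
  transpose, and a product of operators must be shown to preserve the image of \<open>EE\<close>.
  This comes from a degenerate R-matrix: at one spectral parameter R is a multiple of
  \<open>trn Dt * Dt\<close>, and the Yang-Baxter or reflection equation moves it through the
  product to where it kills \<open>EE\<close>. The spin 1/2 factor ends up on the left because its
  double-row operator stands first in M, and the other one acts on the sites as well and cannot be
  passed. The change of side is made without commutativity of the transfer matrices. Everything is
  proved for each u separately, so scalars are cancelled only where they do not vanish. The
  condition that f is nonzero is inherited by all smaller instances met on expanding from either
  end.\<close>

type_synonym state = "nat \<Rightarrow> nat"

text \<open>Finite rows make products finite sums, and finite columns keep the type closed under the
  transposition \<open>trn\<close>, which the dual K-matrices require.\<close>

typedef mx = "{A :: state \<Rightarrow> state \<Rightarrow> complex.
    (\<forall>s. finite {t. A s t \<noteq> 0}) \<and> (\<forall>t. finite {s. A s t \<noteq> 0})}"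
  by (rule exI[of _ "\<lambda>_ _. 0"]) simp

setup_lifting type_definition_mx

lift_definition ent :: "mx \<Rightarrow> state \<Rightarrow> state \<Rightarrow> complex" is "\<lambda>A. A" .

lemma finite_ent_row: "finite {t. ent A s t \<noteq> 0}"
  by transfer simp

lemma mx_eqI: "(\<And>s t. ent A s t = ent B s t) \<Longrightarrow> A = B"
  by transfer (auto intro!: ext)

lemma finite_supp_prod_row:
  assumes "\<And>s. finite {t. A s t \<noteq> (0::complex)}" "\<And>s. finite {t. B s t \<noteq> (0::complex)}"
  shows "finite {t. (\<Sum>r\<in>{r. A s r \<noteq> 0}. A s r * B r t) \<noteq> 0}"
proof (rule finite_subset)
  show "{t. (\<Sum>r\<in>{r. A s r \<noteq> 0}. A s r * B r t) \<noteq> 0} \<subseteq> (\<Union>r\<in>{r. A s r \<noteq> 0}. {t. B r t \<noteq> 0})"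
  proof
    fix t assume "t \<in> {t. (\<Sum>r\<in>{r. A s r \<noteq> 0}. A s r * B r t) \<noteq> 0}"
    then obtain r where "r \<in> {r. A s r \<noteq> 0}" "A s r * B r t \<noteq> 0"
      by (metis (mono_tags, lifting) mem_Collect_eq sum.neutral)
    then show "t \<in> (\<Union>r\<in>{r. A s r \<noteq> 0}. {t. B r t \<noteq> 0})" by auto
  qed
qed (use assms in auto)

lemma finite_supp_prod_col:
  assumes "\<And>t. finite {s. A s t \<noteq> (0::complex)}" "\<And>t. finite {s. B s t \<noteq> (0::complex)}"
  shows "finite {s. (\<Sum>r\<in>{r. A s r \<noteq> 0}. A s r * B r t) \<noteq> 0}"
proof (rule finite_subset)
  show "{s. (\<Sum>r\<in>{r. A s r \<noteq> 0}. A s r * B r t) \<noteq> 0} \<subseteq> (\<Union>r\<in>{r. B r t \<noteq> 0}. {s. A s r \<noteq> 0})"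
  proof
    fix s assume "s \<in> {s. (\<Sum>r\<in>{r. A s r \<noteq> 0}. A s r * B r t) \<noteq> 0}"
    then obtain r where "r \<in> {r. A s r \<noteq> 0}" "A s r * B r t \<noteq> 0"
      by (metis (mono_tags, lifting) mem_Collect_eq sum.neutral)
    then show "s \<in> (\<Union>r\<in>{r. B r t \<noteq> 0}. {s. A s r \<noteq> 0})" by auto
  qed
qed (use assms in auto)

instantiation mx :: "{zero, one, plus, minus, uminus, times}"
begin

lift_definition zero_mx :: mx is "\<lambda>_ _. 0" by simp
lift_definition one_mx :: mx is "\<lambda>s t. if s = t then 1 else 0" by simp
lift_definition plus_mx :: "mx \<Rightarrow> mx \<Rightarrow> mx" is "\<lambda>A B s t. A s t + B s t"
proof -
  fix A B :: "state \<Rightarrow> state \<Rightarrow> complex"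
  assume *: "(\<forall>s. finite {t. A s t \<noteq> 0}) \<and> (\<forall>t. finite {s. A s t \<noteq> 0})"
    "(\<forall>s. finite {t. B s t \<noteq> 0}) \<and> (\<forall>t. finite {s. B s t \<noteq> 0})"
  have "finite {t. A s t + B s t \<noteq> 0}" for s
    by (rule finite_subset[of _ "{t. A s t \<noteq> 0} \<union> {t. B s t \<noteq> 0}"]) (use * in auto)
  moreover have "finite {s. A s t + B s t \<noteq> 0}" for t
    by (rule finite_subset[of _ "{s. A s t \<noteq> 0} \<union> {s. B s t \<noteq> 0}"]) (use * in auto)
  ultimately show "(\<forall>s. finite {t. A s t + B s t \<noteq> 0}) \<and> (\<forall>t. finite {s. A s t + B s t \<noteq> 0})"
    by blast
qed
lift_definition uminus_mx :: "mx \<Rightarrow> mx" is "\<lambda>A s t. - A s t" by simp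
definition minus_mx :: "mx \<Rightarrow> mx \<Rightarrow> mx" where "minus_mx A B = A + (- B)"
lift_definition times_mx :: "mx \<Rightarrow> mx \<Rightarrow> mx" is
  "\<lambda>A B s t. \<Sum>r\<in>{r. A s r \<noteq> 0}. A s r * B r t"
  by (auto intro!: finite_supp_prod_row finite_supp_prod_col)

instance ..
end

lift_definition scal :: "complex \<Rightarrow> mx \<Rightarrow> mx" is "\<lambda>c A s t. c * A s t"
  by (auto intro: rev_finite_subset)

lift_definition trn :: "mx \<Rightarrow> mx" is "\<lambda>A s t. A t s" by simp

section \<open>Action on functions of states\<close>

definition app :: "mx \<Rightarrow> (state \<Rightarrow> complex) \<Rightarrow> state \<Rightarrow> complex" where
  "app A f s = (\<Sum>t\<in>{t. ent A s t \<noteq> 0}. ent A s t * f t)"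

lemma app_eq:
  assumes "finite T" "\<And>t. ent A s t \<noteq> 0 \<Longrightarrow> t \<in> T"
  shows "app A f s = (\<Sum>t\<in>T. ent A s t * f t)"
  unfolding app_def by (rule sum.mono_neutral_left) (use assms in auto)

lemma ent_mult: 
  assumes "finite T" "\<And>r. ent A s r \<noteq> 0 \<Longrightarrow> ent B r t \<noteq> 0 \<Longrightarrow> r \<in> T"
  shows "ent (A * B) s t = (\<Sum>r\<in>T. ent A s r * ent B r t)"
proof -
  have "ent (A * B) s t = (\<Sum>r\<in>{r. ent A s r \<noteq> 0}. ent A s r * ent B r t)" by transfer simp
  also have "\<dots> = (\<Sum>r\<in>{r. ent A s r \<noteq> 0} \<union> T. ent A s r * ent B r t)"
    by (rule sum.mono_neutral_left) (use assms finite_ent_row in auto)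
  also have "\<dots> = (\<Sum>r\<in>T. ent A s r * ent B r t)"
    by (rule sum.mono_neutral_right) (use assms finite_ent_row in auto)
  finally show ?thesis .
qed

text \<open>Operators on disjoint legs, and bras or kets, admit only one intermediate state; this
  evaluates such products without a sum.\<close>

lemma ent_mult1:
  assumes "\<And>r. ent A s r \<noteq> 0 \<Longrightarrow> ent B r t \<noteq> 0 \<Longrightarrow> r = r0"
  shows "ent (A * B) s t = ent A s r0 * ent B r0 t"
  using ent_mult[of "{r0}" A s B t] assms by auto

lemma ent_simps [simp]:
  "ent 0 s t = 0" "ent 1 s t = (if s = t then 1 else 0)"
  "ent (A + B) s t = ent A s t + ent B s t" "ent (- A) s t = - ent A s t"
  "ent (scal c A) s t = c * ent A s t" "ent (trn A) s t = ent A t s"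
  by (transfer, simp)+

lemma app_delta: "app A (\<lambda>r. if r = t then 1 else 0) s = ent A s t"
  unfolding app_def by (simp add: sum.delta finite_ent_row if_distrib[of "\<lambda>x. _ * x"] cong: if_cong)

text \<open>The action on functions is faithful and turns products into composition, so
  associativity and all later identities in components can be checked through
  \<open>app\<close>.\<close>

lemma mx_ext: "(\<And>f s. app A f s = app B f s) \<Longrightarrow> A = B"
  by (rule mx_eqI) (metis app_delta)

lemma app_mult: "app (A * B) f s = app A (app B f) s"
proof -
  define R where "R = {r. ent A s r \<noteq> 0}"
  define T where "T = (\<Union>r\<in>R. {t. ent B r t \<noteq> 0})"
  have fR: "finite R" and fT: "finite T" by (simp_all add: R_def T_def finite_ent_row)
  have e: "ent (A * B) s t = (\<Sum>r\<in>R. ent A s r * ent B r t)" for t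
    by (rule ent_mult) (auto simp: R_def finite_ent_row)
  have "app (A * B) f s = (\<Sum>t\<in>T. ent (A * B) s t * f t)"
  proof (rule app_eq[OF fT])
    fix t assume "ent (A * B) s t \<noteq> 0"
    then show "t \<in> T" unfolding e T_def
      by (metis (mono_tags, lifting) UN_I mem_Collect_eq mult_zero_right sum.neutral)
  qed
  also have "\<dots> = (\<Sum>r\<in>R. ent A s r * (\<Sum>t\<in>T. ent B r t * f t))"
    unfolding e sum_distrib_right sum_distrib_left by (subst sum.swap) (simp add: mult.assoc)
  also have "\<dots> = (\<Sum>r\<in>R. ent A s r * app B f r)"
    by (intro sum.cong refl arg_cong2[where f="(*)"] app_eq[symmetric] fT) (auto simp: T_def)
  also have "\<dots> = app A (app B f) s" by (simp add: app_def R_def)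
  finally show ?thesis .
qed

lemma app_mult_fun [simp]: "app (A * B) f = app A (app B f)"
  by (rule ext) (rule app_mult)

lemma app_add [simp]: "app (A + B) f s = app A f s + app B f s"
proof -
  let ?T = "{t. ent A s t \<noteq> 0} \<union> {t. ent B s t \<noteq> 0}"
  have f: "finite ?T" by (simp add: finite_ent_row)
  have "app (A + B) f s = (\<Sum>t\<in>?T. ent (A + B) s t * f t)"
    by (rule app_eq[OF f]) auto
  moreover have "app A f s = (\<Sum>t\<in>?T. ent A s t * f t)" by (rule app_eq[OF f]) auto
  moreover have "app B f s = (\<Sum>t\<in>?T. ent B s t * f t)" by (rule app_eq[OF f]) auto
  ultimately show ?thesis by (simp add: sum.distrib algebra_simps)
qed

lemma app_fadd: "app A (\<lambda>x. f x + g x) s = app A f s + app A g s"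
  by (simp add: app_def sum.distrib algebra_simps)

lemma app_scal [simp]: "app (scal c A) f s = c * app A f s"
proof -
  have "app (scal c A) f s = (\<Sum>t\<in>{t. ent A s t \<noteq> 0}. ent (scal c A) s t * f t)"
    by (rule app_eq) (auto simp: finite_ent_row)
  then show ?thesis by (simp add: app_def sum_distrib_left mult.assoc)
qed

lemma app_fscal: "app A (\<lambda>x. c * f x) s = c * app A f s"
  by (simp add: app_def sum_distrib_left algebra_simps)

lemma app_one [simp]: "app 1 f s = f s"
  using app_eq[of "{s}" 1 s f] by (auto split: if_splits)

lemma app_zero [simp]: "app 0 f s = 0"
  by (simp add: app_def)

instance mx :: ring_1
proof
  fix A B C :: mx
  show "A * B * C = A * (B * C)" by (rule mx_ext) (simp add: app_mult)
  show "A + B + C = A + (B + C)" by (rule mx_eqI) simp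
  show "A + B = B + A" by (rule mx_eqI) simp
  show "0 + A = A" by (rule mx_eqI) simp
  show "- A + A = 0" by (rule mx_eqI) simp
  show "A - B = A + - B" by (rule minus_mx_def)
  show "(A + B) * C = A * C + B * C" by (rule mx_ext) (simp add: app_mult)
  have "app B f = app B f" for f ..
  show "A * (B + C) = A * B + A * C"
  proof (rule mx_ext)
    fix f s
    have "app (B + C) f = (\<lambda>x. app B f x + app C f x)" by auto
    then show "app (A * (B + C)) f s = app (A * B + A * C) f s"
      by (simp add: app_mult app_fadd)
  qed
  have "app 1 f = f" for f by auto
  then show "1 * A = A" "A * 1 = A" by (auto intro!: mx_ext simp: app_mult)
  have "ent 0 undefined undefined \<noteq> ent 1 undefined undefined" by simp
  then show "(0::mx) \<noteq> 1" by metis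
qed

lemma scal_mult_left [simp]: "scal c A * B = scal c (A * B)"
  by (rule mx_ext) (simp add: app_mult)

lemma scal_mult_right [simp]: "A * scal c B = scal c (A * B)"
proof (rule mx_ext)
  fix f s
  have "app (scal c B) f = (\<lambda>x. c * app B f x)" by auto
  then show "app (A * scal c B) f s = app (scal c (A * B)) f s" by (simp add: app_mult app_fscal)
qed

lemma scal_scal [simp]: "scal c (scal d A) = scal (c * d) A"
  by (rule mx_eqI) simp

lemma scal_one [simp]: "scal 1 A = A"
  by (rule mx_eqI) simp

lemma scal_zero_right [simp]: "scal c 0 = 0"
  by (rule mx_eqI) simp

lemma scal_zero_left [simp]: "scal 0 A = 0"
  by (rule mx_eqI) simp

lemma scal_add_right: "scal c (A + B) = scal c A + scal c B"
  by (rule mx_eqI) (simp add: algebra_simps)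

lemma scal_add_left: "scal (c + d) A = scal c A + scal d A"
  by (rule mx_eqI) (simp add: algebra_simps)

lemma scal_sum: "scal c (sum f I) = (\<Sum>i\<in>I. scal c (f i))"
  by (induction I rule: infinite_finite_induct) (simp_all add: scal_add_right)

lemma ent_sum: "ent (sum f I) s t = (\<Sum>i\<in>I. ent (f i) s t)"
  by (induction I rule: infinite_finite_induct) simp_all

lemma scal_eq_0_iff: "scal c A = 0 \<longleftrightarrow> c = 0 \<or> A = 0"
proof
  assume "scal c A = 0"
  then have "c * ent A s t = 0" for s t by (metis ent_simps(1,5))
  then show "c = 0 \<or> A = 0" by (metis ent_simps(1) mult_eq_0_iff mx_eqI)
qed auto

lemma scal_cancel: "c \<noteq> 0 \<Longrightarrow> scal c A = scal c B \<Longrightarrow> A = B"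
  by (metis left_inverse scal_one scal_scal)

lemma trn_mult [simp]: "trn (A * B) = trn B * trn A"
proof (rule mx_eqI)
  fix s t
  let ?T = "{r. ent A t r \<noteq> 0}"
  have f: "finite ?T" by (simp add: finite_ent_row)
  show "ent (trn (A * B)) s t = ent (trn B * trn A) s t"
    using ent_mult[OF f, of A t B s] ent_mult[OF f, of "trn B" s "trn A" t] by (simp add: mult.commute)
qed

lemma trn_simps [simp]: "trn (A + B) = trn A + trn B" "trn (scal c A) = scal c (trn A)"
  "trn (trn A) = A" "trn 1 = 1" "trn 0 = 0"
  by (rule mx_eqI; simp)+

section \<open>Operators of the form A \<otimes> 1 with A acting on a given set of legs\<close>

definition on_legs :: "nat set \<Rightarrow> mx \<Rightarrow> bool" where
  "on_legs P A \<longleftrightarrow> (\<forall>s t. ent A s t \<noteq> 0 \<longrightarrow> (\<forall>r. r \<notin> P \<longrightarrow> s r = t r))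
     \<and> (\<forall>s t s' t'. (\<forall>r\<in>P. s r = s' r \<and> t r = t' r) \<longrightarrow> (\<forall>r. r \<notin> P \<longrightarrow> s r = t r \<and> s' r = t' r)
          \<longrightarrow> ent A s t = ent A s' t')"

lemma on_legs_off: "on_legs P A \<Longrightarrow> ent A s t \<noteq> 0 \<Longrightarrow> r \<notin> P \<Longrightarrow> s r = t r"
  using on_legs_def[THEN iffD1, THEN conjunct1] by blast

lemma on_legs_eq:
  assumes "on_legs P A" "\<And>r. r \<in> P \<Longrightarrow> s r = s' r \<and> t r = t' r"
    "\<And>r. r \<notin> P \<Longrightarrow> s r = t r \<and> s' r = t' r"
  shows "ent A s t = ent A s' t'"
proof -
  have "\<forall>r\<in>P. s r = s' r \<and> t r = t' r" "\<forall>r. r \<notin> P \<longrightarrow> s r = t r \<and> s' r = t' r"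
    using assms(2,3) by blast+
  then show ?thesis using assms(1)[unfolded on_legs_def, THEN conjunct2] by blast
qed

lemma on_legsI:
  assumes "\<And>s t r. ent A s t \<noteq> 0 \<Longrightarrow> r \<notin> P \<Longrightarrow> s r = t r"
    and "\<And>s t s' t'. (\<And>r. r \<in> P \<Longrightarrow> s r = s' r \<and> t r = t' r) \<Longrightarrow>
      (\<And>r. r \<notin> P \<Longrightarrow> s r = t r \<and> s' r = t' r) \<Longrightarrow> ent A s t = ent A s' t'"
  shows "on_legs P A"
  using assms unfolding on_legs_def by blast

lemma on_legs_mono:
  assumes A: "on_legs P A" and PQ: "P \<subseteq> Q"
  shows "on_legs Q A"
  unfolding on_legs_def
proof (intro conjI allI impI)
  fix s t r assume "ent A s t \<noteq> 0" "r \<notin> Q"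
  then show "s r = t r" using on_legs_off[OF A] PQ by blast
next
  fix s t s' t' :: state assume *: "\<forall>r\<in>Q. s r = s' r \<and> t r = t' r" "\<forall>r. r \<notin> Q \<longrightarrow> s r = t r \<and> s' r = t' r"
  show "ent A s t = ent A s' t'"
  proof (cases "\<forall>r. r \<notin> P \<longrightarrow> s r = t r")
    case True
    show ?thesis
    proof (rule on_legs_eq[OF A])
      show "s r = s' r \<and> t r = t' r" if "r \<in> P" for r using that PQ * by blast
      show "s r = t r \<and> s' r = t' r" if "r \<notin> P" for r using that True * by (metis)
    qed
  next
    case False
    then obtain r where r: "r \<notin> P" "s r \<noteq> t r" by blast
    then have "r \<in> Q" using * by blast
    then have "s' r \<noteq> t' r" using * r by auto
    then show ?thesis using on_legs_off[OF A] r by metis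
  qed
qed

lemma on_legs_mult:
  assumes A: "on_legs P A" and B: "on_legs P B"
  shows "on_legs P (A * B)"
  unfolding on_legs_def
proof (intro conjI allI impI)
  fix s t r assume ne: "ent (A * B) s t \<noteq> 0" and r: "r \<notin> P"
  have "ent (A * B) s t = (\<Sum>u\<in>{u. ent A s u \<noteq> 0}. ent A s u * ent B u t)"
    by (rule ent_mult) (auto simp: finite_ent_row)
  with ne have "(\<Sum>u\<in>{u. ent A s u \<noteq> 0}. ent A s u * ent B u t) \<noteq> 0" by simp
  then obtain u where "ent A s u * ent B u t \<noteq> 0"
    by (rule sum.not_neutral_contains_not_neutral)
  then have "ent A s u \<noteq> 0" "ent B u t \<noteq> 0" by auto
  then show "s r = t r" using on_legs_off[OF A, of s u r] on_legs_off[OF B, of u t r] r by simp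
next
  fix s t s' t' :: state assume *: "\<forall>r\<in>P. s r = s' r \<and> t r = t' r" "\<forall>r. r \<notin> P \<longrightarrow> s r = t r \<and> s' r = t' r"
  \<comment> \<open>\<open>g\<close> and \<open>g'\<close> exchange the values of an intermediate
    state outside \<open>P\<close>, those of \<open>s\<close> against those of \<open>s'\<close>.
    This matches the nonzero terms of the two sums bijectively.\<close>
  define g where "g u r = (if r \<in> P then u r else s' r)" for u :: state and r :: nat
  define g' where "g' u r = (if r \<in> P then u r else s r)" for u :: state and r :: nat
  have e1: "ent (A * B) s t = (\<Sum>u\<in>{u. ent A s u \<noteq> 0}. ent A s u * ent B u t)"
    by (rule ent_mult) (auto simp: finite_ent_row)
  have e2: "ent (A * B) s' t' = (\<Sum>u\<in>{u. ent A s' u \<noteq> 0}. ent A s' u * ent B u t')"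
    by (rule ent_mult) (auto simp: finite_ent_row)
  have A': "ent A s' (g u) = ent A s u" if "\<forall>r. r \<notin> P \<longrightarrow> s r = u r" for u
    using * that by (intro on_legs_eq[OF A]) (auto simp: g_def)
  have B': "ent B (g u) t' = ent B u t" if "\<forall>r. r \<notin> P \<longrightarrow> s r = u r" for u
    using * that by (intro on_legs_eq[OF B]) (auto simp: g_def)
  have A'': "ent A s (g' u) = ent A s' u" if "\<forall>r. r \<notin> P \<longrightarrow> s' r = u r" for u
    using * that by (intro on_legs_eq[OF A]) (auto simp: g'_def)
  have gg: "g (g' u) = u" if "\<forall>r. r \<notin> P \<longrightarrow> s' r = u r" for u
    using that by (auto simp: g_def g'_def)
  have gg': "g' (g u) = u" if "\<forall>r. r \<notin> P \<longrightarrow> s r = u r" for u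
    using that by (auto simp: g_def g'_def)
  have off: "\<forall>r. r \<notin> P \<longrightarrow> s r = u r" if "ent A s u \<noteq> 0" for u using on_legs_off[OF A that] by auto
  have off': "\<forall>r. r \<notin> P \<longrightarrow> s' r = u r" if "ent A s' u \<noteq> 0" for u using on_legs_off[OF A that] by auto
  show "ent (A * B) s t = ent (A * B) s' t'"
    unfolding e1 e2
  proof (rule sum.reindex_bij_witness[of _ g' g])
    fix u assume "u \<in> {u. ent A s u \<noteq> 0}"
    then show "g' (g u) = u" "g u \<in> {u. ent A s' u \<noteq> 0}"
      "ent A s' (g u) * ent B (g u) t' = ent A s u * ent B u t"
      using off gg' A' B' by auto
  next
    fix u assume "u \<in> {u. ent A s' u \<noteq> 0}"
    then show "g (g' u) = u" "g' u \<in> {u. ent A s u \<noteq> 0}"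
      using off' gg A'' by auto
  qed
qed

lemma on_legs_zero: "on_legs P 0" by (simp add: on_legs_def)

lemma on_legs_one: "on_legs P 1"
proof -
  have "s = t \<longleftrightarrow> s' = t'"
    if "\<forall>r\<in>P. s r = s' r \<and> t r = t' r" "\<forall>r. r \<notin> P \<longrightarrow> s r = t r \<and> s' r = t' r"
    for s t s' t' :: state
  proof -
    have "s = t \<longleftrightarrow> (\<forall>r\<in>P. s r = t r)" "s' = t' \<longleftrightarrow> (\<forall>r\<in>P. s' r = t' r)"
      using that(2) by (auto simp: fun_eq_iff)
    then show ?thesis using that(1) by auto
  qed
  then have "(if s = t then 1 else (0::complex)) = (if s' = t' then 1 else 0)"
    if "\<forall>r\<in>P. s r = s' r \<and> t r = t' r" "\<forall>r. r \<notin> P \<longrightarrow> s r = t r \<and> s' r = t' r"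
    for s t s' t' :: state
    using that by presburger
  then show ?thesis unfolding on_legs_def ent_simps by metis
qed

lemma on_legs_add:
  assumes A: "on_legs P A" and B: "on_legs P B"
  shows "on_legs P (A + B)"
proof (rule on_legsI)
  fix s t r assume "ent (A + B) s t \<noteq> 0" "r \<notin> P"
  then show "s r = t r" using on_legs_off[OF A, of s t r] on_legs_off[OF B, of s t r] by fastforce
next
  fix s t s' t' :: state
  assume *: "\<And>r. r \<in> P \<Longrightarrow> s r = s' r \<and> t r = t' r" "\<And>r. r \<notin> P \<Longrightarrow> s r = t r \<and> s' r = t' r"
  show "ent (A + B) s t = ent (A + B) s' t'"
    using on_legs_eq[OF A *] on_legs_eq[OF B *] by simp
qed

lemma on_legs_scal:
  assumes A: "on_legs P A" shows "on_legs P (scal c A)"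
proof (rule on_legsI)
  fix s t r assume "ent (scal c A) s t \<noteq> 0" "r \<notin> P"
  then show "s r = t r" using on_legs_off[OF A, of s t r] by simp
next
  fix s t s' t' :: state
  assume *: "\<And>r. r \<in> P \<Longrightarrow> s r = s' r \<and> t r = t' r" "\<And>r. r \<notin> P \<Longrightarrow> s r = t r \<and> s' r = t' r"
  show "ent (scal c A) s t = ent (scal c A) s' t'" using on_legs_eq[OF A *] by simp
qed

lemma on_legs_trn:
  assumes A: "on_legs P A" shows "on_legs P (trn A)"
proof (rule on_legsI)
  fix s t r assume "ent (trn A) s t \<noteq> 0" "r \<notin> P"
  then show "s r = t r" using on_legs_off[OF A, of t s r] by simp
next
  fix s t s' t' :: state
  assume *: "\<And>r. r \<in> P \<Longrightarrow> s r = s' r \<and> t r = t' r" "\<And>r. r \<notin> P \<Longrightarrow> s r = t r \<and> s' r = t' r"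
  show "ent (trn A) s t = ent (trn A) s' t'"
    unfolding ent_simps by (rule on_legs_eq[OF A]) (use * in metis)+
qed

lemma on_legs_sum: "(\<And>i. i \<in> I \<Longrightarrow> on_legs P (f i)) \<Longrightarrow> on_legs P (sum f I)"
  by (induction I rule: infinite_finite_induct) (simp_all add: on_legs_zero on_legs_add)

text \<open>Each entry of either product has a single intermediate state: in \<open>u\<close> the
  legs of \<open>A\<close> have already changed, in \<open>v\<close> those of
  \<open>B\<close>.\<close>

lemma commute:
  assumes A: "on_legs P A" and B: "on_legs Q B" and PQ: "P \<inter> Q = {}"
  shows "A * B = B * A"
proof (rule mx_eqI)
  fix s t :: state
  define u where "u r = (if r \<in> P then t r else s r)" for r
  define v where "v r = (if r \<in> P then s r else t r)" for r
  have 1: "ent (A * B) s t = ent A s u * ent B u t"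
  proof (rule ent_mult1)
    fix r assume "ent A s r \<noteq> 0" "ent B r t \<noteq> 0"
    then show "r = u" using on_legs_off[OF A] on_legs_off[OF B] PQ by (fastforce simp: u_def)
  qed
  have 2: "ent (B * A) s t = ent B s v * ent A v t"
  proof (rule ent_mult1)
    fix r assume "ent B s r \<noteq> 0" "ent A r t \<noteq> 0"
    then show "r = v" using on_legs_off[OF A] on_legs_off[OF B] PQ by (fastforce simp: v_def)
  qed
  show "ent (A * B) s t = ent (B * A) s t"
  proof (cases "\<forall>r. r \<notin> P \<union> Q \<longrightarrow> s r = t r")
    case True
    have "ent A s u = ent A v t"
      by (rule on_legs_eq[OF A]) (auto simp: u_def v_def)
    moreover have "ent B u t = ent B s v"
      by (rule on_legs_eq[OF B]) (use True PQ in \<open>auto simp: u_def v_def\<close>)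
    ultimately show ?thesis using 1 2 by simp
  next
    case False
    then obtain r where r: "r \<notin> P" "r \<notin> Q" "s r \<noteq> t r" by auto
    then have "ent B u t = 0" "ent B s v = 0"
      using on_legs_off[OF B, of u t r] on_legs_off[OF B, of s v r] by (auto simp: u_def v_def)
    then show ?thesis using 1 2 by simp
  qed
qed

section \<open>Operators on legs\<close>

text \<open>Mixed-radix value with the leftmost place most significant, the convention shared by
  \<open>kron\<close> and \<open>digit\<close>; \<open>digit\<close> reads off the places
  again.\<close>

fun enc :: "nat list \<Rightarrow> nat list \<Rightarrow> nat" where
  "enc (d # ds) (x # xs) = x * prod_list ds + enc ds xs"
| "enc _ _ = 0"

lemma enc_less: "length xs = length ds \<Longrightarrow> (\<And>i. i < length ds \<Longrightarrow> xs ! i < ds ! i) \<Longrightarrow> enc ds xs < prod_list ds"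
proof (induction ds xs rule: enc.induct)
  case (1 d ds x xs)
  have "enc ds xs < prod_list ds"
  proof (rule 1(1))
    show "xs ! i < ds ! i" if "i < length ds" for i using 1(3)[of "Suc i"] that by simp
  qed (use 1(2) in simp)
  moreover have "x < d" using 1(3)[of 0] by simp
  then have "Suc x * prod_list ds \<le> d * prod_list ds" by (intro mult_le_mono) auto
  ultimately show ?case by simp
qed auto

lemma digit_Cons_Suc: "digit (d # ds) (Suc r) i = digit ds r i"
  by (simp add: digit_def)

lemma digit_enc: "length xs = length ds \<Longrightarrow> (\<And>i. i < length ds \<Longrightarrow> xs ! i < ds ! i) \<Longrightarrow> r < length ds \<Longrightarrow>
   digit ds r (enc ds xs) = xs ! r"
proof (induction ds xs arbitrary: r rule: enc.induct)
  case (1 d ds x xs)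
  have lt: "xs ! i < ds ! i" if "i < length ds" for i using 1(3)[of "Suc i"] that by simp
  have len: "length xs = length ds" using 1(2) by simp
  have e: "enc ds xs < prod_list ds" by (rule enc_less[OF len lt])
  show ?case
  proof (cases r)
    case 0
    then show ?thesis using e 1(3)[of 0] by (simp add: digit_def div_mult_self3)
  next
    case (Suc r')
    have "digit ds r' (x * prod_list ds + enc ds xs) = digit ds r' (enc ds xs)"
    proof -
      have r': "r' < length ds" using Suc 1(4) by simp
      define Q where "Q = prod_list (drop (Suc r') ds)"
      have "prod_list ds = prod_list (take r' ds) * (ds ! r' * Q)"
        using id_take_nth_drop[OF r'] unfolding Q_def
        by (metis prod_list.Cons prod_list.append)
      moreover have "Q > 0" using e calculation by (cases "Q = 0") auto
      moreover have e1: "x * prod_list ds + enc ds xs = enc ds xs + (x * prod_list (take r' ds) * ds ! r') * Q"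
        by (simp add: calculation(1))
      ultimately have "(x * prod_list ds + enc ds xs) div Q = x * prod_list (take r' ds) * ds ! r' + enc ds xs div Q"
        unfolding e1 by (intro div_mult_self1) simp
      then show ?thesis by (simp add: digit_def Q_def)
    qed
    then show ?thesis using 1(1)[OF len lt] Suc 1(4) by (simp add: digit_Cons_Suc)
  qed
qed auto

lemma digit_less: "r < length ds \<Longrightarrow> i < prod_list ds \<Longrightarrow> digit ds r i < ds ! r"
proof -
  assume r: "r < length ds" and i: "i < prod_list ds"
  have "prod_list ds = prod_list (take r ds) * (ds ! r * prod_list (drop (Suc r) ds))"
    using id_take_nth_drop[OF r] by (metis prod_list.Cons prod_list.append)
  then have "ds ! r \<noteq> 0" using i by (cases "ds ! r = 0") auto
  then show ?thesis by (simp add: digit_def)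
qed

lemma enc_digit: "i < prod_list ds \<Longrightarrow> enc ds (map (\<lambda>r. digit ds r i) [0..<length ds]) = i"
proof (induction ds arbitrary: i)
  case (Cons d ds)
  let ?m = "prod_list ds"
  have m: "?m > 0" using Cons.prems by (cases "?m = 0") auto
  have "enc (d # ds) (map (\<lambda>r. digit (d # ds) r i) [0..<length (d # ds)])
     = enc (d # ds) (digit (d # ds) 0 i # map (\<lambda>r. digit (d # ds) r i) (map Suc [0..<length ds]))"
    by (simp add: upt_conv_Cons map_Suc_upt del: upt_Suc enc.simps)
  also have "\<dots> = digit (d # ds) 0 i * ?m + enc ds (map (\<lambda>r. digit ds r i) [0..<length ds])"
    by (simp add: digit_Cons_Suc comp_def)
  \<comment> \<open>The lower places see only the remainder, because \<open>?m\<close> is a multiple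
    of \<open>ds ! r * Q\<close> for each of them.\<close>
  also have "(map (\<lambda>r. digit ds r i) [0..<length ds]) = (map (\<lambda>r. digit ds r (i mod ?m)) [0..<length ds])"
  proof (rule map_cong[OF refl])
    fix r assume "r \<in> set [0..<length ds]"
    then have r: "r < length ds" by simp
    define Q where "Q = prod_list (drop (Suc r) ds)"
    have P: "?m = prod_list (take r ds) * ds ! r * Q"
      using id_take_nth_drop[OF r] unfolding Q_def
      by (metis prod_list.Cons prod_list.append mult.assoc)
    then have Q: "Q > 0" using m by (cases "Q = 0") auto
    have "i = i mod ?m + (i div ?m) * prod_list (take r ds) * ds ! r * Q"
      using P by (metis mod_div_mult_eq mult.assoc)
    then have "i div Q = (i mod ?m + (i div ?m) * prod_list (take r ds) * ds ! r * Q) div Q" by (rule arg_cong)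
    also have "\<dots> = (i div ?m) * prod_list (take r ds) * ds ! r + i mod ?m div Q"
      using Q by (intro div_mult_self1) simp
    finally have "i div Q = (i div ?m) * prod_list (take r ds) * ds ! r + i mod ?m div Q" .
    then show "digit ds r i = digit ds r (i mod ?m)" by (simp add: digit_def Q_def)
  qed
  also have "enc ds \<dots> = i mod ?m" using Cons.IH[of "i mod ?m"] m by simp
  also have "digit (d # ds) 0 i = i div ?m" using Cons.prems m by (simp add: digit_def less_mult_imp_div_less)
  finally show ?case by simp
qed simp

lemma enc_append: "length xs = length ds \<Longrightarrow> enc (ds @ es) (xs @ ys) = enc ds xs * prod_list es + enc es ys"
  by (induction ds xs rule: enc.induct) (auto simp: algebra_simps)

definition inr :: "nat list \<Rightarrow> nat list \<Rightarrow> state \<Rightarrow> bool" where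
  "inr ps ds s \<longleftrightarrow> (\<forall>i<length ps. s (ps ! i) < ds ! i)"

definition encs :: "nat list \<Rightarrow> nat list \<Rightarrow> state \<Rightarrow> nat" where
  "encs ps ds s = enc ds (map s ps)"

text \<open>Writes the digits of \<open>k\<close> into the legs \<open>ps\<close>. This parametrises
  the states that can stand between two operators on those legs.\<close>

definition decs :: "nat list \<Rightarrow> nat list \<Rightarrow> state \<Rightarrow> nat \<Rightarrow> state" where
  "decs ps ds s k = (\<lambda>r. case map_of (zip ps [0..<length ps]) r of None \<Rightarrow> s r | Some i \<Rightarrow> digit ds i k)"

lemma decs_nth: "distinct ps \<Longrightarrow> i < length ps \<Longrightarrow> decs ps ds s k (ps ! i) = digit ds i k"
  by (simp add: decs_def map_of_zip_nth)

lemma decs_off: "r \<notin> set ps \<Longrightarrow> decs ps ds s k r = s r"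
proof -
  assume "r \<notin> set ps"
  then have "map_of (zip ps [0..<length ps]) r = None" by simp
  then show ?thesis unfolding decs_def by (simp only: option.case)
qed

lemma inr_decs: "distinct ps \<Longrightarrow> length ps = length ds \<Longrightarrow> k < prod_list ds \<Longrightarrow> inr ps ds (decs ps ds s k)"
  by (simp add: inr_def decs_nth digit_less)

lemma encs_decs:
  assumes "distinct ps" "length ps = length ds" "k < prod_list ds"
  shows "encs ps ds (decs ps ds s k) = k"
proof -
  have "map (decs ps ds s k) ps = map (\<lambda>r. digit ds r k) [0..<length ds]"
    by (rule nth_equalityI) (use assms in \<open>auto simp: decs_nth\<close>)
  then show ?thesis using enc_digit[OF assms(3)] by (simp add: encs_def)
qed

lemma encs_less: "length ps = length ds \<Longrightarrow> inr ps ds s \<Longrightarrow> encs ps ds s < prod_list ds"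
  unfolding encs_def inr_def by (rule enc_less) auto

lemma digit_encs: "length ps = length ds \<Longrightarrow> inr ps ds s \<Longrightarrow> i < length ps \<Longrightarrow> digit ds i (encs ps ds s) = s (ps ! i)"
  unfolding encs_def inr_def by (subst digit_enc) auto

lemma decs_encs:
  assumes "distinct ps" "length ps = length ds" "inr ps ds t" "\<And>r. r \<notin> set ps \<Longrightarrow> s r = t r"
  shows "decs ps ds s (encs ps ds t) = t"
proof
  fix r show "decs ps ds s (encs ps ds t) r = t r"
  proof (cases "r \<in> set ps")
    case True
    then obtain i where "i < length ps" "r = ps ! i" by (metis in_set_conv_nth)
    then show ?thesis using assms by (simp add: decs_nth digit_encs)
  qed (use assms in \<open>simp add: decs_off\<close>)
qed

definition agr :: "nat set \<Rightarrow> state \<Rightarrow> state \<Rightarrow> bool" where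
  "agr P s t \<longleftrightarrow> (\<forall>r. r \<notin> P \<longrightarrow> s r = t r)"

lemma agr_sym: "agr P s t \<longleftrightarrow> agr P t s"
  by (auto simp: agr_def)

text \<open>Row and column dimensions may differ, and an index outside its dimension gives the entry
  0. So a rectangular matrix is a ring element as well, while the identity matrix becomes the
  projection \<open>PI\<close> and not 1; such projections are carried along throughout.\<close>

definition mop :: "nat list \<Rightarrow> nat list \<Rightarrow> nat list \<Rightarrow> complex mat \<Rightarrow> mx" where
  "mop ps ds ds' A = Abs_mx (\<lambda>s t.
     if (\<forall>r. r \<notin> set ps \<longrightarrow> s r = t r) \<and> inr ps ds s \<and> inr ps ds' t
     then A $$ (encs ps ds s, encs ps ds' t) else 0)"

lemma mop_finite:
  "(\<lambda>s t. if (\<forall>r. r \<notin> set ps \<longrightarrow> s r = t r) \<and> inr ps ds s \<and> inr ps ds' t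
     then A $$ (encs ps ds s, encs ps ds' t) else 0)
   \<in> {A. (\<forall>s. finite {t. A s t \<noteq> (0::complex)}) \<and> (\<forall>t. finite {s. A s t \<noteq> 0})}"
proof -
  have fin: "finite {t. (\<forall>r. r \<notin> set ps \<longrightarrow> s r = t r) \<and> inr ps es t}" for ps es and s :: state
  proof (rule finite_subset)
    let ?M = "Max (insert 0 (set es))"
    let ?S = "{f. \<forall>x. (x \<in> set ps \<longrightarrow> f x \<in> {..Max ((!) es ` {..<length ps})}) \<and> (x \<notin> set ps \<longrightarrow> f x = 0)}"
    show "{t. (\<forall>r. r \<notin> set ps \<longrightarrow> s r = t r) \<and> inr ps es t} \<subseteq> (\<lambda>f r. if r \<in> set ps then f r else s r) ` ?S"
    proof
      fix t assume t: "t \<in> {t. (\<forall>r. r \<notin> set ps \<longrightarrow> s r = t r) \<and> inr ps es t}"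
      have "t x \<le> Max ((!) es ` {..<length ps})" if x: "x \<in> set ps" for x
      proof -
        obtain i where i: "i < length ps" "x = ps ! i" using x by (metis in_set_conv_nth)
        have "t x \<le> es ! i" using t i by (auto simp: inr_def intro: less_imp_le)
        also have "\<dots> \<le> Max ((!) es ` {..<length ps})" by (rule Max_ge) (use i in auto)
        finally show ?thesis .
      qed
      then show "t \<in> (\<lambda>f r. if r \<in> set ps then f r else s r) ` ?S"
        using t by (intro image_eqI[of _ _ "\<lambda>r. if r \<in> set ps then t r else 0"]) auto
    qed
    show "finite ((\<lambda>f r. if r \<in> set ps then f r else s r) ` ?S)"
      by (rule finite_imageI, rule finite_set_of_finite_funs) auto
  qed
  show ?thesis
    unfolding mem_Collect_eq
  proof (intro conjI allI)
    fix s :: state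
    show "finite {t. (if (\<forall>r. r \<notin> set ps \<longrightarrow> s r = t r) \<and> inr ps ds s \<and> inr ps ds' t
      then A $$ (encs ps ds s, encs ps ds' t) else 0) \<noteq> 0}"
      by (rule finite_subset[OF _ fin[of ps s ds']]) (auto split: if_splits)
  next
    fix t :: state
    show "finite {s. (if (\<forall>r. r \<notin> set ps \<longrightarrow> s r = t r) \<and> inr ps ds s \<and> inr ps ds' t
      then A $$ (encs ps ds s, encs ps ds' t) else 0) \<noteq> 0}"
      by (rule finite_subset[OF _ fin[of ps t ds]]) (auto split: if_splits)
  qed
qed

lemma ent_mop: "ent (mop ps ds ds' A) s t = (if (\<forall>r. r \<notin> set ps \<longrightarrow> s r = t r) \<and> inr ps ds s \<and> inr ps ds' t
      then A $$ (encs ps ds s, encs ps ds' t) else 0)"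
  unfolding mop_def ent.rep_eq Abs_mx_inverse[OF mop_finite] by (rule refl)

lemma agr_ent_mop: "ent (mop ps ds ds' A) s t = (if agr (set ps) s t \<and> inr ps ds s \<and> inr ps ds' t
      then A $$ (encs ps ds s, encs ps ds' t) else 0)"
  by (simp add: ent_mop agr_def)

lemma inr_cong: "(\<And>r. r \<in> set ps \<Longrightarrow> s r = s' r) \<Longrightarrow> inr ps ds s = inr ps ds s'"
  by (simp add: inr_def)

lemma encs_cong: "(\<And>r. r \<in> set ps \<Longrightarrow> s r = s' r) \<Longrightarrow> encs ps ds s = encs ps ds s'"
  by (simp add: encs_def cong: map_cong)

lemma on_legs_mop: "on_legs (set ps) (mop ps ds ds' A)"
proof (rule on_legsI)
  fix s t s' t' :: state
  assume *: "\<And>r. r \<in> set ps \<Longrightarrow> s r = s' r \<and> t r = t' r" "\<And>r. r \<notin> set ps \<Longrightarrow> s r = t r \<and> s' r = t' r"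
  have "inr ps ds s = inr ps ds s'" "inr ps ds' t = inr ps ds' t'"
    by (rule inr_cong, use * in blast)+
  moreover have "encs ps ds s = encs ps ds s'" "encs ps ds' t = encs ps ds' t'"
    by (rule encs_cong, use * in blast)+
  ultimately show "ent (mop ps ds ds' A) s t = ent (mop ps ds ds' A) s' t'" using * by (simp add: ent_mop)
qed (auto simp: ent_mop split: if_splits)

lemma trn_mop:
  assumes "length ps = length ds" "length ps = length ds'" "A \<in> carrier_mat (prod_list ds) (prod_list ds')"
  shows "trn (mop ps ds ds' A) = mop ps ds' ds (transpose_mat A)"
  by (rule mx_eqI) (use assms in \<open>auto simp: agr_ent_mop encs_less agr_sym\<close>)

lemma mop_mult:
  assumes "distinct ps" "length ps = length ds" "length ps = length ds'" "length ps = length ds''"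
    and A: "A \<in> carrier_mat (prod_list ds) (prod_list ds')" and B: "B \<in> carrier_mat (prod_list ds') (prod_list ds'')"
  shows "mop ps ds ds' A * mop ps ds' ds'' B = mop ps ds ds'' (A * B)"
proof (rule mx_eqI)
  fix s t :: state
  let ?A = "mop ps ds ds' A" and ?B = "mop ps ds' ds'' B"
  let ?T = "decs ps ds' s ` {..<prod_list ds'}"
  have inj: "inj_on (decs ps ds' s) {..<prod_list ds'}"
    by (rule inj_on_inverseI[of _ "encs ps ds'"]) (use assms encs_decs in auto)
  have "ent (?A * ?B) s t = (\<Sum>r\<in>?T. ent ?A s r * ent ?B r t)"
  proof (rule ent_mult)
    fix r assume "ent ?A s r \<noteq> 0"
    then have "\<And>x. x \<notin> set ps \<Longrightarrow> s x = r x" "inr ps ds' r" by (auto simp: ent_mop split: if_splits)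
    then have "decs ps ds' s (encs ps ds' r) = r" "encs ps ds' r < prod_list ds'"
      using assms by (auto intro: decs_encs encs_less)
    then show "r \<in> ?T" by (metis imageI lessThan_iff)
  qed simp
  also have "\<dots> = (\<Sum>k<prod_list ds'. ent ?A s (decs ps ds' s k) * ent ?B (decs ps ds' s k) t)"
    by (simp add: sum.reindex[OF inj])
  also have "\<dots> = ent (mop ps ds ds'' (A * B)) s t"
  proof (cases "(\<forall>r. r \<notin> set ps \<longrightarrow> s r = t r) \<and> inr ps ds s \<and> inr ps ds'' t")
    case True
    then have "encs ps ds s < prod_list ds" "encs ps ds'' t < prod_list ds''" using assms encs_less by auto
    then show ?thesis using True assms
      by (simp add: ent_mop decs_off inr_decs encs_decs scalar_prod_def atLeast0LessThan)
  next
    case False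
    have "ent (mop ps ds ds'' (A * B)) s t = 0" unfolding ent_mop by (rule if_not_P[OF False])
    moreover have "ent ?A s (decs ps ds' s k) * ent ?B (decs ps ds' s k) t = 0" for k
      using False by (auto simp: ent_mop decs_off)
    ultimately show ?thesis by (simp only: sum.neutral_const)
  qed
  finally show "ent (?A * ?B) s t = ent (mop ps ds ds'' (A * B)) s t" .
qed

lemma inr_append: "length ps = length ds \<Longrightarrow> inr (ps @ qs) (ds @ es) s \<longleftrightarrow> inr ps ds s \<and> inr qs es s"
  unfolding inr_def
  apply (auto simp: nth_append)
  subgoal for i by (drule spec[of _ "length ds + i"]) simp
  done

lemma encs_append: "length ps = length ds \<Longrightarrow> encs (ps @ qs) (ds @ es) s = encs ps ds s * prod_list es + encs qs es s"
  by (simp add: encs_def enc_append)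

lemma mop_kron:
  assumes l: "length ps = length ds" "length ps = length ds'" "length qs = length es" "length qs = length es'"
    and d: "set ps \<inter> set qs = {}"
    and A: "A \<in> carrier_mat (prod_list ds) (prod_list ds')" and B: "B \<in> carrier_mat (prod_list es) (prod_list es')"
  shows "mop (ps @ qs) (ds @ es) (ds' @ es') (A \<otimes>\<^sub>m B) = mop ps ds ds' A * mop qs es es' B"
proof (rule mx_eqI)
  fix s t :: state
  define u where "u r = (if r \<in> set ps then t r else s r)" for r
  have 1: "ent (mop ps ds ds' A * mop qs es es' B) s t = ent (mop ps ds ds' A) s u * ent (mop qs es es' B) u t"
  proof (rule ent_mult1)
    fix r assume "ent (mop ps ds ds' A) s r \<noteq> 0" "ent (mop qs es es' B) r t \<noteq> 0"
    then have *: "\<And>x. x \<notin> set ps \<Longrightarrow> s x = r x" "\<And>x. x \<notin> set qs \<Longrightarrow> r x = t x" by (auto simp: ent_mop split: if_splits)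
    show "r = u"
    proof
      fix x show "r x = u x" using * d by (cases "x \<in> set ps") (auto simp: u_def)
    qed
  qed
  have u: "inr ps ds' u = inr ps ds' t" "encs ps ds' u = encs ps ds' t" "inr qs es u = inr qs es s" "encs qs es u = encs qs es s"
    using d by (auto intro!: inr_cong encs_cong simp: u_def)
  show "ent (mop (ps @ qs) (ds @ es) (ds' @ es') (A \<otimes>\<^sub>m B)) s t = ent (mop ps ds ds' A * mop qs es es' B) s t"
  proof (cases "(\<forall>r. r \<notin> set ps \<union> set qs \<longrightarrow> s r = t r) \<and> inr ps ds s \<and> inr ps ds' t \<and> inr qs es s \<and> inr qs es' t")
    case True
    have b: "encs ps ds s < prod_list ds" "encs ps ds' t < prod_list ds'" "encs qs es s < prod_list es" "encs qs es' t < prod_list es'"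
      using True l encs_less by auto
    have "encs ps ds s * prod_list es + encs qs es s < prod_list ds * prod_list es"
         "encs ps ds' t * prod_list es' + encs qs es' t < prod_list ds' * prod_list es'"
      using b encs_less[of "ps @ qs" "ds @ es" s] encs_less[of "ps @ qs" "ds' @ es'" t] True l
      by (auto simp: inr_append encs_append)
    then show ?thesis unfolding 1 using True l b A B
      by (auto simp: ent_mop u inr_append encs_append kron_def u_def)
  next
    case False
    have "ent (mop (ps @ qs) (ds @ es) (ds' @ es') (A \<otimes>\<^sub>m B)) s t = 0"
      using False l by (auto simp: ent_mop inr_append)
    moreover have "ent (mop ps ds ds' A) s u * ent (mop qs es es' B) u t = 0"
      using False by (auto simp: ent_mop u u_def split: if_splits)
    ultimately show ?thesis using 1 by simp
  qed
qed

definition PI :: "nat list \<Rightarrow> nat list \<Rightarrow> mx" where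
  "PI ps ds = mop ps ds ds (1\<^sub>m (prod_list ds))"

lemma ent_PI:
  assumes "distinct ps" "length ps = length ds"
  shows "ent (PI ps ds) s t = (if s = t \<and> inr ps ds s then 1 else 0)"
proof (cases "(\<forall>r. r \<notin> set ps \<longrightarrow> s r = t r) \<and> inr ps ds s \<and> inr ps ds t")
  case True
  have "encs ps ds s = encs ps ds t \<longleftrightarrow> s = t"
    using decs_encs[OF assms, of s s] decs_encs[OF assms, of t s] True by metis
  then show ?thesis using True assms by (simp add: PI_def ent_mop encs_less)
next
  case False
  then show ?thesis by (auto simp: PI_def ent_mop)
qed

lemma PI_mult_left: "distinct ps \<Longrightarrow> length ps = length ds \<Longrightarrow> ent (PI ps ds * A) s t = (if inr ps ds s then ent A s t else 0)"
  by (subst ent_mult1[of _ _ _ _ s]) (auto simp: ent_PI split: if_splits)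

lemma PI_mult_right: "distinct ps \<Longrightarrow> length ps = length ds \<Longrightarrow> ent (A * PI ps ds) s t = (if inr ps ds t then ent A s t else 0)"
  by (subst ent_mult1[of _ _ _ _ t]) (auto simp: ent_PI split: if_splits)

text \<open>Replaces the positional \<open>embed2\<close> by an operator on two named legs. The
  factor \<open>PI\<close> remains since the other legs of \<open>ps\<close> are bounded
  too.\<close>

lemma mop_embed2:
  assumes ps: "distinct ps" "length ps = length ds" and p: "p < length ds" "p' < length ds" "p \<noteq> p'"
    and A: "A \<in> carrier_mat (ds ! p * ds ! p') (ds ! p * ds ! p')"
  shows "mop ps ds ds (embed2 ds p p' A)
    = PI ps ds * mop [ps ! p, ps ! p'] [ds ! p, ds ! p'] [ds ! p, ds ! p'] A"
proof (rule mx_eqI)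
  fix s t :: state
  let ?R = "mop [ps ! p, ps ! p'] [ds ! p, ds ! p'] [ds ! p, ds ! p'] A"
  show "ent (mop ps ds ds (embed2 ds p p' A)) s t = ent (PI ps ds * ?R) s t"
  proof (cases "(\<forall>r. r \<notin> set ps \<longrightarrow> s r = t r) \<and> inr ps ds s \<and> inr ps ds t")
    case True
    then have "encs ps ds s < prod_list ds" "encs ps ds t < prod_list ds" using ps encs_less by auto
    then have e: "ent (mop ps ds ds (embed2 ds p p' A)) s t =
      (if \<forall>r<length ds. r \<noteq> p \<and> r \<noteq> p' \<longrightarrow> s (ps ! r) = t (ps ! r)
       then A $$ (s (ps ! p) * ds ! p' + s (ps ! p'), t (ps ! p) * ds ! p' + t (ps ! p')) else 0)"
      using True ps p by (simp add: ent_mop embed2_def digit_encs) blast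
    have "(\<forall>r<length ds. r \<noteq> p \<and> r \<noteq> p' \<longrightarrow> s (ps ! r) = t (ps ! r)) \<longleftrightarrow> (\<forall>r. r \<notin> set [ps ! p, ps ! p'] \<longrightarrow> s r = t r)"
    proof
      assume *: "\<forall>r<length ds. r \<noteq> p \<and> r \<noteq> p' \<longrightarrow> s (ps ! r) = t (ps ! r)"
      show "\<forall>r. r \<notin> set [ps ! p, ps ! p'] \<longrightarrow> s r = t r"
      proof (intro allI impI)
        fix r assume r: "r \<notin> set [ps ! p, ps ! p']"
        show "s r = t r"
        proof (cases "r \<in> set ps")
          case True
          then obtain i where "i < length ps" "r = ps ! i" by (metis in_set_conv_nth)
          then show ?thesis using * r ps by auto
        qed (use True in blast)
      qed
    next
      assume *: "\<forall>r. r \<notin> set [ps ! p, ps ! p'] \<longrightarrow> s r = t r"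
      show "\<forall>r<length ds. r \<noteq> p \<and> r \<noteq> p' \<longrightarrow> s (ps ! r) = t (ps ! r)"
        using * ps p by (auto simp: nth_eq_iff_index_eq)
    qed
    moreover have "inr [ps ! p, ps ! p'] [ds ! p, ds ! p'] s" "inr [ps ! p, ps ! p'] [ds ! p, ds ! p'] t"
      using True ps p by (auto simp: inr_def less_Suc_eq nth_Cons')
    ultimately show ?thesis using True ps p
      unfolding e by (simp add: PI_mult_left ent_mop encs_def) blast
  next
    case False
    have "ent (mop ps ds ds (embed2 ds p p' A)) s t = 0" using False by (auto simp: ent_mop)
    moreover have "ent ?R s t = 0" if s: "inr ps ds s"
    proof (rule ccontr)
      assume "ent ?R s t \<noteq> 0"
      then have R: "\<forall>r. r \<notin> set [ps ! p, ps ! p'] \<longrightarrow> s r = t r" "inr [ps ! p, ps ! p'] [ds ! p, ds ! p'] t"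
        by (auto simp: ent_mop split: if_splits)
      have "set [ps ! p, ps ! p'] \<subseteq> set ps" using ps p by auto
      then have "\<forall>r. r \<notin> set ps \<longrightarrow> s r = t r" using R(1) by blast
      moreover have "inr ps ds t"
        unfolding inr_def
      proof (intro allI impI)
        fix i assume i: "i < length ps"
        show "t (ps ! i) < ds ! i"
        proof (cases "i = p \<or> i = p'")
          case True
          then show ?thesis using R(2) by (auto simp: inr_def less_Suc_eq nth_Cons')
        next
          case False
          then have "ps ! i \<notin> set [ps ! p, ps ! p']" using ps p i by (auto simp: nth_eq_iff_index_eq)
          then show ?thesis using R(1) s i by (metis inr_def)
        qed
      qed
      ultimately show False using False s by blast
    qed
    ultimately show ?thesis using ps by (simp add: PI_mult_left)
  qed
qed

text \<open>The way back from operator identities to the matrices of the statement; it is enough to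
  test states that vanish off \<open>ps\<close>.\<close>

lemma mop_inj:
  assumes ps: "distinct ps" "length ps = length ds" and A: "A \<in> carrier_mat (prod_list ds) (prod_list ds)"
    and B: "B \<in> carrier_mat (prod_list ds) (prod_list ds)"
    and eq: "\<And>s t. (\<And>r. r \<notin> set ps \<Longrightarrow> s r = 0 \<and> t r = 0) \<Longrightarrow> ent (mop ps ds ds A) s t = ent (mop ps ds ds B) s t"
  shows "A = B"
proof (rule eq_matI)
  fix i j assume "i < dim_row B" "j < dim_col B"
  then have ij: "i < prod_list ds" "j < prod_list ds" using B by auto
  let ?s = "decs ps ds (\<lambda>_. 0) i" and ?t = "decs ps ds (\<lambda>_. 0) j"
  have "ent (mop ps ds ds A) ?s ?t = ent (mop ps ds ds B) ?s ?t" by (rule eq) (simp add: decs_off)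
  then show "A $$ (i, j) = B $$ (i, j)" using ij ps by (simp add: ent_mop decs_off inr_decs encs_decs)
qed (use A B in auto)

section \<open>R-matrices and fusion in components\<close>

lemma app_mop2:
  assumes "p \<noteq> q"
  shows "app (mop [p, q] [n, m] [n', m'] A) f s =
    (if s p < n \<and> s q < m
     then \<Sum>i<n'. \<Sum>j<m'. A $$ (s p * m + s q, i * m' + j) * f (s(p := i, q := j)) else 0)"
proof -
  let ?g = "\<lambda>(i, j). s(p := i, q := j)"
  let ?T = "?g ` ({..<n'} \<times> {..<m'})"
  have inj: "inj_on ?g ({..<n'} \<times> {..<m'})"
  proof (rule inj_onI, clarify)
    fix i j i' j' assume "s(p := i, q := j) = s(p := i', q := j')"
    then have "(s(p := i, q := j)) p = (s(p := i', q := j')) p" "(s(p := i, q := j)) q = (s(p := i', q := j')) q"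
      by simp_all
    then show "i = i' \<and> j = j'" using assms by simp
  qed
  have "app (mop [p, q] [n, m] [n', m'] A) f s = (\<Sum>t\<in>?T. ent (mop [p, q] [n, m] [n', m'] A) s t * f t)"
  proof (rule app_eq)
    fix t assume "ent (mop [p, q] [n, m] [n', m'] A) s t \<noteq> 0"
    then have "agr {p, q} s t" "inr [p, q] [n', m'] t" by (auto simp: agr_ent_mop split: if_splits)
    then have "t = ?g (t p, t q)" "t p < n'" "t q < m'"
      using assms by (auto simp: agr_def inr_def fun_eq_iff less_Suc_eq)
    then show "t \<in> ?T" by (metis (no_types, lifting) SigmaI image_eqI lessThan_iff)
  qed simp
  also have "\<dots> = (\<Sum>x\<in>{..<n'} \<times> {..<m'}. ent (mop [p, q] [n, m] [n', m'] A) s (?g x) * f (?g x))"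
    by (rule sum.reindex[OF inj, unfolded comp_def])
  also have "\<dots> = (\<Sum>i<n'. \<Sum>j<m'. ent (mop [p, q] [n, m] [n', m'] A) s (s(p := i, q := j)) * f (s(p := i, q := j)))"
    by (simp add: sum.cartesian_product case_prod_beta)
  also have "\<dots> = (if s p < n \<and> s q < m
     then \<Sum>i<n'. \<Sum>j<m'. A $$ (s p * m + s q, i * m' + j) * f (s(p := i, q := j)) else 0)"
  proof -
    have "ent (mop [p, q] [n, m] [n', m'] A) s (s(p := i, q := j)) =
      (if s p < n \<and> s q < m then A $$ (s p * m + s q, i * m' + j) else 0)" if "i < n'" "j < m'" for i j
      using that assms by (auto simp: ent_mop inr_def encs_def less_Suc_eq nth_Cons')
    then show ?thesis by (cases "s p < n \<and> s q < m") auto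
  qed
  finally show ?thesis .
qed

lemma app_mop1:
  "app (mop [p] [n] [n'] A) f s = (if s p < n then \<Sum>i<n'. A $$ (s p, i) * f (s(p := i)) else 0)"
proof -
  let ?g = "\<lambda>i. s(p := i)"
  have inj: "inj_on ?g {..<n'}"
    by (rule inj_onI) (metis fun_upd_same)
  have "app (mop [p] [n] [n'] A) f s = (\<Sum>t\<in>?g ` {..<n'}. ent (mop [p] [n] [n'] A) s t * f t)"
  proof (rule app_eq)
    fix t assume "ent (mop [p] [n] [n'] A) s t \<noteq> 0"
    then have "agr {p} s t" "inr [p] [n'] t" by (auto simp: agr_ent_mop split: if_splits)
    then have "t = ?g (t p)" "t p < n'" by (auto simp: agr_def inr_def fun_eq_iff)
    then show "t \<in> ?g ` {..<n'}" by (metis image_eqI lessThan_iff)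
  qed simp
  also have "\<dots> = (\<Sum>i<n'. ent (mop [p] [n] [n'] A) s (s(p := i)) * f (s(p := i)))"
    by (simp add: sum.reindex[OF inj])
  also have "\<dots> = (if s p < n then \<Sum>i<n'. A $$ (s p, i) * f (s(p := i)) else 0)"
    by (auto simp: ent_mop inr_def encs_def intro!: sum.cong)
  finally show ?thesis .
qed

section \<open>Generic q, q-numbers and the coefficients of the fusion map\<close>

locale qgen =
  fixes h :: complex
  assumes h0 [simp]: "h \<noteq> 0" and hroot: "\<And>n::nat. n > 0 \<Longrightarrow> h ^ n \<noteq> 1"
begin

abbreviation H :: "int \<Rightarrow> complex" where "H m \<equiv> h powi m"

lemma H_mult: "H m * H n = H (m + n)"
  by (simp add: power_int_add)

lemma inverse_H: "inverse (H m) = H (- m)"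
  by (simp add: power_int_minus)

lemma qc_H_neq_0: 
  assumes "m \<noteq> 0" shows "qc (H m) \<noteq> 0"
proof
  assume "qc (H m) = 0"
  then have "H m = H (- m)" by (simp add: qc_def inverse_H)
  then have "H m * H m = H (- m) * H m" by simp
  then have 1: "H (2 * m) = 1" by (simp add: H_mult)
  have "H (2 * \<bar>m\<bar>) = 1"
  proof (cases "m \<ge> 0")
    case False
    then have "H (2 * \<bar>m\<bar>) = inverse (H (2 * m))" by (simp add: inverse_H)
    then show ?thesis using 1 by simp
  qed (use 1 in simp)
  moreover have "2 * \<bar>m\<bar> = int (nat (2 * \<bar>m\<bar>))" by simp
  ultimately have "h ^ nat (2 * \<bar>m\<bar>) = 1" by (metis power_int_of_nat)
  then show False using hroot[of "nat (2 * \<bar>m\<bar>)"] assms by simp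
qed

text \<open>The q-number without its denominator, \<open>cq n\<close> = q^n - q^(-n).\<close>

definition cq :: "int \<Rightarrow> complex" where "cq n = qc (H (2 * n))"

lemma cq_0 [simp]: "cq 0 = 0"
  by (simp add: cq_def qc_def)

lemma cq_neq_0 [simp]: "n \<noteq> 0 \<Longrightarrow> cq n \<noteq> 0"
  by (simp add: cq_def qc_H_neq_0)

lemma cq_minus: "cq (- n) = - cq n"
  by (simp add: cq_def qc_def inverse_H)

lemma qnum_cq: "qnum h (2 * n) = cq n / cq 1"
  by (simp add: qnum_def cq_def qc_def inverse_H)

text \<open>The entries of (q - 1/q) times the spin matrices, between the indices j - 1 and j
  counted from 0. They vanish at j = 0 and j = d + 1, which makes the formulas uniform at both ends
  of the spin ladder.\<close>

definition b :: "nat \<Rightarrow> nat \<Rightarrow> complex" where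
  "b d j = (if j = 0 then 0 else cq 1 * B_coef h (int d) (int d - 2 * int (j - 1)))"

text \<open>Column i of the fusion map, counted from 0, is \<open>al d i\<close> times |0>|i> plus
  \<open>be d i\<close> times |1>|i-1>: these are q-Clebsch-Gordan coefficients.\<close>

definition al :: "nat \<Rightarrow> nat \<Rightarrow> complex" where "al d i = E_diag h d (Suc i)"
definition be :: "nat \<Rightarrow> nat \<Rightarrow> complex" where "be d i = E_low h d (Suc i)"

lemma b_0 [simp]: "b d 0 = 0"
  by (simp add: b_def)

text \<open>The branch of the complex square root drops out of the square; the relations between
  \<open>b\<close>, \<open>al\<close> and \<open>be\<close> rest on this and on the defining
  recursions.\<close>

lemma b_sq: "j \<le> Suc d \<Longrightarrow> b d j * b d j = cq (int j) * cq (int d + 1 - int j)"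
proof (cases "j = 0")
  case False
  then have e: "int d + (int d - 2 * int (j - 1)) = 2 * (int d + 1 - int j)" "int d - (int d - 2 * int (j - 1)) + 2 = 2 * int j"
    by (auto simp: of_nat_diff)
  have "csqrt x * csqrt x = x" for x by (metis power2_csqrt power2_eq_square)
  then have "B_coef h (int d) (int d - 2 * int (j - 1)) * B_coef h (int d) (int d - 2 * int (j - 1))
    = (cq (int d + 1 - int j) / cq 1) * (cq (int j) / cq 1)"
    unfolding B_coef_def e qnum_cq by simp
  then have "cq 1 * cq 1 * (B_coef h (int d) (int d - 2 * int (j - 1)) * B_coef h (int d) (int d - 2 * int (j - 1)))
    = cq (int j) * cq (int d + 1 - int j)"
    by (simp add: field_simps)
  then show ?thesis using False by (simp add: b_def mult_ac)
qed simp

lemma b_end [simp]: "b d (Suc d) = 0"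
proof -
  have "b d (Suc d) * b d (Suc d) = 0" by (subst b_sq) simp_all
  then show ?thesis by simp
qed

lemma b_neq_0: "0 < j \<Longrightarrow> j \<le> d \<Longrightarrow> b d j \<noteq> 0"
proof
  assume "0 < j" "j \<le> d" "b d j = 0"
  then have "cq (int j) * cq (int d + 1 - int j) = 0" using b_sq[of j d] by simp
  moreover have "cq (int j) \<noteq> 0" "cq (int d + 1 - int j) \<noteq> 0" using \<open>0 < j\<close> \<open>j \<le> d\<close> by (auto intro!: cq_neq_0)
  ultimately show False by simp
qed

lemma al_0 [simp]: "al d 0 = 1"
  by (simp add: al_def E_diag_def)

lemma al_Suc: "d > 0 \<Longrightarrow> al d (Suc i) = al d i * b (d - 1) (Suc i) / b d (Suc i)"
  by (simp add: al_def E_diag_def b_def of_nat_diff algebra_simps)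

lemma al_end: "d > 0 \<Longrightarrow> al d d = 0"
  by (cases d) (simp_all add: al_Suc)

lemma be_0 [simp]: "be d 0 = 0"
  by (simp add: be_def E_low_def qnum_def)

lemma be_Suc: "be d (Suc i) = cq (int i + 1) * al d i / b d (Suc i)"
proof -
  have "qnum h (2 * int (Suc i)) = cq (int i + 1) / cq 1" by (subst qnum_cq) (simp add: algebra_simps)
  moreover have "int d + 2 - 2 * int (Suc i) = int d - 2 * int i" by simp
  ultimately show ?thesis unfolding be_def E_low_def Let_def by (simp add: al_def b_def)
qed

lemma al_b: "d > 0 \<Longrightarrow> 0 < i \<Longrightarrow> i \<le> d \<Longrightarrow> al d i * b d i = b (d - 1) i * al d (i - 1)"
  using al_Suc[of d "i - 1"] b_neq_0[of i d] by (cases i) (auto simp: field_simps)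

lemma be_b: "0 < i \<Longrightarrow> i \<le> d \<Longrightarrow> be d i * b d i = cq (int i) * al d (i - 1)"
  using be_Suc[of d "i - 1"] b_neq_0[of i d] by (cases i) (auto simp: field_simps)

text \<open>The defining product telescopes after squaring: the step from i to i + 1 contributes
  \<open>cq\<close> of d - 1 - i divided by \<open>cq\<close> of d - i.\<close>

lemma al_sq: "d > 0 \<Longrightarrow> i \<le> d \<Longrightarrow> al d i * al d i = cq (int d - int i) / cq (int d)"
proof (induction i)
  case (Suc i)
  have "al d (Suc i) * al d (Suc i) = (al d i * al d i) * (b (d - 1) (Suc i) * b (d - 1) (Suc i)) / (b d (Suc i) * b d (Suc i))"
    using Suc.prems by (simp add: al_Suc mult_ac)
  also have "\<dots> = cq (int d - int (Suc i)) / cq (int d)"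
    using Suc by (simp add: b_sq of_nat_diff)
  finally show ?case .
qed simp

lemma be_sq: "i \<le> d \<Longrightarrow> be d i * be d i = cq (int i) / cq (int d)"
proof (cases i)
  case (Suc k)
  assume i: "i \<le> d"
  have "be d i * be d i = cq (int i) * cq (int i) * (al d k * al d k) / (b d i * b d i)"
    using Suc by (simp add: be_Suc mult_ac add.commute)
  also have "\<dots> = cq (int i) / cq (int d)"
    using i Suc by (simp add: b_sq al_sq)
  finally show ?thesis .
qed simp

lemma b_al: "d > 0 \<Longrightarrow> i \<le> d \<Longrightarrow> b (d - 1) i * al d i = cq (int d - int i) * be d i"
proof (cases i)
  case (Suc k)
  assume i: "i \<le> d" and d: "d > 0"
  have "b (d - 1) i * al d i = (b (d - 1) i * b (d - 1) i) * al d k / b d i"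
    using d Suc by (simp add: al_Suc)
  also have "\<dots> = cq (int d - int i) * be d i"
    using i d Suc by (subst b_sq) (simp_all add: be_Suc of_nat_diff algebra_simps)
  finally show ?thesis .
qed simp

lemma b_be: "d > 0 \<Longrightarrow> i < d \<Longrightarrow> b (d - 1) i * be d (Suc i) = be d i * b d (Suc i)"
proof (cases i)
  case (Suc k)
  assume i: "i < d" and d: "d > 0"
  have n: "b d i \<noteq> 0" "b d (Suc i) \<noteq> 0" using i Suc b_neq_0 by auto
  have "b (d - 1) i * be d (Suc i) * (b d i * b d (Suc i)) = cq (int i + 1) * al d k * (b (d - 1) i * b (d - 1) i)"
    using d Suc n by (simp add: al_Suc be_Suc mult_ac)
  also have "\<dots> = cq (int i) * al d k * (b d (Suc i) * b d (Suc i))"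
    using i d by (simp add: b_sq of_nat_diff algebra_simps)
  also have "\<dots> = be d i * b d (Suc i) * (b d i * b d (Suc i))"
    using Suc n by (simp add: be_Suc[of d k] mult_ac add.commute)
  finally show ?thesis using n by simp
qed simp

text \<open>Makes the off-diagonal entries of R products of two coefficients, as
  \<open>al_sq\<close> and \<open>be_sq\<close> do for the diagonal ones at the degeneration point;
  together they factorise R there.\<close>

lemma al_be: "d > 0 \<Longrightarrow> i \<le> d \<Longrightarrow> cq (int d) * (al d i * be d i) = b (d - 1) i"
proof (cases i)
  case (Suc k)
  assume i: "i \<le> d" and d: "d > 0"
  have n: "b d i \<noteq> 0" using i Suc b_neq_0 by auto
  have "al d i * be d i = b (d - 1) i * cq (int i) * (al d k * al d k) / (b d i * b d i)"
    using d Suc by (simp add: al_Suc be_Suc mult_ac add.commute)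
  also have "cq (int d) * \<dots> = b (d - 1) i"
    using i d Suc by (simp add: al_sq b_sq)
  finally show ?thesis .
qed simp

lemma al_be_comm: "d > 1 \<Longrightarrow> 0 < i \<Longrightarrow> i < d \<Longrightarrow> al d i * be (d - 1) i = be d i * al (d - 1) (i - 1)"
proof (cases i)
  case (Suc k)
  assume i: "i < d" and d: "d > 1"
  have "b (d - 1) (Suc k) \<noteq> 0" using i Suc d by (intro b_neq_0) auto
  then show ?thesis using d Suc by (simp add: al_Suc be_Suc)
qed simp

section \<open>The prefactor of R and products of the function c\<close>

definition pre :: "nat \<Rightarrow> complex \<Rightarrow> complex" where
  "pre d z = (\<Prod>k<d - 1. qc (z * H (int d - 1 - 2 * int k)))"

text \<open>c(z q^(e/2)); with the half-integer shift as a separate integer argument, comparing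
  spectral parameters is linear arithmetic.\<close>

definition cz :: "complex \<Rightarrow> int \<Rightarrow> complex" where "cz z e = qc (z * H e)"

lemma cz_H: "cz (z * H a) e = cz z (a + e)" "cz (z * h) e = cz z (1 + e)" "cz (z * inverse h) e = cz z (e - 1)"
  "cz (z * h\<^sup>2) e = cz z (2 + e)"
  by (simp_all add: cz_def power_int_add power_int_diff power2_eq_square divide_inverse mult_ac)

lemma qc_prod: "x \<noteq> 0 \<Longrightarrow> y \<noteq> 0 \<Longrightarrow> qc x * qc y = (x * y + inverse (x * y)) - (x * inverse y + inverse (x * inverse y))"
  by (simp add: qc_def field_simps)

lemma cz_cz:
  assumes "z \<noteq> 0"
  shows "cz z a * cz z a' = (z * z * H (a + a') + inverse (z * z * H (a + a'))) - (H (a - a') + inverse (H (a - a')))"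
  using assms unfolding cz_def by (subst qc_prod) (simp_all add: power_int_add power_int_diff field_simps)

lemma cz_cq:
  assumes "z \<noteq> 0"
  shows "cz z a * cq i = (z * H (a + 2 * i) + inverse (z * H (a + 2 * i))) - (z * H (a - 2 * i) + inverse (z * H (a - 2 * i)))"
  using assms unfolding cz_def cq_def by (subst qc_prod) (simp_all add: power_int_add power_int_diff divide_inverse mult_ac)

lemma cq_cq:
  "cq i * cq j = (H (2 * (i + j)) + inverse (H (2 * (i + j)))) - (H (2 * (i - j)) + inverse (H (2 * (i - j))))"
  unfolding cq_def by (subst qc_prod) (simp_all add: power_int_add power_int_diff divide_inverse mult_ac distrib_left right_diff_distrib)

text \<open>Each product of two values of c is a difference of two values of x + 1/x. The hypotheses
  pair these values up, where inverting x makes no difference.\<close>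

lemma cz_id:
  assumes "z \<noteq> 0" "a + a' = e + e'" "2 * (i + j) = a - a' \<or> 2 * (i + j) = a' - a" "2 * (i - j) = e - e' \<or> 2 * (i - j) = e' - e"
  shows "cz z a * cz z a' + cq i * cq j = cz z e * cz z e'"
proof -
  have inv: "H x + inverse (H x) = H y + inverse (H y)" if "x = y \<or> x = - y" for x y
    using that by (auto simp: inverse_H)
  have 1: "H (2 * (i + j)) + inverse (H (2 * (i + j))) = H (a - a') + inverse (H (a - a'))"
    using assms by (intro inv) auto
  have 2: "H (2 * (i - j)) + inverse (H (2 * (i - j))) = H (e - e') + inverse (H (e - e'))"
    using assms by (intro inv) auto
  show ?thesis unfolding cz_cz[OF assms(1)] cq_cq 1 2 assms(2) by simp
qed

text \<open>Each product is a difference of two values of x + 1/x, and the hypotheses make the sum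
  on the left telescope.\<close>

lemma czq_id:
  assumes "z \<noteq> 0" "a + 2 * i = a' - 2 * j" "a' + 2 * j = e + 2 * k" "a - 2 * i = e - 2 * k"
  shows "cz z a * cq i + cz z a' * cq j = cz z e * cq k"
  unfolding cz_cq[OF assms(1)] assms(2-4) by simp

lemma b_be': "d > 0 \<Longrightarrow> i \<le> d \<Longrightarrow> b (d - 1) i * be d i = cq (int i) * al d i"
proof -
  assume d: "d > 0" and i: "i \<le> d"
  have "b (d - 1) i * be d i = cq (int d) * al d i * (be d i * be d i)"
    using al_be[OF d i] by (metis mult.assoc)
  also have "\<dots> = cq (int i) * al d i" using be_sq[OF i] d by simp
  finally show ?thesis .
qed

lemma al_b': "i < d \<Longrightarrow> al d i * b d (Suc i) = cq (int d - int i) * be d (Suc i)"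
proof -
  assume i: "i < d"
  have n: "b d (Suc i) \<noteq> 0" using i by (intro b_neq_0) auto
  have "al d i * b d (Suc i) * b d (Suc i) = cq (int d - int i) * be d (Suc i) * b d (Suc i)"
    using n i b_sq[of "Suc i" d] by (simp add: be_Suc mult.assoc add.commute mult.left_commute)
  then show ?thesis using n by simp
qed

definition R1 :: "nat \<Rightarrow> complex \<Rightarrow> nat \<Rightarrow> nat \<Rightarrow> mx" where
  "R1 d z p q = mop [p, q] [2, d + 1] [2, d + 1] (R_half h d z)"

text \<open>Leg \<open>p\<close> receives the spin 1/2 that is split off; leg \<open>q\<close> holds
  the spin d/2 before and the spin (d-1)/2 after the splitting.\<close>

definition EE :: "nat \<Rightarrow> nat \<Rightarrow> nat \<Rightarrow> mx" where
  "EE d p q = mop [p, q] [2, d] [1, d + 1] (fus_E h d)"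

definition FF :: "nat \<Rightarrow> nat \<Rightarrow> nat \<Rightarrow> mx" where
  "FF d p q = mop [p, q] [1, d + 1] [2, d] (fus_F h d)"

lemma less_2_cases': "(i::nat) < 2 \<longleftrightarrow> i = 0 \<or> i = 1"
  by auto

lemma R_half_entry:
  assumes d: "d > 0" and i: "i < 2" "i' < 2" and j: "j \<le> d" "j' \<le> d"
  shows "R_half h d z $$ (i * Suc d + j, i' * Suc d + j') = pre d z *
    (if i = 0 \<and> i' = 0 then if j' = j then qc (z * H (1 + int d - 2 * int j)) else 0
     else if i = 0 then if j = Suc j' then b d j else 0
     else if i' = 0 then if j' = Suc j then b d j' else 0
     else if j' = j then qc (z * H (1 - int d + 2 * int j)) else 0)"
proof -
  have bnd: "i * Suc d + j < 2 * Suc d" "i' * Suc d + j' < 2 * Suc d"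
    using i j by (auto simp: less_2_cases')
  have dm: "(i * Suc d + j) div Suc d = i" "(i * Suc d + j) mod Suc d = j"
    "(i' * Suc d + j') div Suc d = i'" "(i' * Suc d + j') mod Suc d = j'"
    using j by (simp_all del: mult_Suc_right add: div_mult_self3)
  have eq: "i * Suc d + j = i' * Suc d + j' \<longleftrightarrow> i = i' \<and> j = j'"
    using dm by (metis)
  have dims: "dim_row (sigma_plus) = 2" "dim_col sigma_plus = 2" "dim_row (sigma_minus) = 2" "dim_col sigma_minus = 2"
    "dim_row (sigma_z) = 2" "dim_col sigma_z = 2" "dim_row (S_minus h d) = Suc d" "dim_col (S_minus h d) = Suc d"
    "dim_row (S_plus h d) = Suc d" "dim_col (S_plus h d) = Suc d" "dim_row (S_3 d) = Suc d" "dim_col (S_3 d) = Suc d"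
    by (simp_all add: sigma_plus_def sigma_minus_def sigma_z_def S_minus_def S_plus_def S_3_def mat1_def mat_of_rows_list_def)
  have sig: "sigma_plus $$ (i, i') = (if i = 0 \<and> i' = 1 then 1 else 0)"
    "sigma_minus $$ (i, i') = (if i = 1 \<and> i' = 0 then 1 else 0)"
    "sigma_z $$ (i, i') = (if i = i' then if i = 0 then 1 else - 1 else 0)"
    "sigma_z $$ (i, i) = (if i = 0 then 1 else - 1)"
    using i by (auto simp: less_2_cases' sigma_plus_def sigma_minus_def sigma_z_def mat_of_rows_list_def)
  have S: "S_minus h d $$ (j, j') = (if j = Suc j' then B_coef h (int d) (int d - 2 * int j') else 0)"
     "S_plus h d $$ (j, j') = (if j' = Suc j then B_coef h (int d) (int d - 2 * int j) else 0)"
     "S_3 d $$ (j, j) = int d - 2 * int j"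
    using j by (auto simp: S_minus_def S_plus_def S_3_def mat1_def)
  define r r' where "r = i * Suc d + j" and "r' = i' * Suc d + j'"
  note rr = r_def[symmetric] r'_def[symmetric]
  note bnd = bnd[unfolded rr] and dm = dm[unfolded rr] and eq = eq[unfolded rr]
  define M where "M = 1\<^sub>m (2 * (d + 1)) + sigma_z \<otimes>\<^sub>m S_3 d"
  have M: "dim_row M = 2 * Suc d" "dim_col M = 2 * Suc d" "M $$ (r, r) = 1 + sigma_z $$ (i, i) * S_3 d $$ (j, j)"
    using bnd by (simp_all add: M_def kron_def dims dm del: mult_Suc_right mult_Suc)
  have sp: "(sigma_plus \<otimes>\<^sub>m S_minus h d) $$ (r, r') = sigma_plus $$ (i, i') * S_minus h d $$ (j, j')"
    "(sigma_minus \<otimes>\<^sub>m S_plus h d) $$ (r, r') = sigma_minus $$ (i, i') * S_plus h d $$ (j, j')"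
    "dim_row (sigma_plus \<otimes>\<^sub>m S_minus h d) = 2 * Suc d" "dim_col (sigma_plus \<otimes>\<^sub>m S_minus h d) = 2 * Suc d"
    "dim_row (sigma_minus \<otimes>\<^sub>m S_plus h d) = 2 * Suc d" "dim_col (sigma_minus \<otimes>\<^sub>m S_plus h d) = 2 * Suc d"
    using bnd by (simp_all add: kron_def dims dm del: mult_Suc_right mult_Suc)
  have qp: "qpow_half h M $$ (r, r') = (if i = i' \<and> j = j' then H (M $$ (r, r)) else 0)"
    "qpow_half h (- M) $$ (r, r') = (if i = i' \<and> j = j' then H (- M $$ (r, r)) else 0)"
    "dim_row (qpow_half h M) = 2 * Suc d" "dim_col (qpow_half h M) = 2 * Suc d"
    "dim_row (qpow_half h (- M)) = 2 * Suc d" "dim_col (qpow_half h (- M)) = 2 * Suc d"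
    using bnd by (simp_all add: qpow_half_def M(1,2) eq del: mult_Suc_right mult_Suc)
  have "R_half h d z $$ (r, r') = pre d z *
     (cq 1 * (sigma_plus $$ (i, i') * S_minus h d $$ (j, j') + sigma_minus $$ (i, i') * S_plus h d $$ (j, j'))
      + z * qpow_half h M $$ (r, r') - inverse z * qpow_half h (- M) $$ (r, r'))"
    using d bnd unfolding R_half_def Let_def M_def[symmetric]
    by (simp add: sp qp(3-) pre_def cq_def del: mult_Suc_right mult_Suc)
  also have "\<dots> = pre d z *
     (cq 1 * (sigma_plus $$ (i, i') * S_minus h d $$ (j, j') + sigma_minus $$ (i, i') * S_plus h d $$ (j, j'))
      + (if i = i' \<and> j = j' then qc (z * H (1 + sigma_z $$ (i, i) * S_3 d $$ (j, j))) else 0))"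
    unfolding qp M(3) by (simp add: qc_def inverse_H)
  also have "\<dots> = pre d z *
    (if i = 0 \<and> i' = 0 then if j' = j then qc (z * H (1 + int d - 2 * int j)) else 0
     else if i = 0 then if j = Suc j' then b d j else 0
     else if i' = 0 then if j' = Suc j then b d j' else 0
     else if j' = j then qc (z * H (1 - int d + 2 * int j)) else 0)"
    using i unfolding sig S by (auto simp: less_2_cases' b_def algebra_simps)
  finally show ?thesis unfolding rr .
qed

lemma sum_lessThan_delta: "(\<Sum>j<(n::nat). if j = k then g j else 0) = (if k < n then g k else (0::complex))"
  by (simp add: sum.delta)

text \<open>At the ends of the ladder the neighbouring index \<open>s q - 1\<close> or
  \<open>Suc (s q)\<close> is not a valid one; there its coefficient \<open>b d 0\<close> or
  \<open>b d (Suc d)\<close> is zero.\<close>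

lemma R1_app:
  assumes "d > 0" "p \<noteq> q"
  shows "app (R1 d z p q) f s = (if s q \<le> d then
     if s p = 0 then pre d z * (cz z (1 + int d - 2 * int (s q)) * f s + b d (s q) * f (s(p := 1, q := s q - 1)))
     else if s p = 1 then pre d z * (b d (Suc (s q)) * f (s(p := 0, q := Suc (s q))) + cz z (1 - int d + 2 * int (s q)) * f s)
     else 0 else 0)"
proof (cases "s p < 2 \<and> s q \<le> d")
  case True
  have two: "(\<Sum>i<2. g i) = g 0 + g (1::nat)" for g :: "nat \<Rightarrow> complex"
    by (simp add: numeral_2_eq_2)
  have R: "R_half h d z $$ (s p * Suc d + s q, i' * Suc d + j') = pre d z *
    (if s p = 0 \<and> i' = 0 then if j' = s q then qc (z * H (1 + int d - 2 * int (s q))) else 0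
     else if s p = 0 then if s q = Suc j' then b d (s q) else 0
     else if i' = 0 then if j' = Suc (s q) then b d j' else 0
     else if j' = s q then qc (z * H (1 - int d + 2 * int (s q))) else 0)" if "i' < 2" "j' < Suc d" for i' j'
    using R_half_entry[of d "s p" i' "s q" j' z] True that assms by simp
  have "app (R1 d z p q) f s = (\<Sum>i<2. \<Sum>j<Suc d. R_half h d z $$ (s p * Suc d + s q, i * Suc d + j) * f (s(p := i, q := j)))"
    using True assms by (simp add: R1_def app_mop2 del: mult_Suc mult_Suc_right)
  also have "\<dots> = (\<Sum>i<2. \<Sum>j<Suc d. pre d z *
    (if s p = 0 \<and> i = 0 then if j = s q then qc (z * H (1 + int d - 2 * int (s q))) else 0
     else if s p = 0 then if s q = Suc j then b d (s q) else 0
     else if i = 0 then if j = Suc (s q) then b d j else 0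
     else if j = s q then qc (z * H (1 - int d + 2 * int (s q))) else 0) * f (s(p := i, q := j)))"
    by (intro sum.cong refl, subst R) auto
  also have "\<dots> = (if s p = 0 then pre d z * (cz z (1 + int d - 2 * int (s q)) * f s + b d (s q) * f (s(p := 1, q := s q - 1)))
     else pre d z * (b d (Suc (s q)) * f (s(p := 0, q := Suc (s q))) + cz z (1 - int d + 2 * int (s q)) * f s))"
  proof -
    have d1: "(\<Sum>j<Suc d. pre d z * (if j = k then w j else 0) * g j) = (if k \<le> d then pre d z * w k * g k else 0)" for k and w g :: "nat \<Rightarrow> complex"
      by (simp add: if_distrib[of "\<lambda>x. _ * x * _"] if_distrib[of "\<lambda>x. x * _"] sum.delta less_Suc_eq_le cong: if_cong del: sum.lessThan_Suc)
    have s0: "s(p := s p, q := s q) = s" by simp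
    show ?thesis
    proof (cases "s p = 0")
      case p0: True
      have "(\<Sum>j<Suc d. pre d z * (if s q = Suc j then b d (s q) else 0) * f (s(p := 1, q := j)))
         = pre d z * b d (s q) * f (s(p := 1, q := s q - 1))"
      proof (cases "s q")
        case (Suc k)
        then show ?thesis using d1[of k "\<lambda>_. b d (s q)" "\<lambda>j. f (s(p := 1, q := j))"] True by (simp del: sum.lessThan_Suc add: eq_commute[of k])
      qed simp
      moreover have "s(p := 0, q := s q) = s" using p0 s0 by metis
      ultimately show ?thesis using p0 True d1[of "s q" "\<lambda>_. qc (z * H (1 + int d - 2 * int (s q)))" "\<lambda>j. f (s(p := 0, q := j))"]
        unfolding two by (simp del: sum.lessThan_Suc add: algebra_simps cz_def)
    next
      case p1: False
      then have "s p = 1" using True by simp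
      then have "s(p := 1, q := s q) = s" using s0 by metis
      moreover have "(\<Sum>j<Suc d. pre d z * (if j = Suc (s q) then b d j else 0) * f (s(p := 0, q := j)))
         = pre d z * b d (Suc (s q)) * f (s(p := 0, q := Suc (s q)))"
        using d1[of "Suc (s q)" "\<lambda>j. b d j" "\<lambda>j. f (s(p := 0, q := j))"] True by (cases "s q = d") (auto simp del: sum.lessThan_Suc)
      ultimately show ?thesis using p1 True d1[of "s q" "\<lambda>_. qc (z * H (1 - int d + 2 * int (s q)))" "\<lambda>j. f (s(p := 1, q := j))"]
        unfolding two by (simp del: sum.lessThan_Suc add: algebra_simps cz_def)
    qed
  qed
  finally show ?thesis using True by (auto simp: less_2_cases')
next
  case False
  then show ?thesis using assms by (auto simp: R1_def app_mop2 less_Suc_eq_le less_2_cases')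
qed

lemma R1_0_app:
  assumes "p \<noteq> q"
  shows "app (R1 0 z p q) f s = (if s p < 2 \<and> s q = 0 then f s else 0)"
proof (cases "s p < 2 \<and> s q = 0")
  case True
  then have "s p = 0 \<Longrightarrow> s(p := 0, q := 0) = s" "s p = Suc 0 \<Longrightarrow> s(p := Suc 0, q := 0) = s"
    by (auto simp: fun_eq_iff)
  moreover have "s p = 0 \<or> s p = Suc 0" using True by auto
  ultimately show ?thesis using True assms
    by (auto simp: R1_def app_mop2 R_half_def less_2_cases' numeral_2_eq_2)
next
  case False
  then show ?thesis using assms by (auto simp: R1_def app_mop2)
qed

lemma EE_app:
  assumes "d > 0" "p \<noteq> q"
  shows "app (EE d p q) f s = (if s q < d then
     if s p = 0 then al d (s q) * f s
     else if s p = 1 then be d (Suc (s q)) * f (s(p := 0, q := Suc (s q))) else 0 else 0)"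
proof (cases "s p < 2 \<and> s q < d")
  case True
  have bnd: "s p * d + s q < 2 * d" using True by (auto simp: less_2_cases')
  have E: "fus_E h d $$ (r, j) = (if r = j \<and> Suc j \<le> d then al d j
      else if Suc r = j + d \<and> 1 \<le> j then be d j else 0)" if "r < 2 * d" "j < Suc d" for r j
  proof -
    have "fus_E h d $$ (r, j) = (if Suc r = Suc j \<and> 1 \<le> Suc j \<and> Suc j \<le> d then E_diag h d (Suc j)
      else if Suc r = Suc j + d - 1 \<and> 2 \<le> Suc j \<and> Suc j \<le> d + 1 then E_low h d (Suc j) else 0)"
      using that by (auto simp: fus_E_def mat1_def)
    then show ?thesis using that unfolding al_def be_def by auto
  qed
  have e: "fus_E h d $$ (s p * d + s q, j) = (if s p = 0 then if j = s q then al d j else 0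
      else if j = Suc (s q) then be d j else 0)" if "j < Suc d" for j
  proof (cases "s p = 0")
    case p0: True
    then show ?thesis using True that E[of "s q" j] by auto
  next
    case False
    then have "s p = 1" using True by simp
    then show ?thesis using True that E[of "d + s q" j] by auto
  qed
  have "app (EE d p q) f s = (\<Sum>j<Suc d. fus_E h d $$ (s p * d + s q, j) * f (s(p := 0, q := j)))"
    using True assms by (simp add: EE_def app_mop2)
  also have "\<dots> = (\<Sum>j<Suc d. (if j = (if s p = 0 then s q else Suc (s q)) then
      (if s p = 0 then al d j else be d j) * f (s(p := 0, q := j)) else 0))"
    by (intro sum.cong refl, subst e) auto
  also have "\<dots> = (if s p = 0 then al d (s q) * f (s(p := 0, q := s q)) else be d (Suc (s q)) * f (s(p := 0, q := Suc (s q))))"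
    unfolding sum_lessThan_delta using True by auto
  finally show ?thesis using True by (auto simp: less_2_cases') (metis fun_upd_triv)
next
  case False
  then show ?thesis using assms by (auto simp: EE_def app_mop2 less_2_cases')
qed

end

text \<open>A normal form for states in which three legs are singled out: component computations
  then never meet updates in different orders.\<close>

definition st3 :: "nat \<Rightarrow> nat \<Rightarrow> nat \<Rightarrow> state \<Rightarrow> nat \<Rightarrow> nat \<Rightarrow> nat \<Rightarrow> state" where
  "st3 t p q s x y w = s(t := x, p := y, q := w)"

lemma st3:
  assumes "t \<noteq> p" "t \<noteq> q" "p \<noteq> q"
  shows "st3 t p q s x y w t = x" "st3 t p q s x y w p = y" "st3 t p q s x y w q = w"
    "(st3 t p q s x y w)(t := x') = st3 t p q s x' y w" "(st3 t p q s x y w)(p := x') = st3 t p q s x x' w"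
    "(st3 t p q s x y w)(q := x') = st3 t p q s x y x'" "s = st3 t p q s (s t) (s p) (s q)"
  using assms by (auto simp: st3_def fun_eq_iff)

lemma mx_ext3:
  assumes n: "t \<noteq> p" "t \<noteq> q" "p \<noteq> q"
    and eq: "\<And>f s i j k. app A f (st3 t p q s i j k) = app B f (st3 t p q s i j k)"
  shows "A = B"
proof (rule mx_ext)
  fix f and s :: state
  show "app A f s = app B f s"
    using eq[of f s "s t" "s p" "s q"] by (simp only: st3(7)[OF n, symmetric])
qed

definition st2 :: "nat \<Rightarrow> nat \<Rightarrow> state \<Rightarrow> nat \<Rightarrow> nat \<Rightarrow> state" where
  "st2 p q s y w = s(p := y, q := w)"

lemma st2:
  assumes "p \<noteq> q"
  shows "st2 p q s y w p = y" "st2 p q s y w q = w" "(st2 p q s y w)(p := x') = st2 p q s x' w"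
    "(st2 p q s y w)(q := x') = st2 p q s y x'" "s = st2 p q s (s p) (s q)"
  using assms by (auto simp: st2_def fun_eq_iff)

lemma mx_ext2:
  assumes n: "p \<noteq> q"
    and eq: "\<And>f s j k. app A f (st2 p q s j k) = app B f (st2 p q s j k)"
  shows "A = B"
proof (rule mx_ext)
  fix f and s :: state
  show "app A f s = app B f s"
    using eq[of f s "s p" "s q"] by (simp only: st2(5)[OF n, symmetric])
qed

lemma ge2E:
  assumes "d > (1::nat)" obtains m where "d = Suc (Suc m)"
proof -
  have "d = Suc (Suc (d - 2))" using assms by simp
  then show ?thesis by (rule that)
qed

lemma app_two_terms:
  assumes pq: "p \<noteq> q" and s: "s p < n" "s q < m"
    and row: "\<And>i j. i < n' \<Longrightarrow> j < m' \<Longrightarrow> A $$ (s p * m + s q, i * m' + j)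
      = (if i = i1 \<and> j = j1 then c1 else 0) + (if i = i2 \<and> j = j2 then c2 else 0)"
    and ok: "c1 = 0 \<or> i1 < n' \<and> j1 < m'" "c2 = 0 \<or> i2 < n' \<and> j2 < m'"
  shows "app (mop [p, q] [n, m] [n', m'] A) f s = c1 * f (s(p := i1, q := j1)) + c2 * f (s(p := i2, q := j2))"
proof -
  have d: "(\<Sum>i<n'. \<Sum>j<m'. (if i = i1 \<and> j = j1 then c else 0) * g i j) = c * g i1 j1"
    if "c = 0 \<or> i1 < n' \<and> j1 < m'" for c i1 j1 and g :: "nat \<Rightarrow> nat \<Rightarrow> complex"
  proof -
    have inner: "(\<Sum>j<m'. (if j = j1 then c else 0) * g i j) = (if j1 < m' then c * g i j1 else 0)" for i
    proof -
      have "(\<Sum>j<m'. (if j = j1 then c else 0) * g i j) = (\<Sum>j<m'. if j = j1 then c * g i j else 0)"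
        by (intro sum.cong refl) auto
      also have "\<dots> = (if j1 < m' then c * g i j1 else 0)" by (subst sum.delta) auto
      finally show ?thesis .
    qed
    have "(\<Sum>i<n'. \<Sum>j<m'. (if i = i1 \<and> j = j1 then c else 0) * g i j)
      = (\<Sum>i<n'. if i = i1 then (\<Sum>j<m'. (if j = j1 then c else 0) * g i j) else 0)"
      by (intro sum.cong refl) (auto intro!: sum.neutral)
    also have "\<dots> = (if i1 < n' then (if j1 < m' then c * g i1 j1 else 0) else 0)"
      unfolding inner by (subst sum.delta) auto
    finally show ?thesis using that by auto
  qed
  have "app (mop [p, q] [n, m] [n', m'] A) f s = (\<Sum>i<n'. \<Sum>j<m'. ((if i = i1 \<and> j = j1 then c1 else 0)
      + (if i = i2 \<and> j = j2 then c2 else 0)) * f (s(p := i, q := j)))"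
    using s by (simp add: app_mop2[OF pq] row cong: sum.cong_simp)
  then show ?thesis using d[OF ok(1)] d[OF ok(2)] by (simp add: distrib_right sum.distrib)
qed

context qgen
begin

text \<open>Spins and dimensions are written with the numeral \<open>1\<close>, which the simplifier would turn into \<open>Suc 0\<close>.\<close>

declare One_nat_def [simp del]

lemma al_ge: "d > 0 \<Longrightarrow> i \<ge> d \<Longrightarrow> al d i = 0"
proof (induction i)
  case (Suc i)
  then show ?case by (cases "d = Suc i") (auto simp: al_end al_Suc)
qed simp

lemma be_gt: "d > 0 \<Longrightarrow> i > d \<Longrightarrow> be d i = 0"
  by (cases i) (auto simp: be_Suc al_ge)

lemma EE_app':
  assumes "d > 0" "p \<noteq> q"
  shows "app (EE d p q) f s = (if s p = 0 then al d (s q) * f s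
     else if s p = 1 then be d (Suc (s q)) * f (s(p := 0, q := Suc (s q))) else 0)"
  using assms by (auto simp: EE_app al_ge be_gt)

lemma qnum_2 [simp]: "qnum h 2 = 1"
  using qnum_cq[of 1] by simp

lemma b_1 [simp]: "b 1 1 = cq 1" "b 1 (Suc 0) = cq 1" "b (Suc 0) (Suc 0) = cq 1"
  by (simp_all add: b_def B_coef_def)

lemma pre_1 [simp]: "pre 0 z = 1" "pre (Suc 0) z = 1" "pre 1 z = 1"
  by (simp_all add: pre_def)

text \<open>Dropping the last factor of the product amounts to the shift by \<open>h\<close>, and
  dropping the first, in \<open>pre_Suc_high\<close>, to the shift by its inverse. These are the
  shifts in the two orders of fusion.\<close>

lemma pre_Suc_low:
  assumes d: "d > 1"
  shows "pre d z = cz z (3 - int d) * pre (d - 1) (z * h)"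
proof -
  obtain m where m: "d = Suc (Suc m)" by (rule ge2E[OF d])
  have e: "z * H (int (Suc (Suc m)) - 1 - 2 * int k) = z * h * H (int (Suc m) - 1 - 2 * int k)" for k
  proof -
    have "H (int (Suc (Suc m)) - 1 - 2 * int k) = H (1 + (int (Suc m) - 1 - 2 * int k))"
      by (rule arg_cong[of _ _ H]) simp
    then show ?thesis by (subst (asm) H_mult[symmetric]) simp
  qed
  have "z * h * H (int (Suc m) - 1 - 2 * int m) = z * H (3 - int (Suc (Suc m)))"
    unfolding e[symmetric] by (rule arg_cong[of _ _ "\<lambda>x. z * H x"]) simp
  moreover have "pre d z = (\<Prod>k<Suc m. qc (z * h * H (int (Suc m) - 1 - 2 * int k)))"
    unfolding pre_def m e by (simp add: One_nat_def)
  ultimately show ?thesis unfolding m by (simp only: prod.lessThan_Suc pre_def diff_Suc_1 mult.commute cz_def)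
qed

lemma pre_Suc_high:
  assumes d: "d > 1"
  shows "pre d z = cz z (int d - 1) * pre (d - 1) (z * inverse h)"
proof -
  obtain m where m: "d = Suc (Suc m)" by (rule ge2E[OF d])
  have e: "z * H (int (Suc (Suc m)) - 1 - 2 * int (Suc k)) = z * inverse h * H (int (Suc m) - 1 - 2 * int k)" for k
  proof -
    have "H (int (Suc (Suc m)) - 1 - 2 * int (Suc k)) = H (- 1 + (int (Suc m) - 1 - 2 * int k))"
      by (rule arg_cong[of _ _ H]) simp
    then show ?thesis by (subst (asm) H_mult[symmetric]) simp
  qed
  show ?thesis unfolding pre_def m diff_Suc_1 prod.lessThan_Suc_shift e cz_def by simp
qed

lemma R11_app:
  assumes "p \<noteq> q"
  shows "app (R1 1 z p q) f s = (if s p = 0 \<and> s q = 0 \<or> s p = 1 \<and> s q = 1 then cz z 2 * f s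
    else if s p = 0 \<and> s q = 1 then cz z 0 * f s + cq 1 * f (s(p := 1, q := 0))
    else if s p = 1 \<and> s q = 0 then cq 1 * f (s(p := 0, q := 1)) + cz z 0 * f s else 0)"
proof -
  have "b 1 2 = 0" using b_end[of 1] by (simp add: numeral_2_eq_2 One_nat_def)
  moreover have "s q \<le> 1 \<longleftrightarrow> s q = 0 \<or> s q = 1" by linarith
  moreover have "Suc 1 = 2" by simp
  ultimately show ?thesis using assms by (auto simp: R1_app One_nat_def[symmetric])
qed

lemma R11_flip: "p \<noteq> q \<Longrightarrow> R1 1 z p q = R1 1 z q p"
  by (rule mx_ext) (auto simp: R11_app fun_upd_twist)

lemma RE_app:
  assumes d: "d > 1" and n: "t \<noteq> p" "t \<noteq> q" "p \<noteq> q"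
  shows
    "app (R1 (d - 1) z t q) (app (EE d p q) f) (st3 t p q s 0 0 k) = pre (d - 1) z *
      (cz z (int d - 2 * int k) * al d k * f (st3 t p q s 0 0 k) + b (d - 1) k * al d (k - 1) * f (st3 t p q s 1 0 (k - 1)))" (is ?A)
    "app (R1 (d - 1) z t q) (app (EE d p q) f) (st3 t p q s 0 1 k) = pre (d - 1) z *
      (cz z (int d - 2 * int k) * be d (Suc k) * f (st3 t p q s 0 0 (Suc k)) + b (d - 1) k * be d k * f (st3 t p q s 1 0 k))" (is ?B)
    "app (R1 (d - 1) z t q) (app (EE d p q) f) (st3 t p q s 1 0 k) = pre (d - 1) z *
      (b (d - 1) (Suc k) * al d (Suc k) * f (st3 t p q s 0 0 (Suc k)) + cz z (2 - int d + 2 * int k) * al d k * f (st3 t p q s 1 0 k))" (is ?C)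
    "app (R1 (d - 1) z t q) (app (EE d p q) f) (st3 t p q s 1 1 k) = pre (d - 1) z *
      (b (d - 1) (Suc k) * be d (Suc (Suc k)) * f (st3 t p q s 0 0 (Suc (Suc k))) + cz z (2 - int d + 2 * int k) * be d (Suc k) * f (st3 t p q s 1 0 (Suc k)))" (is ?D)
    "j > 1 \<or> i > 1 \<Longrightarrow> app (R1 (d - 1) z t q) (app (EE d p q) f) (st3 t p q s i j k) = 0" (is "_ \<Longrightarrow> ?E")
proof -
  have i: "1 + int (d - 1) - 2 * int k = int d - 2 * int k" "1 - int (d - 1) + 2 * int k = 2 - int d + 2 * int k"
    using d by auto
  have big: "al d k = 0" "be d (Suc k) = 0" "al d (Suc k) = 0" "be d (Suc (Suc k)) = 0"
     "b (d - 1) k * al d (k - 1) = 0" "b (d - 1) k * be d k = 0" if "\<not> k \<le> d - 1"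
  proof -
    show "al d k = 0" "be d (Suc k) = 0" "al d (Suc k) = 0" "be d (Suc (Suc k)) = 0" using that d by (auto intro!: al_ge be_gt)
    have "b (d - 1) k = 0" if "k = d" using that b_end[of "d - 1"] d by simp
    moreover have "al d (k - 1) = 0 \<and> be d k = 0" if "k > d" using that d by (auto intro!: al_ge be_gt)
    ultimately show "b (d - 1) k * al d (k - 1) = 0" "b (d - 1) k * be d k = 0" using that d by (cases "k = d"; auto)+
  qed
  have d1: "d - 1 > 0" "d > 0" using d by auto
  have k1: "b (d - 1) k * g (Suc (k - 1)) = b (d - 1) k * g k" for g :: "nat \<Rightarrow> complex" by (cases k) simp_all
  note S = st3(1-6)[OF n] n n[symmetric] d d1 R1_app EE_app' i
  show ?A
  proof (cases "k \<le> d - 1")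
    case True
    then show ?thesis by (simp add: S mult.assoc)
  next
    case False
    then show ?thesis by (simp add: S big)
  qed
  show ?B using k1[of "\<lambda>x. be d x * f (st3 t p q s 1 0 x)"]
    by (cases "k \<le> d - 1") (simp_all add: S big mult.assoc)
  show ?C by (cases "k \<le> d - 1") (simp_all add: S big mult.assoc)
  show ?D by (cases "k \<le> d - 1") (simp_all add: S big mult.assoc)
  show "j > 1 \<or> i > 1 \<Longrightarrow> ?E" by (elim disjE) (simp_all add: S)
qed

lemma ER_app:
  assumes d: "d > 0" and n: "t \<noteq> p" "t \<noteq> q" "p \<noteq> q"
  shows
    "app (EE d p q) (app (R1 d z t q) f) (st3 t p q s 0 0 k) = al d k * pre d z *
      (cz z (1 + int d - 2 * int k) * f (st3 t p q s 0 0 k) + b d k * f (st3 t p q s 1 0 (k - 1)))" (is ?A)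
    "app (EE d p q) (app (R1 d z t q) f) (st3 t p q s 0 1 k) = be d (Suc k) * pre d z *
      (cz z (int d - 1 - 2 * int k) * f (st3 t p q s 0 0 (Suc k)) + b d (Suc k) * f (st3 t p q s 1 0 k))" (is ?B)
    "app (EE d p q) (app (R1 d z t q) f) (st3 t p q s 1 0 k) = al d k * pre d z *
      (b d (Suc k) * f (st3 t p q s 0 0 (Suc k)) + cz z (1 - int d + 2 * int k) * f (st3 t p q s 1 0 k))" (is ?C)
    "app (EE d p q) (app (R1 d z t q) f) (st3 t p q s 1 1 k) = be d (Suc k) * pre d z *
      (b d (Suc (Suc k)) * f (st3 t p q s 0 0 (Suc (Suc k))) + cz z (3 - int d + 2 * int k) * f (st3 t p q s 1 0 (Suc k)))" (is ?D)
    "j > 1 \<or> i > 1 \<Longrightarrow> app (EE d p q) (app (R1 d z t q) f) (st3 t p q s i j k) = 0" (is "_ \<Longrightarrow> ?E")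
proof -
  have i: "1 + int d - 2 * int (Suc k) = int d - 1 - 2 * int k" "1 - int d + 2 * int (Suc k) = 3 - int d + 2 * int k"
    by auto
  have big: "al d k = 0" if "\<not> k \<le> d" using that d by (intro al_ge) auto
  have big': "be d (Suc k) = 0" if "\<not> Suc k \<le> d" using that d by (intro be_gt) auto
  note S = st3(1-6)[OF n] n n[symmetric] d R1_app EE_app'
  show ?A by (cases "k \<le> d") (simp_all add: S big del: of_nat_Suc)
  show ?B by (cases "Suc k \<le> d") (simp_all add: S big' i del: of_nat_Suc)
  show ?C by (cases "k \<le> d") (simp_all add: S big del: of_nat_Suc)
  show ?D by (cases "Suc k \<le> d") (simp_all add: S big' i del: of_nat_Suc)
  show "j > 1 \<or> i > 1 \<Longrightarrow> ?E" by (elim disjE) (simp_all add: S)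
qed

lemma G_coefs:
  assumes d: "d > 1" and k: "k < d"
  shows "b (d - 1) k * al d (k - 1) = al d k * b d k"
    "b (d - 1) (Suc k) * al d (Suc k) = cq (int d - 1 - int k) * be d (Suc k)"
    "b (d - 1) k * be d k = cq (int k) * al d k"
    "be d (Suc k) * b d (Suc k) = cq (int k + 1) * al d k"
    "al d k * b d (Suc k) = cq (int d - int k) * be d (Suc k)"
    "b (d - 1) (Suc k) * be d (Suc (Suc k)) = be d (Suc k) * b d (Suc (Suc k))"
proof -
  show "b (d - 1) k * al d (k - 1) = al d k * b d k"
    using al_b[of d k] d k by (cases "k = 0") (auto simp: mult.commute)
  show "b (d - 1) (Suc k) * al d (Suc k) = cq (int d - 1 - int k) * be d (Suc k)"
    using b_al[of d "Suc k"] d k by (simp add: algebra_simps)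
  show "b (d - 1) k * be d k = cq (int k) * al d k" "be d (Suc k) * b d (Suc k) = cq (int k + 1) * al d k"
    using b_be'[of d k] be_b[of "Suc k" d] d k by (auto simp: add.commute)
  show "al d k * b d (Suc k) = cq (int d - int k) * be d (Suc k)" using al_b'[OF k] .
  show "b (d - 1) (Suc k) * be d (Suc (Suc k)) = be d (Suc k) * b d (Suc (Suc k))"
  \<comment> \<open>At the top index both sides vanish, since the ladders for d - 1 and for d both
    end there.\<close>
  proof (cases "Suc k = d")
    case True
    then show ?thesis using b_end[of d] b_end[of "d - 1"] d by simp
  next
    case False
    then show ?thesis using b_be[of d "Suc k"] d k by auto
  qed
qed

text \<open>Turns an identity that follows from known relations into a polynomial identity: \<open>Z\<close> is an explicit
  linear combination of the relations (left minus right hand sides), found by computer algebra.\<close>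

lemma lincomb: "L - R = (Z :: complex) \<Longrightarrow> Z = 0 \<Longrightarrow> L = R"
  by simp

lemma two_cases: "(i::nat) = 0 \<or> i = 1 \<or> i > 1"
  by linarith

text \<open>Checked by entries: equal row indices on the legs \<open>t\<close> and \<open>p\<close>
  need only one relation between the coefficients, unequal ones need in addition three-term
  identities for c.\<close>

lemma R_fusion_ge2:
  assumes d: "d > 1" and z: "z \<noteq> 0" and n: "t \<noteq> p" "t \<noteq> q" "p \<noteq> q"
  shows "R1 1 (z * H (1 - int d)) t p * R1 (d - 1) (z * h) t q * EE d p q = EE d p q * R1 d z t q"
proof (rule mx_ext3[OF n])
  fix f and s :: state and i j k
  let ?S = "st3 t p q s"
  define P where "P = pre (d - 1) (z * h)"
  have cz1: "cz (z * H (1 - int d)) 2 = cz z (3 - int d)" "cz (z * H (1 - int d)) 0 = cz z (1 - int d)"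
    "cz (z * h) (int d - 2 * int k) = cz z (1 + int d - 2 * int k)" "cz (z * h) (2 - int d + 2 * int k) = cz z (3 - int d + 2 * int k)" for k
    unfolding cz_H by (rule arg_cong[of _ _ "cz z"]; simp)+
  note T = RE_app[OF d n, where z = "z * h", folded P_def] ER_app[OF _ n, of d] R11_app[OF n(1)] st3(1-6)[OF n]
     pre_Suc_low[OF d, of z, folded P_def] cz1
  have d0: "d > 0" using d by simp
  show "app (R1 1 (z * H (1 - int d)) t p * R1 (d - 1) (z * h) t q * EE d p q) f (?S i j k) = app (EE d p q * R1 d z t q) f (?S i j k)"
  proof (cases "k < d")
    case False
    then have "al d k = 0" "be d (Suc k) = 0" "al d (Suc k) = 0" "be d (Suc (Suc k)) = 0" 
      using d by (auto intro!: al_ge be_gt)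
    moreover have "b (d - 1) k * be d k = 0" "b (d - 1) k * al d (k - 1) = 0"
      using False d0 b_end[of "d - 1"] be_gt[of d k] al_ge[of d "k - 1"] by (cases "k = d"; auto)+
    ultimately show ?thesis using d0 two_cases[of i] two_cases[of j] by (elim disjE) (simp_all add: T)
  next
    case k: True
    note G = G_coefs[OF d k]
    have i1: "cz z (1 - int d) * cz z (1 + int d - 2 * int k) + cq 1 * cq (int d - 1 - int k) = cz z (3 - int d) * cz z (int d - 1 - 2 * int k)"
      by (rule cz_id[OF z]) auto
    have i2: "cz z (1 - int d) * cq (int k) + cz z (3 - int d + 2 * int k) * cq 1 = cz z (3 - int d) * cq (int k + 1)"
      by (rule czq_id[OF z]) auto
    have i3: "cz z (1 - int d) * cq (int d - 1 - int k) + cz z (1 + int d - 2 * int k) * cq 1 = cz z (3 - int d) * cq (int d - int k)"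
      by (rule czq_id[OF z]) auto
    have i4: "cz z (1 - int d) * cz z (3 - int d + 2 * int k) + cq 1 * cq (int k) = cz z (3 - int d) * cz z (1 - int d + 2 * int k)"
      by (rule cz_id[OF z]) auto
    consider "i = 0" "j = 0" | "i = 0" "j = 1" | "i = 1" "j = 0" | "i = 1" "j = 1" | "i > 1 \<or> j > 1" by linarith
    then show ?thesis
    proof cases
      case 1
      show ?thesis unfolding 1 using d0 G(1) by (simp add: T, simp add: algebra_simps)
    next
      case 2
      show ?thesis unfolding 2 using d0 apply (simp add: T)
        apply (rule lincomb[where Z = "P * f (?S 0 0 (Suc k)) * be d (Suc k) * ((cz z (1 - int d)*cz z (1 + int d - 2 * int k)+cq 1*cq (int d - 1 - int k)) - (cz z (3 - int d)*cz z (int d - 1 - 2 * int k))) + P * f (?S 0 0 (Suc k)) * cq 1 * ((b (d - 1) (Suc k)*al d (Suc k)) - (cq (int d - 1 - int k)*be d (Suc k))) + P * f (?S 1 0 k) * cz z (1 - int d) * ((b (d - 1) k*be d k) - (cq (int k)*al d k)) + P * f (?S 1 0 k) * al d k * ((cz z (1 - int d)*cq (int k)+cz z (3 - int d + 2 * int k)*cq 1) - (cz z (3 - int d)*cq (int k + 1))) - P * f (?S 1 0 k) * cz z (3 - int d) * ((be d (Suc k)*b d (Suc k)) - (cq (int k + 1)*al d k))"])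
        subgoal by (simp add: algebra_simps)
        subgoal by (simp only: i1 i2 G(2,3,4) diff_self mult_zero_right add_0_left diff_zero)
        done
    next
      case 3
      show ?thesis unfolding 3 using d0 apply (simp add: T)
        apply (rule lincomb[where Z = "P * f (?S 0 0 (Suc k)) * be d (Suc k) * ((cz z (1 - int d)*cq (int d - 1 - int k)+cz z (1 + int d - 2 * int k)*cq 1) - (cz z (3 - int d)*cq (int d - int k))) + P * f (?S 0 0 (Suc k)) * cz z (1 - int d) * ((b (d - 1) (Suc k)*al d (Suc k)) - (cq (int d - 1 - int k)*be d (Suc k))) - P * f (?S 0 0 (Suc k)) * cz z (3 - int d) * ((al d k*b d (Suc k)) - (cq (int d - int k)*be d (Suc k))) + P * f (?S 1 0 k) * cq 1 * ((b (d - 1) k*be d k) - (cq (int k)*al d k)) + P * f (?S 1 0 k) * al d k * ((cz z (1 - int d)*cz z (3 - int d + 2 * int k)+cq 1*cq (int k)) - (cz z (3 - int d)*cz z (1 - int d + 2 * int k)))"])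
        subgoal by (simp add: algebra_simps)
        subgoal by (simp only: i3 i4 G(2,3,5) diff_self mult_zero_right add_0_left diff_zero)
        done
    next
      case 4
      show ?thesis unfolding 4 using d0 G(6) by (simp add: T, simp add: algebra_simps)
    next
      case 5
      then show ?thesis using d0 by (elim disjE) (simp_all add: T)
    qed
  qed
qed

text \<open>The product in the other order, with the opposite shifts, agrees with the first one on
  the image of \<open>EE\<close>. Having both orders lets the factors be nested suitably in the
  exchange relation and in the reflection equation.\<close>

lemma R_fusion_rev_ge2:
  assumes d: "d > 1" and z: "z \<noteq> 0" and n: "t \<noteq> p" "t \<noteq> q" "p \<noteq> q"
  shows "R1 (d - 1) (z * inverse h) t q * R1 1 (z * H (int d - 1)) t p * EE d p q = EE d p q * R1 d z t q"
proof (rule mx_ext3[OF n])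
  fix f and s :: state and i j k
  let ?S = "st3 t p q s"
  define P where "P = pre (d - 1) (z * inverse h)"
  have cz1: "cz (z * H (int d - 1)) 2 = cz z (int d + 1)" "cz (z * H (int d - 1)) 0 = cz z (int d - 1)"
    "cz (z * inverse h) (1 + int (d - 1) - 2 * int k) = cz z (int d - 1 - 2 * int k)"
    "cz (z * inverse h) (1 - int (d - 1) + 2 * int k) = cz z (1 - int d + 2 * int k)" for k
    unfolding cz_H by (rule arg_cong[of _ _ "cz z"]; use d in \<open>simp add: of_nat_diff\<close>)+
  have d0: "d > 0" "d - 1 > 0" using d by auto
  have i0: "1 + int d - 2 * int (Suc k) = int d - 1 - 2 * int k" for k by simp
  note T = EE_app'[OF d0(1) n(3)] R1_app[OF d0(2) n(2)] R1_app[OF d0(1) n(2)] R11_app[OF n(1)] st3(1-6)[OF n]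
     pre_Suc_high[OF d, of z, folded P_def] cz1
  show "app (R1 (d - 1) (z * inverse h) t q * R1 1 (z * H (int d - 1)) t p * EE d p q) f (?S i j k) = app (EE d p q * R1 d z t q) f (?S i j k)"
  proof (cases "k < d")
    case False
    then have "al d k = 0" "be d (Suc k) = 0" "\<not> k \<le> d - 1"
      using d by (auto intro!: al_ge be_gt)
    then show ?thesis using d0 n two_cases[of i] two_cases[of j] by (elim disjE) (simp_all add: T P_def[symmetric])
  next
    case k: True
    note G = G_coefs[OF d k]
    have k': "k \<le> d - 1" using k by simp
    have i1: "cz z (int d - 1 - 2 * int k) * cz z (int d + 1) + cq 1 * cq (int k) = cz z (int d - 1) * cz z (1 + int d - 2 * int k)"
      by (rule cz_id[OF z]) auto
    have i2: "cz z (int d - 1 - 2 * int k) * cq 1 + cz z (int d + 1) * cq (int k) = cz z (int d - 1) * cq (int k + 1)"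
      by (rule czq_id[OF z]) auto
    have i3: "cz z (1 - int d + 2 * int k) * cq 1 + cz z (int d + 1) * cq (int d - 1 - int k) = cz z (int d - 1) * cq (int d - int k)"
      by (rule czq_id[OF z]) auto
    have i4: "cz z (1 - int d + 2 * int k) * cz z (int d + 1) + cq 1 * cq (int d - 1 - int k) = cz z (int d - 1) * cz z (3 - int d + 2 * int k)"
      by (rule cz_id[OF z]) auto
    have k1: "b (d - 1) k * (c * (be d (Suc (k - 1)) * f (?S x 0 (Suc (k - 1))))) = b (d - 1) k * (c * (be d k * f (?S x 0 k)))" for c x
      by (cases k) simp_all
    consider "i = 0" "j = 0" | "i = 0" "j = 1" | "i = 1" "j = 0" | "i = 1" "j = 1" | "i > 1 \<or> j > 1" by linarith
    then show ?thesis
    proof cases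
      case 1
      show ?thesis unfolding 1 app_mult_fun ER_app(1-4)[OF d0(1) n] using n k' apply (simp add: T distrib_left k1 P_def[symmetric])
        apply (rule lincomb[where Z = "P * f (?S 0 0 k) * al d k * ((cz z (int d - 1 - 2 * int k)*cz z (int d + 1)+cq 1*cq (int k)) - (cz z (int d - 1)*cz z (1 + int d - 2 * int k))) + P * f (?S 0 0 k) * cq 1 * ((b (d - 1) k*be d k) - (cq (int k)*al d k)) + P * f (?S 1 0 (k - 1)) * cz z (int d - 1) * ((b (d - 1) k*al d (k - 1)) - (al d k*b d k))"])
        subgoal by (simp add: algebra_simps)
        subgoal by (simp only: i1 G(1,3) diff_self mult_zero_right add_0_left diff_zero)
        done
    next
      case 2
      show ?thesis unfolding 2 app_mult_fun ER_app(1-4)[OF d0(1) n] using n k' apply (simp add: T distrib_left k1 P_def[symmetric])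
        apply (rule lincomb[where Z = "P * f (?S 1 0 k) * al d k * ((cz z (int d - 1 - 2 * int k)*cq 1+cz z (int d + 1)*cq (int k)) - (cz z (int d - 1)*cq (int k + 1))) + P * f (?S 1 0 k) * cz z (int d + 1) * ((b (d - 1) k*be d k) - (cq (int k)*al d k)) - P * f (?S 1 0 k) * cz z (int d - 1) * ((be d (Suc k)*b d (Suc k)) - (cq (int k + 1)*al d k))"])
        subgoal by (simp add: algebra_simps)
        subgoal by (simp only: i2 G(3,4) diff_self mult_zero_right add_0_left diff_zero)
        done
    next
      case 3
      show ?thesis unfolding 3 app_mult_fun ER_app(1-4)[OF d0(1) n] using n k' apply (simp add: T distrib_left k1 P_def[symmetric])
        apply (rule lincomb[where Z = "P * f (?S 0 0 (Suc k)) * be d (Suc k) * ((cz z (1 - int d + 2 * int k)*cq 1+cz z (int d + 1)*cq (int d - 1 - int k)) - (cz z (int d - 1)*cq (int d - int k))) + P * f (?S 0 0 (Suc k)) * cz z (int d + 1) * ((b (d - 1) (Suc k)*al d (Suc k)) - (cq (int d - 1 - int k)*be d (Suc k))) - P * f (?S 0 0 (Suc k)) * cz z (int d - 1) * ((al d k*b d (Suc k)) - (cq (int d - int k)*be d (Suc k)))"])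
        subgoal by (simp add: algebra_simps)
        subgoal by (simp only: i3 G(2,5) diff_self mult_zero_right add_0_left diff_zero)
        done
    next
      case 4
      show ?thesis unfolding 4 app_mult_fun ER_app(1-4)[OF d0(1) n] using n k' apply (simp add: T distrib_left k1 P_def[symmetric])
        apply (rule lincomb[where Z = "P * f (?S 0 0 (Suc (Suc k))) * cz z (int d - 1) * ((b (d - 1) (Suc k)*be d (Suc (Suc k))) - (be d (Suc k)*b d (Suc (Suc k)))) + P * f (?S 1 0 (Suc k)) * cq 1 * ((b (d - 1) (Suc k)*al d (Suc k)) - (cq (int d - 1 - int k)*be d (Suc k))) + P * f (?S 1 0 (Suc k)) * be d (Suc k) * ((cz z (1 - int d + 2 * int k)*cz z (int d + 1)+cq 1*cq (int d - 1 - int k)) - (cz z (int d - 1)*cz z (3 - int d + 2 * int k)))"])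
        subgoal by (simp add: algebra_simps)
        subgoal by (simp only: i4 G(2,6) diff_self mult_zero_right add_0_left diff_zero)
        done
    next
      case 5
      then show ?thesis using n k' d0 ER_app(5)[OF d0(1) n, of j i] by (elim disjE) (simp_all add: T del: One_nat_def)
    qed
  qed
qed

section \<open>The complement of the fused spin\<close>

lemma H_eq_1: "H m = 1 \<Longrightarrow> m = 0"
  using qc_H_neq_0[of m] by (auto simp: qc_def)

text \<open>With X = q^i and Y = q^j the sum is (X + Y)(XY - 1)/(XY), so a zero would make q a root
  of unity. Such sums are the denominators in \<open>FF\<close> and \<open>Dp\<close>.\<close>

lemma cq_add_neq_0:
  assumes "i + j \<noteq> 0" shows "cq i + cq j \<noteq> 0"
proof
  assume z: "cq i + cq j = 0"
  define X Y where "X = H (2 * i)" and "Y = H (2 * j)"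
  have nz: "X \<noteq> 0" "Y \<noteq> 0" by (simp_all add: X_def Y_def)
  have XY: "X * Y \<noteq> 1" using H_eq_1[of "2 * i + 2 * j"] assms by (auto simp: X_def Y_def H_mult)
  have "(X + Y) * (X * Y - 1) = X * Y * (cq i + cq j)"
    using nz unfolding cq_def X_def[symmetric] Y_def[symmetric] qc_def by (simp add: field_simps)
  then have XmY: "X = - Y" using z XY by (auto simp: add_eq_0_iff)
  then have "X * X = Y * Y" by simp
  then have 1: "X * X * inverse (Y * Y) = 1" using nz by (simp add: field_simps)
  have "H (4 * i - 4 * j) = H (2 * i) * H (2 * i) * (H (- (2 * j)) * H (- (2 * j)))"
    unfolding H_mult by (rule arg_cong[of _ _ H]) simp
  also have "\<dots> = X * X * inverse (Y * Y)" by (simp add: X_def Y_def power_int_minus)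
  finally have "H (4 * i - 4 * j) = 1" using 1 by simp
  then have "i = j" using H_eq_1[of "4 * i - 4 * j"] by simp
  then show False using XmY nz by (simp add: X_def Y_def)
qed

text \<open>The bilinear square of column k of the fusion map. It depends on k, so \<open>EE\<close>
  is not an isometry even up to a scalar.\<close>

definition nu :: "nat \<Rightarrow> nat \<Rightarrow> complex" where "nu d k = al d k * al d k + be d k * be d k"

lemma nu_neq_0: "d > 0 \<Longrightarrow> k \<le> d \<Longrightarrow> nu d k \<noteq> 0"
  using cq_add_neq_0[of "int d - int k" "int k"] by (simp add: nu_def al_sq be_sq add_divide_distrib[symmetric])

lemma al_neq_0: "d > 0 \<Longrightarrow> k < d \<Longrightarrow> al d k \<noteq> 0"
  using al_sq[of d k] by auto

definition PR :: "nat \<Rightarrow> nat \<Rightarrow> mx" where "PR n p = PI [p] [n]"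

lemma app_PR: "app (PR n p) f s = (if s p < n then f s else 0)"
proof -
  have "app (PR n p) f s = (\<Sum>t\<in>{s}. ent (PR n p) s t * f t)"
    by (rule app_eq) (auto simp: PR_def ent_PI split: if_splits)
  then show ?thesis by (simp add: PR_def ent_PI inr_def)
qed

text \<open>\<open>FF\<close> is the transpose of \<open>EE\<close> with row k divided by
  \<open>nu d k\<close>. The entries that \<open>fus_F\<close> lists separately fit in, because
  \<open>be d 0\<close> and \<open>al d d\<close> are zero.\<close>

lemma FF_app:
  assumes "d > 0" "p \<noteq> q"
  shows "app (FF d p q) f s = (if s p = 0 \<and> s q \<le> d
    then al d (s q) / nu d (s q) * f s + be d (s q) / nu d (s q) * f (s(p := 1, q := s q - 1)) else 0)"
proof (cases "s p = 0 \<and> s q \<le> d")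
  case True
  let ?k = "s q"
  have F: "fus_F h d $$ (?k, r) = (if ?k = 0 \<and> r = 0 then 1 else if 1 \<le> ?k \<and> ?k < d \<and> r + 1 = ?k + d then be d ?k / nu d ?k
     else if 1 \<le> ?k \<and> ?k < d \<and> r = ?k then al d ?k / nu d ?k
     else if ?k = d \<and> r + 1 = 2 * d then 1 / be d ?k else 0)" if r: "r < 2 * d" for r
  proof -
    have 1: "F_upp h d (Suc ?k) = be d ?k / nu d ?k"
      by (simp add: F_upp_def nu_def al_def be_def power2_eq_square)
    have 2: "(1 - be d ?k / nu d ?k * be d ?k) / al d ?k = al d ?k / nu d ?k" if "?k < d"
      using nu_neq_0[of d ?k] al_neq_0[of d ?k] that assms by (simp add: field_simps) (simp add: nu_def algebra_simps)
    have "fus_F h d $$ (?k, r) = (if Suc ?k = 1 \<and> Suc r = 1 then 1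
     else if 2 \<le> Suc ?k \<and> Suc ?k \<le> d \<and> Suc r = Suc ?k + d - 1 then F_upp h d (Suc ?k)
     else if 2 \<le> Suc ?k \<and> Suc ?k \<le> d \<and> Suc r = Suc ?k then (1 - F_upp h d (Suc ?k) * E_low h d (Suc ?k)) / E_diag h d (Suc ?k)
     else if Suc ?k = d + 1 \<and> Suc r = 2 * d then inverse (E_low h d (d + 1))
     else 0)" using r True by (simp add: fus_F_def mat1_def Suc_eq_plus1[symmetric])
    also have "\<dots> = (if ?k = 0 \<and> r = 0 then 1 else if 1 \<le> ?k \<and> ?k < d \<and> r + 1 = ?k + d then be d ?k / nu d ?k
     else if 1 \<le> ?k \<and> ?k < d \<and> r = ?k then al d ?k / nu d ?k
     else if ?k = d \<and> r + 1 = 2 * d then 1 / be d ?k else 0)"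
      unfolding 1 al_def[symmetric] be_def[symmetric] using 2
      by (auto simp: be_def al_def inverse_eq_divide Suc_eq_plus1[symmetric])
    finally show ?thesis .
  qed
  have e: "1 / be d d = be d d / nu d d" using assms by (simp add: nu_def al_end)
  have z: "nu d 0 = 1" by (simp add: nu_def)
  have "app (mop [p, q] [1, d + 1] [2, d] (fus_F h d)) f s = al d ?k / nu d ?k * f (s(p := 0, q := ?k)) + be d ?k / nu d ?k * f (s(p := 1, q := ?k - 1))"
  proof (rule app_two_terms)
    fix i j :: nat assume ij: "i < 2" "j < d"
    have r: "i * d + j < 2 * d" using ij by (auto simp: less_2_cases')
    have m: "s p * (d + 1) + s q = ?k" using True by simp
    show "fus_F h d $$ (s p * (d + 1) + s q, i * d + j) = (if i = 0 \<and> j = ?k then al d ?k / nu d ?k else 0)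
      + (if i = 1 \<and> j = ?k - 1 then be d ?k / nu d ?k else 0)"
    proof (cases "i = 0")
      case True
      then show ?thesis unfolding m F[OF r] using ij assms by (auto simp: z al_end)
    next
      case False
      then have i: "i = 1" using ij by simp
      consider "?k = 0" | "?k = d" "?k > 0" | "0 < ?k" "?k < d" using \<open>s p = 0 \<and> s q \<le> d\<close> by linarith
      then show ?thesis
      proof cases
        case 1
        then show ?thesis unfolding m F[OF r] using i ij assms by auto
      next
        case 2
        then have "i * d + j + 1 = 2 * d \<longleftrightarrow> j = d - 1" using ij i by auto
        then show ?thesis unfolding m F[OF r] using 2 e i by auto
      next
        case 3
        then have "i * d + j + 1 = ?k + d \<longleftrightarrow> j = ?k - 1" "i * d + j \<noteq> ?k" using ij i by auto
        then show ?thesis unfolding m F[OF r] using 3 i by auto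
      qed
    qed
  next
    show "al d (s q) / nu d (s q) = 0 \<or> 0 < (2::nat) \<and> s q < d" using True assms by (cases "s q = d") (auto simp: al_end)
    show "be d (s q) / nu d (s q) = 0 \<or> 1 < (2::nat) \<and> s q - 1 < d" using True assms by (cases "s q = 0") auto
  qed (use True assms in auto)
  moreover have "s(p := 0, q := s q) = s" using True by (auto simp: fun_eq_iff)
  ultimately show ?thesis using True by (simp add: FF_def)
next
  case False
  then show ?thesis using assms by (auto simp: FF_def app_mop2)
qed

lemma TE_app:
  assumes "d > 0" "p \<noteq> q"
  shows "app (trn (EE d p q)) f s = (if s p = 0 \<and> s q \<le> d
    then al d (s q) * f s + be d (s q) * f (s(p := 1, q := s q - 1)) else 0)"
proof -
  have t: "trn (EE d p q) = mop [p, q] [1, d + 1] [2, d] (transpose_mat (fus_E h d))"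
    unfolding EE_def by (rule trn_mop) (auto simp: fus_E_def mat1_def)
  show ?thesis
  proof (cases "s p = 0 \<and> s q \<le> d")
    case True
    let ?k = "s q"
    have "app (mop [p, q] [1, d + 1] [2, d] (transpose_mat (fus_E h d))) f s = al d ?k * f (s(p := 0, q := ?k)) + be d ?k * f (s(p := 1, q := ?k - 1))"
    proof (rule app_two_terms)
      fix i j :: nat assume ij: "i < 2" "j < d"
      have r: "i * d + j < 2 * d" using ij by (auto simp: less_2_cases')
      have m: "s p * (d + 1) + s q = ?k" using True by simp
      have E: "fus_E h d $$ (i * d + j, ?k) = (if i * d + j = ?k \<and> Suc ?k \<le> d then al d ?k
        else if Suc (i * d + j) = ?k + d \<and> 1 \<le> ?k then be d ?k else 0)"
        using r True by (auto simp: fus_E_def mat1_def al_def be_def Suc_eq_plus1[symmetric])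
      have "transpose_mat (fus_E h d) $$ (?k, i * d + j) = fus_E h d $$ (i * d + j, ?k)"
        using r True by (subst index_transpose_mat) (auto simp: fus_E_def mat1_def)
      then show "transpose_mat (fus_E h d) $$ (s p * (d + 1) + s q, i * d + j) = (if i = 0 \<and> j = ?k then al d ?k else 0)
        + (if i = 1 \<and> j = ?k - 1 then be d ?k else 0)"
        unfolding m E using ij True assms by (cases "i = 0"; cases "?k = 0") (auto simp: less_2_cases')
    next
      show "al d (s q) = 0 \<or> 0 < (2::nat) \<and> s q < d" using True assms by (cases "s q = d") (auto simp: al_end)
      show "be d (s q) = 0 \<or> 1 < (2::nat) \<and> s q - 1 < d" using True assms by (cases "s q = 0") auto
    qed (use True assms in auto)
    moreover have "s(p := 0, q := s q) = s" using True by (auto simp: fun_eq_iff)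
    ultimately show ?thesis using True by (simp add: t)
  next
    case False
    then show ?thesis using assms by (auto simp: t app_mop2)
  qed
qed

text \<open>Up to the scalars \<open>w\<close>, the rows span the orthogonal complement of the image of \<open>fus_E\<close>, of spin \<open>(d - 2) / 2\<close>.\<close>

definition Dmat :: "nat \<Rightarrow> (nat \<Rightarrow> complex) \<Rightarrow> complex mat" where
  "Dmat d w = mat (d - 1) (2 * d) (\<lambda>(r, k). if k = Suc r then w r * be (d - 1) (Suc r) else if k = d + r then - w r * al (d - 1) r else 0)"

definition Dt :: "nat \<Rightarrow> nat \<Rightarrow> nat \<Rightarrow> mx" where
  "Dt d p q = mop [p, q] [1, d - 1] [2, d] (Dmat d (\<lambda>_. 1))"

text \<open>The right inverse of \<open>Dt\<close>: its transpose with each column divided by the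
  bilinear square of the corresponding row of \<open>Dt\<close>.\<close>

definition Dp :: "nat \<Rightarrow> nat \<Rightarrow> nat \<Rightarrow> mx" where
  "Dp d p q = mop [p, q] [2, d] [1, d - 1] (transpose_mat (Dmat d (\<lambda>r. 1 / (be (d - 1) (Suc r) * be (d - 1) (Suc r) + al (d - 1) r * al (d - 1) r))))"

lemma Dt_app:
  assumes "d > 1" "p \<noteq> q"
  shows "app (Dt d p q) f s = (if s p = 0 \<and> s q < d - 1
    then be (d - 1) (Suc (s q)) * f (s(q := Suc (s q))) - al (d - 1) (s q) * f (s(p := 1)) else 0)"
proof (cases "s p = 0 \<and> s q < d - 1")
  case True
  have "app (Dt d p q) f s = be (d - 1) (Suc (s q)) * f (s(p := 0, q := Suc (s q))) + (- al (d - 1) (s q)) * f (s(p := 1, q := s q))"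
    unfolding Dt_def
  proof (rule app_two_terms)
    fix i j :: nat assume ij: "i < 2" "j < d"
    have m: "s p * (d - 1) + s q = s q" using True by simp
    have r: "i * d + j < 2 * d" using ij by (auto simp: less_2_cases')
    show "Dmat d (\<lambda>_. 1) $$ (s p * (d - 1) + s q, i * d + j) = (if i = 0 \<and> j = Suc (s q) then be (d - 1) (Suc (s q)) else 0)
      + (if i = 1 \<and> j = s q then - al (d - 1) (s q) else 0)"
      unfolding m Dmat_def using r ij True by (cases "i = 0") (auto simp: less_2_cases')
  qed (use True assms in auto)
  moreover have "s(p := 0, q := Suc (s q)) = s(q := Suc (s q))" "s(p := 1, q := s q) = s(p := 1)"
    using True assms by (auto simp: fun_eq_iff)
  ultimately show ?thesis using True by simp
next
  case False
  then show ?thesis using assms by (auto simp: Dt_def app_mop2)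
qed

text \<open>Stated for arbitrary weights so as to serve \<open>trn Dt\<close>, with weight 1, as
  well as \<open>Dp\<close>.\<close>

lemma DT_app:
  assumes "d > 1" "p \<noteq> q"
  shows "app (mop [p, q] [2, d] [1, d - 1] (transpose_mat (Dmat d w))) f s =
    (if s p = 0 \<and> s q < d then w (s q - 1) * be (d - 1) (s q) * f (s(p := 0, q := s q - 1))
     else if s p = 1 \<and> s q < d then - w (s q) * al (d - 1) (s q) * f (s(p := 0)) else 0)"
proof (cases "s p < 2 \<and> s q < d")
  case True
  let ?c = "if s p = 0 then w (s q - 1) * be (d - 1) (s q) else - w (s q) * al (d - 1) (s q)"
  let ?j = "if s p = 0 then s q - 1 else s q"
  have "app (mop [p, q] [2, d] [1, d - 1] (transpose_mat (Dmat d w))) f s = ?c * f (s(p := 0, q := ?j)) + 0 * f (s(p := 0, q := 0))"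
  proof (rule app_two_terms)
    fix i j :: nat assume ij: "i < 1" "j < d - 1"
    have r: "s p * d + s q < 2 * d" using True by (auto simp: less_2_cases')
    have "transpose_mat (Dmat d w) $$ (s p * d + s q, i * (d - 1) + j) = Dmat d w $$ (j, s p * d + s q)"
      using r ij by (subst index_transpose_mat) (auto simp: Dmat_def)
    then show "transpose_mat (Dmat d w) $$ (s p * d + s q, i * (d - 1) + j) = (if i = 0 \<and> j = ?j then ?c else 0) + (if i = 0 \<and> j = 0 then 0 else 0)"
      using r ij True unfolding Dmat_def by (cases "s p = 0"; cases "s q = 0") (auto simp: less_2_cases')
  next
    show "?c = 0 \<or> 0 < (1::nat) \<and> ?j < d - 1"
      using True assms al_end[of "d - 1"] by (cases "s p = 0"; cases "s q = 0"; cases "s q = d - 1") auto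
  qed (use True assms in auto)
  moreover have "s p \<noteq> 0 \<Longrightarrow> s(p := 0, q := s q) = s(p := 0)" using assms by (auto simp: fun_eq_iff)
  ultimately show ?thesis using True by (auto simp: less_2_cases')
next
  case False
  then show ?thesis using assms by (auto simp: app_mop2)
qed

lemma trn_Dt: "trn (Dt d p q) = mop [p, q] [2, d] [1, d - 1] (transpose_mat (Dmat d (\<lambda>_. 1)))"
  unfolding Dt_def by (rule trn_mop) (auto simp: Dmat_def)

lemma FF_EE: "d > 0 \<Longrightarrow> p \<noteq> q \<Longrightarrow> FF d p q * EE d p q = PR 1 p * PR (d + 1) q"
proof (rule mx_ext2[of p q])
  fix f and s :: state and j k assume d: "d > 0" and n: "p \<noteq> q"
  show "app (FF d p q * EE d p q) f (st2 p q s j k) = app (PR 1 p * PR (d + 1) q) f (st2 p q s j k)"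
  proof (cases "j = 0 \<and> k \<le> d")
    case True
    have "al d k / nu d k * (al d k * x) + be d k / nu d k * (be d k * x) = x" for x
    proof -
      have "al d k / nu d k * (al d k * x) + be d k / nu d k * (be d k * x) = nu d k * x / nu d k"
        by (simp add: nu_def add_divide_distrib distrib_right mult.assoc)
      then show ?thesis using nu_neq_0[OF d] True by simp
    qed
    then show ?thesis using True d n
      by (cases k) (simp_all add: FF_app EE_app' app_PR st2(1-4)[OF n] del: times_divide_eq_left times_divide_eq_right)
  next
    case False
    then show ?thesis using d n by (auto simp: FF_app EE_app' app_PR st2(1-4)[OF n])
  qed
qed

text \<open>Says that the rows of \<open>Dt\<close> are orthogonal to the columns of
  \<open>EE\<close>. The same identity makes two successive splittings symmetric in
  \<open>EE_swap\<close>.\<close>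

lemma al_be_sym: "d > 1 \<Longrightarrow> be (d - 1) (Suc k) * al d (Suc k) = al (d - 1) k * be d (Suc k)"
proof (cases "Suc k < d")
  case False
  assume "d > 1"
  then show ?thesis using False al_ge[of d "Suc k"] al_ge[of "d - 1" k] by simp
qed (use al_be_comm[of d "Suc k"] in \<open>simp add: mult.commute\<close>)

lemma Dt_EE: "d > 1 \<Longrightarrow> p \<noteq> q \<Longrightarrow> Dt d p q * EE d p q = 0"
proof (rule mx_ext2[of p q])
  fix f and s :: state and j k assume d: "d > 1" and n: "p \<noteq> q"
  show "app (Dt d p q * EE d p q) f (st2 p q s j k) = app 0 f (st2 p q s j k)"
    using d n al_be_sym[OF d, of k] by (auto simp: Dt_app EE_app' st2(1-4)[OF n] mult.assoc[symmetric])
qed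

lemma mu_neq_0:
  assumes "d > 1" "k < d - 1"
  shows "be (d - 1) (Suc k) * be (d - 1) (Suc k) + al (d - 1) k * al (d - 1) k \<noteq> 0"
  using cq_add_neq_0[of "int (Suc k)" "int (d - 1) - int k"] assms
  by (simp add: al_sq be_sq add_divide_distrib[symmetric])

lemma resolution: "d > 1 \<Longrightarrow> p \<noteq> q \<Longrightarrow> EE d p q * FF d p q + Dp d p q * Dt d p q = PR 2 p * PR d q"
proof (rule mx_ext2[of p q])
  fix f and s :: state and j k assume d: "d > 1" and n: "p \<noteq> q"
  have n0: "nu d k \<noteq> 0" if "k \<le> d" for k using nu_neq_0 d that by simp
  have m0: "be (d - 1) (Suc k) * be (d - 1) (Suc k) + al (d - 1) k * al (d - 1) k \<noteq> 0" if "k < d - 1" for k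
    using mu_neq_0[OF d that] .
  \<comment> \<open>One weight space is a plane. The column (x1, y1) of \<open>EE\<close> and the
    row (y2, -x2) of \<open>Dt\<close> are orthogonal by \<open>r\<close>, so the projections onto
    their lines add up to the identity.\<close>
  have key: "x1 * (x1 / N * f + y1 / N * g) + 1 / M * y2 * (y2 * f - x2 * g) = f"
      "y1 * (x1 / N * f + y1 / N * g) - 1 / M * x2 * (y2 * f - x2 * g) = g"
    if r: "y2 * x1 = x2 * y1" and N: "N = x1 * x1 + y1 * y1" "N \<noteq> 0" and M: "M = y2 * y2 + x2 * x2" "M \<noteq> 0"
    for x1 x2 y1 y2 N M f g :: complex
  proof -
    have 1: "x1 * x1 * M + y2 * y2 * N = N * M"
     by (rule lincomb[where Z = "(y2 * x1 - x2 * y1) * (y2 * x1 + x2 * y1)"]) (simp add: N M algebra_simps, simp add: r)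
    have 2: "x1 * y1 * M = y2 * x2 * N"
     by (rule lincomb[where Z = "(y2 * x1 - x2 * y1) * (y1 * y2 - x1 * x2)"]) (simp add: N M algebra_simps, simp add: r)
    have 3: "y1 * y1 * M + x2 * x2 * N = N * M"
     by (rule lincomb[where Z = "(x2 * y1 - y2 * x1) * (y2 * x1 + x2 * y1)"]) (simp add: N M algebra_simps, simp add: r)
    have "x1 * (x1 / N * f + y1 / N * g) + 1 / M * y2 * (y2 * f - x2 * g) = ((x1 * x1 * M + y2 * y2 * N) * f + (x1 * y1 * M - y2 * x2 * N) * g) / (N * M)"
      using N(2) M(2) by (simp add: field_simps)
    then show "x1 * (x1 / N * f + y1 / N * g) + 1 / M * y2 * (y2 * f - x2 * g) = f"
      unfolding 1 2 using N(2) M(2) by simp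
    have "y1 * (x1 / N * f + y1 / N * g) - 1 / M * x2 * (y2 * f - x2 * g) = ((x1 * y1 * M - y2 * x2 * N) * f + (y1 * y1 * M + x2 * x2 * N) * g) / (N * M)"
      using N(2) M(2) by (simp add: field_simps)
    then show "y1 * (x1 / N * f + y1 / N * g) - 1 / M * x2 * (y2 * f - x2 * g) = g"
      unfolding 2 3 using N(2) M(2) by simp
  qed
  have key': "al d (Suc i) * (al d (Suc i) / nu d (Suc i) * x + be d (Suc i) / nu d (Suc i) * y) +
      1 / (be (d - 1) (Suc i) * be (d - 1) (Suc i) + al (d - 1) i * al (d - 1) i) * be (d - 1) (Suc i) * (be (d - 1) (Suc i) * x - al (d - 1) i * y) = x"
     "be d (Suc i) * (al d (Suc i) / nu d (Suc i) * x + be d (Suc i) / nu d (Suc i) * y) -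
      1 / (be (d - 1) (Suc i) * be (d - 1) (Suc i) + al (d - 1) i * al (d - 1) i) * al (d - 1) i * (be (d - 1) (Suc i) * x - al (d - 1) i * y) = y"
    if "i < d - 1" for i x y
    by (rule key[OF al_be_sym[OF d] nu_def _ refl m0[OF that]], rule nu_neq_0, use d that in simp, use that in simp)+
  have d0: "d > 0" using d by simp
  note T = EE_app'[OF d0 n] FF_app[OF d0 n] Dp_def DT_app[OF d n] Dt_app[OF d n] app_PR st2(1-4)[OF n]
  show "app (EE d p q * FF d p q + Dp d p q * Dt d p q) f (st2 p q s j k) = app (PR 2 p * PR d q) f (st2 p q s j k)"
  proof (cases "k < d")
    case False
    then have "al d k = 0" "be d (Suc k) = 0" using d by (auto intro!: al_ge be_gt)
    then show ?thesis using False two_cases[of j] by (elim disjE) (simp_all add: T)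
  next
    case k: True
    show ?thesis using two_cases[of j]
    proof (elim disjE)
      assume j: "j = 0"
      show ?thesis
      proof (cases k)
        case 0
        then show ?thesis using j d0 by (simp add: T nu_def)
      next
        case (Suc i)
        then have i: "i < d - 1" using k by simp
        from key'(1)[OF i] show ?thesis using i j k Suc by (simp add: T)
      qed
    next
      assume j: "j = 1"
      show ?thesis
      proof (cases "k < d - 1")
        case True
        from key'(2)[OF this] show ?thesis using j k True by (simp add: T)
      next
        \<comment> \<open>The highest weight lies in the image of \<open>EE\<close> alone: the
          complement does not reach it, and \<open>nu d d\<close> is the square of
          \<open>be d d\<close>.\<close>
        case False
        then have e: "Suc k = d" using k by simp
        have "d - 1 = k" using e by simp
        then have e2: "f (st2 p q s 1 (d - 1)) = f (st2 p q s 1 k)" by simp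
        have "al (d - 1) k = 0" using False d by (intro al_ge) auto
        moreover have "al d d = 0" using al_end[OF d0] .
        moreover have "be d d \<noteq> 0" using be_sq[of d d] d by auto
        ultimately show ?thesis using j k e e2 by (simp add: T nu_def)
      qed
    next
      assume "j > 1"
      then show ?thesis by (simp add: T)
    qed
  qed
qed

lemma Dt_Dp: "d > 1 \<Longrightarrow> p \<noteq> q \<Longrightarrow> Dt d p q * Dp d p q = PR 1 p * PR (d - 1) q"
proof (rule mx_ext2[of p q])
  fix f and s :: state and j k assume d: "d > 1" and n: "p \<noteq> q"
  have "be (d - 1) (Suc k) * (1 / m * be (d - 1) (Suc k) * x) - al (d - 1) k * (- (1 / m) * al (d - 1) k * x) = x"
    if "m = be (d - 1) (Suc k) * be (d - 1) (Suc k) + al (d - 1) k * al (d - 1) k" "k < d - 1" for x m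
    using mu_neq_0[OF d that(2)] unfolding that(1)[symmetric] by (simp add: field_simps) (simp add: that(1) algebra_simps)
  from this[OF refl] show "app (Dt d p q * Dp d p q) f (st2 p q s j k) = app (PR 1 p * PR (d - 1) q) f (st2 p q s j k)"
    using d n by (auto simp: Dt_app Dp_def DT_app app_PR st2(1-4)[OF n])
qed

section \<open>Relations for spin one half\<close>

lemma al_be2: "0 < i \<Longrightarrow> i \<le> e \<Longrightarrow> cq (int e) * (al e (i - 1) * be e i) = b e i"
proof (cases i)
  case (Suc k)
  assume i: "i \<le> e"
  have nb: "b e i \<noteq> 0" using i Suc by (intro b_neq_0) auto
  have "cq (int e) * (al e k * be e i) * b e i = cq (int e) * (al e k * al e k) * cq (int k + 1)"
    using nb Suc by (simp add: be_Suc)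
  also have "\<dots> = b e i * b e i" using i Suc by (simp add: b_sq al_sq add.commute)
  finally show ?thesis using nb Suc by simp
qed simp

text \<open>At q^(d/2) the diagonal entries become q-numbers, and all entries turn into products of
  two coefficients of the fusion map: R drops to the rank of the higher spin.\<close>

lemma R1_symmetrizer:
  assumes d: "d > 1" and n: "p \<noteq> q"
  shows "R1 (d - 1) (H (int d)) p q = scal (pre (d - 1) (H (int d)) * cq (int d)) (EE d p q * trn (EE d p q))"
proof (rule mx_ext2[OF n])
  fix f and s :: state and j k
  have c: "cz (H (int d)) (1 + int (d - 1) - 2 * int k) = cq (int d - int k)" "cz (H (int d)) (1 - int (d - 1) + 2 * int k) = cq (int k + 1)" for k
    unfolding cz_def cq_def H_mult by (rule arg_cong[of _ _ "\<lambda>x. qc (H x)"], use d in simp)+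
  have d0: "d > 0" "d - 1 > 0" using d by auto
  have cd: "cq (int d) \<noteq> 0" using d by simp
  define P where "P = pre (d - 1) (H (int d))"
  have R: "app (R1 (d - 1) (H (int d)) p q) g u = (if u q \<le> d - 1 then
     if u p = 0 then P * (cq (int d - int (u q)) * g u + b (d - 1) (u q) * g (u(p := 1, q := u q - 1)))
     else if u p = 1 then P * (b (d - 1) (Suc (u q)) * g (u(p := 0, q := Suc (u q))) + cq (int (u q) + 1) * g u)
     else 0 else 0)" for g u
    unfolding R1_app[OF d0(2) n] c P_def by (rule refl)
  note T = R P_def[symmetric] EE_app'[OF d0(1) n] TE_app[OF d0(1) n] st2(1-4)[OF n]
  show "app (R1 (d - 1) (H (int d)) p q) f (st2 p q s j k) = app (scal (pre (d - 1) (H (int d)) * cq (int d)) (EE d p q * trn (EE d p q))) f (st2 p q s j k)"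
  proof (cases "k < d")
    case True
    have "al d k * al d k * cq (int d) = cq (int d - int k)" "be d (Suc k) * be d (Suc k) * cq (int d) = cq (int k + 1)"
      "cq (int d) * (al d k * be d k) = b (d - 1) k" "cq (int d) * (al d (Suc k) * be d (Suc k)) = b (d - 1) (Suc k)"
      using al_sq[of d k] be_sq[of "Suc k" d] al_be[of d k] al_be[of d "Suc k"] True d cd by (auto simp: add.commute)
    note E = this(1,2)[symmetric] this(3,4)[symmetric]
    have k: "k \<le> d - 1" "Suc k \<le> d" using True by auto
    show ?thesis using two_cases[of j] k by (elim disjE) (simp_all add: T E del: power_int_of_nat, simp_all add: algebra_simps)
  next
    case False
    then have "al d k = 0" "be d (Suc k) = 0" "\<not> k \<le> d - 1" using d by (auto intro!: al_ge be_gt)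
    then show ?thesis using two_cases[of j] by (elim disjE) (simp_all add: T del: power_int_of_nat)
  qed
qed

text \<open>The opposite degeneration point, where R drops to the rank of the lower spin. Its kernel
  detects the image of \<open>EE\<close>.\<close>

lemma R1_antisymmetrizer:
  assumes d: "d > 1" and n: "p \<noteq> q"
  shows "R1 (d - 1) (H (- int d)) p q = scal (- pre (d - 1) (H (- int d)) * cq (int (d - 1))) (trn (Dt d p q) * Dt d p q)"
proof (rule mx_ext2[OF n])
  fix f and s :: state and j k
  have c: "cz (H (- int d)) (1 + int (d - 1) - 2 * int k) = - cq (int k)" "cz (H (- int d)) (1 - int (d - 1) + 2 * int k) = - cq (int (d - 1) - int k)" for k
    unfolding cq_minus[symmetric] unfolding cz_def cq_def H_mult by (rule arg_cong[of _ _ "\<lambda>x. qc (H x)"], use d in simp)+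
  have d0: "d > 0" "d - 1 > 0" using d by auto
  have cd: "cq (int (d - 1)) \<noteq> 0" using d by simp
  define D where "D = int (d - 1)"
  define P where "P = pre (d - 1) (H (- int d))"
  have R: "app (R1 (d - 1) (H (- int d)) p q) g u = (if u q \<le> d - 1 then
     if u p = 0 then P * (- cq (int (u q)) * g u + b (d - 1) (u q) * g (u(p := 1, q := u q - 1)))
     else if u p = 1 then P * (b (d - 1) (Suc (u q)) * g (u(p := 0, q := Suc (u q))) + - cq (int (d - 1) - int (u q)) * g u)
     else 0 else 0)" for g u
    unfolding R1_app[OF d0(2) n] c P_def by (rule refl)
  note T = R P_def[symmetric] Dt_app[OF d n] trn_Dt DT_app[OF d n] st2(1-4)[OF n] D_def[symmetric]
  show "app (R1 (d - 1) (H (- int d)) p q) f (st2 p q s j k) = app (scal (- pre (d - 1) (H (- int d)) * cq (int (d - 1))) (trn (Dt d p q) * Dt d p q)) f (st2 p q s j k)"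
  proof (cases "k < d")
    case True
    then have k: "k \<le> d - 1" by simp
    have e1: "al (d - 1) k * al (d - 1) k * cq (int (d - 1)) = cq (int (d - 1) - int k)" "be (d - 1) k * be (d - 1) k * cq (int (d - 1)) = cq (int k)"
      using al_sq[of "d - 1" k] be_sq[of k "d - 1"] k d cd by auto
    have e2: "k > 0 \<Longrightarrow> cq (int (d - 1)) * (al (d - 1) (k - 1) * be (d - 1) k) = b (d - 1) k"
      using al_be2[of k "d - 1"] k by auto
    have e3: "cq (int (d - 1)) * (al (d - 1) k * be (d - 1) (Suc k)) = b (d - 1) (Suc k)"
    proof (cases "Suc k = d")
      case True
      then show ?thesis using al_end[of "d - 1"] b_end[of "d - 1"] d by auto
    next
      case False
      then show ?thesis using al_be2[of "Suc k" "d - 1"] True by auto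
    qed
    have e4: "k < d - 1 \<or> al (d - 1) k = 0" using al_ge[of "d - 1" k] d by linarith
    note e1 = e1[folded D_def] and e2 = e2[folded D_def] and e3 = e3[folded D_def]
    show ?thesis using two_cases[of j]
    proof (elim disjE)
      assume j: "j = 0"
      show ?thesis
      proof (cases "k = 0")
        case True
        then show ?thesis using j d0 by (simp add: T)
      next
        case False
        then have "Suc (k - 1) = k" "k - 1 < d - 1" using k by auto
        then show ?thesis using j True False k by (simp add: T e1[symmetric] e2[symmetric]) (simp add: algebra_simps)
      qed
    next
      assume j: "j = 1"
      show ?thesis using j True k e4
        by (elim disjE) (simp_all add: T e1[symmetric] e3[symmetric], simp_all add: algebra_simps)
    next
      assume "j > 1" then show ?thesis by (simp add: T)
    qed
  next
    case False
    then have "\<not> k \<le> d - 1" using d by simp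
    then show ?thesis using False two_cases[of j] by (elim disjE) (simp_all add: T)
  qed
qed

lemma pre_neq_0: "(\<And>k. k < d - 1 \<Longrightarrow> cz z (int d - 1 - 2 * int k) \<noteq> 0) \<Longrightarrow> pre d z \<noteq> 0"
  by (auto simp: pre_def cz_def)

lemma pre_sym_neq_0: "d > 1 \<Longrightarrow> pre (d - 1) (H (int d)) \<noteq> 0" "d > 1 \<Longrightarrow> pre (d - 1) (H (- int d)) \<noteq> 0"
  by (rule pre_neq_0, unfold cz_def H_mult, rule qc_H_neq_0, linarith)+

section \<open>The spin 1/2 K-matrix and the quantum determinants\<close>

definition KK :: "boundary \<Rightarrow> nat \<Rightarrow> complex \<Rightarrow> nat \<Rightarrow> mx" where
  "KK bd d x q = mop [q] [d + 1] [d + 1] (K_mat h bd d x)"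

text \<open>The singlet covector <01| - <10|, which is \<open>Dt\<close> for d = 2.\<close>

definition st :: "nat \<Rightarrow> nat \<Rightarrow> mx" where
  "st p q = mop [p, q] [1, 1] [2, 2] (mat 1 4 (\<lambda>(r, k). if k = 1 then 1 else if k = 2 then - 1 else 0))"

lemma st_app:
  assumes "p \<noteq> q"
  shows "app (st p q) f s = (if s p = 0 \<and> s q = 0 then f (s(q := 1)) - f (s(p := 1)) else 0)"
proof (cases "s p = 0 \<and> s q = 0")
  case True
  have "s(p := 0, q := Suc 0) = s(q := 1)" "s(p := Suc 0, q := 0) = s(p := 1)"
    using True assms by (auto simp: fun_eq_iff)
  then show ?thesis using True assms
    by (simp add: st_def app_mop2 numeral_2_eq_2 One_nat_def)
next
  case False
  then show ?thesis using assms by (auto simp: st_def app_mop2)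
qed

definition kd :: "boundary \<Rightarrow> complex \<Rightarrow> complex" where "kd bd x = x * eps_plus bd + inverse x * eps_minus bd"
definition kd' :: "boundary \<Rightarrow> complex \<Rightarrow> complex" where "kd' bd x = x * eps_minus bd + inverse x * eps_plus bd"
definition ko :: "complex \<Rightarrow> complex" where "ko x = qc (x\<^sup>2)"
definition kp :: "boundary \<Rightarrow> complex" where "kp bd = k_plus bd / cq 1"
definition km :: "boundary \<Rightarrow> complex" where "km bd = k_minus bd / cq 1"

lemma K1_app:
  "app (KK bd 1 x q) f s = (if s q = 0 then kd bd x * f s + kp bd * ko x * f (s(q := 1))
     else if s q = 1 then km bd * ko x * f (s(q := 0)) + kd' bd x * f s else 0)"
proof -
  have "s q = 0 \<Longrightarrow> s(q := 0) = s" "s q = Suc 0 \<Longrightarrow> s(q := Suc 0) = s" by (auto simp: fun_eq_iff)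
  then show ?thesis
    by (auto simp: KK_def app_mop1 K_half_def mat_of_rows_list_def kd_def kd'_def ko_def kp_def km_def cq_def One_nat_def numeral_2_eq_2 less_Suc_eq)
qed

lemma expand_simps: 
  "cz z 2 = z * h * h - inverse z * inverse h * inverse h" "cz z 0 = z - inverse z" "cq 1 = h * h - inverse h * inverse h"
  by (simp_all add: cz_def cq_def qc_def power2_eq_square)

lemma yang_baxter_half:
  assumes n: "t \<noteq> p" "t \<noteq> q" "p \<noteq> q" and z: "x \<noteq> 0" "y \<noteq> 0"
  shows "R1 1 x t p * R1 1 (x * y) t q * R1 1 y p q = R1 1 y p q * R1 1 (x * y) t q * R1 1 x t p"
proof (rule mx_ext3[OF n])
  fix f and s :: state and i j k
  note T = R11_app[OF n(1)] R11_app[OF n(2)] R11_app[OF n(3)] st3(1-6)[OF n]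
  show "app (R1 1 x t p * R1 1 (x * y) t q * R1 1 y p q) f (st3 t p q s i j k) = app (R1 1 y p q * R1 1 (x * y) t q * R1 1 x t p) f (st3 t p q s i j k)"
    using two_cases[of i] two_cases[of j] two_cases[of k]
    apply (elim disjE)
    apply (simp_all only: T app_mult_fun)
    apply (simp_all add: T)
    apply (insert z)
    apply (simp_all add: expand_simps field_simps)
    done
qed

text \<open>The quantum determinant of a spin 1/2 site. The diagonal entries come from c(zq)^2 =
  c(z) c(z q^2) + c(q)^2.\<close>

lemma st_R_half:
  assumes n: "t \<noteq> p" "t \<noteq> q" "p \<noteq> q" and z: "z \<noteq> 0"
  shows "st p q * R1 1 z t p * R1 1 (z * h\<^sup>2) t q = scal (cz z 0 * cz z 4) (st p q * PR 2 t)"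
proof (rule mx_ext3[OF n])
  fix f and s :: state and i j k
  note T = R11_app[OF n(1)] R11_app[OF n(2)] st_app[OF n(3)] app_PR st3(1-6)[OF n]
  have 1: "cz (z * h\<^sup>2) 2 = cz z 4" "cz (z * h\<^sup>2) 0 = cz z 2" unfolding cz_H by simp_all
  have 2: "cz z 2 * cz z 2 = cz z 0 * cz z 4 + cq 1 * cq 1"
    by (rule cz_id[symmetric, OF z]) auto
  show "app (st p q * R1 1 z t p * R1 1 (z * h\<^sup>2) t q) f (st3 t p q s i j k) = app (scal (cz z 0 * cz z 4) (st p q * PR 2 t)) f (st3 t p q s i j k)"
    using two_cases[of i] two_cases[of j] two_cases[of k]
    apply (elim disjE)
    apply (simp_all only: T app_mult_fun)
    apply (simp_all add: T 1)
    apply (simp_all add: algebra_simps)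
    apply (simp_all only: mult.assoc[symmetric] 2)
    apply (simp_all add: algebra_simps)
    done
qed

lemma reflection_half:
  assumes n: "p \<noteq> q" and z: "x \<noteq> 0" "y \<noteq> 0"
  shows "R1 1 (x * inverse y) p q * KK bd 1 x p * R1 1 (x * y) p q * KK bd 1 y q
       = KK bd 1 y q * R1 1 (x * y) p q * KK bd 1 x p * R1 1 (x * inverse y) p q"
proof (rule mx_ext2[OF n])
  fix f and s :: state and j k
  \<comment> \<open>Named inverses turn each component into a polynomial identity modulo the
    relations \<open>inv\<close>, with no division left.\<close>
  define xi yi g gi where "xi = inverse x" and "yi = inverse y" and "g = h * h" and "gi = inverse (h * h)"
  have inv: "x * xi = 1" "y * yi = 1" "g * gi = 1" using z by (simp_all add: xi_def yi_def g_def gi_def del: inverse_mult_distrib)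
  have inv': "x * (xi * w) = w" "y * (yi * w) = w" "g * (gi * w) = w" for w
    using inv by (simp_all add: mult.assoc[symmetric])
  have e: "cz (x * inverse y) 2 = x * yi * g - xi * y * gi" "cz (x * inverse y) 0 = x * yi - xi * y"
     "cz (x * y) 2 = x * y * g - xi * yi * gi" "cz (x * y) 0 = x * y - xi * yi" "cq 1 = g - gi"
     "ko x = x * x - xi * xi" "ko y = y * y - yi * yi" "kd bd x = x * eps_plus bd + xi * eps_minus bd"
     "kd bd y = y * eps_plus bd + yi * eps_minus bd" "kd' bd x = x * eps_minus bd + xi * eps_plus bd"
     "kd' bd y = y * eps_minus bd + yi * eps_plus bd"
    by (simp_all add: expand_simps ko_def qc_def kd_def kd'_def xi_def yi_def g_def gi_def power2_eq_square)
  note T = R11_app[OF n] K1_app st2(1-4)[OF n]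
  have t: "app A f (st2 p q s j k) = app B f (st2 p q s j k)" if "app A f (st2 p q s j k) - app B f (st2 p q s j k) = 0" for A B
    using that by simp
  show "app (R1 1 (x * inverse y) p q * KK bd 1 x p * R1 1 (x * y) p q * KK bd 1 y q) f (st2 p q s j k)
    = app (KK bd 1 y q * R1 1 (x * y) p q * KK bd 1 x p * R1 1 (x * inverse y) p q) f (st2 p q s j k)"
    using two_cases[of j] two_cases[of k]
    apply (elim disjE)
    apply (simp_all only: T app_mult_fun)
    apply (simp_all add: T)
    apply (simp_all only: e)
    apply (simp_all add: algebra_simps inv inv')
    done
qed

lemma Gamma_minus_alt: "Gamma_minus h bd x = ko x * ((eps_plus bd)\<^sup>2 + (eps_minus bd)\<^sup>2
   + eps_plus bd * eps_minus bd * (x\<^sup>2 * (h\<^sup>2)\<^sup>2 + inverse (x\<^sup>2 * (h\<^sup>2)\<^sup>2)) - kp bd * km bd * (qc (x\<^sup>2 * (h\<^sup>2)\<^sup>2))\<^sup>2)"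
  unfolding Gamma_minus_def Let_def
  by (simp add: ko_def kp_def km_def cq_def qc_def power2_eq_square power_int_minus mult.assoc)

text \<open>This is where \<open>Gamma_minus\<close> originates: it is the quantum determinant of K
  for the reflection equation, the scalar by which two K-matrices joined by R act on the
  singlet.\<close>

lemma st_K_half:
  assumes n: "p \<noteq> q" and z: "x \<noteq> 0"
  shows "st p q * KK bd 1 x p * R1 1 (x\<^sup>2 * h\<^sup>2) p q * KK bd 1 (x * h\<^sup>2) q = scal (Gamma_minus h bd x) (st p q)"
proof (rule mx_ext2[OF n])
  fix f and s :: state and j k
  define xi g gi where "xi = inverse x" and "g = h * h" and "gi = inverse (h * h)"
  have inv: "x * xi = 1" "g * gi = 1" using z by (simp_all add: xi_def g_def gi_def del: inverse_mult_distrib)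
  have inv': "x * (xi * w) = w" "g * (gi * w) = w" for w
    using inv by (simp_all add: mult.assoc[symmetric])
  have e: "cz (x\<^sup>2 * h\<^sup>2) 2 = x * x * g * g - xi * xi * gi * gi" "cz (x\<^sup>2 * h\<^sup>2) 0 = x * x * g - xi * xi * gi" "cq 1 = g - gi"
     "ko x = x * x - xi * xi" "ko (x * h\<^sup>2) = x * x * g * g - xi * xi * gi * gi" "kd bd x = x * eps_plus bd + xi * eps_minus bd"
     "kd bd (x * h\<^sup>2) = x * g * eps_plus bd + xi * gi * eps_minus bd" "kd' bd x = x * eps_minus bd + xi * eps_plus bd"
     "kd' bd (x * h\<^sup>2) = x * g * eps_minus bd + xi * gi * eps_plus bd"
     "Gamma_minus h bd x = (x * x - xi * xi) * (eps_plus bd * eps_plus bd + eps_minus bd * eps_minus bd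
   + eps_plus bd * eps_minus bd * (x * x * g * g + xi * xi * gi * gi) - kp bd * km bd * ((x * x * g * g - xi * xi * gi * gi) * (x * x * g * g - xi * xi * gi * gi)))"
    by (simp_all add: expand_simps ko_def qc_def kd_def kd'_def xi_def g_def gi_def power2_eq_square Gamma_minus_alt mult.assoc)
  note T = R11_app[OF n] K1_app st2(1-4)[OF n] st_app[OF n]
  show "app (st p q * KK bd 1 x p * R1 1 (x\<^sup>2 * h\<^sup>2) p q * KK bd 1 (x * h\<^sup>2) q) f (st2 p q s j k) = app (scal (Gamma_minus h bd x) (st p q)) f (st2 p q s j k)"
    using two_cases[of j] two_cases[of k]
    apply (elim disjE)
    apply (simp_all only: T app_mult_fun app_scal)
    apply (simp_all add: T)
    apply (simp_all only: e)
    apply (simp_all add: algebra_simps inv inv')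
    done
qed

text \<open>The lower spin in 1/2 \<otimes> (d-1)/2 is reached by splitting a spin 1/2 off the
  second factor and contracting it with the first to a singlet. All determinants of higher spin
  thereby reduce to \<open>st\<close>.\<close>

lemma Dt_st:
  assumes d: "d > 1" and n: "p \<noteq> q" "p \<noteq> r" "q \<noteq> r"
  shows "Dt d p r * PR 1 q = st p q * EE (d - 1) q r"
proof (rule mx_ext3[OF n])
  fix f and s :: state and i j k
  have d0: "d - 1 > 0" using d by auto
  have "be (d - 1) (Suc k) = 0 \<and> al (d - 1) k = 0" if "\<not> k < d - 1" using that d by (auto intro!: be_gt al_ge)
  then show "app (Dt d p r * PR 1 q) f (st3 p q r s i j k) = app (st p q * EE (d - 1) q r) f (st3 p q r s i j k)"
    using n by (auto simp: st_app EE_app'[OF d0 n(3)] Dt_app[OF d n(2)] app_PR st3(1-6)[OF n])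
qed

end

section \<open>Fusion of R-matrices\<close>

lemmas mx_assoc = mult.assoc[where ?'a = mx]

lemma assoc_swap: "A * B = C * D \<Longrightarrow> A * (B * X) = C * (D * (X :: mx))"
  by (metis mult.assoc)

lemma assoc_swap3: "A * B * C = D * E * F \<Longrightarrow> A * (B * (C * X)) = D * (E * (F * (X :: mx)))"
  by (metis mult.assoc)

lemma assoc_swap3': "A * B * C = D * E * F \<Longrightarrow> A * (B * C) = D * (E * (F :: mx))"
  by (metis mult.assoc)

lemma assoc_collapse: "A * B = C \<Longrightarrow> A * (B * X) = C * (X :: mx)"
  by (metis mult.assoc)

lemma fresh_leg:
  obtains r :: nat where "r \<notin> set xs"
  using ex_new_if_finite[OF infinite_UNIV_nat, of "set xs"] by auto

text \<open>This removes the projections onto index 0 that auxiliary legs leave behind.\<close>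

lemma cancel_leg:
  assumes X: "on_legs P X" and Y: "on_legs P Y" and r: "r \<notin> P"
    and eq: "PI [r] [1] * X = PI [r] [1] * Y"
  shows "X = Y"
proof (rule mx_eqI)
  fix s t :: state
  have e: "ent X s t = ent Y s t" if "s r = 0" for s t
    using arg_cong[OF eq, of "\<lambda>A. ent A s t"] that by (simp add: PI_mult_left inr_def)
  show "ent X s t = ent Y s t"
  proof (cases "\<forall>x. x \<notin> P \<longrightarrow> s x = t x")
    case True
    have *: "ent A s t = ent A (s(r := 0)) (t(r := 0))" if "on_legs P A" for A
      by (rule on_legs_eq[OF that]) (use True r in auto)
    show ?thesis using *[OF X] *[OF Y] e[of "s(r := 0)"] by simp
  next
    case False
    then obtain x where x: "x \<notin> P" "s x \<noteq> t x" by blast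
    then have "ent X s t = 0" "ent Y s t = 0" using on_legs_off[OF X, of s t x] on_legs_off[OF Y, of s t x] by blast+
    then show ?thesis by simp
  qed
qed

context qgen
begin

section \<open>Leg calculus for the R-matrices, K-matrices and fusion maps\<close>

definition S :: "nat \<Rightarrow> nat \<Rightarrow> complex \<Rightarrow> nat \<Rightarrow> nat \<Rightarrow> mx" where
  "S a d z t p = mop [t, p] [a + 1, d + 1] [a + 1, d + 1] (R_mat h a d z)"

lemma S_1: "S 1 d z t p = R1 d z t p"
  by (simp add: S_def R1_def One_nat_def numeral_2_eq_2)

lemma on_legs_basic:
  "on_legs {p, q} (R1 d z p q)" "on_legs {p, q} (EE d p q)" "on_legs {p, q} (FF d p q)" "on_legs {p, q} (trn (EE d p q))"
  "on_legs {p, q} (Dt d p q)" "on_legs {p, q} (Dp d p q)" "on_legs {p, q} (trn (Dt d p q))" "on_legs {p, q} (st p q)"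
  "on_legs {p, q} (trn (st p q))"
  "on_legs {q} (KK bd d x q)" "on_legs {q} (PR n q)" "on_legs {p, q} (S d' d z p q)" "on_legs {q} (trn (KK bd d x q))"
proof -
  have 2: "on_legs {p, q} (mop [p, q] ds ds' A)" for ds ds' A using on_legs_mop[of "[p, q]" ds ds' A] by simp
  have 1: "on_legs {q} (mop [q] ds ds' A)" for ds ds' A using on_legs_mop[of "[q]" ds ds' A] by simp
  show "on_legs {p, q} (R1 d z p q)" "on_legs {p, q} (EE d p q)" "on_legs {p, q} (FF d p q)" "on_legs {p, q} (trn (EE d p q))"
  "on_legs {p, q} (Dt d p q)" "on_legs {p, q} (Dp d p q)" "on_legs {p, q} (trn (Dt d p q))" "on_legs {p, q} (st p q)"
  "on_legs {p, q} (trn (st p q))"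
  "on_legs {q} (KK bd d x q)" "on_legs {q} (PR n q)" "on_legs {p, q} (S d' d z p q)" "on_legs {q} (trn (KK bd d x q))"
    unfolding R1_def EE_def FF_def Dt_def Dp_def st_def KK_def PR_def PI_def S_def
    by (intro on_legs_trn 2 1)+
qed

lemma PR_left2:
  assumes "p \<noteq> q"
  shows "PR n p * mop [p, q] [n, m] [n', m'] A = mop [p, q] [n, m] [n', m'] A"
    "PR m q * mop [p, q] [n, m] [n', m'] A = mop [p, q] [n, m] [n', m'] A"
    "mop [p, q] [n, m] [n', m'] A * PR n' p = mop [p, q] [n, m] [n', m'] A"
    "mop [p, q] [n, m] [n', m'] A * PR m' q = mop [p, q] [n, m] [n', m'] A"
  using assms by (auto intro!: mx_ext sum.cong simp: app_mop2 app_PR)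

lemma PR_left1:
  "PR n p * mop [p] [n] [n'] A = mop [p] [n] [n'] A" "mop [p] [n] [n'] A * PR n' p = mop [p] [n] [n'] A"
  by (auto intro!: mx_ext sum.cong simp: app_mop1 app_PR)

lemma PR_absorb:
  assumes "p \<noteq> q"
  shows "PR 2 p * R1 d z p q = R1 d z p q" "PR (d + 1) q * R1 d z p q = R1 d z p q"
    "R1 d z p q * PR 2 p = R1 d z p q" "R1 d z p q * PR (d + 1) q = R1 d z p q"
    "PR 2 p * EE d p q = EE d p q" "PR d q * EE d p q = EE d p q" "EE d p q * PR 1 p = EE d p q" "EE d p q * PR (d + 1) q = EE d p q"
    "PR (a + 1) p * S a d z p q = S a d z p q" "PR (d + 1) q * S a d z p q = S a d z p q"
    "S a d z p q * PR (a + 1) p = S a d z p q" "S a d z p q * PR (d + 1) q = S a d z p q"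
    "PR (d + 1) q * KK bd d z q = KK bd d z q" "KK bd d z q * PR (d + 1) q = KK bd d z q"
    "PR 1 p * Dt d p q = Dt d p q" "PR (d - 1) q * Dt d p q = Dt d p q" "Dt d p q * PR 2 p = Dt d p q" "Dt d p q * PR d q = Dt d p q"
    "PR 1 p * FF d p q = FF d p q" "PR (d + 1) q * FF d p q = FF d p q"  "FF d p q * PR 2 p = FF d p q" "FF d p q * PR d q = FF d p q"
    "PR 1 p * st p q = st p q" "PR 1 q * st p q = st p q" "st p q * PR 2 p = st p q" "st p q * PR 2 q = st p q"
  unfolding R1_def EE_def S_def KK_def Dt_def FF_def st_def by (rule PR_left2[OF assms] PR_left1)+

lemma PR_idem: "PR n p * PR m p = PR (min n m) p"
  by (auto intro!: mx_ext simp: app_PR)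

lemma trn_PR: "trn (PR n p) = PR n p"
  by (rule mx_eqI) (auto simp: PR_def ent_PI)

lemma trn_R1: 
  assumes "p \<noteq> q" shows "trn (R1 d z p q) = R1 d z p q"
proof (cases "d = 0")
  case True
  then show ?thesis unfolding R1_def by (subst trn_mop) (auto simp: R_half_def)
next
  case False
  have c: "R_half h d z \<in> carrier_mat (2 * Suc d) (2 * Suc d)"
    using False by (auto simp: R_half_def Let_def qpow_half_def kron_def sigma_z_def S_3_def mat1_def mat_of_rows_list_def)
  have "transpose_mat (R_half h d z) = R_half h d z"
  proof (rule eq_matI)
    fix r c assume "r < dim_row (R_half h d z)" "c < dim_col (R_half h d z)"
    then have rc: "r < 2 * Suc d" "c < 2 * Suc d" using c by auto
    have r: "r = r div Suc d * Suc d + r mod Suc d" "c = c div Suc d * Suc d + c mod Suc d" by (simp_all only: div_mult_mod_eq)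
    have b: "r div Suc d < 2" "c div Suc d < 2" "r mod Suc d \<le> d" "c mod Suc d \<le> d"
      using rc by (simp_all add: less_mult_imp_div_less del: mult_Suc_right)
    define i j i' j' where ij: "i = r div Suc d" "j = r mod Suc d" "i' = c div Suc d" "j' = c mod Suc d"
    note b = b[folded ij] and r = r[folded ij]
    have "R_half h d z $$ (i' * Suc d + j', i * Suc d + j) = R_half h d z $$ (i * Suc d + j, i' * Suc d + j')"
      using R_half_entry[OF _ b(2,1,4,3), of z] R_half_entry[OF _ b, of z] False b
      by (auto simp: less_2_cases' simp del: mult_Suc_right)
    then have "R_half h d z $$ (c, r) = R_half h d z $$ (r, c)" using r by metis
    then show "transpose_mat (R_half h d z) $$ (r, c) = R_half h d z $$ (r, c)" using rc c by simp
  qed (use c in auto)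
  then show ?thesis unfolding R1_def by (subst trn_mop) (use c in auto)
qed

text \<open>\<open>FF\<close> is a left inverse of \<open>EE\<close>, so an identity may be tested
  after multiplication by \<open>EE\<close> with a fresh leg \<open>r\<close>;
  \<open>cancel_leg\<close> removes the projection left on \<open>r\<close>. The inductions on the
  spin end with this.\<close>

lemma cancel_E:
  assumes d: "d > 0" and X: "on_legs P X" and Y: "on_legs P Y" and r: "r \<notin> P" "r \<noteq> q"
    and eq: "EE d r q * X = EE d r q * Y" and PX: "PR (d + 1) q * X = X" and PY: "PR (d + 1) q * Y = Y"
  shows "X = Y"
proof (rule cancel_leg[OF X Y r(1)])
  have "PR 1 r * PR (d + 1) q * X = PR 1 r * PR (d + 1) q * Y"
    unfolding FF_EE[OF d r(2), symmetric] mx_assoc eq ..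
  then show "PI [r] [1] * X = PI [r] [1] * Y" unfolding PR_def[symmetric] mx_assoc PX PY .
qed

text \<open>Splitting off two spins 1/2 produces vectors symmetric under plain exchange of the two
  legs, by the symmetry \<open>al_be_sym\<close> of the coefficients.\<close>

lemma EE_swap:
  assumes d: "d > 1" and n: "distinct [p, q, r]"
  shows "EE (d - 1) p r * EE d q r = EE (d - 1) q r * EE d p r"
proof (rule mx_ext3[of p q r])
  fix f and s :: state and i j k
  have n': "p \<noteq> q" "p \<noteq> r" "q \<noteq> r" using n by auto
  have d0: "d - 1 > 0" "d > 0" using d by auto
  show "app (EE (d - 1) p r * EE d q r) f (st3 p q r s i j k) = app (EE (d - 1) q r * EE d p r) f (st3 p q r s i j k)"
    using al_be_sym[OF d, of k]
    by (auto simp: EE_app'[OF d0(1) n'(2)] EE_app'[OF d0(1) n'(3)] EE_app'[OF d0(2) n'(2)] EE_app'[OF d0(2) n'(3)] st3(1-6)[OF n'] mult.assoc[symmetric])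
qed (use n in auto)

text \<open>For d = 1 the fusion map just transports the spin 1/2 from leg \<open>q\<close> to leg
  \<open>p\<close>. With these relations d = 1 needs no separate form of the fusion
  statements.\<close>

lemma EE_1_relations:
  assumes n: "distinct [t, p, q]"
  shows "R1 1 z t p * R1 0 z' t q * EE 1 p q = EE 1 p q * R1 1 z t q" "R1 0 z' t q * R1 1 z t p * EE 1 p q = EE 1 p q * R1 1 z t q"
    "R1 0 z p q * KK bd 0 z' q * EE 1 p q = EE 1 p q"
    "KK bd 1 z p * R1 0 z' p q * KK bd 0 z'' q * EE 1 p q = EE 1 p q * KK bd 1 z q"
    "KK bd 0 z'' q * R1 0 z' p q * KK bd 1 z p * EE 1 p q = EE 1 p q * KK bd 1 z q"
    "trn (EE 1 p q) * KK bd 1 z p * R1 0 z' p q * KK bd 0 z'' q = KK bd 1 z q * trn (EE 1 p q)"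
proof -
  have n': "t \<noteq> p" "t \<noteq> q" "p \<noteq> q" using n by auto
  have a: "al 1 0 = 1" "al 1 1 = 0" "be 1 1 = 1" "al 1 2 = 0" "be 1 2 = 0" "be 1 (Suc (Suc 0)) = 0" "be 1 (Suc 0) = 1" "al 1 (Suc 0) = 0"
    using al_end[of 1] be_sq[of 1 1] be_Suc[of 1 0] al_ge[of 1 2] be_gt[of 1 2] by (auto simp: One_nat_def numeral_2_eq_2)
  have z: "k > 1 \<Longrightarrow> al 1 k = 0" "k > 0 \<Longrightarrow> al 1 k = 0" "k > 0 \<Longrightarrow> be 1 (Suc k) = 0" for k using al_ge[of 1 k] be_gt[of 1 "Suc k"] by auto
  have k0: "app (KK bd 0 w q) f s = (if s q = 0 then f s else 0)" for w f s
  proof -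
    have "s q = 0 \<Longrightarrow> s(q := 0) = s" by (auto simp: fun_eq_iff)
    then show ?thesis by (auto simp: KK_def app_mop1)
  qed
  have d1: "(0::nat) < 1" by simp
  note T = R11_app[OF n'(1)] R11_app[OF n'(2)] R1_0_app[OF n'(2)] R1_0_app[OF n'(3)] EE_app'[OF d1 n'(3)] 
     TE_app[OF d1 n'(3)] K1_app k0 a z st3(1-6)[OF n'] two_cases One_nat_def[symmetric]
  have c: "k = 0 \<or> k = 1 \<or> k = 2 \<or> k > (2::nat)" for k by linarith
  show "R1 1 z t p * R1 0 z' t q * EE 1 p q = EE 1 p q * R1 1 z t q" "R1 0 z' t q * R1 1 z t p * EE 1 p q = EE 1 p q * R1 1 z t q"
    by (rule mx_ext3[OF n'], subst (1 2) app_mult_fun, insert two_cases, auto simp: T)+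
  show "R1 0 z p q * KK bd 0 z' q * EE 1 p q = EE 1 p q"
    by (rule mx_ext3[OF n'], insert two_cases, auto simp: T)
  show "KK bd 1 z p * R1 0 z' p q * KK bd 0 z'' q * EE 1 p q = EE 1 p q * KK bd 1 z q"
    "KK bd 0 z'' q * R1 0 z' p q * KK bd 1 z p * EE 1 p q = EE 1 p q * KK bd 1 z q"
    by (rule mx_ext3[OF n'], insert two_cases, auto simp: T)+
  show "trn (EE 1 p q) * KK bd 1 z p * R1 0 z' p q * KK bd 0 z'' q = KK bd 1 z q * trn (EE 1 p q)"
  proof (rule mx_ext3[OF n'])
    fix f and s :: state and i j k
    show "app (trn (EE 1 p q) * KK bd 1 z p * R1 0 z' p q * KK bd 0 z'' q) f (st3 t p q s i j k) = app (KK bd 1 z q * trn (EE 1 p q)) f (st3 t p q s i j k)"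
      using two_cases[of j] c[of k] by (elim disjE) (auto simp: T)
  qed
qed

lemma R_fusion:
  assumes d: "d > 0" and z: "z \<noteq> 0" and n: "distinct [t, p, q]"
  shows "R1 1 (z * H (1 - int d)) t p * R1 (d - 1) (z * h) t q * EE d p q = EE d p q * R1 d z t q"
proof (cases "d = 1")
  case True
  then show ?thesis using EE_1_relations(1)[OF n] by simp
qed (use assms in \<open>auto intro!: R_fusion_ge2\<close>)

lemma R_fusion_rev:
  assumes d: "d > 0" and z: "z \<noteq> 0" and n: "distinct [t, p, q]"
  shows "R1 (d - 1) (z * inverse h) t q * R1 1 (z * H (int d - 1)) t p * EE d p q = EE d p q * R1 d z t q"
proof (cases "d = 1")
  case True
  then show ?thesis using EE_1_relations(2)[OF n] by simp
qed (use assms in \<open>auto intro!: R_fusion_rev_ge2\<close>)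

text \<open>The leg \<open>q\<close> is split into a spin 1/2 on \<open>r\<close> and a smaller spin
  on \<open>q\<close>. The spin 1/2 equation and the induction hypothesis then carry R on
  \<open>t\<close>, \<open>p\<close> past the two halves in turn.\<close>

lemma yang_baxter:
  assumes "d > 0" and "x \<noteq> 0" "y \<noteq> 0" and "distinct [t, p, q]"
  shows "R1 1 x t p * R1 d (x * y) t q * R1 d y p q = R1 d y p q * R1 d (x * y) t q * R1 1 x t p"
  using assms
proof (induction d arbitrary: x y)
  case (Suc d x y)
  note z = Suc.prems(2,3) and n = Suc.prems(4)
  show ?case
  proof (cases "d = 0")
    case True
    show ?thesis unfolding True One_nat_def[symmetric] by (rule yang_baxter_half) (use n z in auto)
  next
    case False
    obtain r where "r \<notin> set [t, p, q]" by (rule fresh_leg)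
    then have r: "distinct [t, p, q, r]" using n by auto
    let ?w = "H (1 - int (Suc d))" and ?E = "EE (Suc d) r q"
    let ?P = "R1 1 x t p" and ?Ar = "R1 1 (x * (y * ?w)) t r" and ?Aq = "R1 d (x * (y * h)) t q"
    let ?Br = "R1 1 (y * ?w) p r" and ?Bq = "R1 d (y * h) p q"
    have A: "?E * R1 (Suc d) (x * y) t q = ?Ar * ?Aq * ?E"
      using R_fusion[of "Suc d" "x * y" t r q] z r by (simp add: mult.assoc)
    have B: "?E * R1 (Suc d) y p q = ?Br * ?Bq * ?E"
      using R_fusion[of "Suc d" y p r q] z r by simp
    have EP: "?E * ?P = ?P * ?E" by (rule commute, (rule on_legs_basic)+, use r in auto)
    have c1: "?Aq * ?Br = ?Br * ?Aq" by (rule commute, (rule on_legs_basic)+, use r in auto)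
    have c2: "?Ar * ?Bq = ?Bq * ?Ar" by (rule commute, (rule on_legs_basic)+, use r in auto)
    have y1: "?P * ?Ar * ?Br = ?Br * ?Ar * ?P" by (rule yang_baxter_half) (use r z in auto)
    have y2: "?P * ?Aq * ?Bq = ?Bq * ?Aq * ?P" by (rule Suc.IH) (use r z False in auto)
    have "?E * (?P * R1 (Suc d) (x * y) t q * R1 (Suc d) y p q) = ?P * (?E * R1 (Suc d) (x * y) t q) * R1 (Suc d) y p q"
      by (simp only: mx_assoc assoc_swap[OF EP])
    also have "\<dots> = ?P * ?Ar * ?Aq * (?E * R1 (Suc d) y p q)" unfolding A by (simp only: mx_assoc)
    also have "\<dots> = ?P * ?Ar * ?Br * ?Aq * ?Bq * ?E" unfolding B by (simp only: mx_assoc assoc_swap[OF c1])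
    also have "\<dots> = ?Br * ?Ar * ?P * ?Aq * ?Bq * ?E" unfolding y1 ..
    also have "\<dots> = ?Br * ?Ar * ?Bq * ?Aq * ?P * ?E" by (simp only: mx_assoc assoc_swap3[OF y2])
    also have "\<dots> = ?Br * ?Bq * (?Ar * ?Aq * ?E) * ?P" by (simp only: mx_assoc assoc_swap[OF c2] EP)
    also have "\<dots> = (?Br * ?Bq * ?E) * R1 (Suc d) (x * y) t q * ?P" unfolding A[symmetric] by (simp only: mx_assoc)
    also have "\<dots> = ?E * (R1 (Suc d) y p q * R1 (Suc d) (x * y) t q * ?P)" unfolding B[symmetric] by (simp only: mx_assoc)
    finally have eq: "?E * (?P * R1 (Suc d) (x * y) t q * R1 (Suc d) y p q) = ?E * (R1 (Suc d) y p q * R1 (Suc d) (x * y) t q * ?P)" .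
    have L: "on_legs {t, p, q} (R1 e u t q)" "on_legs {t, p, q} (R1 e u p q)" "on_legs {t, p, q} (R1 e u t p)" for e u
      by (rule on_legs_mono[OF on_legs_basic(1)], blast)+
    have PP: "PR (Suc d + 1) q * ?P = ?P * PR (Suc d + 1) q" by (rule commute, (rule on_legs_basic)+, use r in auto)
    have n': "t \<noteq> q" "p \<noteq> q" using n by auto
    show ?thesis
    proof (rule cancel_E[OF _ _ _ _ _ eq, where P = "{t, p, q}"])
      show "PR (Suc d + 1) q * (?P * R1 (Suc d) (x * y) t q * R1 (Suc d) y p q) = ?P * R1 (Suc d) (x * y) t q * R1 (Suc d) y p q"
        by (simp only: mx_assoc assoc_swap[OF PP] assoc_collapse[OF PR_absorb(2)[OF n'(1)]])
      show "PR (Suc d + 1) q * (R1 (Suc d) y p q * R1 (Suc d) (x * y) t q * ?P) = R1 (Suc d) y p q * R1 (Suc d) (x * y) t q * ?P"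
        by (simp only: mx_assoc assoc_collapse[OF PR_absorb(2)[OF n'(2)]])
    qed (use r in \<open>auto intro!: on_legs_mult L\<close>)
  qed
qed simp

text \<open>The quantum determinant of a site of spin a/2, as a product over the spins 1/2 of which
  the site is made. It equals \<open>beta\<close> up to sign and a shift, see
  \<open>beta_del\<close>.\<close>

definition del :: "nat \<Rightarrow> complex \<Rightarrow> complex" where
  "del a z = (\<Prod>k<a. cz z (1 - int a + 2 * int k) * cz z (5 - int a + 2 * int k))"

lemma del_1: "del 1 z = cz z 0 * cz z 4" "del 0 z = 1"
  by (simp_all add: del_def One_nat_def)

lemma del_Suc: "a > 1 \<Longrightarrow> del a z = del 1 (z * H (1 - int a)) * del (a - 1) (z * h)"
proof -
  assume a: "a > 1"
  then obtain m where m: "a = Suc m" "m > 0" by (cases a) auto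
  have "cz z (1 - int (Suc m) + 2 * int (Suc k)) = cz (z * h) (1 - int m + 2 * int k)"
    "cz z (5 - int (Suc m) + 2 * int (Suc k)) = cz (z * h) (5 - int m + 2 * int k)" for k
    unfolding cz_H by (rule arg_cong[of _ _ "cz z"]; simp)+
  moreover have "cz (z * H (1 - int (Suc m))) 0 = cz z (1 - int (Suc m))" "cz (z * H (1 - int (Suc m))) 4 = cz z (5 - int (Suc m))"
    unfolding cz_H by (rule arg_cong[of _ _ "cz z"]; simp)+
  ultimately show ?thesis unfolding m del_1 by (simp add: del_def prod.lessThan_Suc_shift del: prod.lessThan_Suc of_nat_Suc)
qed

text \<open>Splitting the leg \<open>q\<close> factorises both R-matrices, and the singlet passes
  first through the spin 1/2 part and then through the rest, picking up one determinant from
  each.\<close>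

lemma st_R:
  assumes "z \<noteq> 0" and "distinct [p, r, q]"
  shows "st p r * R1 e z p q * R1 e (z * h\<^sup>2) r q = scal (del e z) (st p r * PR (e + 1) q)"
  using assms
proof (induction e arbitrary: z)
  case 0
  have n: "p \<noteq> r" "p \<noteq> q" "r \<noteq> q" using 0 by auto
  have "R1 0 w p q = PR 2 p * PR 1 q" if "p \<noteq> q" for w p q
    using that by (intro mx_ext) (auto simp: R1_0_app app_PR)
  from this[OF n(2)] this[OF n(3)] have "st p r * R1 0 z p q * R1 0 (z * h\<^sup>2) r q = st p r * (PR 2 p * (PR 1 q * PR 2 r * PR 1 q))"
    by (simp add: mult.assoc)
  also have "PR 1 q * PR 2 r = PR 2 r * PR 1 q" by (rule commute, (rule on_legs_basic)+, use n in auto)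
  finally show ?case
    by (simp add: mx_assoc assoc_collapse[OF PR_absorb(25)[OF n(1)]] assoc_collapse[OF PR_absorb(26)[OF n(1)]] PR_idem del_1)
next
  case (Suc e z)
  have n: "p \<noteq> r" "p \<noteq> q" "r \<noteq> q" and z: "z \<noteq> 0" using Suc.prems by auto
  show ?case
  proof (cases "e = 0")
    case True
    have e: "Suc 0 = 1" by simp
    show ?thesis
      unfolding True e R11_flip[OF n(2)] R11_flip[OF n(3)] del_1 using st_R_half[of q p r z] n z by simp
  next
    case False
    obtain t where "t \<notin> set [p, r, q]" by (rule fresh_leg)
    then have t: "distinct [p, r, q, t]" using n by auto
    let ?w = "H (1 - int (Suc e))" and ?E = "EE (Suc e) t q"
    let ?Ar = "R1 1 (z * ?w) p t" and ?Aq = "R1 e (z * h) p q"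
    let ?Br = "R1 1 (z * ?w * h\<^sup>2) r t" and ?Bq = "R1 e (z * h * h\<^sup>2) r q"
    have A: "?E * R1 (Suc e) z p q = ?Ar * ?Aq * ?E"
      using R_fusion[of "Suc e" z p t q] z t by simp
    have B: "?E * R1 (Suc e) (z * h\<^sup>2) r q = ?Br * ?Bq * ?E"
      using R_fusion[of "Suc e" "z * h\<^sup>2" r t q] z t by (simp add: mult_ac)
    have ES: "?E * st p r = st p r * ?E" by (rule commute, (rule on_legs_basic)+, use t in auto)
    have c1: "?Aq * ?Br = ?Br * ?Aq" by (rule commute, (rule on_legs_basic)+, use t in auto)
    have s1: "st p r * ?Ar * ?Br = scal (del 1 (z * ?w)) (st p r * PR 2 t)"
    proof -
      have n: "p \<noteq> t" "r \<noteq> t" using t by auto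
      show ?thesis unfolding R11_flip[OF n(1)] R11_flip[OF n(2)] del_1 by (rule st_R_half) (use t z in auto)
    qed
    have s2: "st p r * ?Aq * ?Bq = scal (del e (z * h)) (st p r * PR (e + 1) q)" by (rule Suc.IH) (use t z in auto)
    have cP: "PR 2 t * ?Aq = ?Aq * PR 2 t" "PR 2 t * ?Bq = ?Bq * PR 2 t" by (rule commute, (rule on_legs_basic)+, use t in auto)+
    have PE: "PR 2 t * ?E = ?E" "PR (e + 1) q * ?E = ?E" "?E * PR (Suc e + 1) q = ?E" using PR_absorb(5,6,8)[of t q "Suc e"] t by (simp_all add: Suc_eq_plus1[symmetric])
    have "?E * (st p r * R1 (Suc e) z p q * R1 (Suc e) (z * h\<^sup>2) r q) = st p r * (?E * R1 (Suc e) z p q) * R1 (Suc e) (z * h\<^sup>2) r q"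
      by (simp only: mx_assoc assoc_swap[OF ES])
    also have "\<dots> = st p r * ?Ar * ?Aq * (?E * R1 (Suc e) (z * h\<^sup>2) r q)" unfolding A by (simp only: mx_assoc)
    also have "\<dots> = (st p r * ?Ar * ?Br) * ?Aq * ?Bq * ?E" unfolding B by (simp only: mx_assoc assoc_swap[OF c1])
    also have "\<dots> = scal (del 1 (z * ?w)) ((st p r * ?Aq * ?Bq) * ?E)" unfolding s1
      by (simp only: mx_assoc scal_mult_left assoc_swap[OF cP(1)] assoc_swap[OF cP(2)] PE)
    also have "\<dots> = scal (del (Suc e) z) (st p r * ?E)" unfolding s2 using False del_Suc[of "Suc e" z] by (simp only: mx_assoc scal_mult_left PE scal_scal) simp
    also have "\<dots> = ?E * scal (del (Suc e) z) (st p r * PR (Suc e + 1) q)"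
      unfolding scal_mult_right by (subst mult.assoc[symmetric]) (simp only: ES mult.assoc PE)
    finally have eq: "?E * (st p r * R1 (Suc e) z p q * R1 (Suc e) (z * h\<^sup>2) r q) = ?E * scal (del (Suc e) z) (st p r * PR (Suc e + 1) q)" .
    have L: "on_legs {p, r, q} (R1 e' u p q)" "on_legs {p, r, q} (R1 e' u r q)" "on_legs {p, r, q} (st p r)" "on_legs {p, r, q} (PR n q)" for e' u n
      by (rule on_legs_mono[OF on_legs_basic(1)] on_legs_mono[OF on_legs_basic(8)] on_legs_mono[OF on_legs_basic(11)], blast)+
    have PP: "PR (Suc e + 1) q * st p r = st p r * PR (Suc e + 1) q" by (rule commute, (rule on_legs_basic)+, use t in auto)
    show ?thesis
    proof (rule cancel_E[OF _ _ _ _ _ eq, where P = "{p, r, q}"])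
      show "PR (Suc e + 1) q * (st p r * R1 (Suc e) z p q * R1 (Suc e) (z * h\<^sup>2) r q) = st p r * R1 (Suc e) z p q * R1 (Suc e) (z * h\<^sup>2) r q"
        by (simp only: mx_assoc assoc_swap[OF PP] assoc_collapse[OF PR_absorb(2)[OF n(2)]])
      show "PR (Suc e + 1) q * scal (del (Suc e) z) (st p r * PR (Suc e + 1) q) = scal (del (Suc e) z) (st p r * PR (Suc e + 1) q)"
        by (simp only: scal_mult_right mx_assoc[symmetric] PP) (simp only: mx_assoc PR_idem min.idem)
    qed (use t in \<open>auto intro!: on_legs_mult on_legs_scal L\<close>)
  qed
qed

end

lemma kron_one_left: "1\<^sub>m 1 \<otimes>\<^sub>m (A :: complex mat) = A"
  by (rule eq_matI) (auto simp: kron_def)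

lemma mop_mult4:
  assumes "distinct ps" "length ps = length ds" "length ps = length es"
    and "A \<in> carrier_mat (prod_list es) (prod_list ds)" "B \<in> carrier_mat (prod_list ds) (prod_list ds)"
    "C \<in> carrier_mat (prod_list ds) (prod_list ds)" "D \<in> carrier_mat (prod_list ds) (prod_list es)"
  shows "mop ps es es (A * B * C * D) = mop ps es ds A * mop ps ds ds B * mop ps ds ds C * mop ps ds es D"
proof -
  have 1: "A * B \<in> carrier_mat (prod_list es) (prod_list ds)" "A * B * C \<in> carrier_mat (prod_list es) (prod_list ds)"
    using assms by auto
  show ?thesis
    by (simp only: mop_mult[OF assms(1,3,2,2,4,5)] mop_mult[OF assms(1,3,2,2) 1(1) assms(6)] mop_mult[OF assms(1,3,2,3) 1(2) assms(7)])
qed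

context qgen
begin

lemma mult_H_assoc:
  "z * H a * H c = z * H (a + c)" "z * h * H a = z * H (1 + a)" "z * H a * h = z * H (a + 1)"
  "z * H a * h\<^sup>2 = z * H (a + 2)" "z * h\<^sup>2 * H a = z * H (2 + a)"
  "z * inverse h * H a = z * H (a - 1)" "z * H a * inverse h = z * H (a - 1)"
  by (simp_all add: power_int_add power_int_diff power2_eq_square divide_inverse mult_ac)

lemma mult_H_cong: "a = c \<Longrightarrow> z * H a = z * H c"
  by simp

lemma R_half_carrier: "R_half h d z \<in> carrier_mat (2 * (d + 1)) (2 * (d + 1))"
  by (auto simp: R_half_def Let_def qpow_half_def kron_def sigma_z_def S_3_def mat1_def mat_of_rows_list_def)

lemma R_mat_carrier: "R_mat h a d z \<in> carrier_mat ((a + 1) * (d + 1)) ((a + 1) * (d + 1))"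
proof (cases "(h, a, d, z)" rule: R_mat.cases)
  case (2 h' d2 u)
  then show ?thesis using R_half_carrier[of d z] by (simp add: numeral_2_eq_2)
qed (auto simp: Let_def kron_def fus_F_def fus_E_def mat1_def)

lemma K_mat_carrier: "K_mat h bd d x \<in> carrier_mat (d + 1) (d + 1)"
  by (cases "(h, bd, d, x)" rule: K_mat.cases) (auto simp: Let_def K_half_def mat_of_rows_list_def fus_F_def fus_E_def mat1_def)

lemma R1_0: "p \<noteq> q \<Longrightarrow> R1 0 w p q = PR 2 p * PR 1 q"
  by (intro mx_ext) (auto simp: R1_0_app app_PR)

lemma fus_carrier: "fus_F h d \<in> carrier_mat (d + 1) (2 * d)" "fus_E h d \<in> carrier_mat (2 * d) (d + 1)"
  by (auto simp: fus_F_def fus_E_def mat1_def)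

text \<open>The defining recursion of \<open>R_mat\<close> with its tensor factors read as legs. On
  the outside the leg \<open>t'\<close> of the split-off spin 1/2 has dimension 1, hence the factor
  \<open>PR 1 t'\<close>.\<close>

lemma S_rec:
  assumes a: "a > 1" and n: "distinct [t', t, p]"
  shows "PR 1 t' * S a d z t p = FF a t' t * S 1 d (z * H (1 - int a)) t' p * S (a - 1) d (z * h) t p * EE a t' t"
proof -
  obtain m where m: "a = Suc (Suc m)" by (rule ge2E[OF a])
  let ?D3 = "[2, a, d + 1]" and ?DI = "[1, a + 1, d + 1]" and ?L = "[t', t, p]"
  let ?F = "fus_F h a \<otimes>\<^sub>m 1\<^sub>m (d + 1)" and ?E = "fus_E h a \<otimes>\<^sub>m 1\<^sub>m (d + 1)"
  let ?A = "embed2 ?D3 0 2 (R_half h d (z * H (1 - int a)))" and ?B = "1\<^sub>m 2 \<otimes>\<^sub>m R_mat h (a - 1) d (z * h)"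
  have R: "R_mat h a d z = ?F * ?A * ?B * ?E" by (simp add: m Let_def)
  have cF: "?F \<in> carrier_mat (prod_list ?DI) (prod_list ?D3)" "?E \<in> carrier_mat (prod_list ?D3) (prod_list ?DI)"
    using fus_carrier[of a] by (auto simp: kron_def algebra_simps)
  have cA: "?A \<in> carrier_mat (prod_list ?D3) (prod_list ?D3)" by (simp add: embed2_def)
  have cB: "?B \<in> carrier_mat (prod_list ?D3) (prod_list ?D3)"
    using R_mat_carrier[of "a - 1" d "z * h"] a by (auto simp: kron_def)
  have "mop ?L ?DI ?DI (R_mat h a d z) = mop ?L ?DI ?D3 ?F * mop ?L ?D3 ?D3 ?A * mop ?L ?D3 ?D3 ?B * mop ?L ?D3 ?DI ?E"
    unfolding R by (rule mop_mult4[OF _ _ _ cF(1) cA cB cF(2)]) (use n in auto)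
  also have "mop ?L ?DI ?D3 ?F = FF a t' t * PR (d + 1) p"
    using mop_kron[of "[t', t]" "[1, a + 1]" "[2, a]" "[p]" "[d + 1]" "[d + 1]" "fus_F h a" "1\<^sub>m (d + 1)"] fus_carrier[of a] n
    by (simp add: FF_def PR_def PI_def)
  also have "mop ?L ?D3 ?DI ?E = EE a t' t * PR (d + 1) p"
    using mop_kron[of "[t', t]" "[2, a]" "[1, a + 1]" "[p]" "[d + 1]" "[d + 1]" "fus_E h a" "1\<^sub>m (d + 1)"] fus_carrier[of a] n
    by (simp add: EE_def PR_def PI_def)
  also have "mop ?L ?D3 ?D3 ?B = PR 2 t' * S (a - 1) d (z * h) t p"
    using mop_kron[of "[t']" "[2]" "[2]" "[t, p]" "[a, d + 1]" "[a, d + 1]" "1\<^sub>m 2" "R_mat h (a - 1) d (z * h)"] R_mat_carrier[of "a - 1" d "z * h"] n a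
    by (simp add: S_def PR_def PI_def)
  also have "mop ?L ?D3 ?D3 ?A = PI ?L ?D3 * S 1 d (z * H (1 - int a)) t' p"
    using mop_embed2[of ?L ?D3 0 2 "R_half h d (z * H (1 - int a))"] R_half_carrier[of d "z * H (1 - int a)"] n
    by (simp add: S_1 R1_def)
  also have "PI ?L ?D3 = PR 2 t' * PR a t * PR (d + 1) p"
    using n by (intro mx_eqI) (auto simp: PI_mult_left PI_mult_right ent_PI PR_def mult.assoc inr_def less_Suc_eq nth_Cons' numeral_2_eq_2)
  also have "mop ?L ?DI ?DI (R_mat h a d z) = PR 1 t' * S a d z t p"
    using mop_kron[of "[t']" "[1]" "[1]" "[t, p]" "[a + 1, d + 1]" "[a + 1, d + 1]" "1\<^sub>m 1" "R_mat h a d z"] R_mat_carrier[of a d z] n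
    by (simp add: S_def PR_def PI_def kron_one_left)
  finally have eq: "PR 1 t' * S a d z t p = FF a t' t * PR (d + 1) p * (PR 2 t' * PR a t * PR (d + 1) p * S 1 d (z * H (1 - int a)) t' p)
    * (PR 2 t' * S (a - 1) d (z * h) t p) * (EE a t' t * PR (d + 1) p)" .
  let ?X = "S 1 d (z * H (1 - int a)) t' p" and ?Y = "S (a - 1) d (z * h) t p"
  have n': "t' \<noteq> t" "t' \<noteq> p" "t \<noteq> p" using n by auto
  have a1: "a - 1 + 1 = a" using a by simp
  note SX = PR_absorb(9,10)[OF n'(2), where a = 1 and d = d] PR_absorb(9,10)[OF n'(3), where a = "a - 1" and d = d, unfolded a1] PR_absorb(12)[OF n'(3), where a = "a - 1" and d = d]
  have c: "EE a t' t * PR (d + 1) p = PR (d + 1) p * EE a t' t" "PR 2 t' * ?Y = ?Y * PR 2 t'" "PR a t * ?X = ?X * PR a t"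
     "PR (d + 1) p * PR 2 t' = PR 2 t' * PR (d + 1) p" "PR (d + 1) p * PR a t = PR a t * PR (d + 1) p"
    by (rule commute, (rule on_legs_basic)+, use n in auto)+
  have X2: "PR 2 t' * ?X = ?X" using SX(1) by (simp add: numeral_2_eq_2 One_nat_def)
  show ?thesis unfolding eq
    by (simp only: mx_assoc c(1) assoc_swap[OF c(4)] assoc_swap[OF c(5)] assoc_swap[OF c(2)] assoc_swap[OF c(3)] assoc_collapse[OF SX(2)] assoc_collapse[OF SX(3)] assoc_collapse[OF SX(5)] assoc_collapse[OF X2] assoc_collapse[OF PR_absorb(5)[OF n'(1), of a]] PR_absorb(5)[OF n'(1), of a])
qed

text \<open>For a site of spin a/2, in this order: trivial auxiliary space, agreement with the
  explicit matrix for auxiliary spin 1/2, fusion, determinant and exchange in the auxiliary space.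
  They are bundled because the step to a needs exchange at a - 1 before fusion at a can be
  reached.\<close>

definition site_relations :: "nat \<Rightarrow> bool" where
  "site_relations a \<longleftrightarrow>
   (\<forall>z t p. t \<noteq> p \<longrightarrow> S a 0 z t p = PR (a + 1) t * PR 1 p) \<and>
   (\<forall>z t p. z \<noteq> 0 \<longrightarrow> t \<noteq> p \<longrightarrow> S a 1 z t p = R1 a z p t) \<and>
   (\<forall>d z t p q. d > 0 \<longrightarrow> z \<noteq> 0 \<longrightarrow> distinct [t, p, q] \<longrightarrow>
      S a 1 (z * H (1 - int d)) t p * S a (d - 1) (z * h) t q * EE d p q = EE d p q * S a d z t q) \<and>
   (\<forall>d z t p q. d > 1 \<longrightarrow> z \<noteq> 0 \<longrightarrow> distinct [t, p, q] \<longrightarrow>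
      Dt d p q * S a 1 (z * H (1 - int d)) t p * S a (d - 1) (z * h) t q
        = scal (del a (z * H (1 - int d))) (S a (d - 2) (z * h * h) t q * Dt d p q)) \<and>
   (\<forall>d x y t p q. d > 0 \<longrightarrow> x \<noteq> 0 \<longrightarrow> y \<noteq> 0 \<longrightarrow> distinct [t, p, q] \<longrightarrow>
      S a 1 x t p * R1 d (x * y) p q * S a d y t q = S a d y t q * R1 d (x * y) p q * S a 1 x t p)"

lemma site_relationsD:
  assumes "site_relations a"
  shows "t \<noteq> p \<Longrightarrow> S a 0 z t p = PR (a + 1) t * PR 1 p"
   "z \<noteq> 0 \<Longrightarrow> t \<noteq> p \<Longrightarrow> S a 1 z t p = R1 a z p t"
   "d > 0 \<Longrightarrow> z \<noteq> 0 \<Longrightarrow> distinct [t, p, q] \<Longrightarrow>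
      S a 1 (z * H (1 - int d)) t p * S a (d - 1) (z * h) t q * EE d p q = EE d p q * S a d z t q"
   "d > 1 \<Longrightarrow> z \<noteq> 0 \<Longrightarrow> distinct [t, p, q] \<Longrightarrow>
      Dt d p q * S a 1 (z * H (1 - int d)) t p * S a (d - 1) (z * h) t q
        = scal (del a (z * H (1 - int d))) (S a (d - 2) (z * h * h) t q * Dt d p q)"
   "d > 0 \<Longrightarrow> x \<noteq> 0 \<Longrightarrow> y \<noteq> 0 \<Longrightarrow> distinct [t, p, q] \<Longrightarrow>
      S a 1 x t p * R1 d (x * y) p q * S a d y t q = S a d y t q * R1 d (x * y) p q * S a 1 x t p"
  by (rule assms[unfolded site_relations_def, THEN conjunct1, rule_format]
      assms[unfolded site_relations_def, THEN conjunct2, THEN conjunct1, rule_format]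
      assms[unfolded site_relations_def, THEN conjunct2, THEN conjunct2, THEN conjunct1, rule_format]
      assms[unfolded site_relations_def, THEN conjunct2, THEN conjunct2, THEN conjunct2, THEN conjunct1, rule_format]
      assms[unfolded site_relations_def, THEN conjunct2, THEN conjunct2, THEN conjunct2, THEN conjunct2, rule_format]; assumption)+

lemma on_legs_two_legs:
  assumes "{p, q} \<subseteq> P"
  shows "on_legs P (R1 d z p q)" "on_legs P (EE d p q)" "on_legs P (FF d p q)" "on_legs P (Dt d p q)" "on_legs P (trn (Dt d p q))"
    "on_legs P (trn (EE d p q))" "on_legs P (st p q)" "on_legs P (S a d z p q)" "on_legs P (trn (st p q))"
  by (rule on_legs_mono[OF on_legs_basic(1) assms] on_legs_mono[OF on_legs_basic(2) assms] on_legs_mono[OF on_legs_basic(3) assms] on_legs_mono[OF on_legs_basic(4) assms]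
      on_legs_mono[OF on_legs_basic(5) assms] on_legs_mono[OF on_legs_basic(7) assms] on_legs_mono[OF on_legs_basic(8) assms] on_legs_mono[OF on_legs_basic(9) assms] on_legs_mono[OF on_legs_basic(12) assms])+

lemma on_legs_one_leg:
  assumes "q \<in> P"
  shows "on_legs P (KK bd d z q)" "on_legs P (PR d q)" "on_legs P (trn (KK bd d z q))"
  by (rule on_legs_mono[OF on_legs_basic(10)] on_legs_mono[OF on_legs_basic(11)] on_legs_mono[OF on_legs_basic(13)], use assms in blast)+

lemma Dt_st': "d > 1 \<Longrightarrow> distinct [p, q, r] \<Longrightarrow> Dt d p r * PR 1 q = st p q * EE (d - 1) q r"
  by (rule Dt_st) auto

lemma site_relations_1: "site_relations 1"
  unfolding site_relations_def
proof (intro conjI allI impI)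
  fix z :: complex and t p :: nat assume n: "t \<noteq> (p :: nat)"
  show "S 1 0 z t p = PR (1 + 1) t * PR 1 p" using n by (simp add: S_1 R1_0)
  show "z \<noteq> 0 \<Longrightarrow> S 1 1 z t p = R1 1 z p t" unfolding S_1 by (rule R11_flip[OF n])
next
  fix d t p q :: nat and z :: complex assume "0 < (d::nat)" "z \<noteq> 0" "distinct [t, p, q]"
  then show "S 1 1 (z * H (1 - int d)) t p * S 1 (d - 1) (z * h) t q * EE d p q = EE d p q * S 1 d z t q"
    unfolding S_1 by (rule R_fusion)
next
  fix d t p q :: nat and x y :: complex assume "0 < (d::nat)" "x \<noteq> 0" "y \<noteq> 0" and n: "distinct [t, p, q]"
  moreover have "t \<noteq> p" using n by simp
  ultimately show "S 1 1 x t p * R1 d (x * y) p q * S 1 d y t q = S 1 d y t q * R1 d (x * y) p q * S 1 1 x t p"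
    unfolding S_1 R11_flip[OF \<open>t \<noteq> p\<close>] by (intro yang_baxter) auto
next
  fix d t p q :: nat and z :: complex assume d: "1 < (d::nat)" and z: "z \<noteq> 0" and n: "distinct [t, p, q]"
  \<comment> \<open>The leg \<open>b\<close> takes up the spin 1/2 split off from \<open>q\<close>,
    which turns \<open>Dt\<close> into a contraction with the singlet.\<close>
  obtain b where "b \<notin> set [t, p, q]" by (rule fresh_leg)
  then have b: "distinct [t, p, q, b]" using n by auto
  let ?w = "z * H (1 - int d)" and ?E = "EE (d - 1) b q"
  let ?Ap = "R1 1 ?w t p" and ?Aq = "R1 (d - 1) (z * h) t q" and ?Ab = "R1 1 (?w * h\<^sup>2) t b" and ?B = "R1 (d - 2) (z * h * h) t q"
  have D: "Dt d p q * PR 1 b = st p b * ?E" by (rule Dt_st'[OF d]) (use b in auto)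
  have w: "z * h * H (1 - int (d - 1)) = ?w * h\<^sup>2" unfolding mult_H_assoc by (rule mult_H_cong) (use d in simp)
  have E: "?E * ?Aq = ?Ab * ?B * ?E"
    using R_fusion[of "d - 1" "z * h" t b q, unfolded w] d z b by (simp add: numeral_2_eq_2 One_nat_def)
  have cE: "?E * ?Ap = ?Ap * ?E" "PR 1 b * ?Ap = ?Ap * PR 1 b" "PR 1 b * ?Aq = ?Aq * PR 1 b" "st p b * ?B = ?B * st p b"
    by (rule commute, (rule on_legs_basic)+, use b in auto)+
  have s: "st p b * ?Ap * ?Ab = scal (del 1 ?w) (st p b * PR 2 t)"
    unfolding del_1 by (rule st_R_half) (use b z in auto)
  have P: "PR 2 t * ?B = ?B" by (rule PR_absorb(1)) (use n in auto)
  have "Dt d p q * ?Ap * ?Aq * PR 1 b = Dt d p q * PR 1 b * ?Ap * ?Aq" by (simp only: mx_assoc assoc_swap[OF cE(2)] cE(3))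
  also have "\<dots> = st p b * ?Ap * (?E * ?Aq)" unfolding D by (simp only: mx_assoc assoc_swap[OF cE(1)])
  also have "\<dots> = (st p b * ?Ap * ?Ab) * ?B * ?E" unfolding E by (simp only: mx_assoc)
  also have "\<dots> = scal (del 1 ?w) (?B * (st p b * ?E))" unfolding s by (simp only: mx_assoc scal_mult_left assoc_collapse[OF P] assoc_swap[OF cE(4)])
  finally have eq: "Dt d p q * ?Ap * ?Aq * PR 1 b = scal (del 1 ?w) (?B * Dt d p q) * PR 1 b"
    unfolding D[symmetric] by (simp only: mx_assoc scal_mult_left)
  have L: "on_legs {t, p, q} (Dt d p q * ?Ap * ?Aq)" "on_legs {t, p, q} (scal (del 1 ?w) (?B * Dt d p q))"
    by (intro on_legs_mult on_legs_scal on_legs_two_legs; simp)+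
  have cP1: "PR 1 b * (Dt d p q * ?Ap * ?Aq) = Dt d p q * ?Ap * ?Aq * PR 1 b"
    by (rule commute[OF on_legs_basic(11) L(1)]) (use b in auto)
  have cP2: "PR 1 b * scal (del 1 ?w) (?B * Dt d p q) = scal (del 1 ?w) (?B * Dt d p q) * PR 1 b"
    by (rule commute[OF on_legs_basic(11) L(2)]) (use b in auto)
  show "Dt d p q * S 1 1 ?w t p * S 1 (d - 1) (z * h) t q = scal (del 1 ?w) (S 1 (d - 2) (z * h * h) t q * Dt d p q)"
  proof -
    have "PI [b] [1] * (Dt d p q * ?Ap * ?Aq) = PI [b] [1] * scal (del 1 ?w) (?B * Dt d p q)"
      unfolding PR_def[symmetric] cP1 cP2 by (rule eq)
    then show ?thesis unfolding S_1 by (intro cancel_leg[OF L]) (use b in auto)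
  qed
qed

text \<open>The degenerate R is a nonzero multiple of \<open>trn Dt * Dt\<close>, and
  \<open>trn Dt\<close> has the left inverse \<open>trn Dp\<close>. So \<open>Dt\<close> kills
  \<open>X\<close>, and in \<open>resolution\<close> only the projection \<open>EE * FF\<close> acts
  on \<open>X\<close>.\<close>

lemma EE_FF_absorb:
  assumes d: "d > 1" and n: "p \<noteq> q" and X: "PR 2 p * X = X" "PR d q * X = X"
    and eq: "R1 (d - 1) (H (- int d)) p q * X = 0"
  shows "EE d p q * (FF d p q * X) = X"
proof -
  have "scal (- pre (d - 1) (H (- int d)) * cq (int (d - 1))) (trn (Dt d p q) * Dt d p q * X) = 0"
    using eq unfolding R1_antisymmetrizer[OF d n] by simp
  moreover have "- pre (d - 1) (H (- int d)) * cq (int (d - 1)) \<noteq> 0" using pre_sym_neq_0(2)[OF d] d by simp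
  ultimately have "trn (Dt d p q) * Dt d p q * X = 0" unfolding scal_eq_0_iff by blast
  then have "trn (Dp d p q) * trn (Dt d p q) * Dt d p q * X = 0" by (simp add: mx_assoc)
  moreover have "trn (Dp d p q) * trn (Dt d p q) = PR 1 p * PR (d - 1) q"
  proof -
    have "trn (Dt d p q * Dp d p q) = trn (PR 1 p * PR (d - 1) q)" using Dt_Dp[OF d n] by simp
    also have "\<dots> = PR (d - 1) q * PR 1 p" by (simp add: trn_PR)
    also have "\<dots> = PR 1 p * PR (d - 1) q" by (rule commute, (rule on_legs_basic)+, use n in auto)
    finally show ?thesis by simp
  qed
  ultimately have D: "Dt d p q * X = 0" by (simp add: mx_assoc assoc_collapse[OF PR_absorb(15)[OF n]] assoc_collapse[OF PR_absorb(16)[OF n]])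
  have "X = PR 2 p * PR d q * X" by (simp add: mx_assoc X)
  also have "\<dots> = EE d p q * FF d p q * X + Dp d p q * (Dt d p q * X)"
    unfolding resolution[OF d n, symmetric] by (simp add: distrib_right mx_assoc)
  finally show ?thesis by (simp add: D mx_assoc)
qed

lemma R1_antisym_E: "d > 1 \<Longrightarrow> p \<noteq> q \<Longrightarrow> R1 (d - 1) (H (- int d)) p q * EE d p q = 0"
  by (simp add: R1_antisymmetrizer mx_assoc Dt_EE)

text \<open>The recursion of \<open>R_mat\<close> contains \<open>FF\<close> on the left; moving it
  to the other side is legitimate once the product in the middle is known to preserve the image of
  \<open>EE\<close>.\<close>

lemma EE_S:
  assumes a: "a > 1" and IH: "site_relations (a - 1)" and z: "z \<noteq> 0" and n: "distinct [t', t, p]"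
  shows "EE a t' t * S a d z t p = S 1 d (z * H (1 - int a)) t' p * S (a - 1) d (z * h) t p * EE a t' t"
proof -
  let ?E = "EE a t' t" and ?A = "S 1 d (z * H (1 - int a)) t' p" and ?B = "S (a - 1) d (z * h) t p"
  have n': "t' \<noteq> t" "t' \<noteq> p" "t \<noteq> p" using n by auto
  have a1: "a - 1 + 1 = a" "a > 0" using a by auto
  have "?E * S a d z t p = ?E * PR 1 t' * S a d z t p" by (simp add: PR_absorb(7)[OF n'(1)])
  also have "\<dots> = ?E * (FF a t' t * (?A * ?B * ?E))" unfolding mx_assoc S_rec[OF a n] by (simp only: mx_assoc)
  also have "\<dots> = ?A * ?B * ?E"
  proof (cases "d = 0")
    \<comment> \<open>The exchange relation is available for d > 0 only; for d = 0 all operators are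
      projections.\<close>
    case True
    have c: "PR 1 p * ?E = ?E * PR 1 p" by (rule commute, (rule on_legs_basic)+, use n in auto)
    have c2: "PR 1 p * PR a t = PR a t * PR 1 p" by (rule commute, (rule on_legs_basic)+, use n in auto)
    have "?A * ?B * ?E = PR 2 t' * (PR 1 p * PR a t * PR 1 p) * ?E"
      using site_relationsD(1)[OF IH n'(3)] site_relationsD(1)[OF site_relations_1 n'(2)] True by (simp add: mx_assoc a1)
    also have "\<dots> = ?E * PR 1 p"
      unfolding c2 by (simp add: mx_assoc assoc_collapse[OF PR_idem] PR_idem c assoc_collapse[OF PR_absorb(5)[OF n'(1)]] assoc_collapse[OF PR_absorb(6)[OF n'(1)]])
    finally have X: "?A * ?B * ?E = ?E * PR 1 p" .
    show ?thesis unfolding X using FF_EE[OF a1(2) n'(1)] 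
      by (simp add: assoc_collapse[of "FF a t' t" "?E"] mx_assoc) (simp add: mx_assoc[symmetric] PR_absorb(7,8)[OF n'(1)])
  next
    case False
    have h: "H (- int a) \<noteq> 0" by simp
    have e: "H (- int a) * (z * h) = z * H (1 - int a)"
      using H_mult[of "- int a" 1] by (simp add: mult_ac)
    \<comment> \<open>The exchange relation at q^(-a/2), the degeneration point: R moves to the far
      right, where it kills \<open>EE\<close>.\<close>
    have Y: "R1 (a - 1) (H (- int a)) t' t * ?A * ?B = ?B * ?A * R1 (a - 1) (H (- int a)) t' t"
      using site_relationsD(5)[OF IH, of d "H (- int a)" "z * h" t t' p] site_relationsD(2)[OF IH h, of t t'] False z n
      by (auto simp: e S_1)
    show ?thesis
    proof (rule EE_FF_absorb[OF a n'(1)])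
      show "PR 2 t' * (?A * ?B * ?E) = ?A * ?B * ?E"
        using PR_absorb(9)[OF n'(2), of 1] by (simp add: mx_assoc[symmetric])
      have c: "PR a t * ?A = ?A * PR a t" by (rule commute, (rule on_legs_basic)+, use n in auto)
      show "PR a t * (?A * ?B * ?E) = ?A * ?B * ?E"
      proof -
        have P: "PR a t * ?B = ?B" using PR_absorb(9)[OF n'(3), where a = "a - 1"] unfolding a1 .
        show ?thesis by (simp only: mx_assoc assoc_swap[OF c] assoc_collapse[OF P])
      qed
      show "R1 (a - 1) (H (- int a)) t' t * (?A * ?B * ?E) = 0"
        by (simp only: mx_assoc assoc_swap3[OF Y] R1_antisym_E[OF a n'(1)] mult_zero_right)
    qed
  qed
  finally show ?thesis .
qed

text \<open>For fusion, determinant and exchange, multiplication by \<open>EE\<close> on the site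
  replaces the site by one of spin 1/2 and one of spin (a-1)/2. Their relations are applied one
  after the other, and \<open>EE\<close> is cancelled at the end.\<close>

lemma site_relations_step:
  assumes a: "a > 1" and IH: "site_relations (a - 1)"
  shows "site_relations a"
proof -
  have a0: "a > 0" using a by simp
  have S00: "S a 0 z t p = PR (a + 1) t * PR 1 p" if n0: "t \<noteq> p" for z t p
  proof -
    obtain t' where "t' \<notin> set [t, p]" by (rule fresh_leg)
    then have n: "distinct [t', t, p]" using n0 by auto
    have n': "t' \<noteq> t" "t' \<noteq> p" "t \<noteq> p" using n by auto
    have a1: "a - 1 + 1 = a" using a by auto
    have c: "PR 1 p * EE a t' t = EE a t' t * PR 1 p" "PR 1 p * PR a t = PR a t * PR 1 p" by (rule commute, (rule on_legs_basic)+, use n in auto)+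
    have "S 1 0 (z * H (1 - int a)) t' p * S (a - 1) 0 (z * h) t p * EE a t' t = PR 2 t' * (PR 1 p * PR a t * PR 1 p) * EE a t' t"
      using site_relationsD(1)[OF IH n'(3)] site_relationsD(1)[OF site_relations_1 n'(2)] by (simp add: mx_assoc a1)
    also have "\<dots> = EE a t' t * PR 1 p"
      unfolding c(2) by (simp add: mx_assoc assoc_collapse[OF PR_idem] PR_idem c(1) assoc_collapse[OF PR_absorb(5)[OF n'(1)]] assoc_collapse[OF PR_absorb(6)[OF n'(1)]])
    finally have X: "S 1 0 (z * H (1 - int a)) t' p * S (a - 1) 0 (z * h) t p * EE a t' t = EE a t' t * PR 1 p" .
    have "PR 1 t' * S a 0 z t p = FF a t' t * (S 1 0 (z * H (1 - int a)) t' p * S (a - 1) 0 (z * h) t p * EE a t' t)"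
      unfolding S_rec[OF a n] by (simp only: mx_assoc)
    also have "\<dots> = PR 1 t' * (PR (a + 1) t * PR 1 p)" unfolding X using FF_EE[OF a0 n'(1)] by (simp add: mx_assoc[symmetric])
    finally show ?thesis
      unfolding PR_def[of 1 t'] by (rule cancel_leg[of "{t, p}", rotated 3]) (use n in \<open>auto intro!: on_legs_mult on_legs_basic on_legs_one_leg\<close>)
  qed
  have S0: "S a 1 z t p = R1 a z p t" if z: "z \<noteq> 0" and n0: "t \<noteq> p" for z t p
  proof -
    obtain t' where "t' \<notin> set [t, p]" by (rule fresh_leg)
    then have n: "distinct [t', t, p]" using n0 by auto
    have n': "t' \<noteq> t" "t' \<noteq> p" "t \<noteq> p" "p \<noteq> t" using n by auto
    have G: "R1 1 (z * H (1 - int a)) p t' * R1 (a - 1) (z * h) p t * EE a t' t = EE a t' t * R1 a z p t"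
      by (rule R_fusion[OF a0 z]) (use n in auto)
    have "PR 1 t' * S a 1 z t p = FF a t' t * (R1 1 (z * H (1 - int a)) p t' * R1 (a - 1) (z * h) p t * EE a t' t)"
      unfolding S_rec[OF a n] S_1 R11_flip[OF n'(2)] using site_relationsD(2)[OF IH, of "z * h" t p] z n' by (simp add: mx_assoc)
    also have "\<dots> = PR 1 t' * R1 a z p t" unfolding G using FF_EE[OF a0 n'(1)] PR_absorb(2)[OF n'(4), of a z]
      by (simp add: mx_assoc[symmetric]) (simp add: mx_assoc)
    finally show ?thesis
      unfolding PR_def[of 1 t'] by (rule cancel_leg[of "{t, p}", rotated 3]) (use n in \<open>auto intro!: on_legs_two_legs\<close>)
  qed
  have L1: "S a 1 (z * H (1 - int d)) t p * S a (d - 1) (z * h) t q * EE d p q = EE d p q * S a d z t q"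
    if d: "d > 0" and z: "z \<noteq> 0" and n0: "distinct [t, p, q]" for d z t p q
  proof -
    obtain r where "r \<notin> set [t, p, q]" by (rule fresh_leg)
    then have n: "distinct [r, t, p, q]" using n0 by auto
    let ?w = "z * H (1 - int a)" and ?E = "EE a r t" and ?Ed = "EE d p q"
    let ?A = "S 1 1 (?w * H (1 - int d)) r p" and ?B = "S (a - 1) 1 (z * h * H (1 - int d)) t p"
    let ?C = "S 1 (d - 1) (?w * h) r q" and ?D = "S (a - 1) (d - 1) (z * h * h) t q"
    have e1: "?E * S a 1 (z * H (1 - int d)) t p = ?A * ?B * ?E"
      using EE_S[OF a IH, of "z * H (1 - int d)" r t p 1] z n by (simp add: mult_ac)
    have e2: "?E * S a (d - 1) (z * h) t q = ?C * ?D * ?E"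
      using EE_S[OF a IH, of "z * h" r t q "d - 1"] z n by (simp add: mult_ac)
    have e3: "?E * S a d z t q = S 1 d ?w r q * S (a - 1) d (z * h) t q * ?E"
      using EE_S[OF a IH, of z r t q d] z n by simp
    have c: "?E * ?Ed = ?Ed * ?E" "?B * ?C = ?C * ?B" by (rule commute, (rule on_legs_basic)+, use n in auto)+
    have i1: "?A * ?C * ?Ed = ?Ed * S 1 d ?w r q" by (rule site_relationsD(3)[OF site_relations_1 d]) (use n z in auto)
    have i2: "?B * ?D * ?Ed = ?Ed * S (a - 1) d (z * h) t q" by (rule site_relationsD(3)[OF IH d]) (use n z in auto)
    have "?E * (S a 1 (z * H (1 - int d)) t p * S a (d - 1) (z * h) t q * ?Ed) = ?A * ?B * (?E * S a (d - 1) (z * h) t q) * ?Ed"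
      unfolding mx_assoc assoc_swap3'[of ?E "S a 1 (z * H (1 - int d)) t p"] by (simp only: mx_assoc[symmetric] e1)
    also have "\<dots> = ?A * ?C * (?B * ?D * ?Ed) * ?E" unfolding e2 by (simp only: mx_assoc c(1) assoc_swap[OF c(2)])
    also have "\<dots> = (?A * ?C * ?Ed) * S (a - 1) d (z * h) t q * ?E" unfolding i2 by (simp only: mx_assoc)
    also have "\<dots> = ?E * (?Ed * S a d z t q)" unfolding i1 by (simp only: mx_assoc assoc_swap[OF c(1)] e3)
    finally have eq: "?E * (S a 1 (z * H (1 - int d)) t p * S a (d - 1) (z * h) t q * ?Ed) = ?E * (?Ed * S a d z t q)" .
    have n': "t \<noteq> p" "t \<noteq> q" using n by auto
    have cP: "PR (a + 1) t * ?Ed = ?Ed * PR (a + 1) t" by (rule commute, (rule on_legs_basic)+, use n in auto)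
    show ?thesis
    proof (rule cancel_E[OF a0 _ _ _ _ eq, where P = "{t, p, q}"])
      show "PR (a + 1) t * (?Ed * S a d z t q) = ?Ed * S a d z t q"
        by (simp only: assoc_swap[OF cP] PR_absorb(9)[OF n'(2)])
    qed (use n in \<open>auto intro!: on_legs_mult on_legs_two_legs simp: mx_assoc assoc_collapse[OF PR_absorb(9)[OF n'(1)]]\<close>)
  qed
  have L2: "Dt d p q * S a 1 (z * H (1 - int d)) t p * S a (d - 1) (z * h) t q
        = scal (del a (z * H (1 - int d))) (S a (d - 2) (z * h * h) t q * Dt d p q)"
    if d: "d > 1" and z: "z \<noteq> 0" and n0: "distinct [t, p, q]" for d z t p q
  proof -
    obtain r where "r \<notin> set [t, p, q]" by (rule fresh_leg)
    then have n: "distinct [r, t, p, q]" using n0 by auto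
    let ?w = "z * H (1 - int a)" and ?E = "EE a r t" and ?Ed = "Dt d p q" and ?u = "z * H (1 - int d)"
    let ?A = "S 1 1 (?w * H (1 - int d)) r p" and ?B = "S (a - 1) 1 (z * h * H (1 - int d)) t p"
    let ?C = "S 1 (d - 1) (?w * h) r q" and ?D = "S (a - 1) (d - 1) (z * h * h) t q"
    let ?G = "S 1 (d - 2) (?w * h * h) r q" and ?I = "S (a - 1) (d - 2) (z * h * h * h) t q"
    have e1: "?E * S a 1 ?u t p = ?A * ?B * ?E"
      using EE_S[OF a IH, of "z * H (1 - int d)" r t p 1] z n by (simp add: mult_ac)
    have e2: "?E * S a (d - 1) (z * h) t q = ?C * ?D * ?E"
      using EE_S[OF a IH, of "z * h" r t q "d - 1"] z n by (simp add: mult_ac)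
    have e3: "?E * S a (d - 2) (z * h * h) t q = ?G * ?I * ?E"
      using EE_S[OF a IH, of "z * h * h" r t q "d - 2"] z n by (simp add: mult_ac)
    have c: "?E * ?Ed = ?Ed * ?E" "?B * ?C = ?C * ?B" by (rule commute, (rule on_legs_basic)+, use n in auto)+
    have i1: "?Ed * ?A * ?C = scal (del 1 (?w * H (1 - int d))) (?G * ?Ed)" by (rule site_relationsD(4)[OF site_relations_1 d]) (use n z in auto)
    have i2: "?Ed * ?B * ?D = scal (del (a - 1) (z * h * H (1 - int d))) (?I * ?Ed)" by (rule site_relationsD(4)[OF IH d]) (use n z in auto)
    have site_del: "del a ?u = del 1 (?w * H (1 - int d)) * del (a - 1) (z * h * H (1 - int d))"
      using del_Suc[OF a, of ?u] by (simp add: mult_ac)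
    have "?E * (?Ed * S a 1 ?u t p * S a (d - 1) (z * h) t q) = ?Ed * (?E * S a 1 ?u t p) * S a (d - 1) (z * h) t q"
      by (simp only: mx_assoc assoc_swap[OF c(1)])
    also have "\<dots> = ?Ed * ?A * ?B * (?E * S a (d - 1) (z * h) t q)" unfolding e1 by (simp only: mx_assoc)
    also have "\<dots> = (?Ed * ?A * ?C) * ?B * ?D * ?E" unfolding e2 by (simp only: mx_assoc assoc_swap[OF c(2)])
    also have "\<dots> = scal (del 1 (?w * H (1 - int d))) (?G * (?Ed * ?B * ?D) * ?E)" unfolding i1 by (simp only: mx_assoc scal_mult_left)
    also have "\<dots> = scal (del a ?u) ((?G * ?I * ?E) * ?Ed)" unfolding i2 site_del by (simp only: mx_assoc scal_mult_left scal_mult_right scal_scal c(1))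
    also have "\<dots> = ?E * scal (del a ?u) (S a (d - 2) (z * h * h) t q * ?Ed)" unfolding e3[symmetric] by (simp only: mx_assoc scal_mult_right)
    finally have eq: "?E * (?Ed * S a 1 ?u t p * S a (d - 1) (z * h) t q) = ?E * scal (del a ?u) (S a (d - 2) (z * h * h) t q * ?Ed)" .
    have n': "t \<noteq> p" "t \<noteq> q" using n by auto
    have cP: "PR (a + 1) t * ?Ed = ?Ed * PR (a + 1) t" by (rule commute, (rule on_legs_basic)+, use n in auto)
    show ?thesis
    proof (rule cancel_E[OF a0 _ _ _ _ eq, where P = "{t, p, q}"])
      show "PR (a + 1) t * (?Ed * S a 1 ?u t p * S a (d - 1) (z * h) t q) = ?Ed * S a 1 ?u t p * S a (d - 1) (z * h) t q"
        by (simp only: mx_assoc assoc_swap[OF cP] assoc_collapse[OF PR_absorb(9)[OF n'(1)]])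
      show "PR (a + 1) t * scal (del a ?u) (S a (d - 2) (z * h * h) t q * ?Ed) = scal (del a ?u) (S a (d - 2) (z * h * h) t q * ?Ed)"
        by (simp only: scal_mult_right assoc_collapse[OF PR_absorb(9)[OF n'(2)]])
    qed (use n in \<open>auto intro!: on_legs_mult on_legs_scal on_legs_two_legs\<close>)
  qed
  have L3: "S a 1 x t p * R1 d (x * y) p q * S a d y t q = S a d y t q * R1 d (x * y) p q * S a 1 x t p"
    if d: "d > 0" and x: "x \<noteq> 0" and y: "y \<noteq> 0" and n0: "distinct [t, p, q]" for d x y t p q
  proof -
    obtain r where "r \<notin> set [t, p, q]" by (rule fresh_leg)
    then have n: "distinct [r, t, p, q]" using n0 by auto
    have n': "t \<noteq> p" "t \<noteq> q" "p \<noteq> t" using n by auto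
    let ?E = "EE a r t" and ?R = "R1 d (x * y) p q"
    let ?A = "R1 (a - 1) (x * inverse h) p t" and ?B = "R1 1 (x * H (int a - 1)) p r"
    let ?C = "R1 d (y * H (1 - int a)) r q" and ?D = "S (a - 1) d (y * h) t q"
    have s: "S a 1 x t p = R1 a x p t" by (rule S0[OF x n'(1)])
    \<comment> \<open>The first factor is split in the reversed order, the last one in the forward
      order. The relation for the leg \<open>r\<close> then sits inside that for
      \<open>t\<close>.\<close>
    have e1: "?E * S a 1 x t p = ?A * ?B * ?E" unfolding s by (rule R_fusion_rev[symmetric, OF a0 x]) (use n in auto)
    have e2: "?E * S a d y t q = ?C * ?D * ?E" using EE_S[OF a IH, of y r t q d] y n by (simp add: S_1)
    have c: "?E * ?R = ?R * ?E" "?B * ?D = ?D * ?B" "?A * ?C = ?C * ?A" by (rule commute, (rule on_legs_basic)+, use n in auto)+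
    have xy1: "x * H (int a - 1) * (y * H (1 - int a)) = x * y" using H_mult[of "int a - 1" "1 - int a"] by (simp add: mult_ac)
    have xy2: "x * inverse h * (y * h) = x * y" by simp
    have y1: "?B * ?R * ?C = ?C * ?R * ?B"
      using yang_baxter[OF d, of "x * H (int a - 1)" "y * H (1 - int a)" p r q, unfolded xy1] x y n by simp
    have y2: "?A * ?R * ?D = ?D * ?R * ?A"
      using site_relationsD(5)[OF IH d, of "x * inverse h" "y * h" t p q, unfolded xy2] site_relationsD(2)[OF IH, of "x * inverse h" t p] x y n by simp
    have "?E * (S a 1 x t p * ?R * S a d y t q) = (?E * S a 1 x t p) * ?R * S a d y t q" by (simp only: mx_assoc)
    also have "\<dots> = ?A * ?B * ?R * (?E * S a d y t q)" unfolding e1 by (simp only: mx_assoc c(1) assoc_swap[OF c(1)])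
    also have "\<dots> = ?A * (?B * ?R * ?C) * ?D * ?E" unfolding e2 by (simp only: mx_assoc)
    also have "\<dots> = ?C * (?A * ?R * ?D) * ?B * ?E" unfolding y1 by (simp only: mx_assoc assoc_swap[OF c(2)] assoc_swap[OF c(3)])
    also have "\<dots> = ?C * ?D * ?R * (?A * ?B * ?E)" unfolding y2 by (simp only: mx_assoc)
    also have "\<dots> = (?C * ?D * ?E) * ?R * S a 1 x t p" unfolding e1[symmetric] by (simp only: mx_assoc assoc_swap[OF c(1)])
    also have "\<dots> = ?E * (S a d y t q * ?R * S a 1 x t p)" unfolding e2[symmetric] by (simp only: mx_assoc)
    finally have eq: "?E * (S a 1 x t p * ?R * S a d y t q) = ?E * (S a d y t q * ?R * S a 1 x t p)" .
    show ?thesis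
    proof (rule cancel_E[OF a0 _ _ _ _ eq, where P = "{t, p, q}"])
    qed (use n in \<open>auto intro!: on_legs_mult on_legs_two_legs simp: mx_assoc assoc_collapse[OF PR_absorb(9)[OF n'(1)]] assoc_collapse[OF PR_absorb(9)[OF n'(2)]]\<close>)
  qed
  show ?thesis unfolding site_relations_def by (intro conjI allI impI) (rule S00 S0 L1 L2 L3; assumption)+
qed

lemma site_relations: "a > 0 \<Longrightarrow> site_relations a"
proof (induction a)
  case (Suc a)
  then show ?case using site_relations_1 site_relations_step[of "Suc a"] by (cases "a = 0") (auto simp: One_nat_def)
qed simp

section \<open>Fusion of K-matrices\<close>

lemma KK_rec:
  assumes d: "d > 1" and n: "p \<noteq> q"
  shows "PR 1 p * KK bd d x q = FF d p q * KK bd 1 (x * H (1 - int d)) p * R1 (d - 1) (x\<^sup>2 * H (2 - int d)) p q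
    * KK bd (d - 1) (x * h) q * EE d p q"
proof -
  obtain m where m: "d = Suc (Suc m)" by (rule ge2E[OF d])
  let ?D = "[2, d]" and ?I = "[1, d + 1]"
  let ?A = "K_half h bd (x * H (1 - int d)) \<otimes>\<^sub>m 1\<^sub>m d" and ?B = "R_half h (d - 1) (x\<^sup>2 * H (2 - int d))"
    and ?C = "1\<^sub>m 2 \<otimes>\<^sub>m K_mat h bd (d - 1) (x * h)"
  have K: "K_mat h bd d x = fus_F h d * ?A * ?B * ?C * fus_E h d" by (simp add: m Let_def)
  have d1: "d - 1 + 1 = d" using d by simp
  have cK: "K_half h bd y \<in> carrier_mat 2 2" for y by (auto simp: K_half_def mat_of_rows_list_def)
  have cA: "?A \<in> carrier_mat (2 * d) (2 * d)" using cK[of "x * H (1 - int d)"] by (auto simp: kron_def)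
  have cB: "?B \<in> carrier_mat (2 * d) (2 * d)" using R_half_carrier[of "d - 1" "x\<^sup>2 * H (2 - int d)"] unfolding d1 .
  have cC: "?C \<in> carrier_mat (2 * d) (2 * d)" using K_mat_carrier[of bd "d - 1" "x * h"] unfolding d1 by (auto simp: kron_def)
  have AB: "?A * ?B \<in> carrier_mat (2 * d) (2 * d)" using cA cB by auto
  have K': "K_mat h bd d x = fus_F h d * (?A * ?B) * ?C * fus_E h d"
    unfolding K using fus_carrier[of d] cA cB by (simp add: assoc_mult_mat[of "fus_F h d" "d + 1" "2 * d" ?A "2 * d" ?B "2 * d"])
  have "mop [p, q] ?I ?I (K_mat h bd d x) = mop [p, q] ?I ?D (fus_F h d) * mop [p, q] ?D ?D (?A * ?B) * mop [p, q] ?D ?D ?C * mop [p, q] ?D ?I (fus_E h d)"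
    unfolding K' by (rule mop_mult4) (use n fus_carrier[of d] AB cC in auto)
  also have "mop [p, q] ?D ?D (?A * ?B) = mop [p, q] ?D ?D ?A * mop [p, q] ?D ?D ?B"
    by (rule mop_mult[symmetric]) (use n cA cB in auto)
  also have "mop [p, q] ?D ?D ?A = KK bd 1 (x * H (1 - int d)) p * PR d q"
    using mop_kron[of "[p]" "[2]" "[2]" "[q]" "[d]" "[d]" "K_half h bd (x * H (1 - int d))" "1\<^sub>m d"] cK[of "x * H (1 - int d)"] n
    by (simp add: KK_def PR_def PI_def One_nat_def numeral_2_eq_2)
  also have "mop [p, q] ?D ?D ?C = PR 2 p * KK bd (d - 1) (x * h) q"
    using mop_kron[of "[p]" "[2]" "[2]" "[q]" "[d]" "[d]" "1\<^sub>m 2" "K_mat h bd (d - 1) (x * h)"] K_mat_carrier[of bd "d - 1" "x * h"] n unfolding d1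
    by (simp add: KK_def PR_def PI_def d1)
  also have "mop [p, q] ?D ?D ?B = R1 (d - 1) (x\<^sup>2 * H (2 - int d)) p q" by (simp add: R1_def d1)
  also have "mop [p, q] ?I ?I (K_mat h bd d x) = PR 1 p * KK bd d x q"
    using mop_kron[of "[p]" "[1]" "[1]" "[q]" "[d + 1]" "[d + 1]" "1\<^sub>m 1" "K_mat h bd d x"] K_mat_carrier[of bd d x] n
    by (simp add: KK_def PR_def PI_def kron_one_left)
  finally have eq: "PR 1 p * KK bd d x q = FF d p q * (KK bd 1 (x * H (1 - int d)) p * PR d q * R1 (d - 1) (x\<^sup>2 * H (2 - int d)) p q)
     * (PR 2 p * KK bd (d - 1) (x * h) q) * EE d p q" by (simp add: FF_def EE_def)
  have R: "PR d q * R1 (d - 1) y p q = R1 (d - 1) y p q" "R1 (d - 1) y p q * PR 2 p = R1 (d - 1) y p q" for y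
    using PR_absorb(2,3)[OF n, where d = "d - 1"] unfolding d1 by auto
  show ?thesis unfolding eq by (simp only: mx_assoc assoc_collapse[OF R(1)] assoc_collapse[OF R(2)])
qed

lemma xH: "x * H a * inverse (x * h) = (if x = 0 then 0 else H (a - 1))" "x * H a * (x * h) = x\<^sup>2 * H (a + 1)"
  by (simp_all add: power_int_add power_int_diff power2_eq_square field_simps)

text \<open>With the ratio of parameters at the degeneration point, the reflection equation moves R
  to the right, where it kills \<open>EE\<close>. The equation for spin (d-1)/2 is a hypothesis
  here, because fusion and reflection are reached by one interlocking induction.\<close>

lemma K_fusion_from_reflection:
  assumes d: "d > 1" and x: "x \<noteq> 0" and n: "p \<noteq> q"
    and RE: "\<And>x y. x \<noteq> 0 \<Longrightarrow> y \<noteq> 0 \<Longrightarrow>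
      R1 (d - 1) (x * inverse y) p q * KK bd 1 x p * R1 (d - 1) (x * y) p q * KK bd (d - 1) y q
       = KK bd (d - 1) y q * R1 (d - 1) (x * y) p q * KK bd 1 x p * R1 (d - 1) (x * inverse y) p q"
  shows "KK bd 1 (x * H (1 - int d)) p * R1 (d - 1) (x\<^sup>2 * H (2 - int d)) p q * KK bd (d - 1) (x * h) q * EE d p q = EE d p q * KK bd d x q"
proof -
  let ?M = "KK bd 1 (x * H (1 - int d)) p * R1 (d - 1) (x\<^sup>2 * H (2 - int d)) p q * KK bd (d - 1) (x * h) q"
  have e: "x * H (1 - int d) * inverse (x * h) = H (- int d)" "x * H (1 - int d) * (x * h) = x\<^sup>2 * H (2 - int d)"
    unfolding xH using x by (auto intro: mult_H_cong)
  have d1: "d - 1 + 1 = d" using d by simp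
  have c: "PR d q * KK bd 1 (x * H (1 - int d)) p = KK bd 1 (x * H (1 - int d)) p * PR d q" by (rule commute, (rule on_legs_basic)+, use n in auto)
  have R: "PR d q * R1 (d - 1) y p q = R1 (d - 1) y p q" for y using PR_absorb(2)[OF n, where d = "d - 1"] unfolding d1 by auto
  have K: "PR 2 p * KK bd 1 y p = KK bd 1 y p" for y using PR_absorb(13)[OF n[symmetric], where d = 1] by simp
  have "EE d p q * (FF d p q * (?M * EE d p q)) = ?M * EE d p q"
  proof (rule EE_FF_absorb[OF d n])
    show "PR 2 p * (?M * EE d p q) = ?M * EE d p q" by (simp only: mx_assoc assoc_collapse[OF K])
    show "PR d q * (?M * EE d p q) = ?M * EE d p q" by (simp only: mx_assoc assoc_swap[OF c] assoc_collapse[OF R])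
    have "R1 (d - 1) (H (- int d)) p q * ?M = KK bd (d - 1) (x * h) q * R1 (d - 1) (x\<^sup>2 * H (2 - int d)) p q * KK bd 1 (x * H (1 - int d)) p * R1 (d - 1) (H (- int d)) p q"
      using RE[of "x * H (1 - int d)" "x * h"] x unfolding e by (simp add: mx_assoc)
    then show "R1 (d - 1) (H (- int d)) p q * (?M * EE d p q) = 0"
      using R1_antisym_E[OF d n] by (simp add: mx_assoc[symmetric]) (simp add: mx_assoc)
  qed
  then have "?M * EE d p q = EE d p q * (FF d p q * ?M * EE d p q)" by (simp only: mx_assoc)
  also have "\<dots> = EE d p q * (PR 1 p * KK bd d x q)" unfolding KK_rec[OF d n] by (simp only: mx_assoc)
  also have "\<dots> = EE d p q * KK bd d x q" by (simp only: assoc_collapse[OF PR_absorb(7)[OF n]])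
  finally show ?thesis .
qed

text \<open>The leg \<open>q\<close> is split, R(x/y) in reversed and R(xy) in forward order. Then
  the spin 1/2 reflection equation, two Yang-Baxter equations and the induction hypothesis apply in
  turn. The fusion of K used for the splitting needs only the induction hypothesis.\<close>

lemma reflection:
  assumes "d > 0" "x \<noteq> 0" "y \<noteq> 0" "p \<noteq> q"
  shows "R1 d (x * inverse y) p q * KK bd 1 x p * R1 d (x * y) p q * KK bd d y q
       = KK bd d y q * R1 d (x * y) p q * KK bd 1 x p * R1 d (x * inverse y) p q"
  using assms
proof (induction d arbitrary: x y p q)
  case (Suc d x y p q)
  note z = Suc.prems(2,3) and n0 = Suc.prems(4)
  show ?case
  proof (cases "d = 0")
    case True
    show ?thesis unfolding True One_nat_def[symmetric] by (rule reflection_half[OF n0 z])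
  next
    case False
    let ?d = "Suc d"
    have d: "?d > 1" "?d > 0" "d > 0" using False by auto
    obtain r where "r \<notin> set [p, q]" by (rule fresh_leg)
    then have n: "distinct [r, p, q]" using n0 by auto
    have n': "r \<noteq> p" "r \<noteq> q" "p \<noteq> q" using n by auto
    let ?y1 = "y * H (1 - int ?d)" and ?y2 = "y * h" and ?E = "EE ?d r q"
    have y: "?y1 \<noteq> 0" "?y2 \<noteq> 0" using z by auto
    let ?Qm = "R1 d (x * inverse ?y2) p q" and ?Rm = "R1 1 (x * inverse ?y1) p r"
    let ?Qp = "R1 d (x * ?y2) p q" and ?Rp = "R1 1 (x * ?y1) p r" and ?W = "R1 d (y\<^sup>2 * H (2 - int ?d)) r q"
    let ?Kp = "KK bd 1 x p" and ?Kr = "KK bd 1 ?y1 r" and ?Kq = "KK bd d ?y2 q"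
    have K1: "?Kr * ?W * ?Kq * ?E = ?E * KK bd ?d y q"
      using K_fusion_from_reflection[OF d(1) z(2) n'(2), of bd] Suc.IH[OF d(3) _ _ n'(2)] by simp
    have iy: "inverse ?y1 = inverse y * H (int ?d - 1)" "inverse ?y2 = inverse y * inverse h"
      by (simp_all add: inverse_H)
    have a1: "x * inverse y * inverse h = x * inverse ?y2" "x * inverse y * H (int ?d - 1) = x * inverse ?y1"
      "x * y * H (1 - int ?d) = x * ?y1" "x * y * h = x * ?y2" unfolding iy by (simp_all only: mult.assoc)
    have Em: "?E * R1 ?d (x * inverse y) p q = ?Qm * ?Rm * ?E"
      using R_fusion_rev[OF d(2), of "x * inverse y" p r q] z n unfolding a1 by simp
    have Ep: "?E * R1 ?d (x * y) p q = ?Rp * ?Qp * ?E"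
      using R_fusion[OF d(2), of "x * y" p r q] z n unfolding a1 by simp
    have cE: "?E * ?Kp = ?Kp * ?E" by (rule commute, (rule on_legs_basic)+, use n in auto)
    have c1: "?Qp * ?Kr = ?Kr * ?Qp" "?Qm * ?Kr = ?Kr * ?Qm" "?Rm * ?Kq = ?Kq * ?Rm" "?Rp * ?Kq = ?Kq * ?Rp" "?W * ?Kp = ?Kp * ?W"
      by (rule commute, (rule on_legs_basic)+, use n in auto)+
    have r1: "?Rm * ?Kp * ?Rp * ?Kr = ?Kr * ?Rp * ?Kp * ?Rm" by (rule reflection_half[OF n'(1)[symmetric] z(1) y(1)])
    have b1: "x * inverse ?y1 * (y\<^sup>2 * H (2 - int ?d)) = x * ?y2"
      unfolding iy using H_mult[of "int ?d - 1" "2 - int ?d"] z by (simp add: power2_eq_square field_simps)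
    have y1: "?Rm * ?Qp * ?W = ?W * ?Qp * ?Rm"
      using yang_baxter[OF d(3), of "x * inverse ?y1" "y\<^sup>2 * H (2 - int ?d)" p r q] z n unfolding b1 by simp
    have b2: "x * inverse ?y2 * (y\<^sup>2 * H (2 - int ?d)) = x * ?y1"
      unfolding iy using H_mult[of "-1" "2 - int ?d"] z by (simp add: power2_eq_square field_simps power_int_minus)
    have b3: "x * inverse ?y2 \<noteq> 0" "y\<^sup>2 * H (2 - int ?d) \<noteq> 0" using z by auto
    \<comment> \<open>Here the higher spin on \<open>q\<close> belongs to the two outer R-matrices,
      so this is the exchange relation with \<open>q\<close> in the role of a site.\<close>
    have y2: "?Qm * ?Rp * ?W = ?W * ?Rp * ?Qm"
    proof -
      have one: "(1::nat) > 0" by simp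
      have "S d 1 (x * inverse ?y2) q p * R1 1 (x * ?y1) p r * S d 1 (y\<^sup>2 * H (2 - int ?d)) q r = S d 1 (y\<^sup>2 * H (2 - int ?d)) q r * R1 1 (x * ?y1) p r * S d 1 (x * inverse ?y2) q p"
        using site_relationsD(5)[OF site_relations[OF d(3)] one b3, of q p r] n unfolding b2 by auto
      then show ?thesis using site_relationsD(2)[OF site_relations[OF d(3)] b3(1), of q p] site_relationsD(2)[OF site_relations[OF d(3)] b3(2), of q r] n by auto
    qed
    have r2: "?Qm * ?Kp * ?Qp * ?Kq = ?Kq * ?Qp * ?Kp * ?Qm" by (rule Suc.IH[OF d(3) z(1) y(2) n'(3)])
    let ?L = "R1 ?d (x * inverse y) p q * ?Kp * R1 ?d (x * y) p q * KK bd ?d y q"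
    let ?R = "KK bd ?d y q * R1 ?d (x * y) p q * ?Kp * R1 ?d (x * inverse y) p q"
    have "?E * ?L = (?E * R1 ?d (x * inverse y) p q) * ?Kp * R1 ?d (x * y) p q * KK bd ?d y q" by (simp only: mx_assoc)
    also have "\<dots> = ?Qm * ?Rm * (?E * ?Kp) * R1 ?d (x * y) p q * KK bd ?d y q" unfolding Em by (simp only: mx_assoc)
    also have "\<dots> = ?Qm * ?Rm * ?Kp * (?E * R1 ?d (x * y) p q) * KK bd ?d y q" unfolding cE by (simp only: mx_assoc)
    also have "\<dots> = ?Qm * ?Rm * ?Kp * ?Rp * ?Qp * (?E * KK bd ?d y q)" unfolding Ep by (simp only: mx_assoc)
    also have "\<dots> = ?Qm * (?Rm * ?Kp * ?Rp * ?Kr) * ?Qp * ?W * ?Kq * ?E" unfolding K1[symmetric] by (simp only: mx_assoc assoc_swap[OF c1(1)])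
    also have "\<dots> = ?Qm * ?Kr * ?Rp * ?Kp * (?Rm * ?Qp * ?W) * ?Kq * ?E" unfolding r1 by (simp only: mx_assoc)
    also have "\<dots> = ?Kr * (?Qm * ?Rp * ?W) * ?Kp * ?Qp * ?Kq * ?Rm * ?E" unfolding y1
      by (simp only: mx_assoc assoc_swap[OF c1(2)] assoc_swap[OF c1(3)] assoc_swap[OF c1(5)])
    also have "\<dots> = ?Kr * ?W * ?Rp * (?Qm * ?Kp * ?Qp * ?Kq) * ?Rm * ?E" unfolding y2 by (simp only: mx_assoc)
    also have "\<dots> = ?Kr * ?W * ?Kq * ?Rp * ?Qp * ?Kp * (?Qm * ?Rm * ?E)" unfolding r2 by (simp only: mx_assoc assoc_swap[OF c1(4)])
    also have "\<dots> = ?Kr * ?W * ?Kq * (?Rp * ?Qp * ?E) * ?Kp * R1 ?d (x * inverse y) p q" unfolding Em[symmetric] by (simp only: mx_assoc assoc_swap[OF cE])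
    also have "\<dots> = (?Kr * ?W * ?Kq * ?E) * R1 ?d (x * y) p q * ?Kp * R1 ?d (x * inverse y) p q" unfolding Ep[symmetric] by (simp only: mx_assoc)
    also have "\<dots> = ?E * ?R" unfolding K1 by (simp only: mx_assoc)
    finally have eq: "?E * ?L = ?E * ?R" .
    show ?thesis
    proof (rule cancel_E[OF d(2) _ _ _ _ eq, where P = "{p, q}"])
      show "PR (?d + 1) q * ?L = ?L" by (simp only: mx_assoc assoc_collapse[OF PR_absorb(2)[OF n'(3)]])
      show "PR (?d + 1) q * ?R = ?R" by (simp only: mx_assoc assoc_collapse[OF PR_absorb(13)[OF n'(3)]])
    qed (use n in \<open>auto intro!: on_legs_mult on_legs_two_legs on_legs_one_leg\<close>)
  qed
qed simp

lemma K_fusion: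
  assumes d: "d > 0" and x: "x \<noteq> 0" and n: "p \<noteq> q"
  shows "KK bd 1 (x * H (1 - int d)) p * R1 (d - 1) (x\<^sup>2 * H (2 - int d)) p q * KK bd (d - 1) (x * h) q * EE d p q = EE d p q * KK bd d x q"
proof (cases "d = 1")
  case True
  obtain t where "t \<notin> set [p, q]" by (rule fresh_leg)
  then show ?thesis using EE_1_relations(4)[of t p q] n True by simp
next
  case False
  then show ?thesis using d by (intro K_fusion_from_reflection[OF _ x n] reflection) (use n in auto)
qed

text \<open>The order met on the side of the dual K-matrices. One spin 1/2 is split off forwards on
  a fresh leg \<open>a\<close>, the induction hypothesis splits off the one on \<open>p\<close>
  backwards, and R on \<open>p\<close>, \<open>a\<close> joins the two.\<close>

lemma K_fusion_rev:
  assumes "d > 0" "x \<noteq> 0" "p \<noteq> q"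
  shows "KK bd (d - 1) (x * inverse h) q * R1 (d - 1) (x\<^sup>2 * H (int d - 2)) p q * KK bd 1 (x * H (int d - 1)) p * EE d p q = EE d p q * KK bd d x q"
  using assms
proof (induction d arbitrary: x p q)
  case (Suc d x p q)
  note x = Suc.prems(2) and n0 = Suc.prems(3)
  show ?case
  proof (cases "d = 0")
    case True
    obtain t where "t \<notin> set [p, q]" by (rule fresh_leg)
    then show ?thesis using EE_1_relations(5)[of t p q] n0 True by (simp add: One_nat_def[symmetric])
  next
    case False
    let ?d = "Suc d"
    have d: "?d > 1" "?d > 0" "d > 0" "?d - 1 = d" using False by auto
    obtain a where "a \<notin> set [p, q]" by (rule fresh_leg)
    then have n: "distinct [a, p, q]" using n0 by auto
    have n': "a \<noteq> p" "a \<noteq> q" "p \<noteq> q" "p \<noteq> a" using n by auto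
    have z: "x * inverse h \<noteq> 0" "x\<^sup>2 * H (int ?d - 2) \<noteq> 0" "x\<^sup>2 * H (2 - int ?d) \<noteq> 0" "x * h \<noteq> 0" using x by auto
    let ?Ka = "KK bd 1 (x * H (1 - int ?d)) a" and ?Raq = "R1 (d - 1) (x\<^sup>2 * H (1 - int ?d)) a q" and ?K3 = "KK bd (d - 1) x q"
    let ?Rpa = "R1 1 (x\<^sup>2) p a" and ?Rap = "R1 1 (x\<^sup>2) a p" and ?Rpq = "R1 (d - 1) (x\<^sup>2 * H (int ?d - 1)) p q" and ?Kp = "KK bd 1 (x * H (int ?d - 1)) p"
    let ?Ea = "EE d a q" and ?Ep = "EE d p q" and ?R = "R1 d (x\<^sup>2 * H (int ?d - 2)) p q" and ?R' = "R1 d (x\<^sup>2 * H (2 - int ?d)) a q"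
    have e1: "x * inverse h * H (1 - int d) = x * H (1 - int ?d)" "(x * inverse h)\<^sup>2 * H (2 - int d) = x\<^sup>2 * H (1 - int ?d)"
      "x * inverse h * h = x" "x\<^sup>2 * H (int ?d - 2) * H (1 - int d) = x\<^sup>2" "x\<^sup>2 * H (int ?d - 2) * h = x\<^sup>2 * H (int ?d - 1)"
      "x\<^sup>2 * H (2 - int ?d) * inverse h = x\<^sup>2 * H (1 - int ?d)" "x\<^sup>2 * H (2 - int ?d) * H (int d - 1) = x\<^sup>2"
      "x * h * inverse h = x" "(x * h)\<^sup>2 * H (int d - 2) = x\<^sup>2 * H (int ?d - 1)" "x * h * H (int d - 1) = x * H (int ?d - 1)"
    proof -
      have p: "(x * inverse h)\<^sup>2 = x\<^sup>2 * H (- 2)" "(x * h)\<^sup>2 = x\<^sup>2 * H 2"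
        by (simp_all add: power_mult_distrib power_int_minus power_inverse)
      show "x * inverse h * H (1 - int d) = x * H (1 - int ?d)" "(x * inverse h)\<^sup>2 * H (2 - int d) = x\<^sup>2 * H (1 - int ?d)"
        "x\<^sup>2 * H (int ?d - 2) * h = x\<^sup>2 * H (int ?d - 1)" "x\<^sup>2 * H (2 - int ?d) * inverse h = x\<^sup>2 * H (1 - int ?d)"
        "(x * h)\<^sup>2 * H (int d - 2) = x\<^sup>2 * H (int ?d - 1)" "x * h * H (int d - 1) = x * H (int ?d - 1)"
        unfolding p mult_H_assoc by (rule mult_H_cong; simp)+
      have "H (int ?d - 2 + (1 - int d)) = 1" "H (2 - int ?d + (int d - 1)) = 1" by simp_all
      then show "x\<^sup>2 * H (int ?d - 2) * H (1 - int d) = x\<^sup>2" "x\<^sup>2 * H (2 - int ?d) * H (int d - 1) = x\<^sup>2" unfolding mult_H_assoc by simp_all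
    qed simp_all
    have A1: "?Ea * KK bd d (x * inverse h) q = ?Ka * ?Raq * ?K3 * ?Ea"
      using K_fusion[OF d(3) z(1) n'(2), of bd] unfolding e1 by simp
    have A2: "?Ea * ?R = ?Rpa * ?Rpq * ?Ea" using R_fusion[OF d(3) z(2), of p a q] n unfolding e1 by auto
    have A3: "?Ep * ?R' = ?Raq * ?Rap * ?Ep" using R_fusion_rev[OF d(3) z(3), of a p q] n unfolding e1 by auto
    have A4: "?Ep * KK bd d (x * h) q = ?K3 * ?Rpq * ?Kp * ?Ep"
      using Suc.IH[OF d(3) z(4) n'(3)] unfolding e1 by simp
    have A5: "EE ?d a q * KK bd ?d x q = ?Ka * ?R' * KK bd d (x * h) q * EE ?d a q"
      using K_fusion[OF d(2) x n'(2), of bd] by simp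
    \<comment> \<open>The two splittings, on \<open>a\<close> and on \<open>p\<close>, may be done
      in either order; this links the two directions of fusion.\<close>
    have sw: "?Ea * EE ?d p q = ?Ep * EE ?d a q" using EE_swap[OF d(1), of a p q] n by simp
    have fl: "?Rap = ?Rpa" by (rule R11_flip) (use n in auto)
    have c: "?Ea * ?Kp = ?Kp * ?Ea" "?Ep * ?Ka = ?Ka * ?Ep" "?Rpa * ?K3 = ?K3 * ?Rpa" by (rule commute, (rule on_legs_basic)+, use n in auto)+
    have "?Ea * (KK bd d (x * inverse h) q * ?R * ?Kp * EE ?d p q) = ?Ka * ?Raq * ?K3 * (?Ea * ?R) * ?Kp * EE ?d p q"
      unfolding mx_assoc[symmetric] A1 ..
    also have "\<dots> = ?Ka * ?Raq * ?K3 * ?Rpa * ?Rpq * ?Kp * (?Ea * EE ?d p q)" unfolding A2 by (simp only: mx_assoc assoc_swap[OF c(1)])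
    also have "\<dots> = ?Ka * ?Raq * ?Rap * (?K3 * ?Rpq * ?Kp * ?Ep) * EE ?d a q" unfolding sw fl by (simp only: mx_assoc assoc_swap[OF c(3)])
    also have "\<dots> = ?Ka * (?Raq * ?Rap * ?Ep) * KK bd d (x * h) q * EE ?d a q" unfolding A4[symmetric] by (simp only: mx_assoc)
    also have "\<dots> = ?Ep * (?Ka * ?R' * KK bd d (x * h) q * EE ?d a q)" unfolding A3[symmetric] by (simp only: mx_assoc assoc_swap[OF c(2)])
    also have "\<dots> = ?Ea * (EE ?d p q * KK bd ?d x q)" unfolding A5[symmetric] by (simp only: mx_assoc[symmetric] sw)
    finally have eq: "?Ea * (KK bd d (x * inverse h) q * ?R * ?Kp * EE ?d p q) = ?Ea * (EE ?d p q * KK bd ?d x q)" .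
    have PE: "PR (d + 1) q * EE ?d p q = EE ?d p q" using PR_absorb(6)[OF n'(3), of ?d] by (simp add: Suc_eq_plus1[symmetric])
    show ?thesis unfolding d(4)
    proof (rule cancel_E[OF d(3) _ _ _ _ eq, where P = "{p, q}"])
      show "PR (d + 1) q * (EE ?d p q * KK bd ?d x q) = EE ?d p q * KK bd ?d x q" by (simp only: assoc_collapse[OF PE])
      show "PR (d + 1) q * (KK bd d (x * inverse h) q * ?R * ?Kp * EE ?d p q) = KK bd d (x * inverse h) q * ?R * ?Kp * EE ?d p q"
        by (simp only: mx_assoc assoc_collapse[OF PR_absorb(13)[OF n'(3)]])
    qed (use n in \<open>auto intro!: on_legs_mult on_legs_two_legs on_legs_one_leg\<close>)
  qed
qed simp

text \<open>The reflection equation at the other degeneration point, where R is a multiple of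
  \<open>EE * trn EE\<close>. On the right-hand side \<open>K_fusion_rev\<close> brings
  \<open>EE\<close> to the front, and it is cancelled by \<open>FF\<close>.\<close>

lemma K_fusion_rev_trn:
  assumes d: "d > 0" and x: "x \<noteq> 0" and n: "p \<noteq> q"
  shows "trn (EE d p q) * KK bd 1 (x * H (int d - 1)) p * R1 (d - 1) (x\<^sup>2 * H (int d - 2)) p q * KK bd (d - 1) (x * inverse h) q = KK bd d x q * trn (EE d p q)"
proof (cases "d = 1")
  case True
  obtain t where "t \<notin> set [p, q]" by (rule fresh_leg)
  then show ?thesis using EE_1_relations(6)[of t p q] n True by simp
next
  case False
  then have d1: "d > 1" "d - 1 > 0" "d - 1 + 1 = d" using d by auto
  let ?K1 = "KK bd 1 (x * H (int d - 1)) p" and ?R = "R1 (d - 1) (x\<^sup>2 * H (int d - 2)) p q" and ?K2 = "KK bd (d - 1) (x * inverse h) q"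
  let ?E = "EE d p q" and ?S = "R1 (d - 1) (H (int d)) p q" and ?c = "pre (d - 1) (H (int d)) * cq (int d)"
  have c0: "?c \<noteq> 0" using pre_sym_neq_0(1)[OF d1(1)] d by simp
  have z: "x * H (int d - 1) \<noteq> 0" "x * inverse h \<noteq> 0" using x by auto
  have e: "x * H (int d - 1) * inverse (x * inverse h) = H (int d)" "x * H (int d - 1) * (x * inverse h) = x\<^sup>2 * H (int d - 2)"
  proof -
    show "x * H (int d - 1) * inverse (x * inverse h) = H (int d)" using x H_mult[of "int d - 1" 1] by (simp add: field_simps)
    show "x * H (int d - 1) * (x * inverse h) = x\<^sup>2 * H (int d - 2)"
      using H_mult[of "int d - 1" "-1"] by (simp add: power2_eq_square power_int_minus mult_ac)
  qed
  have "?S * ?K1 * ?R * ?K2 = ?K2 * ?R * ?K1 * ?S" using reflection[OF d1(2) z n, of bd] unfolding e .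
  then have "scal ?c (?E * (trn ?E * ?K1 * ?R * ?K2)) = scal ?c ((?K2 * ?R * ?K1 * ?E) * trn ?E)"
    unfolding R1_symmetrizer[OF d1(1) n] by (simp add: mx_assoc)
  then have "?E * (trn ?E * ?K1 * ?R * ?K2) = (?K2 * ?R * ?K1 * ?E) * trn ?E" by (rule scal_cancel[OF c0])
  then have "FF d p q * (?E * (trn ?E * ?K1 * ?R * ?K2)) = FF d p q * (?E * KK bd d x q * trn ?E)" unfolding K_fusion_rev[OF d x n] by simp
  then have eq: "PR 1 p * PR (d + 1) q * (trn ?E * ?K1 * ?R * ?K2) = PR 1 p * PR (d + 1) q * (KK bd d x q * trn ?E)"
    unfolding FF_EE[OF d n, symmetric] by (simp only: mx_assoc)
  have t: "PR 1 p * trn ?E = trn ?E" "PR (d + 1) q * trn ?E = trn ?E"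
    using arg_cong[OF PR_absorb(7)[OF n, of d], of trn] arg_cong[OF PR_absorb(8)[OF n, of d], of trn] by (simp_all add: trn_PR)
  have c: "PR (d + 1) q * PR 1 p = PR 1 p * PR (d + 1) q" "PR 1 p * KK bd d x q = KK bd d x q * PR 1 p" by (rule commute, (rule on_legs_basic)+, use n in auto)+
  from eq show ?thesis by (simp only: mx_assoc assoc_collapse[OF t(2)] assoc_collapse[OF t(1)] assoc_collapse[OF PR_absorb(13)[OF n]] assoc_swap[OF c(2)] t)
qed

lemma R_fusion_rev_trn:
  assumes d: "d > 0" and z: "z \<noteq> 0" and n: "distinct [t, p, q]"
  shows "R1 d z t q * trn (EE d p q) = trn (EE d p q) * R1 1 (z * H (int d - 1)) t p * R1 (d - 1) (z * inverse h) t q"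
  using arg_cong[OF R_fusion_rev[OF assms], of trn] trn_R1[of t q] trn_R1[of t p] n by (simp add: mx_assoc)

text \<open>The reflection algebra analogue of the quantum determinant.\<close>

lemma Dt_K:
  assumes d: "d > 1" and x: "x \<noteq> 0" and n0: "p \<noteq> q"
  shows "Dt d p q * KK bd 1 (x * H (1 - int d)) p * R1 (d - 1) (x\<^sup>2 * H (2 - int d)) p q * KK bd (d - 1) (x * h) q
    = scal (Gamma_minus h bd (x * H (1 - int d)) * del (d - 2) (x\<^sup>2 * H (3 - int d))) (KK bd (d - 2) (x * h * h) q * Dt d p q)"
proof -
  obtain b where "b \<notin> set [p, q]" by (rule fresh_leg)
  then have n: "distinct [p, b, q]" using n0 by auto
  have n': "p \<noteq> b" "b \<noteq> q" "p \<noteq> q" using n by auto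
  have d1: "d - 1 > 0" "d - 1 - 1 = d - 2" "d - 2 + 1 = d - 1" using d by auto
  let ?y = "x * H (1 - int d)" and ?w = "x\<^sup>2 * H (3 - int d)" and ?E = "EE (d - 1) b q"
  let ?Kp = "KK bd 1 ?y p" and ?Rpb = "R1 1 (?y\<^sup>2 * h\<^sup>2) p b" and ?Rpq = "R1 (d - 2) ?w p q" and ?Kb = "KK bd 1 (?y * h\<^sup>2) b"
    and ?Rbq = "R1 (d - 2) (?w * h\<^sup>2) b q" and ?K3 = "KK bd (d - 2) (x * h * h) q"
  let ?R = "R1 (d - 1) (x\<^sup>2 * H (2 - int d)) p q" and ?K = "KK bd (d - 1) (x * h) q"
  have p: "?y\<^sup>2 = x\<^sup>2 * H (2 - 2 * int d)" "(x * h)\<^sup>2 = x\<^sup>2 * H 2"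
    using H_mult[of "1 - int d" "1 - int d"] by (simp_all add: power_mult_distrib power2_eq_square)
  have e: "x\<^sup>2 * H (2 - int d) * H (1 - int (d - 1)) = ?y\<^sup>2 * h\<^sup>2" "x\<^sup>2 * H (2 - int d) * h = ?w"
    "x * h * H (1 - int (d - 1)) = ?y * h\<^sup>2" "(x * h)\<^sup>2 * H (2 - int (d - 1)) = ?w * h\<^sup>2"
    unfolding p mult_H_assoc by (rule mult_H_cong; use d in simp)+
  have D: "Dt d p q * PR 1 b = st p b * ?E" by (rule Dt_st'[OF d]) (use n in auto)
  have z: "x\<^sup>2 * H (2 - int d) \<noteq> 0" "x * h \<noteq> 0" "?y \<noteq> 0" "?w \<noteq> 0" using x by auto
  have E1: "?E * ?R = ?Rpb * ?Rpq * ?E" using R_fusion[OF d1(1) z(1), of p b q] n unfolding e d1 by auto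
  have E2: "?E * ?K = ?Kb * ?Rbq * ?K3 * ?E" using K_fusion[OF d1(1) z(2) n'(2), of bd] unfolding e d1 by simp
  have c: "?E * ?Kp = ?Kp * ?E" "?Rpq * ?Kb = ?Kb * ?Rpq" "PR 1 b * ?Kp = ?Kp * PR 1 b" "PR 1 b * ?R = ?R * PR 1 b" "PR 1 b * ?K = ?K * PR 1 b"
     "st p b * ?K3 = ?K3 * st p b" by (rule commute, (rule on_legs_basic)+, use n in auto)+
  have s1: "st p b * ?Kp * ?Rpb * ?Kb = scal (Gamma_minus h bd ?y) (st p b)" by (rule st_K_half[OF n'(1) z(3)])
  have s2: "st p b * ?Rpq * ?Rbq = scal (del (d - 2) ?w) (st p b * PR (d - 1) q)" using st_R[OF z(4) n, of "d - 2"] unfolding d1 .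
  have P: "PR (d - 1) q * ?K3 = ?K3" using PR_absorb(13)[OF n'(2), where d = "d - 2"] unfolding d1 .
  have "Dt d p q * ?Kp * ?R * ?K * PR 1 b = (Dt d p q * PR 1 b) * ?Kp * ?R * ?K" by (simp only: mx_assoc assoc_swap[OF c(3)] assoc_swap[OF c(4)] c(5))
  also have "\<dots> = st p b * ?Kp * (?E * ?R) * ?K" unfolding D by (simp only: mx_assoc assoc_swap[OF c(1)])
  also have "\<dots> = st p b * ?Kp * ?Rpb * ?Rpq * (?E * ?K)" unfolding E1 by (simp only: mx_assoc)
  also have "\<dots> = (st p b * ?Kp * ?Rpb * ?Kb) * ?Rpq * ?Rbq * ?K3 * ?E" unfolding E2 by (simp only: mx_assoc assoc_swap[OF c(2)])
  also have "\<dots> = scal (Gamma_minus h bd ?y) ((st p b * ?Rpq * ?Rbq) * ?K3 * ?E)" unfolding s1 by (simp only: mx_assoc scal_mult_left)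
  also have "\<dots> = scal (Gamma_minus h bd ?y * del (d - 2) ?w) (?K3 * (st p b * ?E))" unfolding s2
    by (simp only: mx_assoc scal_mult_left scal_scal assoc_collapse[OF P] assoc_swap[OF c(6)])
  finally have eq: "Dt d p q * ?Kp * ?R * ?K * PR 1 b = scal (Gamma_minus h bd ?y * del (d - 2) ?w) (?K3 * Dt d p q) * PR 1 b"
    unfolding D[symmetric] by (simp only: mx_assoc scal_mult_left)
  have L: "on_legs {p, q} (Dt d p q * ?Kp * ?R * ?K)" "on_legs {p, q} (scal (Gamma_minus h bd ?y * del (d - 2) ?w) (?K3 * Dt d p q))"
    by (intro on_legs_mult on_legs_scal on_legs_two_legs on_legs_one_leg; simp)+
  have cP1: "PR 1 b * (Dt d p q * ?Kp * ?R * ?K) = Dt d p q * ?Kp * ?R * ?K * PR 1 b" by (rule commute[OF on_legs_basic(11) L(1)]) (use n in auto)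
  have cP2: "PR 1 b * scal (Gamma_minus h bd ?y * del (d - 2) ?w) (?K3 * Dt d p q) = scal (Gamma_minus h bd ?y * del (d - 2) ?w) (?K3 * Dt d p q) * PR 1 b"
    by (rule commute[OF on_legs_basic(11) L(2)]) (use n in auto)
  have "PI [b] [1] * (Dt d p q * ?Kp * ?R * ?K) = PI [b] [1] * scal (Gamma_minus h bd ?y * del (d - 2) ?w) (?K3 * Dt d p q)"
    unfolding PR_def[symmetric] cP1 cP2 by (rule eq)
  then show ?thesis by (intro cancel_leg[OF L]) (use n in auto)
qed

text \<open>The parameters of the transposed spin 1/2 K-matrix. \<open>Gamma_minus\<close> contains
  the off-diagonal parameters only through their product and is unchanged.\<close>

definition swb :: "boundary \<Rightarrow> boundary" where
  "swb bd = bd\<lparr>k_plus := k_minus bd, k_minus := k_plus bd\<rparr>"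

lemma trn_KK1: "trn (KK bd 1 x q) = KK (swb bd) 1 x q"
proof -
  have "transpose_mat (K_half h bd x) = K_half h (swb bd) x"
    by (rule eq_matI) (auto simp: K_half_def swb_def mat_of_rows_list_def less_Suc_eq numeral_2_eq_2)
  then show ?thesis unfolding KK_def
    by (subst trn_mop) (auto simp: K_half_def mat_of_rows_list_def One_nat_def)
qed

lemma Gamma_swb: "Gamma_minus h (swb bd) x = Gamma_minus h bd x"
proof -
  have "eps_plus (swb bd) = eps_plus bd" "eps_minus (swb bd) = eps_minus bd" "k_plus (swb bd) = k_minus bd" "k_minus (swb bd) = k_plus bd"
    by (simp_all add: swb_def)
  then show ?thesis by (simp only: Gamma_minus_def Let_def mult.commute[of "k_minus bd" "k_plus bd"])
qed

text \<open>The determinant on the dual side: the singlet argument of \<open>Dt_K\<close> read in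
  transposed form, with the fusion relations for \<open>trn EE\<close> in place of those for
  \<open>EE\<close>.\<close>

lemma K_trn_Dt:
  assumes d: "d > 1" and x: "x \<noteq> 0" and n0: "p \<noteq> q"
  shows "KK bd 1 (x * H (int d - 1)) p * R1 (d - 1) (x\<^sup>2 * H (int d - 2)) p q * KK bd (d - 1) (x * inverse h) q * trn (Dt d p q)
    = scal (Gamma_minus h bd (x * H (int d - 3)) * del (d - 2) (x\<^sup>2 * H (int d - 5))) (trn (Dt d p q) * KK bd (d - 2) (x * inverse h * inverse h) q)"
proof -
  obtain b where "b \<notin> set [p, q]" by (rule fresh_leg)
  then have n: "distinct [b, p, q]" using n0 by auto
  have n': "b \<noteq> p" "b \<noteq> q" "p \<noteq> q" "p \<noteq> b" using n by auto
  have d1: "d - 1 > 0" "d - 1 - 1 = d - 2" "d - 2 + 1 = d - 1" using d by auto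
  let ?y = "x * H (int d - 3)" and ?w = "x\<^sup>2 * H (int d - 5)" and ?E = "trn (EE (d - 1) b q)" and ?s = "trn (st p b)"
  let ?Kp = "KK bd 1 (?y * h\<^sup>2) p" and ?Rpb = "R1 1 (?y\<^sup>2 * h\<^sup>2) p b" and ?Rpq = "R1 (d - 2) (?w * h\<^sup>2) p q" and ?Kb = "KK bd 1 ?y b"
    and ?Rbq = "R1 (d - 2) ?w b q" and ?K3 = "KK bd (d - 2) (x * inverse h * inverse h) q"
  let ?R = "R1 (d - 1) (x\<^sup>2 * H (int d - 2)) p q" and ?K = "KK bd (d - 1) (x * inverse h) q" and ?D = "trn (Dt d p q)"
  have p: "?y\<^sup>2 = x\<^sup>2 * H (2 * int d - 6)" "(x * inverse h)\<^sup>2 = x\<^sup>2 * H (- 2)"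
    using H_mult[of "int d - 3" "int d - 3"] by (simp_all add: power_mult_distrib power2_eq_square power_int_minus power_inverse)
  have e: "x\<^sup>2 * H (int d - 2) * H (int (d - 1) - 1) = ?y\<^sup>2 * h\<^sup>2" "x\<^sup>2 * H (int d - 2) * inverse h = ?w * h\<^sup>2"
    "x * inverse h * H (int (d - 1) - 1) = ?y" "(x * inverse h)\<^sup>2 * H (int (d - 1) - 2) = ?w" "x * H (int d - 1) = ?y * h\<^sup>2"
    unfolding p mult_H_assoc by (rule mult_H_cong; use d in simp)+
  have D0: "Dt d p q * PR 1 b = st p b * EE (d - 1) b q" by (rule Dt_st'[OF d]) (use n in auto)
  have D: "PR 1 b * ?D = ?E * ?s" using arg_cong[OF D0, of trn] by (simp add: trn_PR)
  have z: "x\<^sup>2 * H (int d - 2) \<noteq> 0" "x * inverse h \<noteq> 0" "?y \<noteq> 0" "?w \<noteq> 0" using x by auto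
  have E1: "?R * ?E = ?E * ?Rpb * ?Rpq" using R_fusion_rev_trn[OF d1(1) z(1), of p b q] n unfolding e d1 by auto
  have E2: "?K * ?E = ?E * ?Kb * ?Rbq * ?K3" using K_fusion_rev_trn[OF d1(1) z(2) n'(2), of bd] unfolding e d1 by simp
  have c: "?Kp * ?E = ?E * ?Kp" "?Rpq * ?Kb = ?Kb * ?Rpq" "PR 1 b * ?Kp = ?Kp * PR 1 b" "PR 1 b * ?R = ?R * PR 1 b" "PR 1 b * ?K = ?K * PR 1 b"
     "?K3 * ?s = ?s * ?K3" by (rule commute, (rule on_legs_basic)+, use n in auto)+
  \<comment> \<open>Transposition reverses the order of the two legs, and the singlet is
    antisymmetric in them; the sign appears on both sides.\<close>
  have sw: "st p b = scal (- 1) (st b p)"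
    by (rule mx_ext) (use n' in \<open>auto simp: st_app[OF n'(1)] st_app[OF n'(4)]\<close>)
  have s1: "?Kp * ?Rpb * ?Kb * ?s = scal (Gamma_minus h bd ?y) ?s"
  proof -
    have "st b p * KK (swb bd) 1 ?y b * R1 1 (?y\<^sup>2 * h\<^sup>2) b p * KK (swb bd) 1 (?y * h\<^sup>2) p = scal (Gamma_minus h bd ?y) (st b p)"
      using st_K_half[OF n'(1) z(3), of "swb bd"] unfolding Gamma_swb .
    from arg_cong[OF this, of trn] have "trn (KK (swb bd) 1 (?y * h\<^sup>2) p) * ?Rpb * trn (KK (swb bd) 1 ?y b) * trn (st b p) = scal (Gamma_minus h bd ?y) (trn (st b p))"
      using trn_R1[OF n'(4)] R11_flip[OF n'(1)] by (simp add: mx_assoc)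
    moreover have "swb (swb bd) = bd" by (simp add: swb_def)
    ultimately show ?thesis unfolding sw by (simp add: trn_KK1 mult.commute)
  qed
  have s2: "?Rpq * ?Rbq * ?s = scal (del (d - 2) ?w) (PR (d - 1) q * ?s)"
  proof -
    have "st b p * ?Rbq * ?Rpq = scal (del (d - 2) ?w) (st b p * PR (d - 1) q)" using st_R[OF z(4) n, of "d - 2"] unfolding d1 .
    from arg_cong[OF this, of trn] show ?thesis unfolding sw using trn_R1[OF n'(3)] trn_R1[OF n'(2)] by (simp add: mx_assoc trn_PR mult.commute)
  qed
  have P: "?K3 * PR (d - 1) q = ?K3" using PR_absorb(14)[OF n'(2), where d = "d - 2"] unfolding d1 .
  have cs: "PR (d - 1) q * ?s = ?s * PR (d - 1) q" by (rule commute, (rule on_legs_basic)+, use n in auto)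
  have Pl: "PR (d - 1) q * ?K3 = ?K3" using PR_absorb(13)[OF n'(2), where d = "d - 2"] unfolding d1 .
  have "PR 1 b * (?Kp * ?R * ?K * ?D) = ?Kp * ?R * ?K * (PR 1 b * ?D)" by (simp only: mx_assoc assoc_swap[OF c(3)] assoc_swap[OF c(4)] assoc_swap[OF c(5)])
  also have "\<dots> = ?Kp * ?R * (?K * ?E) * ?s" unfolding D by (simp only: mx_assoc)
  also have "\<dots> = ?Kp * (?R * ?E) * ?Kb * ?Rbq * ?K3 * ?s" unfolding E2 by (simp only: mx_assoc)
  also have "\<dots> = ?E * ?Kp * ?Rpb * ?Kb * (?Rpq * ?Rbq * ?s) * ?K3" unfolding E1 by (simp only: mx_assoc assoc_swap[OF c(1)] assoc_swap[OF c(2)] c(6))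
  also have "\<dots> = scal (del (d - 2) ?w) (?E * (?Kp * ?Rpb * ?Kb * ?s) * ?K3)" unfolding s2 cs by (simp only: mx_assoc scal_mult_left scal_mult_right Pl)
  also have "\<dots> = scal (Gamma_minus h bd ?y * del (d - 2) ?w) (?E * ?s * ?K3)" unfolding s1 by (simp only: mx_assoc scal_mult_left scal_mult_right scal_scal mult.commute[of "del (d - 2) ?w"])
  finally have eq: "PR 1 b * (?Kp * ?R * ?K * ?D) = PR 1 b * scal (Gamma_minus h bd ?y * del (d - 2) ?w) (?D * ?K3)"
    unfolding D[symmetric] by (simp only: mx_assoc scal_mult_right)
  have L: "on_legs {p, q} (?Kp * ?R * ?K * ?D)" "on_legs {p, q} (scal (Gamma_minus h bd ?y * del (d - 2) ?w) (?D * ?K3))"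
    by (intro on_legs_mult on_legs_scal on_legs_two_legs on_legs_one_leg; simp)+
  show ?thesis unfolding e(5) by (rule cancel_leg[OF L _ eq[unfolded PR_def[of 1 b]]]) (use n in auto)
qed

section \<open>Partial traces and crossing\<close>

text \<open>On the common legs both operators are multiples of the projection onto index 0, and
  elsewhere they act on different legs.\<close>

lemma commute_restr:
  assumes A: "on_legs P A" and B: "on_legs Q B"
    and a: "\<And>r s t. r \<in> P \<inter> Q \<Longrightarrow> ent A s t \<noteq> 0 \<Longrightarrow> s r = 0 \<and> t r = 0"
    and b: "\<And>r s t. r \<in> P \<inter> Q \<Longrightarrow> ent B s t \<noteq> 0 \<Longrightarrow> s r = 0 \<and> t r = 0"
  shows "A * B = B * A"
proof (rule mx_eqI)
  fix s t :: state
  define u where "u r = (if r \<in> P \<inter> Q then 0 else if r \<in> P then t r else s r)" for r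
  define v where "v r = (if r \<in> P \<inter> Q then 0 else if r \<in> P then s r else t r)" for r
  have 1: "ent (A * B) s t = ent A s u * ent B u t"
  proof (rule ent_mult1)
    fix r assume r: "ent A s r \<noteq> 0" "ent B r t \<noteq> 0"
    show "r = u"
    proof
      fix x
      show "r x = u x" using on_legs_off[OF A r(1), of x] on_legs_off[OF B r(2), of x] a[OF _ r(1), of x] by (auto simp: u_def)
    qed
  qed
  have 2: "ent (B * A) s t = ent B s v * ent A v t"
  proof (rule ent_mult1)
    fix r assume r: "ent B s r \<noteq> 0" "ent A r t \<noteq> 0"
    show "r = v"
    proof
      fix x
      show "r x = v x" using on_legs_off[OF B r(1), of x] on_legs_off[OF A r(2), of x] a[OF _ r(2), of x] by (auto simp: v_def)
    qed
  qed
  show "ent (A * B) s t = ent (B * A) s t"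
  proof (cases "(\<forall>r. r \<notin> P \<union> Q \<longrightarrow> s r = t r) \<and> (\<forall>r\<in>P \<inter> Q. s r = 0 \<and> t r = 0)")
    case True
    have "ent A s u = ent A v t"
      by (rule on_legs_eq[OF A]) (use True in \<open>auto simp: u_def v_def\<close>)
    moreover have "ent B u t = ent B s v"
      by (rule on_legs_eq[OF B]) (use True in \<open>auto simp: u_def v_def\<close>)
    ultimately show ?thesis using 1 2 by simp
  next
    case False
    then consider r where "r \<notin> P" "r \<notin> Q" "s r \<noteq> t r" | r where "r \<in> P \<inter> Q" "s r \<noteq> 0" | r where "r \<in> P \<inter> Q" "t r \<noteq> 0" by auto
    then show ?thesis
    proof cases
      case (1 r)
      then have "ent B u t = 0" "ent B s v = 0"
        using on_legs_off[OF B, of u t r] on_legs_off[OF B, of s v r] by (auto simp: u_def v_def)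
      then show ?thesis using \<open>ent (A * B) s t = _\<close> 2 by simp
    next
      case (2 r)
      then have "ent A s u = 0" "ent B s v = 0" using a[of r s u] b[of r s v] by auto
      then show ?thesis using \<open>ent (B * A) s t = _\<close> 1 by simp
    next
      case (3 r)
      then have "ent B u t = 0" "ent A v t = 0" using a[of r v t] b[of r u t] by auto
      then show ?thesis using 1 2 by simp
    qed
  qed
qed

lemma on_legs_UNIV: "on_legs UNIV X"
  by (rule on_legsI) (auto simp: fun_eq_iff intro!: arg_cong2[of _ _ _ _ "ent X"])

lemma ent_PR_mult: "ent (PR n p * A) s t = (if s p < n then ent A s t else 0)"
  "ent (A * PR n p) s t = (if t p < n then ent A s t else 0)"
  by (simp_all add: PR_def PI_mult_left PI_mult_right inr_def)

lemma PR1_restr: "PR 1 p * A = A \<Longrightarrow> ent A s t \<noteq> 0 \<Longrightarrow> s p = 0" "A * PR 1 p = A \<Longrightarrow> ent A s t \<noteq> 0 \<Longrightarrow> t p = 0"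
  using ent_PR_mult(1)[of 1 p A s t] ent_PR_mult(2)[of A 1 p s t] by (auto split: if_splits)

section \<open>Partial traces by bras and kets\<close>

definition ket :: "nat \<Rightarrow> nat \<Rightarrow> mx" where
  "ket p i = mop [p] [i + 1] [1] (mat (i + 1) 1 (\<lambda>(r, c). if r = i then 1 else 0))"

definition bra :: "nat \<Rightarrow> nat \<Rightarrow> mx" where
  "bra p i = mop [p] [1] [i + 1] (mat 1 (i + 1) (\<lambda>(r, c). if c = i then 1 else 0))"

lemma ket_app: "app (ket p i) f s = (if s p = i then f (s(p := 0)) else 0)"
  by (auto simp: ket_def app_mop1 One_nat_def)

lemma bra_app: "app (bra p i) f s = (if s p = 0 then f (s(p := i)) else 0)"
proof -
  have "(\<Sum>k<Suc i. (if k = i then 1 else 0) * f (s(p := k))) = f (s(p := i))"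
    by (simp add: if_distrib[of "\<lambda>x. x * _"] cong: if_cong)
  then show ?thesis by (auto simp: bra_def app_mop1 One_nat_def)
qed

lemma on_legs_ket_bra: "on_legs {p} (ket p i)" "on_legs {p} (bra p i)"
  unfolding ket_def bra_def using on_legs_mop[of "[p]"] by auto

lemma on_legs_ket_bra_mono: "p \<in> P \<Longrightarrow> on_legs P (ket p i)" "p \<in> P \<Longrightarrow> on_legs P (bra p i)"
  by (rule on_legs_mono[OF on_legs_ket_bra(1)] on_legs_mono[OF on_legs_ket_bra(2)]; simp)+

lemma ket_absorb:
  "bra p i * ket p j = (if i = j then PR 1 p else 0)" "PR 1 p * bra p i = bra p i" "ket p i * PR 1 p = ket p i"
  "i < n \<Longrightarrow> PR n p * ket p i = ket p i" "i < n \<Longrightarrow> bra p i * PR n p = bra p i" "ket p 0 = PR 1 p" "bra p 0 = PR 1 p"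
  by (rule mx_ext, auto simp: ket_app bra_app app_PR One_nat_def fun_upd_idem)+

lemma sum_ket_bra: "(\<Sum>i<n. ket p i * bra p i) = PR n p"
proof (induction n)
  case 0
  show ?case by (rule mx_ext) (simp add: app_PR)
next
  case (Suc n)
  show ?case unfolding sum.lessThan_Suc Suc.IH by (rule mx_ext) (auto simp: app_PR ket_app bra_app less_Suc_eq)
qed

text \<open>Since \<open>ket p i\<close> is |i><0| and \<open>bra p i\<close> is |0><i|, the
  traced-out leg stays in the ring and carries the projection |0><0| afterwards.\<close>

definition ptr :: "nat \<Rightarrow> nat \<Rightarrow> mx \<Rightarrow> mx" where
  "ptr p n X = (\<Sum>i<n. bra p i * X * ket p i)"

definition kt :: "nat \<Rightarrow> nat \<Rightarrow> nat \<times> nat \<Rightarrow> mx" where "kt p q I = ket p (fst I) * ket q (snd I)"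
definition br :: "nat \<Rightarrow> nat \<Rightarrow> nat \<times> nat \<Rightarrow> mx" where "br p q I = bra q (snd I) * bra p (fst I)"

definition tr2 :: "nat \<Rightarrow> nat \<Rightarrow> nat \<Rightarrow> nat \<Rightarrow> mx \<Rightarrow> mx" where
  "tr2 p q n m X = (\<Sum>I\<in>{..<n} \<times> {..<m}. br p q I * X * kt p q I)"

lemma sum_kt_br:
  assumes "p \<noteq> q"
  shows "(\<Sum>I\<in>{..<n} \<times> {..<m}. kt p q I * br p q I) = PR n p * PR m q"
proof -
  have e: "ket p i * ket q j * (bra q j * bra p i) = (ket p i * bra p i) * (ket q j * bra q j)" for i j
  proof -
    have c: "ket q j * bra q j * bra p i = bra p i * (ket q j * bra q j)"
      by (rule commute[where P = "{q}" and Q = "{p}"]; use assms in \<open>auto intro!: on_legs_mult on_legs_ket_bra_mono\<close>)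
    show ?thesis using c by (simp only: mx_assoc)
  qed
  have "(\<Sum>I\<in>{..<n} \<times> {..<m}. kt p q I * br p q I) = (\<Sum>i<n. \<Sum>j<m. (ket p i * bra p i) * (ket q j * bra q j))"
    unfolding kt_def br_def e by (simp add: sum.cartesian_product case_prod_beta)
  also have "\<dots> = (\<Sum>i<n. ket p i * bra p i) * (\<Sum>j<m. ket q j * bra q j)" by (simp add: sum_product)
  finally show ?thesis unfolding sum_ket_bra .
qed

text \<open>Conjugating \<open>A\<close> by bras and kets of both legs gives multiples of one projection, and these commute with everything.\<close>

lemma tr2_cyc:
  assumes n: "p \<noteq> q" and A: "on_legs {p, q} A" and L: "PR n p * PR m q * A = A" and R: "A * (PR n' p * PR m' q) = A"
  shows "tr2 p q n m (A * Z) = tr2 p q n' m' (Z * A)"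
proof -
  let ?F = "{..<n} \<times> {..<m}" and ?G = "{..<n'} \<times> {..<m'}"
  have br: "PR 1 r * br p q I = br p q I" if "r \<in> {p, q}" for r I
  proof -
    have c: "bra q i * bra p j = bra p j * bra q i" for i j
      by (rule commute[where P = "{q}" and Q = "{p}"]; use n in \<open>auto intro!: on_legs_ket_bra_mono\<close>)
    from that consider "r = q" | "r = p" by auto
    then show ?thesis
    proof cases
      case 1
      show ?thesis unfolding br_def 1 by (simp only: assoc_collapse[OF ket_absorb(2)])
    next
      case 2
      show ?thesis unfolding br_def 2 c by (simp only: assoc_collapse[OF ket_absorb(2)])
    qed
  qed
  have kt: "kt p q I * PR 1 r = kt p q I" if "r \<in> {p, q}" for r I
  proof -
    have c: "ket p i * ket q j = ket q j * ket p i" for i j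
      by (rule commute[where P = "{p}" and Q = "{q}"]; use n in \<open>auto intro!: on_legs_ket_bra_mono\<close>)
    from that consider "r = q" | "r = p" by auto
    then show ?thesis
    proof cases
      case 1
      show ?thesis unfolding kt_def 1 by (simp only: mx_assoc ket_absorb(3))
    next
      case 2
      show ?thesis unfolding kt_def 2 c by (simp only: mx_assoc ket_absorb(3))
    qed
  qed
  have sw: "(br p q I * A * kt p q K) * (br p q K * Z * kt p q I) = (br p q K * Z * kt p q I) * (br p q I * A * kt p q K)" for I K
  proof (rule commute_restr[where P = "{p, q}" and Q = UNIV])
    show "on_legs {p, q} (br p q I * A * kt p q K)" unfolding br_def kt_def by (intro on_legs_mult A on_legs_ket_bra_mono) auto
    show "on_legs UNIV (br p q K * Z * kt p q I)" by (rule on_legs_UNIV)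
    have X: "s r = 0 \<and> t r = 0" if e: "ent (br p q I' * Y * kt p q K') s t \<noteq> 0" and r: "r \<in> {p, q}" for r s t I' K' Y
    proof -
      have 1: "PR 1 r * (br p q I' * Y * kt p q K') = br p q I' * Y * kt p q K'" by (simp only: mx_assoc assoc_collapse[OF br[OF r]])
      have 2: "br p q I' * Y * kt p q K' * PR 1 r = br p q I' * Y * kt p q K'" by (simp only: mx_assoc kt[OF r])
      show ?thesis using PR1_restr(1)[OF 1 e] PR1_restr(2)[OF 2 e] by simp
    qed
    show "s r = 0 \<and> t r = 0" if "r \<in> {p, q} \<inter> UNIV" "ent (br p q I * A * kt p q K) s t \<noteq> 0" for r s t using X[OF that(2)] that(1) by simp
    show "s r = 0 \<and> t r = 0" if "r \<in> {p, q} \<inter> UNIV" "ent (br p q K * Z * kt p q I) s t \<noteq> 0" for r s t using X[OF that(2)] that(1) by simp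
  qed
  have "tr2 p q n m (A * Z) = (\<Sum>I\<in>?F. br p q I * (A * (\<Sum>K\<in>?G. kt p q K * br p q K)) * Z * kt p q I)"
    unfolding sum_kt_br[OF n] R tr2_def by (simp only: mx_assoc)
  also have "\<dots> = (\<Sum>I\<in>?F. \<Sum>K\<in>?G. (br p q I * A * kt p q K) * (br p q K * Z * kt p q I))"
    by (simp add: sum_distrib_left sum_distrib_right mx_assoc)
  also have "\<dots> = (\<Sum>K\<in>?G. \<Sum>I\<in>?F. br p q K * Z * (kt p q I * br p q I) * A * kt p q K)"
    unfolding sw by (subst sum.swap) (simp add: mx_assoc)
  also have "\<dots> = (\<Sum>K\<in>?G. br p q K * Z * ((\<Sum>I\<in>?F. kt p q I * br p q I) * A) * kt p q K)"
    by (simp add: sum_distrib_left sum_distrib_right mx_assoc)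
  also have "\<dots> = tr2 p q n' m' (Z * A)" unfolding sum_kt_br[OF n] L tr2_def by (simp only: mx_assoc)
  finally show ?thesis .
qed

lemma tr2_add: "tr2 p q n m (X + Y) = tr2 p q n m X + tr2 p q n m Y"
  by (simp add: tr2_def distrib_left distrib_right sum.distrib)

lemma tr2_scal: "tr2 p q n m (scal c X) = scal c (tr2 p q n m X)"
  by (simp add: tr2_def scal_sum)

lemma tr2_ptr: "tr2 p q n m X = (\<Sum>j<m. bra q j * ptr p n X * ket q j)" if "p \<noteq> q"
proof -
  have "ket p i * ket q j = ket q j * ket p i" for i j
    by (rule commute[where P = "{p}" and Q = "{q}"]; use that in \<open>auto intro!: on_legs_ket_bra_mono\<close>)
  then show ?thesis unfolding tr2_def ptr_def br_def kt_def sum.cartesian_product' fst_conv snd_conv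
    by (subst sum.swap) (simp add: sum_distrib_left sum_distrib_right mx_assoc)
qed

lemma tr2_restrict:
  assumes "p \<noteq> q"
  shows "tr2 p q n m X = tr2 p q n m (X * (PR n p * PR m q))"
proof -
  have c: "PR m q * ket p i = ket p i * PR m q" for i by (rule commute[where P = "{q}" and Q = "{p}"]; use assms in \<open>auto intro!: on_legs_ket_bra_mono on_legs_one_leg\<close>)
  have "PR n p * PR m q * kt p q I = kt p q I" if I: "I \<in> {..<n} \<times> {..<m}" for I
  proof -
    have i: "fst I < n" "snd I < m" using I by auto
    show ?thesis unfolding kt_def by (simp only: mx_assoc assoc_swap[OF c] ket_absorb(4)[OF i(2)] assoc_collapse[OF ket_absorb(4)[OF i(1)]])
  qed
  then show ?thesis unfolding tr2_def by (intro sum.cong) (simp_all add: mx_assoc)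
qed

lemma tr2_1:
  assumes "on_legs P X" "p \<notin> P" "p \<noteq> q"
  shows "tr2 p q 1 m X = PR 1 p * ptr q m X"
proof -
  have 1: "PR 1 p * X = X * PR 1 p" by (rule commute[where P = "{p}" and Q = P]; use assms in \<open>auto intro!: on_legs_one_leg\<close>)
  have 2: "bra q j * PR 1 p = PR 1 p * bra q j" for j by (rule commute[where P = "{q}" and Q = "{p}"]; use assms in \<open>auto intro!: on_legs_one_leg on_legs_ket_bra_mono\<close>)
  have 3: "PR 1 p * PR 1 p = PR 1 p" unfolding PR_idem by simp
  have "ptr p 1 X = bra p 0 * X * ket p 0" by (simp add: ptr_def One_nat_def)
  also have "\<dots> = PR 1 p * X" unfolding ket_absorb(6,7) by (simp only: mx_assoc 1[symmetric] assoc_collapse[OF 3])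
  finally show ?thesis unfolding tr2_ptr[OF assms(3)] ptr_def[of q] by (simp only: mx_assoc assoc_swap[OF 2] sum_distrib_left)
qed

text \<open>The spectral parameter \<open>inverse z * H (- 4)\<close> is that of crossing unitarity.\<close>

lemma R1_crossing:
  assumes d: "d > 0" and z: "z \<noteq> 0" and n: "p \<noteq> q" and jk: "j < 2" "k < 2"
  shows "(\<Sum>i<2. (bra p i * R1 d (inverse z * H (- 4)) p q * ket p j) * (bra p k * R1 d z p q * ket p i))
    = (if j = k then scal (pre d z * pre d (inverse z * H (- 4)) * cz z (1 - int d) * cz (inverse z * H (- 4)) (1 - int d)) (PR 1 p * PR (d + 1) q) else 0)"
proof (rule mx_ext2[OF n])
  fix f and s :: state and m l
  let ?z = "inverse z * H (- 4)"
  have cz': "cz ?z e = - cz z (4 - e)" for e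
    using z H_mult[of "-4" e] H_mult[of 4 "-e"] by (simp add: cz_def qc_def power_int_minus power_int_diff field_simps)
  have two: "(\<Sum>i<2. g i) = g 0 + g 1" for g :: "nat \<Rightarrow> mx" by (simp add: numeral_2_eq_2 One_nat_def)
  \<comment> \<open>After the inversion \<open>cz'\<close> each diagonal entry is the left side of a
    three-term identity, so the dependence on \<open>l\<close> disappears.\<close>
  have i1: "cz z (1 - int d) * cz z (3 + int d) + cq (int l + 1) * cq (int d - int l) = cz z (3 - int d + 2 * int l) * cz z (1 + int d - 2 * int l)"
    by (rule cz_id[OF z]) auto
  have i2: "cz z (1 - int d) * cz z (3 + int d) + cq (int l) * cq (int d + 1 - int l) = cz z (3 + int d - 2 * int l) * cz z (1 - int d + 2 * int l)"
    by (rule cz_id[OF z]) auto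
  have b1: "b d (Suc l) * b d (Suc l) = cq (int l + 1) * cq (int d - int l)" if "l \<le> d" using b_sq[of "Suc l" d] that by (simp add: algebra_simps)
  have b2: "b d l * b d l = cq (int l) * cq (int d + 1 - int l)" if "l \<le> d" using b_sq[of l d] that by simp
  have e: "4 - (1 + int d - 2 * int l) = 3 - int d + 2 * int l" "4 - (1 - int d + 2 * int l) = 3 + int d - 2 * int l" "4 - (1 - int d) = 3 + int d"
    "1 - int d + 2 * int (Suc l) = 3 - int d + 2 * int l" by simp_all
  have e': "1 + int d - 2 * int (l - 1) = 3 + int d - 2 * int l" if "l > 0" using that by (simp add: of_nat_diff)
  have key: "P' * (- x1 * (P * (x2 * x))) + P' * (w * (P * (w * x))) = P * P' * y1 * (- y2) * x"
    if "- (x1 * x2) + w * w = - (y1 * y2)" for P P' x1 x2 y1 y2 w x :: complex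
  proof -
    have "P' * (- x1 * (P * (x2 * x))) + P' * (w * (P * (w * x))) = P * P' * x * (- (x1 * x2) + w * w)" by (simp add: algebra_simps)
    then show ?thesis unfolding that by (simp add: algebra_simps)
  qed
  have be: "b d (Suc l) = 0" if "l = d" using that by simp
  show "app (\<Sum>i<2. (bra p i * R1 d ?z p q * ket p j) * (bra p k * R1 d z p q * ket p i)) f (st2 p q s m l)
    = app (if j = k then scal (pre d z * pre d ?z * cz z (1 - int d) * cz ?z (1 - int d)) (PR 1 p * PR (d + 1) q) else 0) f (st2 p q s m l)"
  proof (cases "m = 0 \<and> l \<le> d")
    case False
    then show ?thesis unfolding two
      by (auto simp: ket_app bra_app app_PR R1_app[OF d n] st2(1-4)[OF n])
  next
    case True
    then have m: "m = 0" and l: "l \<le> d" by auto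
    consider "j = 0" "k = 0" | "j = 0" "k = 1" | "j = 1" "k = 0" | "j = 1" "k = 1" using jk by (auto simp: less_2_cases_iff One_nat_def)
    then show ?thesis
    proof cases
      case 1
      have "- (cz z (3 - int d + 2 * int l) * cz z (1 + int d - 2 * int l)) + b d (Suc l) * b d (Suc l) = - (cz z (1 - int d) * cz z (3 + int d))"
        unfolding b1[OF l] i1[symmetric] by simp
      then have "pre d ?z * (- cz z (3 - int d + 2 * int l) * (pre d z * (cz z (1 + int d - 2 * int l) * x))) + pre d ?z * (b d (Suc l) * (pre d z * (b d (Suc l) * x)))
         = pre d z * pre d ?z * cz z (1 - int d) * (- cz z (3 + int d)) * x" for x using key by (simp add: add.commute)
      then show ?thesis using l be unfolding two m 1
        by (cases "l = d") (auto simp: ket_app bra_app app_PR R1_app[OF d n] st2(1-4)[OF n] cz' e One_nat_def)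
    next
      case 2
      then show ?thesis using l be unfolding two m 2
        by (cases "l = d") (auto simp: ket_app bra_app app_PR R1_app[OF d n] st2(1-4)[OF n] cz' e One_nat_def algebra_simps)
    next
      case 3
      then show ?thesis using l e' unfolding two m 3
        by (cases "l = 0") (auto simp: ket_app bra_app app_PR R1_app[OF d n] st2(1-4)[OF n] cz' e One_nat_def algebra_simps)
    next
      case 4
      have "- (cz z (3 + int d - 2 * int l) * cz z (1 - int d + 2 * int l)) + b d l * b d l = - (cz z (1 - int d) * cz z (3 + int d))"
        unfolding b2[OF l] i2[symmetric] by simp
      then have "pre d ?z * (b d l * (pre d z * (b d l * x))) + pre d ?z * (- cz z (3 + int d - 2 * int l) * (pre d z * (cz z (1 - int d + 2 * int l) * x)))
         = pre d z * pre d ?z * cz z (1 - int d) * (- cz z (3 + int d)) * x" for x using key by (simp add: add.commute)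
      then show ?thesis using l unfolding two m 4
        by (cases "l = 0") (auto simp: ket_app bra_app app_PR R1_app[OF d n] st2(1-4)[OF n] cz' e One_nat_def)
    qed
  qed
qed

section \<open>Double-row operators\<close>

text \<open>A site is a triple of leg, doubled spin and inhomogeneity; the head of the list is the
  leftmost factor of the monodromy.\<close>

primrec TT :: "(nat \<times> nat \<times> complex) list \<Rightarrow> nat \<Rightarrow> complex \<Rightarrow> nat \<Rightarrow> mx" where
  "TT [] d z p = 1"
| "TT (x # xs) d z p = S (fst (snd x)) d (z * snd (snd x)) (fst x) p * TT xs d z p"

primrec site_del :: "(nat \<times> nat \<times> complex) list \<Rightarrow> complex \<Rightarrow> complex" where
  "site_del [] z = 1"
| "site_del (x # xs) z = del (fst (snd x)) (z * snd (snd x)) * site_del xs z"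

definition site_legs :: "(nat \<times> nat \<times> complex) list \<Rightarrow> nat set" where "site_legs L = fst ` set L"

definition sites_ok :: "(nat \<times> nat \<times> complex) list \<Rightarrow> bool" where
  "sites_ok L \<longleftrightarrow> distinct (map fst L) \<and> (\<forall>x\<in>set L. fst (snd x) > 0 \<and> snd (snd x) \<noteq> 0)"

text \<open>Reversed order and inverted inhomogeneities give the returning monodromy the same form,
  so the statements about \<open>TT\<close> serve both rows.\<close>

definition inv_sites :: "(nat \<times> nat \<times> complex) list \<Rightarrow> (nat \<times> nat \<times> complex) list" where
  "inv_sites L = rev (map (\<lambda>x. (fst x, fst (snd x), inverse (snd (snd x)))) L)"

lemma site_legs_simps: "site_legs [] = {}" "site_legs (x # L) = insert (fst x) (site_legs L)" "site_legs (inv_sites L) = site_legs L"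
  by (simp_all add: site_legs_def inv_sites_def image_image)

lemma sites_ok_Cons: "sites_ok (x # L) \<longleftrightarrow> sites_ok L \<and> fst x \<notin> site_legs L \<and> fst (snd x) > 0 \<and> snd (snd x) \<noteq> 0"
  by (auto simp: sites_ok_def site_legs_def)

lemma sites_ok_inv: "sites_ok L \<Longrightarrow> sites_ok (inv_sites L)"
  by (auto simp: sites_ok_def inv_sites_def comp_def rev_map[symmetric])

lemma TT_append: "TT (xs @ ys) d z p = TT xs d z p * TT ys d z p"
  by (induction xs) (simp_all add: mx_assoc)

lemma on_legs_TT: "insert p (site_legs L) \<subseteq> P \<Longrightarrow> on_legs P (TT L d z p)"
  by (induction L) (auto simp: site_legs_simps on_legs_one intro!: on_legs_mult on_legs_two_legs(8))

lemma TT_fus: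
  assumes d: "d > 0" and z: "z \<noteq> 0" and n: "p \<noteq> q"
  shows "sites_ok L \<Longrightarrow> p \<notin> site_legs L \<Longrightarrow> q \<notin> site_legs L \<Longrightarrow>
    TT L 1 (z * H (1 - int d)) p * TT L (d - 1) (z * h) q * EE d p q = EE d p q * TT L d z q"
proof (induction L)
  case (Cons x L)
  obtain t a w where x: "x = (t, a, w)" by (cases x)
  have o: "sites_ok L" "t \<notin> site_legs L" "a > 0" "w \<noteq> 0" "p \<notin> site_legs L" "q \<notin> site_legs L" "distinct [t, p, q]"
    using Cons.prems n by (auto simp: sites_ok_Cons site_legs_simps x)
  let ?y = "z * H (1 - int d)" and ?y' = "z * h"
  have c: "TT L 1 ?y p * S a (d - 1) (?y' * w) t q = S a (d - 1) (?y' * w) t q * TT L 1 ?y p"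
    by (rule commute[where P = "insert p (site_legs L)" and Q = "{t, q}"]; use o in \<open>auto intro!: on_legs_TT on_legs_two_legs\<close>)
  have e: "z * w * H (1 - int d) = ?y * w" "z * w * h = ?y' * w" by simp_all
  have s: "S a 1 (?y * w) t p * S a (d - 1) (?y' * w) t q * EE d p q = EE d p q * S a d (z * w) t q"
    using site_relationsD(3)[OF site_relations[OF o(3)] d _ o(7), of "z * w"] z o unfolding e by simp
  have "TT (x # L) 1 ?y p * TT (x # L) (d - 1) ?y' q * EE d p q
    = S a 1 (?y * w) t p * S a (d - 1) (?y' * w) t q * (TT L 1 ?y p * TT L (d - 1) ?y' q * EE d p q)"
    by (simp only: TT.simps x fst_conv snd_conv mx_assoc assoc_swap[OF c])
  also have "\<dots> = (S a 1 (?y * w) t p * S a (d - 1) (?y' * w) t q * EE d p q) * TT L d z q"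
    unfolding Cons.IH[OF o(1,5,6)] by (simp only: mx_assoc)
  also have "\<dots> = EE d p q * TT (x # L) d z q" unfolding s by (simp only: TT.simps x fst_conv snd_conv mx_assoc)
  finally show ?case .
qed simp

lemma TT_det:
  assumes d: "d > 1" and z: "z \<noteq> 0" and n: "p \<noteq> q"
  shows "sites_ok L \<Longrightarrow> p \<notin> site_legs L \<Longrightarrow> q \<notin> site_legs L \<Longrightarrow>
    Dt d p q * TT L 1 (z * H (1 - int d)) p * TT L (d - 1) (z * h) q = scal (site_del L (z * H (1 - int d))) (TT L (d - 2) (z * h * h) q * Dt d p q)"
proof (induction L)
  case (Cons x L)
  obtain t a w where x: "x = (t, a, w)" by (cases x)
  have o: "sites_ok L" "t \<notin> site_legs L" "a > 0" "w \<noteq> 0" "p \<notin> site_legs L" "q \<notin> site_legs L" "distinct [t, p, q]"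
    using Cons.prems n by (auto simp: sites_ok_Cons site_legs_simps x)
  let ?y = "z * H (1 - int d)" and ?y' = "z * h" and ?D = "Dt d p q"
  have c: "TT L 1 ?y p * S a (d - 1) (?y' * w) t q = S a (d - 1) (?y' * w) t q * TT L 1 ?y p"
    by (rule commute[where P = "insert p (site_legs L)" and Q = "{t, q}"]; use o in \<open>auto intro!: on_legs_TT on_legs_two_legs\<close>)
  have e: "z * w * H (1 - int d) = ?y * w" "z * w * h = ?y' * w" "?y' * w * h = z * h * h * w" by simp_all
  have s: "?D * S a 1 (?y * w) t p * S a (d - 1) (?y' * w) t q = scal (del a (?y * w)) (S a (d - 2) (z * h * h * w) t q * ?D)"
    using site_relationsD(4)[OF site_relations[OF o(3)] d _ o(7), of "z * w"] z o unfolding e by simp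
  have "?D * TT (x # L) 1 ?y p * TT (x # L) (d - 1) ?y' q
    = ?D * S a 1 (?y * w) t p * S a (d - 1) (?y' * w) t q * (TT L 1 ?y p * TT L (d - 1) ?y' q)"
    by (simp only: TT.simps x fst_conv snd_conv mx_assoc assoc_swap[OF c])
  also have "\<dots> = scal (del a (?y * w)) (S a (d - 2) (z * h * h * w) t q * (?D * TT L 1 ?y p * TT L (d - 1) ?y' q))"
    unfolding s by (simp only: mx_assoc scal_mult_left)
  also have "\<dots> = scal (site_del (x # L) ?y) (TT (x # L) (d - 2) (z * h * h) q * ?D)" unfolding Cons.IH[OF o(1,5,6)]
    by (simp only: TT.simps site_del.simps x fst_conv snd_conv mx_assoc scal_mult_right scal_scal)
  finally show ?case .
qed simp

text \<open>An inhomogeneity enters one row directly and the other inverted, so the parameters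
  multiply to \<open>x * y\<close> at every site and one R serves the whole chain. The reversed
  order makes the head of the list the innermost pair.\<close>

lemma TT_exch:
  assumes d: "d > 0" and z: "x \<noteq> 0" "y \<noteq> 0" and n: "p \<noteq> q"
  shows "sites_ok L \<Longrightarrow> p \<notin> site_legs L \<Longrightarrow> q \<notin> site_legs L \<Longrightarrow>
    TT (inv_sites L) 1 x p * R1 d (x * y) p q * TT L d y q = TT L d y q * R1 d (x * y) p q * TT (inv_sites L) 1 x p"
proof (induction L)
  case Nil
  then show ?case by (simp add: inv_sites_def)
next
  case (Cons s L)
  obtain t a w where s: "s = (t, a, w)" by (cases s)
  have o: "sites_ok L" "t \<notin> site_legs L" "a > 0" "w \<noteq> 0" "p \<notin> site_legs L" "q \<notin> site_legs L" "distinct [t, p, q]"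
    using Cons.prems n by (auto simp: sites_ok_Cons site_legs_simps s)
  let ?P = "TT (inv_sites L) 1 x p" and ?Q = "TT L d y q" and ?R = "R1 d (x * y) p q" and ?p = "S a 1 (x * inverse w) t p" and ?q = "S a d (y * w) t q"
  have i: "TT (inv_sites (s # L)) 1 x p = ?P * ?p" by (simp add: inv_sites_def s TT_append)
  have e: "x * inverse w * (y * w) = x * y" using o by simp
  have r: "?p * ?R * ?q = ?q * ?R * ?p" using site_relationsD(5)[OF site_relations[OF o(3)] d _ _ o(7), of "x * inverse w" "y * w"] z o unfolding e by simp
  have c: "?P * ?q = ?q * ?P" "?Q * ?p = ?p * ?Q"
    by (rule commute[where P = "insert p (site_legs L)" and Q = "{t, q}"] commute[where P = "insert q (site_legs L)" and Q = "{t, p}"];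
        use o in \<open>auto intro!: on_legs_TT on_legs_two_legs simp: site_legs_simps\<close>)+
  have "TT (inv_sites (s # L)) 1 x p * ?R * TT (s # L) d y q = ?P * (?p * ?R * ?q) * ?Q"
    unfolding i by (simp add: s mx_assoc)
  also have "\<dots> = ?q * (?P * ?R * ?Q) * ?p" unfolding r by (simp only: mx_assoc assoc_swap[OF c(1)] c(2))
  also have "\<dots> = TT (s # L) d y q * ?R * TT (inv_sites (s # L)) 1 x p" unfolding Cons.IH[OF o(1,5,6)] i by (simp add: s mx_assoc)
  finally show ?case .
qed

definition UU :: "boundary \<Rightarrow> (nat \<times> nat \<times> complex) list \<Rightarrow> nat \<Rightarrow> complex \<Rightarrow> nat \<Rightarrow> mx" where
  "UU bd L d u q = TT L d u q * KK bd d u q * TT (inv_sites L) d u q"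

lemma on_legs_UU: "insert p (site_legs L) \<subseteq> P \<Longrightarrow> on_legs P (UU bd L d z p)"
  unfolding UU_def by (auto intro!: on_legs_mult on_legs_TT on_legs_one_leg simp: site_legs_simps)

text \<open>The exchange of the two inner rows through R brings \<open>M\<close> into the form T T
  (K R K) T T. Fusion or determinant relations can then be applied to the three groups in
  succession, and the determinants multiply.\<close>

lemma UU_fus_det:
  fixes bd :: boundary
  assumes d: "d > 0" and u: "u \<noteq> 0" and n: "p \<noteq> q" and L: "sites_ok L" "p \<notin> site_legs L" "q \<notin> site_legs L"
  defines "M \<equiv> UU bd L 1 (u * H (1 - int d)) p * R1 (d - 1) (u\<^sup>2 * H (2 - int d)) p q * UU bd L (d - 1) (u * h) q"
  shows "d > 1 \<Longrightarrow> M * EE d p q = EE d p q * UU bd L d u q"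
   "d > 1 \<Longrightarrow> Dt d p q * M = scal (site_del L (u * H (1 - int d)) * site_del (inv_sites L) (u * H (1 - int d)) * (Gamma_minus h bd (u * H (1 - int d)) * del (d - 2) (u\<^sup>2 * H (3 - int d))))
      (UU bd L (d - 2) (u * h * h) q * Dt d p q)"
proof -
  let ?u = "u * H (1 - int d)" and ?u' = "u * h" and ?R = "R1 (d - 1) (u\<^sup>2 * H (2 - int d)) p q"
  let ?Tp = "TT L 1 ?u p" and ?Tq = "TT L (d - 1) ?u' q" and ?Sp = "TT (inv_sites L) 1 ?u p" and ?Sq = "TT (inv_sites L) (d - 1) ?u' q"
  let ?Kp = "KK bd 1 ?u p" and ?Kq = "KK bd (d - 1) ?u' q" and ?D = "Dt d p q"
  note L' = sites_ok_inv[OF L(1)] L(2,3)[folded site_legs_simps(3)[of L]]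
  have e: "?u * ?u' = u\<^sup>2 * H (2 - int d)" unfolding xH by (rule mult_H_cong) simp
  have z: "?u \<noteq> 0" "?u' \<noteq> 0" using u by auto
  assume d1: "d > 1"
  then have dd: "d - 1 > 0" by simp
  have x: "?Sp * ?R * ?Tq = ?Tq * ?R * ?Sp" using TT_exch[OF dd z n L] unfolding e .
  have c: "?Sp * ?Kq = ?Kq * ?Sp" "?Kp * ?Tq = ?Tq * ?Kp"
    by (rule commute[where P = "insert p (site_legs L)" and Q = "{q}"] commute[where Q = "insert q (site_legs L)" and P = "{p}"];
        use L n in \<open>auto intro!: on_legs_TT on_legs_one_leg simp: site_legs_simps\<close>)+
  have "M = ?Tp * ?Kp * (?Sp * ?R * ?Tq) * ?Kq * ?Sq" unfolding M_def UU_def by (simp only: mx_assoc)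
  also have "\<dots> = ?Tp * ?Tq * (?Kp * ?R * ?Kq) * ?Sp * ?Sq" unfolding x by (simp only: mx_assoc assoc_swap[OF c(1)] assoc_swap[OF c(2)])
  finally have M: "M = ?Tp * ?Tq * (?Kp * ?R * ?Kq) * ?Sp * ?Sq" .
  have "M * EE d p q = ?Tp * ?Tq * ((?Kp * ?R * ?Kq) * (?Sp * ?Sq * EE d p q))" unfolding M by (simp only: mx_assoc)
  also have "\<dots> = ?Tp * ?Tq * (?Kp * ?R * ?Kq * EE d p q) * TT (inv_sites L) d u q" unfolding TT_fus[OF d u n L'] by (simp only: mx_assoc)
  also have "\<dots> = (?Tp * ?Tq * EE d p q) * KK bd d u q * TT (inv_sites L) d u q" unfolding K_fusion[OF d u n] by (simp only: mx_assoc)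
  also have "\<dots> = EE d p q * UU bd L d u q" unfolding TT_fus[OF d u n L] UU_def by (simp only: mx_assoc)
  finally show "M * EE d p q = EE d p q * UU bd L d u q" .
  let ?g = "Gamma_minus h bd ?u * del (d - 2) (u\<^sup>2 * H (3 - int d))"
  have "?D * M = (?D * ?Tp * ?Tq) * (?Kp * ?R * ?Kq) * ?Sp * ?Sq" unfolding M by (simp only: mx_assoc)
  also have "\<dots> = scal (site_del L ?u) (TT L (d - 2) (u * h * h) q * (?D * ?Kp * ?R * ?Kq) * ?Sp * ?Sq)" unfolding TT_det[OF d1 u n L] by (simp only: mx_assoc scal_mult_left)
  also have "\<dots> = scal (site_del L ?u) (scal ?g (TT L (d - 2) (u * h * h) q * KK bd (d - 2) (u * h * h) q * (?D * ?Sp * ?Sq)))" unfolding Dt_K[OF d1 u n]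
    by (simp only: mx_assoc scal_mult_left scal_mult_right)
  also have "\<dots> = scal (site_del L ?u * ?g * site_del (inv_sites L) ?u) (UU bd L (d - 2) (u * h * h) q * ?D)" unfolding TT_det[OF d1 u n L'] UU_def
    by (simp only: mx_assoc scal_mult_left scal_mult_right scal_scal mult.assoc)
  finally show "?D * M = scal (site_del L ?u * site_del (inv_sites L) ?u * ?g) (UU bd L (d - 2) (u * h * h) q * ?D)" by (simp only: mult_ac)
qed

text \<open>The transfer matrix before division by f and with the projection |0><0| on the auxiliary
  leg. Here \<open>bd'\<close> stands for the parameters after the substitution in the dual
  K-matrix, that is, for \<open>dual_bd\<close>.\<close>

definition tau :: "boundary \<Rightarrow> boundary \<Rightarrow> (nat \<times> nat \<times> complex) list \<Rightarrow> nat \<Rightarrow> complex \<Rightarrow> nat \<Rightarrow> mx" where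
  "tau bd' bd L d u q = ptr q (d + 1) (trn (KK bd' d (inverse u * inverse (h\<^sup>2)) q) * UU bd L d u q)"

text \<open>The scalar in crossing unitarity of R.\<close>

definition rho :: "nat \<Rightarrow> complex \<Rightarrow> complex" where
  "rho d z = pre d z * pre d (inverse z * H (- 4)) * cz z (1 - int d) * cz (inverse z * H (- 4)) (1 - int d)"

lemma bra_ket_restr:
  assumes "ent (bra p i * X * ket p j) s t \<noteq> 0" shows "s p = 0 \<and> t p = 0"
proof -
  have 1: "PR 1 p * (bra p i * X * ket p j) = bra p i * X * ket p j" by (simp only: mx_assoc assoc_collapse[OF ket_absorb(2)])
  have 2: "bra p i * X * ket p j * PR 1 p = bra p i * X * ket p j" by (simp only: mx_assoc ket_absorb(3))
  show ?thesis using PR1_restr(1)[OF 1 assms] PR1_restr(2)[OF 2 assms] by simp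
qed

text \<open>Expanded in the leg \<open>p\<close>, the matrix elements of \<open>C\<close> commute
  with those of R, because they do not touch \<open>q\<close>. The two R-matrices then meet in the
  crossing combination.\<close>

lemma ptr_crossing:
  assumes d: "d > 0" and z: "z \<noteq> 0" and n: "p \<noteq> q" and C: "on_legs (insert p P) C" "q \<notin> P"
  shows "ptr p 2 (R1 d (inverse z * H (- 4)) p q * C * R1 d z p q) = scal (rho d z) (ptr p 2 C * PR (d + 1) q)"
proof -
  let ?R' = "R1 d (inverse z * H (- 4)) p q" and ?R = "R1 d z p q"
  have sw: "(bra p j * C * ket p k) * (bra p k * ?R * ket p i) = (bra p k * ?R * ket p i) * (bra p j * C * ket p k)" for i j k
    by (rule commute_restr[where P = "insert p P" and Q = "{p, q}"])
      (use C in \<open>auto intro!: on_legs_mult on_legs_ket_bra_mono on_legs_two_legs dest: bra_ket_restr\<close>)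
  have P1: "(bra p j * C * ket p k) * PR 1 p = bra p j * C * ket p k" for j k by (simp only: mx_assoc ket_absorb(3))
  have "ptr p 2 (?R' * C * ?R) = (\<Sum>i<2. bra p i * (?R' * PR 2 p) * C * (PR 2 p * ?R) * ket p i)"
    unfolding ptr_def PR_absorb(1,3)[OF n] by (simp only: mx_assoc)
  also have "\<dots> = (\<Sum>i<2. \<Sum>j<2. \<Sum>k<2. (bra p i * ?R' * ket p j) * ((bra p j * C * ket p k) * (bra p k * ?R * ket p i)))"
    unfolding sum_ket_bra[symmetric] by (simp only: sum_distrib_left sum_distrib_right mx_assoc) (subst sum.swap, rule refl)
  also have "\<dots> = (\<Sum>j<2. \<Sum>k<2. (\<Sum>i<2. (bra p i * ?R' * ket p j) * (bra p k * ?R * ket p i)) * (bra p j * C * ket p k))"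
    unfolding sw by (subst sum.swap, rule sum.cong[OF refl], subst sum.swap) (simp only: sum_distrib_right mx_assoc)
  also have "\<dots> = (\<Sum>j<2. \<Sum>k<2. (if j = k then scal (rho d z) (PR 1 p * PR (d + 1) q) else 0) * (bra p j * C * ket p k))"
    by (intro sum.cong refl) (simp add: R1_crossing[OF d z n] rho_def)
  also have "\<dots> = (\<Sum>j<2. scal (rho d z) (PR 1 p * PR (d + 1) q) * (bra p j * C * ket p j))"
    by (intro sum.cong refl) (simp add: if_distrib[of "\<lambda>x. x * _"] cong: if_cong)
  also have "\<dots> = (\<Sum>j<2. scal (rho d z) (bra p j * C * ket p j * PR (d + 1) q))"
  proof (intro sum.cong refl)
    fix j
    have c: "PR (d + 1) q * (bra p j * C * ket p j) = bra p j * C * ket p j * PR (d + 1) q"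
      by (rule commute[where P = "{q}" and Q = "insert p P"]) (use C n in \<open>auto intro!: on_legs_mult on_legs_ket_bra_mono on_legs_one_leg\<close>)
    have "PR 1 p * (bra p j * C * ket p j) = bra p j * C * ket p j" by (simp only: mx_assoc assoc_collapse[OF ket_absorb(2)])
    then have "PR 1 p * (PR (d + 1) q * (bra p j * C * ket p j)) = bra p j * C * ket p j * PR (d + 1) q"
      unfolding c by (simp only: mx_assoc assoc_collapse[OF ket_absorb(2)])
    then show "scal (rho d z) (PR 1 p * PR (d + 1) q) * (bra p j * C * ket p j) = scal (rho d z) (bra p j * C * ket p j * PR (d + 1) q)"
      by (simp only: mx_assoc scal_mult_left)
  qed
  finally show ?thesis unfolding ptr_def sum_distrib_right scal_sum .
qed

text \<open>\<open>N\<close> is assembled from transposes in reversed order, so that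
  \<open>EE\<close> and \<open>Dt\<close> pass through it in the same direction as through
  \<open>M\<close>. This is what makes the trace of \<open>N * M\<close> split along the two
  spins.\<close>

lemma tau_rec:
  assumes d: "d > 1" and u: "u \<noteq> 0" and n: "p \<noteq> q" and L: "sites_ok L" "p \<notin> site_legs L" "q \<notin> site_legs L"
  defines "x \<equiv> inverse u * inverse (h\<^sup>2)"
  shows "scal (rho (d - 1) (u\<^sup>2 * H (2 - int d))) (tau bd' bd L 1 (u * H (1 - int d)) p * tau bd' bd L (d - 1) (u * h) q)
   = PR 1 p * tau bd' bd L d u q +
     scal (site_del L (u * H (1 - int d)) * site_del (inv_sites L) (u * H (1 - int d)) * (Gamma_minus h bd (u * H (1 - int d)) * del (d - 2) (u\<^sup>2 * H (3 - int d)))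
       * (Gamma_minus h bd' (x * H (int d - 3)) * del (d - 2) (x\<^sup>2 * H (int d - 5)))) (PR 1 p * tau bd' bd L (d - 2) (u * h * h) q)"
proof -
  have d0: "d > 0" "d - 1 > 0" "d - 1 + 1 = d" "d - 2 + 1 = d - 1" using d by auto
  have x: "x \<noteq> 0" using u by (simp add: x_def)
  let ?z = "u\<^sup>2 * H (2 - int d)" and ?u = "u * H (1 - int d)" and ?u' = "u * h"
  have z: "?z \<noteq> 0" using u by simp
  \<comment> \<open>The first equation says that the parameter of R in \<open>N\<close> is the
    crossing partner of the parameter of R in \<open>M\<close>.\<close>
  have e: "x\<^sup>2 * H (int d - 2) = inverse ?z * H (- 4)" "inverse ?u * inverse (h\<^sup>2) = x * H (int d - 1)" "inverse ?u' * inverse (h\<^sup>2) = x * inverse h"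
    "inverse (u * h * h) * inverse (h\<^sup>2) = x * inverse h * inverse h"
  proof -
    have "x\<^sup>2 = inverse (u\<^sup>2) * H (- 4)" by (simp add: x_def power_mult_distrib power_inverse power_int_minus power2_eq_square[of "h\<^sup>2"] power_add[symmetric] power2_eq_square[of "inverse _"])
    then show "x\<^sup>2 * H (int d - 2) = inverse ?z * H (- 4)" using inverse_H[of "2 - int d"] by simp
    show "inverse ?u * inverse (h\<^sup>2) = x * H (int d - 1)" using inverse_H[of "1 - int d"] by (simp add: x_def)
  qed (simp_all add: x_def)
  let ?Aq = "trn (KK bd' (d - 1) (x * inverse h) q)" and ?Ap = "trn (KK bd' 1 (x * H (int d - 1)) p)" and ?R' = "R1 (d - 1) (x\<^sup>2 * H (int d - 2)) p q" and ?R = "R1 (d - 1) ?z p q"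
  let ?Up = "UU bd L 1 ?u p" and ?Uq = "UU bd L (d - 1) ?u' q"
  let ?g' = "Gamma_minus h bd' (x * H (int d - 3)) * del (d - 2) (x\<^sup>2 * H (int d - 5))"
  let ?g = "site_del L ?u * site_del (inv_sites L) ?u * (Gamma_minus h bd ?u * del (d - 2) (u\<^sup>2 * H (3 - int d)))"
  define N where "N = ?Aq * ?R' * ?Ap"
  define M where "M = ?Up * ?R * ?Uq"
  let ?E = "EE d p q" and ?D = "Dt d p q"
  have ME: "M * ?E = ?E * UU bd L d u q" and DM: "?D * M = scal ?g (UU bd L (d - 2) (u * h * h) q * ?D)"
    unfolding M_def using UU_fus_det[OF d0(1) u n L, of bd] d by auto
  have NE: "N * ?E = ?E * trn (KK bd' d x q)"
    using arg_cong[OF K_fusion_rev_trn[OF d0(1) x n, of bd'], of trn] unfolding N_def by (simp add: trn_R1[OF n] mx_assoc)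
  have DN: "?D * N = scal ?g' (trn (KK bd' (d - 2) (x * inverse h * inverse h) q) * ?D)"
    using arg_cong[OF K_trn_Dt[OF d x n, of bd'], of trn] unfolding N_def by (simp add: trn_R1[OF n] mx_assoc)
  let ?Z = "trn (KK bd' d x q) * UU bd L d u q" and ?Y = "trn (KK bd' (d - 2) (x * inverse h * inverse h) q) * UU bd L (d - 2) (u * h * h) q"
  have lgs: "on_legs (insert q (site_legs L)) ?Z" "on_legs (insert q (site_legs L)) ?Y" by (auto intro!: on_legs_mult on_legs_one_leg on_legs_UU)
  have pin: "p \<notin> insert q (site_legs L)" using n L by auto
  have NME: "N * M * ?E = ?E * ?Z" by (simp only: mx_assoc ME assoc_swap[OF NE])
  have DNM: "?D * (N * M) = scal (?g * ?g') (?Y * ?D)"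
    unfolding mx_assoc[symmetric] DN by (simp only: mx_assoc scal_mult_left scal_mult_right DM scal_scal mult.commute[of ?g'])
  \<comment> \<open>Cyclicity moves \<open>EE\<close> behind \<open>FF\<close>, and
    \<open>FF * EE\<close> is the identity of the fused space.\<close>
  have t1: "tr2 p q 2 d (?E * (?Z * FF d p q)) = PR 1 p * tau bd' bd L d u q"
  proof -
    have "tr2 p q 2 d (?E * (?Z * FF d p q)) = tr2 p q 1 (d + 1) (?Z * FF d p q * ?E)"
      by (rule tr2_cyc[OF n]) (use PR_absorb(5-8)[OF n, of d] in \<open>simp_all add: on_legs_basic mx_assoc assoc_collapse[of _ "PR 1 p" ] mx_assoc[symmetric, of ?E]\<close>)
    also have "\<dots> = tr2 p q 1 (d + 1) (?Z * (PR 1 p * PR (d + 1) q))" by (simp only: mx_assoc FF_EE[OF d0(1) n])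
    also have "\<dots> = tr2 p q 1 (d + 1) ?Z" by (rule tr2_restrict[OF n, symmetric])
    also have "\<dots> = PR 1 p * tau bd' bd L d u q" unfolding tau_def x_def by (rule tr2_1[OF lgs(1)[unfolded x_def] pin n])
    finally show ?thesis .
  qed
  have t2: "tr2 p q 2 d (N * M * Dp d p q * ?D) = scal (?g * ?g') (PR 1 p * tau bd' bd L (d - 2) (u * h * h) q)"
  proof -
    have "tr2 p q 2 d (N * M * Dp d p q * ?D) = tr2 p q 1 (d - 1) (?D * (N * M * Dp d p q))"
      by (rule tr2_cyc[OF n, symmetric]) (use PR_absorb(15-18)[OF n, of d] in \<open>simp_all add: on_legs_basic mx_assoc mx_assoc[symmetric, of ?D]\<close>)
    also have "?D * (N * M * Dp d p q) = ?D * (N * M) * Dp d p q" by (simp only: mx_assoc)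
    also have "\<dots> = scal (?g * ?g') (?Y * (PR 1 p * PR (d - 1) q))" unfolding DNM by (simp only: mx_assoc scal_mult_left Dt_Dp[OF d n])
    also have "tr2 p q 1 (d - 1) \<dots> = scal (?g * ?g') (tr2 p q 1 (d - 1) ?Y)" unfolding tr2_scal using tr2_restrict[OF n, of 1 "d - 1" ?Y] by simp
    also have "\<dots> = scal (?g * ?g') (PR 1 p * tau bd' bd L (d - 2) (u * h * h) q)" unfolding tau_def e d0 tr2_1[OF lgs(2) pin n] by (rule refl)
    finally show ?thesis .
  qed
  have "tr2 p q 2 d (N * M) = tr2 p q 2 d (N * M * (EE d p q * FF d p q + Dp d p q * ?D))"
    unfolding resolution[OF d n] by (rule tr2_restrict[OF n])
  also have "\<dots> = tr2 p q 2 d (N * M * ?E * FF d p q) + tr2 p q 2 d (N * M * Dp d p q * ?D)" by (simp only: distrib_left tr2_add mx_assoc)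
  also have "\<dots> = PR 1 p * tau bd' bd L d u q + scal (?g * ?g') (PR 1 p * tau bd' bd L (d - 2) (u * h * h) q)"
    unfolding NME t2 using t1 by (simp only: mx_assoc)
  finally have rhs: "tr2 p q 2 d (N * M) = PR 1 p * tau bd' bd L d u q + scal (?g * ?g') (PR 1 p * tau bd' bd L (d - 2) (u * h * h) q)" .
  let ?C = "?Ap * ?Up"
  have lC: "on_legs (insert p (site_legs L)) ?C" by (auto intro!: on_legs_mult on_legs_one_leg on_legs_UU)
  \<comment> \<open>Tracing over \<open>p\<close> before \<open>q\<close> makes both R-matrices
    disappear; what remains on \<open>p\<close> is the spin 1/2 transfer matrix.\<close>
  have cr: "ptr p 2 (?R' * ?C * ?R) = scal (rho (d - 1) ?z) (ptr p 2 ?C * PR d q)"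
    unfolding e using ptr_crossing[OF d0(2) z n lC L(3)] unfolding d0 e .
  have cA: "bra p i * ?Aq = ?Aq * bra p i" "?Uq * ket p i = ket p i * ?Uq" for i
    by (rule commute[where P = "{p}" and Q = "{q}"] commute[where Q = "{p}" and P = "insert q (site_legs L)"];
        use n L in \<open>auto intro!: on_legs_ket_bra_mono on_legs_one_leg on_legs_UU\<close>)+
  have "ptr p 2 (N * M) = ?Aq * ptr p 2 (?R' * ?C * ?R) * ?Uq"
    unfolding ptr_def N_def M_def by (simp only: mx_assoc assoc_swap[OF cA(1)] cA(2) sum_distrib_left sum_distrib_right)
  also have "\<dots> = scal (rho (d - 1) ?z) (?Aq * ptr p 2 ?C * PR d q * ?Uq)" unfolding cr by (simp only: mx_assoc scal_mult_left scal_mult_right)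
  finally have pt: "ptr p 2 (N * M) = scal (rho (d - 1) ?z) (?Aq * ptr p 2 ?C * PR d q * ?Uq)" .
  have lP: "on_legs (insert p (site_legs L)) (ptr p 2 ?C)" unfolding ptr_def by (intro on_legs_sum on_legs_mult lC on_legs_ket_bra_mono) auto
  have cB: "bra q j * ptr p 2 ?C = ptr p 2 ?C * bra q j" "?Aq * ptr p 2 ?C = ptr p 2 ?C * ?Aq" for j
    by (rule commute[where P = "{q}" and Q = "insert p (site_legs L)"]; use n L lP in \<open>auto intro!: on_legs_ket_bra_mono on_legs_one_leg\<close>)+
  have AP: "?Aq * PR d q = ?Aq"
    using arg_cong[OF PR_absorb(13)[OF n, of "d - 1" bd' "x * inverse h"], of trn] unfolding d0 by (simp add: trn_PR)
  have p2: "ptr p 2 ?C = tau bd' bd L 1 ?u p" unfolding tau_def e by (simp add: One_nat_def numeral_2_eq_2)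
  have "tr2 p q 2 d (N * M) = scal (rho (d - 1) ?z) (\<Sum>j<d. bra q j * (?Aq * ptr p 2 ?C * PR d q * ?Uq) * ket q j)"
    unfolding tr2_ptr[OF n] pt by (simp only: scal_mult_left scal_mult_right scal_sum)
  \<comment> \<open>The spin 1/2 trace commutes with the dual K-matrix on \<open>q\<close>, so it
    leaves the trace over \<open>q\<close> on the left; the double-row operator \<open>?Uq\<close>
    shares the sites with it.\<close>
  also have "(\<Sum>j<d. bra q j * (?Aq * ptr p 2 ?C * PR d q * ?Uq) * ket q j) = ptr p 2 ?C * ptr q d (?Aq * ?Uq)"
    unfolding ptr_def[of q] cB(2) sum_distrib_left by (simp only: mx_assoc assoc_swap[OF cB(1)] assoc_collapse[OF AP])
  also have "ptr q d (?Aq * ?Uq) = tau bd' bd L (d - 1) ?u' q" unfolding tau_def e d0 by (rule refl)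
  finally show ?thesis unfolding rhs p2 by (rule sym)
qed

section \<open>Scalar factors\<close>

lemma qc_inverse: "qc (inverse z) = - qc z"
  by (simp add: qc_def)

lemma cz_inv: "cz (inverse z * H a) e = - cz z (- a - e)"
proof -
  have "inverse z * H a * H e = inverse (z * H (- a - e))" using inverse_H[of "- a - e"] unfolding mult_H_assoc by (simp add: add.commute)
  then show ?thesis unfolding cz_def by (simp only: qc_inverse)
qed

text \<open>c(y^2 q^m), the form in which all scalars of the auxiliary space are written.\<close>

definition gg :: "complex \<Rightarrow> int \<Rightarrow> complex" where "gg y m = cz (y\<^sup>2) (2 * m)"

lemma gg_shift: "gg (y * h\<^sup>2) m = gg y (m + 2)"
proof -
  have "(y * h\<^sup>2)\<^sup>2 = y\<^sup>2 * H 4" by (simp add: power_mult_distrib)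
  then show ?thesis unfolding gg_def by (simp only: cz_H) (rule arg_cong[of _ _ "cz _"], simp)
qed

text \<open>The normalisation f for spin (n+1)/2 at u = y q^(n/2): with y as variable the exponents
  no longer depend on the spin.\<close>

definition Fp :: "nat \<Rightarrow> complex \<Rightarrow> complex" where
  "Fp n y = (\<Prod>k<n. \<Prod>l<Suc k. - (gg y (int k + int l + 3) * gg y (int k + int l + 1)))"

text \<open>The factors with l = 0 are split off. By \<open>rho_eq\<close> they form the crossing
  scalar, which explains why f is the right normalisation of the dual K-matrices.\<close>

lemma Fp_rec: "Fp (Suc n) y = (\<Prod>k<Suc n. - (gg y (int k + 3) * gg y (int k + 1))) * Fp n (y * h\<^sup>2)"
proof -
  let ?t = "\<lambda>k l. - (gg y (int k + int l + 3) * gg y (int k + int l + 1))"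
  have "Fp (Suc n) y = (\<Prod>k<Suc n. ?t k 0 * (\<Prod>l<k. ?t k (Suc l)))"
    unfolding Fp_def by (simp only: prod.lessThan_Suc_shift comp_def)
  also have "\<dots> = (\<Prod>k<Suc n. ?t k 0) * (\<Prod>k<Suc n. \<Prod>l<k. ?t k (Suc l))" by (rule prod.distrib)
  also have "(\<Prod>k<Suc n. \<Prod>l<k. ?t k (Suc l)) = (\<Prod>k<n. \<Prod>l<Suc k. ?t (Suc k) (Suc l))"
    by (subst prod.lessThan_Suc_shift) (simp add: comp_def del: prod.lessThan_Suc)
  also have "\<dots> = Fp n (y * h\<^sup>2)" unfolding Fp_def gg_shift
    by (intro prod.cong refl) (simp add: algebra_simps)
  finally show ?thesis by simp
qed

text \<open>The expansion from the left shifts y, the one from the right keeps it; the nonvanishing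
  of f descends in both directions and excludes the two poles as well.\<close>

lemma Fp_neq_0:
  assumes "Fp (Suc n) y \<noteq> 0"
  shows "Fp n y \<noteq> 0" "Fp n (y * h\<^sup>2) \<noteq> 0" "gg y 1 \<noteq> 0" "gg y 3 \<noteq> 0"
proof -
  show "Fp n y \<noteq> 0" using assms by (simp add: Fp_def)
  have "(\<Prod>k<Suc n. - (gg y (int k + 3) * gg y (int k + 1))) \<noteq> 0" and *: "Fp n (y * h\<^sup>2) \<noteq> 0" using assms unfolding Fp_rec by auto
  then have "\<And>k. k < Suc n \<Longrightarrow> - (gg y (int k + 3) * gg y (int k + 1)) \<noteq> 0" by (simp only: prod_zero_iff finite_lessThan) blast
  from this[of 0] show "gg y 1 \<noteq> 0" "gg y 3 \<noteq> 0" by auto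
  show "Fp n (y * h\<^sup>2) \<noteq> 0" by (rule *)
qed

lemma q_powi_H: "(h\<^sup>2) powi m = H (2 * m)"
  using power_int_mult[of h 2 m] by simp

lemma f_norm_Fp:
  assumes y: "y \<noteq> 0"
  shows "f_norm h (Suc n) (y * H (int n)) = Fp n y"
proof -
  have p: "(y * H (int n))\<^sup>2 = y\<^sup>2 * H (2 * int n)" using H_mult[of "int n" "int n"] by (simp add: power_mult_distrib power2_eq_square)
  have 1: "qc ((y * H (int n))\<^sup>2 * (h\<^sup>2) powi (int (Suc k) + int (Suc l) + 2 - int (Suc n))) = gg y (int k + int l + 3)" for k l
    unfolding p q_powi_H gg_def cz_def mult_H_assoc by (rule arg_cong[of _ _ qc], rule mult_H_cong) simp
  have 2: "qc ((y * H (int n)) powi (- 2) * (h\<^sup>2) powi (- int (Suc k) - int (Suc l) + int (Suc n))) = - gg y (int k + int l + 1)" for k l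
  proof -
    have "(y * H (int n)) powi (- 2) * (h\<^sup>2) powi (- int (Suc k) - int (Suc l) + int (Suc n))
      = inverse (y\<^sup>2 * H (2 * int n) * H (2 * (int k + int l + 1 - int n)))"
      unfolding q_powi_H using inverse_H[of "2 * (int k + int l + 1 - int n)"] p
      by (simp add: power_int_minus algebra_simps)
    then show ?thesis unfolding gg_def cz_def mult_H_assoc qc_inverse
      by (simp only: qc_inverse) (rule arg_cong[of _ _ "\<lambda>x. - qc x"], rule mult_H_cong, simp)
  qed
  show ?thesis unfolding f_norm_def Fp_def diff_Suc_1 One_nat_def prod.atLeast1_atMost_eq 1 2 by simp
qed

lemma rho_eq:
  assumes y: "y \<noteq> 0" and n: "n > 0"
  shows "rho n (y\<^sup>2 * H (int n + 1)) = (\<Prod>k<n. - (gg y (int k + 3) * gg y (int k + 1)))"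
proof -
  let ?z = "y\<^sup>2 * H (int n + 1)"
  have z: "?z \<noteq> 0" using y by simp
  have pc: "pre n w * cz w (1 - int n) = (\<Prod>k<n. cz w (int n - 1 - 2 * int k))" for w
  proof -
    obtain m where m: "n = Suc m" using n by (cases n) auto
    show ?thesis unfolding m pre_def by (simp add: cz_def)
  qed
  have 1: "(\<Prod>k<n. cz ?z (int n - 1 - 2 * int k)) = (\<Prod>k<n. gg y (int k + 1))"
  proof -
    have "(\<Prod>k<n. gg y (int k + 1)) = (\<Prod>k<n. gg y (int (n - Suc k) + 1))" by (rule prod.nat_diff_reindex[symmetric])
    also have "\<dots> = (\<Prod>k<n. cz ?z (int n - 1 - 2 * int k))" unfolding gg_def cz_H
      by (intro prod.cong refl arg_cong[of _ _ "cz _"]) (simp add: of_nat_diff)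
    finally show ?thesis by simp
  qed
  have 2: "cz (inverse ?z * H (- 4)) (int n - 1 - 2 * int k) = - gg y (int k + 3)" for k
    using cz_inv[of ?z "- 4" "int n - 1 - 2 * int k"] unfolding gg_def cz_H by (simp add: algebra_simps)
  have "rho n ?z = (pre n ?z * cz ?z (1 - int n)) * (pre n (inverse ?z * H (- 4)) * cz (inverse ?z * H (- 4)) (1 - int n))"
    unfolding rho_def by (simp only: mult_ac)
  also have "\<dots> = (\<Prod>k<n. gg y (int k + 1)) * (\<Prod>k<n. - gg y (int k + 3))" unfolding pc 1 2 ..
  also have "\<dots> = (\<Prod>k<n. - (gg y (int k + 3) * gg y (int k + 1)))" unfolding prod.distrib[symmetric] by (simp add: mult.commute)
  finally show ?thesis .
qed

lemma del_gg:
  assumes y: "y \<noteq> 0"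
  shows "del n (y\<^sup>2 * H (int n + 3)) = (\<Prod>k<n. gg y (int k + 2) * gg y (int k + 4))"
    "del n (inverse (y\<^sup>2) * H (- int n - 9)) = (\<Prod>k<n. gg y (int k + 5) * gg y (int k + 3))"
proof -
  show "del n (y\<^sup>2 * H (int n + 3)) = (\<Prod>k<n. gg y (int k + 2) * gg y (int k + 4))"
    unfolding del_def gg_def cz_H by (intro prod.cong refl arg_cong2[of _ _ _ _ "\<lambda>x y. cz _ x * cz _ y"]) simp_all
  have "(\<Prod>k<n. gg y (int k + 5) * gg y (int k + 3)) = (\<Prod>k<n. gg y (int (n - Suc k) + 5) * gg y (int (n - Suc k) + 3))"
    by (rule prod.nat_diff_reindex[symmetric])
  also have "\<dots> = del n (inverse (y\<^sup>2) * H (- int n - 9))"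
    unfolding del_def cz_inv minus_mult_minus gg_def
    by (intro prod.cong refl arg_cong2[of _ _ _ _ "\<lambda>x y. cz _ x * cz _ y"]) (simp_all add: of_nat_diff)
  finally show "del n (inverse (y\<^sup>2) * H (- int n - 9)) = (\<Prod>k<n. gg y (int k + 5) * gg y (int k + 3))" by simp
qed

text \<open>The factors with l = 0 and l = 1 of f are the determinants of the auxiliary R-matrices
  in K and in its dual, except for \<open>gg y 1\<close> and \<open>gg y 3\<close>. These two alone
  survive as denominators of the recursion.\<close>

lemma Fp_del:
  assumes y: "y \<noteq> 0"
  shows "Fp (Suc n) y = - (gg y 1 * gg y 3) * (del n (y\<^sup>2 * H (int n + 3)) * del n (inverse (y\<^sup>2) * H (- int n - 9))) * Fp (n - 1) (y * h\<^sup>2 * h\<^sup>2)"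
proof -
  have a: "(\<Prod>k<Suc n. - (gg y (int k + 3) * gg y (int k + 1))) = - (gg y 1 * gg y 3) * (\<Prod>k<n. - (gg y (int k + 4) * gg y (int k + 2)))"
    unfolding prod.lessThan_Suc_shift comp_def by (simp add: algebra_simps)
  have b: "Fp n (y * h\<^sup>2) = (\<Prod>k<n. - (gg y (int k + 5) * gg y (int k + 3))) * Fp (n - 1) (y * h\<^sup>2 * h\<^sup>2)"
  proof (cases n)
    \<comment> \<open>The truncated \<open>n - 1\<close> is harmless: all products are
      empty.\<close>
    case 0
    then show ?thesis by (simp add: Fp_def)
  next
    case (Suc m)
    then show ?thesis unfolding Suc Fp_rec gg_shift by (simp add: algebra_simps del: prod.lessThan_Suc)
  qed
  have c: "(\<Prod>k<n. - (gg y (int k + 4) * gg y (int k + 2))) * (\<Prod>k<n. - (gg y (int k + 5) * gg y (int k + 3)))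
     = del n (y\<^sup>2 * H (int n + 3)) * del n (inverse (y\<^sup>2) * H (- int n - 9))"
    unfolding del_gg[OF y] prod.distrib[symmetric] by (intro prod.cong refl) simp
  show ?thesis unfolding Fp_rec a b c[symmetric] by (simp add: mult_ac)
qed

text \<open>One of the two products has to be read backwards. The sign comes from the minus in each
  factor of \<open>beta\<close> and cancels between an inhomogeneity and its inverse.\<close>

lemma beta_del: "beta h a (z * h\<^sup>2) = (- 1) ^ a * del a z"
proof -
  have 1: "qc (z * h\<^sup>2 * H (int a + 1 - 2 * int k)) = cz z (int a + 3 - 2 * int k)" "qc (z * h\<^sup>2 * H (- int a - 1 + 2 * int k)) = cz z (1 - int a + 2 * int k)" for k
    unfolding cz_def[symmetric] cz_H by (rule arg_cong[of _ _ "cz z"]; simp)+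
  have "(\<Prod>k<a. cz z (int a + 3 - 2 * int k)) = (\<Prod>k<a. cz z (int a + 3 - 2 * int (a - Suc k)))" by (rule prod.nat_diff_reindex[symmetric])
  also have "\<dots> = (\<Prod>k<a. cz z (5 - int a + 2 * int k))"
    by (intro prod.cong refl arg_cong[of _ _ "cz z"]) (simp add: of_nat_diff)
  finally have 2: "(\<Prod>k<a. cz z (int a + 3 - 2 * int k)) = (\<Prod>k<a. cz z (5 - int a + 2 * int k))" .
  have "beta h a (z * h\<^sup>2) = (\<Prod>k<a. (- 1) * (cz z (int a + 3 - 2 * int k) * cz z (1 - int a + 2 * int k)))"
    unfolding beta_def 1 by simp
  also have "\<dots> = (- 1) ^ a * ((\<Prod>k<a. cz z (int a + 3 - 2 * int k)) * (\<Prod>k<a. cz z (1 - int a + 2 * int k)))" by (simp only: prod.distrib) simp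
  also have "\<dots> = (- 1) ^ a * del a z" unfolding 2 del_def prod.distrib by (simp only: mult_ac)
  finally show ?thesis .
qed

definition dual_bd :: "boundary \<Rightarrow> boundary" where
  "dual_bd bd = \<lparr>eps_plus = eps_minus bd, eps_minus = eps_plus bd, k_plus = - k_minus bd, k_minus = - k_plus bd\<rparr>"

text \<open>\<open>Gamma_plus\<close> is the same quantum determinant for the dual boundary, at the
  parameter q^(-2)/y where the dual K-matrices are fused.\<close>

lemma Gamma_dual:
  assumes y: "y \<noteq> 0"
  shows "Gamma_minus h (dual_bd bd) (inverse y * H (- 4)) = Gamma_plus h bd y"
proof -
  let ?t = "inverse y * H (- 4)"
  have t: "?t\<^sup>2 = inverse (y\<^sup>2) * H (- 8)" "?t powi - 2 = y\<^sup>2 * H 8"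
    using H_mult[of "-4" "-4"] y by (simp_all add: power_mult_distrib power2_eq_square power_inverse power_int_minus)
  have q: "(h\<^sup>2)\<^sup>2 = H 4" "h\<^sup>2 powi - 2 = H (- 4)" "h\<^sup>2 powi - 4 = H (- 8)" unfolding q_powi_H by simp_all
  have u: "y powi - 2 = inverse (y\<^sup>2)" by (simp add: power_int_minus)
  have 1: "inverse (y\<^sup>2) * H (- 8) * H 4 = inverse (y\<^sup>2) * H (- 4)" "y\<^sup>2 * H 8 * H (- 4) = y\<^sup>2 * H 4"
    unfolding mult_H_assoc by simp_all
  have 2: "(qc (inverse (y\<^sup>2) * H (- 4)))\<^sup>2 = (qc (y\<^sup>2 * H 4))\<^sup>2"
  proof -
    have "inverse (y\<^sup>2) * H (- 4) = inverse (y\<^sup>2 * H 4)" using inverse_H[of 4] by simp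
    then show ?thesis by (simp only: qc_inverse power2_minus)
  qed
  show ?thesis unfolding Gamma_minus_def Gamma_plus_def Let_def t q u 1 2 by (simp add: dual_bd_def mult_ac add_ac)
qed

end

section \<open>Transfer matrices\<close>

lemma mop_smult:
  assumes "length ps = length ds" "length ps = length ds'" "A \<in> carrier_mat (prod_list ds) (prod_list ds')"
  shows "mop ps ds ds' (c \<cdot>\<^sub>m A) = scal c (mop ps ds ds' A)"
  by (rule mx_eqI) (use assms encs_less[of ps ds] encs_less[of ps ds'] in \<open>auto simp: ent_mop\<close>)

lemma mop_add:
  assumes "length ps = length ds" "length ps = length ds'" "A \<in> carrier_mat (prod_list ds) (prod_list ds')" "B \<in> carrier_mat (prod_list ds) (prod_list ds')"
  shows "mop ps ds ds' (A + B) = mop ps ds ds' A + mop ps ds ds' B"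
  by (rule mx_eqI) (use assms encs_less[of ps ds] encs_less[of ps ds'] in \<open>auto simp: ent_mop\<close>)

lemma ent_app: "ent A s t = app A (\<lambda>r. if r = t then 1 else 0) s"
proof -
  have "app A (\<lambda>r. if r = t then 1 else 0) s = (\<Sum>r\<in>{r. ent A s r \<noteq> 0} \<union> {t}. ent A s r * (if r = t then 1 else 0))"
    by (rule app_eq) (auto simp: finite_ent_row)
  also have "\<dots> = ent A s t" by (simp add: finite_ent_row if_distrib[of "\<lambda>x. _ * x"] cong: if_cong)
  finally show ?thesis by simp
qed

section \<open>A chain of N sites as operators on legs\<close>

locale chain = qgen h for h +
  fixes N :: nat and J :: "nat \<Rightarrow> nat" and v :: "nat \<Rightarrow> complex" and bd bd' :: boundary
  assumes J: "n \<in> {1..N} \<Longrightarrow> J n \<ge> 1" and v: "n \<in> {1..N} \<Longrightarrow> v n \<noteq> 0"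
begin

lemma ent_bra_ket: "ent (bra p i * X * ket p i) s t = (if s p = 0 \<and> t p = 0 then ent X (s(p := i)) (t(p := i)) else 0)"
proof -
  have k: "ent (ket p i) r t = (if r p = i \<and> r(p := 0) = t then 1 else 0)" for r by (simp add: ent_app ket_app)
  have k': "ent (ket p i) r t = (if r = t(p := i) \<and> t p = 0 then 1 else 0)" for r
    unfolding k by (auto simp: fun_eq_iff)
  have "ent (bra p i * X * ket p i) s t = ent (bra p i * X) s (t(p := i)) * ent (ket p i) (t(p := i)) t"
    by (rule ent_mult1) (auto simp: k' split: if_splits)
  moreover have "ent (bra p i * X) s r = (if s p = 0 then ent X (s(p := i)) r else 0)" for r
    unfolding ent_app[of "bra p i * X"] by (simp add: bra_app ent_app[of X])
  ultimately show ?thesis by (simp add: k')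
qed

abbreviation "ps \<equiv> [0..<N]"
abbreviation "ds \<equiv> map (\<lambda>n. J n + 1) (rev [1..<N + 1])"
text \<open>Site n lives on leg N - n, its position among the tensor factors of the statement. The
  inhomogeneities are a parameter, so that both rows are covered.\<close>

definition "LL ns w = map (\<lambda>n. (N - n, J n, w n :: complex)) ns"
abbreviation "L \<equiv> LL (rev [1..<N + 1]) v"

lemma len: "length ps = length ds" "distinct ps" by auto

lemma prod_ds: "prod_list ds = site_dim N J"
proof -
  have "prod_list ds = (\<Prod>n\<in>set (rev [1..<N + 1]). J n + 1)" by (rule prod.distinct_set_conv_list[symmetric]) simp
  also have "set (rev [1..<N + 1]) = {1..N}" by auto
  finally show ?thesis by (simp add: site_dim_def)
qed

lemma inv_sites_L: "inv_sites L = LL [1..<N + 1] (\<lambda>n. inverse (v n))"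
  by (simp add: inv_sites_def LL_def rev_map comp_def)

lemma site_legs_L: "site_legs L = {..<N}"
proof -
  have "site_legs L = (\<lambda>n. N - n) ` {1..N}" by (auto simp: site_legs_def LL_def image_image)
  also have "\<dots> = {..<N}"
  proof
    show "{..<N} \<subseteq> (\<lambda>n. N - n) ` {1..N}"
    proof
      fix x assume "x \<in> {..<N}"
      then have "x = N - (N - x)" "N - x \<in> {1..N}" by auto
      then show "x \<in> (\<lambda>n. N - n) ` {1..N}" by blast
    qed
  qed auto
  finally show ?thesis .
qed

lemma sites_ok_L: "sites_ok L"
proof -
  have "inj_on (\<lambda>n. N - n) {1..N}" by (rule inj_onI) auto
  moreover have "set [1..<N + 1] = {1..N}" by auto
  ultimately have "distinct (map (\<lambda>n. N - n) (rev [1..<N + 1]))" unfolding distinct_map by simp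
  then have "distinct (map fst L)" by (simp add: LL_def comp_def)
  then show ?thesis using J v by (force simp: sites_ok_def LL_def)
qed

definition trmx :: "nat \<Rightarrow> complex \<Rightarrow> mx" where
  "trmx d u = mop ps ds ds (transfer h bd bd' N J v (int d) u)"

lemma transfer_carrier: "transfer h bd bd' N J v a u \<in> carrier_mat (prod_list ds) (prod_list ds)"
  unfolding prod_ds by (simp add: transfer_def ptrace_last_def Let_def)

section \<open>The transfer matrix with the auxiliary space on an arbitrary leg beyond the
  sites\<close>

context
  fixes p :: nat assumes p: "p \<ge> N"
begin

abbreviation "ps1 \<equiv> ps @ [p]"
abbreviation "ds1 d \<equiv> ds @ [d + 1 :: nat]"
abbreviation "P1 d \<equiv> PI ps1 (ds1 d)"

lemma len1: "length ps1 = length (ds1 d)" "distinct ps1" using p by auto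

lemma P1_split: "P1 d = PI ps ds * PR (d + 1) p"
proof (rule mx_eqI)
  fix s t :: state
  have "inr ps1 (ds1 d) s \<longleftrightarrow> inr ps ds s \<and> s p < d + 1" unfolding inr_append[OF len(1)] by (simp add: inr_def)
  then show "ent (P1 d) s t = ent (PI ps ds * PR (d + 1) p) s t"
    unfolding ent_PR_mult ent_PI[OF len1(2,1)] ent_PI[OF len(2,1)] by auto
qed

lemma mop_P1: "A \<in> carrier_mat (prod_list (ds1 d)) (prod_list (ds1 d)) \<Longrightarrow> mop ps1 (ds1 d) (ds1 d) A * P1 d = mop ps1 (ds1 d) (ds1 d) A"
  unfolding PI_def by (subst mop_mult) (use len1(1)[of d] len1(2) in auto)

lemma mop_R_site:
  assumes n: "n \<in> {1..N}"
  shows "mop ps1 (ds1 d) (ds1 d) (R_site h N J d n z) = P1 d * S (J n) d z (N - n) p"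
proof -
  have nth: "ds1 d ! (N - n) = J n + 1" "ds1 d ! N = d + 1" "ps1 ! (N - n) = N - n" "ps1 ! N = p"
    using n by (auto simp: nth_append rev_nth)
  have "mop ps1 (ds1 d) (ds1 d) (R_site h N J d n z) = P1 d * mop [ps1 ! (N - n), ps1 ! N] [ds1 d ! (N - n), ds1 d ! N] [ds1 d ! (N - n), ds1 d ! N] (R_mat h (J n) d z)"
    unfolding R_site_def by (rule mop_embed2[OF len1(2,1)]) (use n nth R_mat_carrier[of "J n" d z] in auto)
  then show ?thesis unfolding nth S_def .
qed

lemma R_site_carrier: "R_site h N J d n z \<in> carrier_mat (prod_list (ds1 d)) (prod_list (ds1 d))"
  by (simp add: R_site_def embed2_def)

lemma mop_TT:
  assumes "set ns \<subseteq> {1..N}"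
  shows "mat_prod_list (site_dim N J * (d + 1)) (map (\<lambda>n. R_site h N J d n (z * w n)) ns) \<in> carrier_mat (prod_list (ds1 d)) (prod_list (ds1 d)) \<and>
    mop ps1 (ds1 d) (ds1 d) (mat_prod_list (site_dim N J * (d + 1)) (map (\<lambda>n. R_site h N J d n (z * w n)) ns)) = P1 d * TT (LL ns w) d z p"
  using assms
proof (induction ns)
  case Nil
  have "prod_list (ds1 d) = site_dim N J * (d + 1)" using prod_ds by simp
  then show ?case by (simp add: mat_prod_list_def LL_def PI_def)
next
  case (Cons n ns)
  let ?A = "R_site h N J d n (z * w n)" and ?B = "mat_prod_list (site_dim N J * (d + 1)) (map (\<lambda>n. R_site h N J d n (z * w n)) ns)"
  have IH: "?B \<in> carrier_mat (prod_list (ds1 d)) (prod_list (ds1 d))" "mop ps1 (ds1 d) (ds1 d) ?B = P1 d * TT (LL ns w) d z p"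
    using Cons by auto
  have e: "mat_prod_list (site_dim N J * (d + 1)) (map (\<lambda>n. R_site h N J d n (z * w n)) (n # ns)) = ?A * ?B" by (simp add: mat_prod_list_def)
  have "mop ps1 (ds1 d) (ds1 d) (?A * ?B) = mop ps1 (ds1 d) (ds1 d) ?A * mop ps1 (ds1 d) (ds1 d) ?B"
    by (rule mop_mult[symmetric]) (use len1(1)[of d] len1(2) R_site_carrier[of d] IH in auto)
  also have "\<dots> = mop ps1 (ds1 d) (ds1 d) ?A * TT (LL ns w) d z p" unfolding IH(2) mx_assoc[symmetric] mop_P1[OF R_site_carrier] ..
  also have "\<dots> = P1 d * TT (LL (n # ns) w) d z p" using Cons.prems by (simp add: mop_R_site LL_def mx_assoc)
  finally show ?case unfolding e using mult_carrier_mat[OF R_site_carrier IH(1)] by blast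
qed

text \<open>With \<open>p\<close> as last place, tracing by bras and kets is
  \<open>ptrace_last\<close>; the factor \<open>PR 1 p\<close> is the projection that the trace
  leaves on \<open>p\<close>.\<close>

lemma ptr_mop:
  "ptr p n (mop ps1 (ds @ [n]) (ds @ [n]) X) = mop ps ds ds (ptrace_last (site_dim N J) n X) * PR 1 p"
proof (rule mx_eqI)
  fix s t :: state
  let ?Y = "mop ps1 (ds @ [n]) (ds @ [n]) X"
  have r: "inr ps1 (ds @ [n]) (s(p := i)) \<longleftrightarrow> inr ps ds s \<and> i < n" "encs ps1 (ds @ [n]) (s(p := i)) = encs ps ds s * n + i" for s i
  proof -
    have m: "map (s(p := i)) ps = map s ps" using p by auto
    have "inr ps ds (s(p := i)) = inr ps ds s" by (rule inr_cong) (use p in auto)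
    then show "inr ps1 (ds @ [n]) (s(p := i)) \<longleftrightarrow> inr ps ds s \<and> i < n" unfolding inr_append[OF len(1)] by (auto simp: inr_def)
    show "encs ps1 (ds @ [n]) (s(p := i)) = encs ps ds s * n + i" unfolding encs_append[OF len(1)] unfolding encs_def m by simp
  qed
  show "ent (ptr p n ?Y) s t = ent (mop ps ds ds (ptrace_last (site_dim N J) n X) * PR 1 p) s t"
  proof (cases "s p = 0 \<and> t p = 0 \<and> (\<forall>r. r \<notin> set ps \<longrightarrow> s r = t r) \<and> inr ps ds s \<and> inr ps ds t")
    case True
    then have "encs ps ds s < site_dim N J" "encs ps ds t < site_dim N J" using encs_less[of ps ds] prod_ds by auto
    then show ?thesis using True
      by (simp add: ptr_def ent_sum ent_bra_ket ent_PR_mult ent_mop r ptrace_last_def)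
  next
    case False
    have "ent (mop ps ds ds (ptrace_last (site_dim N J) n X) * PR 1 p) s t = 0"
      using False p by (auto simp: ent_PR_mult ent_mop)
    moreover have "ent (bra p i * ?Y * ket p i) s t = 0" for i
    proof (cases "s p = 0 \<and> t p = 0")
      case True
      with False show ?thesis by (auto simp: ent_bra_ket ent_mop r split: if_splits) (metis fun_upd_other)
    next
      case False
      then show ?thesis unfolding ent_bra_ket by auto
    qed
    ultimately show ?thesis by (simp add: ptr_def ent_sum)
  qed
qed

text \<open>Translates the transfer matrix of the statement into \<open>tau\<close>. Each factor
  brings its own projection onto the bounded indices; these are absorbed one by one until only the
  projection on the sites is left.\<close>

lemma trmx_PR: "trmx d u * PR 1 p = scal (1 / f_norm h d u) (PI ps ds * tau (dual_bd bd') bd L d u p)"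
proof -
  let ?D = "site_dim N J" and ?c = "1 / f_norm h d u" and ?x = "inverse u * inverse (h\<^sup>2)"
  let ?C = "carrier_mat (prod_list (ds1 d)) (prod_list (ds1 d))" and ?m = "mop ps1 (ds1 d) (ds1 d)"
  let ?a = "1\<^sub>m ?D \<otimes>\<^sub>m K_dual h bd' d u" and ?b = "T_mat h N J v d u" and ?c' = "1\<^sub>m ?D \<otimes>\<^sub>m K_mat h bd d u" and ?d = "T_hat h N J v d u"
  let ?KD = "trn (KK (dual_bd bd') d ?x p)"
  have KC: "K_mat h b d x \<in> carrier_mat (d + 1) (d + 1)" for b x by (rule K_mat_carrier)
  have KDC: "K_dual h bd' d u \<in> carrier_mat (d + 1) (d + 1)" using KC unfolding K_dual_def by auto
  have si: "set (rev [1..<N + 1]) \<subseteq> {1..N}" "set [1..<N + 1] \<subseteq> {1..N}" by auto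
  have T: "?b \<in> ?C" "?m ?b = P1 d * TT L d u p" unfolding T_mat_def using mop_TT[OF si(1), of d u v] by blast+
  have T': "?d \<in> ?C" "?m ?d = P1 d * TT (inv_sites L) d u p" unfolding T_hat_def inv_sites_L using mop_TT[OF si(2), of d u "\<lambda>n. inverse (v n)"] by blast+
  have one: "?m (1\<^sub>m ?D \<otimes>\<^sub>m K) = PI ps ds * mop [p] [d + 1] [d + 1] K" if "K \<in> carrier_mat (d + 1) (d + 1)" for K
    using mop_kron[of ps ds ds "[p]" "[d + 1]" "[d + 1]" "1\<^sub>m ?D" K] that p len unfolding PI_def prod_ds by simp
  have ac: "?a \<in> ?C" "?c' \<in> ?C" using KC[of bd u] KDC prod_ds by (auto simp: kron_def)
  have a: "?m ?a = P1 d * scal ?c ?KD"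
  proof -
    have "mop [p] [d + 1] [d + 1] (K_dual h bd' d u) = scal ?c ?KD"
      unfolding K_dual_def KK_def dual_bd_def[symmetric] using KC[of "dual_bd bd'" ?x] by (subst mop_smult) (auto simp: trn_mop)
    moreover have "PR (d + 1) p * ?KD = ?KD"
      using arg_cong[OF PR_absorb(14)[where p = "Suc p" and q = p and d = d and bd = "dual_bd bd'" and z = ?x], of trn] by (simp add: trn_PR)
    ultimately show ?thesis unfolding one[OF KDC] P1_split by (simp add: mx_assoc)
  qed
  have c: "?m ?c' = P1 d * KK bd d u p" unfolding one[OF KC] KK_def[symmetric] P1_split
    using PR_absorb(13)[where p = "Suc p" and q = p and d = d and bd = bd and z = u] by (simp add: mx_assoc)
  have s1: "?m ?a * ?m ?b = ?m ?a * TT L d u p" unfolding T(2) mx_assoc[symmetric] mop_P1[OF ac(1)] ..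
  have s2: "?m ?a * ?m ?b * ?m ?c' = ?m ?a * TT L d u p * KK bd d u p"
  proof -
    have "?m ?a * ?m ?b * ?m ?c' = ?m ?a * (?m ?b * P1 d) * KK bd d u p" unfolding c by (simp only: mx_assoc)
    then show ?thesis unfolding mop_P1[OF T(1)] s1 .
  qed
  have "?m (?a * ?b * ?c' * ?d) = ?m ?a * ?m ?b * ?m ?c' * ?m ?d"
    by (rule mop_mult4) (use len1(1)[of d] len1(2) ac T T' in auto)
  also have "\<dots> = ?m ?a * ?m ?b * (?m ?c' * P1 d) * TT (inv_sites L) d u p" unfolding T'(2) by (simp only: mx_assoc)
  also have "\<dots> = ?m ?a * TT L d u p * KK bd d u p * TT (inv_sites L) d u p" unfolding mop_P1[OF ac(2)] s2 ..
  also have "\<dots> = scal ?c (P1 d * (?KD * UU bd L d u p))" unfolding a UU_def by (simp only: mx_assoc scal_mult_left scal_mult_right)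
  also have "P1 d * (?KD * UU bd L d u p) = PI ps ds * (?KD * UU bd L d u p)"
  proof -
    have k: "PR (d + 1) p * ?KD = ?KD"
      using arg_cong[OF PR_absorb(14)[where p = "Suc p" and q = p and d = d and bd = "dual_bd bd'" and z = ?x], of trn] by (simp add: trn_PR)
    show ?thesis unfolding P1_split by (simp only: mx_assoc assoc_collapse[OF k])
  qed
  finally have m: "?m (?a * ?b * ?c' * ?d) = scal ?c (PI ps ds * (?KD * UU bd L d u p))" .
  have tr: "transfer h bd bd' N J v (int d) u = ptrace_last ?D (d + 1) (?a * ?b * ?c' * ?d)" by (simp add: transfer_def Let_def)
  have "on_legs {..<N} (PI ps ds)" unfolding PI_def using on_legs_mop[of ps ds ds] by (simp add: atLeast0LessThan)
  then have cp: "bra p i * PI ps ds = PI ps ds * bra p i" for i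
    by (intro commute[where P = "{p}" and Q = "{..<N}"] on_legs_ket_bra) (use p in auto)
  have "trmx d u * PR 1 p = ptr p (d + 1) (?m (?a * ?b * ?c' * ?d))" unfolding trmx_def tr ptr_mop[symmetric] ..
  also have "\<dots> = scal ?c (PI ps ds * tau (dual_bd bd') bd L d u p)" unfolding m tau_def ptr_def
    by (simp only: mx_assoc assoc_swap[OF cp] scal_mult_left scal_mult_right scal_sum sum_distrib_left)
  finally show ?thesis .
qed

end

section \<open>Expansion of the recursion from the other end\<close>

lemma on_legs_trm: "on_legs {..<N} (trmx d u)" "on_legs {..<N} (PI ps ds)"
  unfolding trmx_def PI_def using on_legs_mop[of ps ds ds] by (simp_all add: atLeast0LessThan)

lemma PI_trmx: "PI ps ds * trmx d u = trmx d u" "trmx d u * PI ps ds = trmx d u"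
  unfolding trmx_def PI_def using transfer_carrier[of "int d" u] by (subst mop_mult; simp)+

lemma cancel_PR:
  assumes A: "on_legs {..<N} A" and B: "on_legs {..<N} B" and p: "p \<ge> N" and e: "A * PR 1 p = B * PR 1 p"
  shows "A = B"
proof (rule cancel_leg[OF A B, of p])
  have "PR 1 p * A = A * PR 1 p" "PR 1 p * B = B * PR 1 p"
    by (rule commute[where P = "{p}" and Q = "{..<N}"]; use p A B in \<open>auto intro: on_legs_one_leg\<close>)+
  then show "PI [p] [1] * A = PI [p] [1] * B" using e by (simp add: PR_def)
qed (use p in simp)

lemma site_del_LL: "site_del (LL ns w) z = prod_list (map (\<lambda>n. del (J n) (z * w n)) ns)"
  by (induction ns) (simp_all add: LL_def)

lemma site_del_beta: "site_del L y * site_del (inv_sites L) y = (\<Prod>n = 1..N. beta h (J n) (y * h\<^sup>2 * v n) * beta h (J n) (y * h\<^sup>2 * inverse (v n)))"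
proof -
  have s: "set [1..<N + 1] = {1..N}" by auto
  have d: "site_del (LL (rev [1..<N + 1]) w) y = (\<Prod>n = 1..N. del (J n) (y * w n))" "site_del (LL [1..<N + 1] w) y = (\<Prod>n = 1..N. del (J n) (y * w n))" for w
    unfolding site_del_LL using prod.distinct_set_conv_list[of "rev [1..<N + 1]" "\<lambda>n. del (J n) (y * w n)"]
      prod.distinct_set_conv_list[of "[1..<N + 1]" "\<lambda>n. del (J n) (y * w n)"] unfolding set_rev s by simp_all
  have "beta h (J n) (y * h\<^sup>2 * v n) * beta h (J n) (y * h\<^sup>2 * inverse (v n)) = del (J n) (y * v n) * del (J n) (y * inverse (v n))" for n
  proof -
    have e: "y * h\<^sup>2 * w = (y * w) * h\<^sup>2" for w by simp
    have "(- 1 :: complex) ^ J n * (- 1) ^ J n = 1" by (simp add: power_mult_distrib[symmetric])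
    moreover have "c * x * (c * y) = (c * c) * (x * y)" for c x y :: complex by (simp only: mult_ac)
    ultimately show ?thesis unfolding e beta_del by simp
  qed
  then show ?thesis unfolding inv_sites_L d prod.distrib[symmetric] by simp
qed

text \<open>The coefficient in the recursion as a function of y = u q^(j-3/2), for the spin j on the
  left-hand side of the claim.\<close>

definition rec_coef :: "complex \<Rightarrow> complex" where
  "rec_coef y = site_del L y * site_del (inv_sites L) y * (Gamma_minus h bd y * Gamma_plus h bd' y) / (gg y 1 * gg y 3)"

definition Y :: "nat \<Rightarrow> complex \<Rightarrow> mx" where "Y n y = trmx n (y * H (int n - 1))"

text \<open>\<open>y\<close> is the parameter of the leftmost spin 1/2 factor; in terms of it the poles and the normalisation
  \<open>f_norm\<close> do not depend on the spin.\<close>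

lemma left_rec:
  assumes y: "y \<noteq> 0" and F: "Fp (Suc n) y \<noteq> 0"
  shows "Y (Suc (Suc n)) y = Y 1 y * Y (Suc n) (y * h\<^sup>2) + scal (rec_coef y) (Y n (y * h\<^sup>2 * h\<^sup>2))"
proof -
  let ?d = "Suc (Suc n)" and ?u = "y * H (int n + 1)" and ?p = N and ?q = "Suc N" and ?b = "dual_bd bd'" and ?Pi = "PI ps ds"
  let ?y1 = "y * h\<^sup>2" and ?y2 = "y * h\<^sup>2 * h\<^sup>2"
  have u: "?u \<noteq> 0" using y by simp
  define x where "x = inverse ?u * inverse (h\<^sup>2)"
  have uu: "?u\<^sup>2 = y\<^sup>2 * H (2 * int n + 2)" using H_mult[of "int n + 1" "int n + 1"] by (simp add: power_mult_distrib power2_eq_square algebra_simps)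
  have xx: "x = inverse y * H (- int n - 3)" "x\<^sup>2 = inverse (y\<^sup>2) * H (- 2 * int n - 6)"
  proof -
    have "inverse (H (int n + 1)) * inverse (h\<^sup>2) = H (- int n - 1) * H (- 2)" using inverse_H[of "int n + 1"] inverse_H[of 2] by simp
    also have "\<dots> = H (- int n - 3)" unfolding H_mult by (rule arg_cong[of _ _ "\<lambda>m. h powi m"]) simp
    finally show 1: "x = inverse y * H (- int n - 3)" unfolding x_def by (simp add: mult.assoc)
    show "x\<^sup>2 = inverse (y\<^sup>2) * H (- 2 * int n - 6)" unfolding 1 using H_mult[of "- int n - 3" "- int n - 3"]
      by (simp add: power_mult_distrib power2_eq_square algebra_simps)
  qed
  have e: "?u * H (1 - int ?d) = y * H 0" "?u\<^sup>2 * H (2 - int ?d) = y\<^sup>2 * H (int (Suc n) + 1)" "?u * h = ?y1 * H (int n)"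
    "?u\<^sup>2 * H (3 - int ?d) = y\<^sup>2 * H (int n + 3)" "?y1 * H (int n) * h = ?y2 * H (int n - 1)"
    unfolding uu mult_H_assoc by (rule mult_H_cong, simp)+
  have ex: "x * H (int ?d - 3) = inverse y * H (- 4)" "x\<^sup>2 * H (int ?d - 5) = inverse (y\<^sup>2) * H (- int n - 9)"
    unfolding xx(2) unfolding xx(1) mult_H_assoc by (rule mult_H_cong, simp)+
  have d: "?d > 1" "?d - 1 = Suc n" "?d - 2 = n" by simp_all
  \<comment> \<open>The two auxiliary spaces occupy the first two legs beyond the sites.\<close>
  have N: "?p \<ge> N" "?q \<ge> N" "?p \<noteq> ?q" "?p \<notin> site_legs L" "?q \<notin> site_legs L" unfolding site_legs_L by auto
  define G where "G = site_del L y * site_del (inv_sites L) y * (Gamma_minus h bd y * del n (y\<^sup>2 * H (int n + 3))) * (Gamma_plus h bd' y * del n (inverse (y\<^sup>2) * H (- int n - 9)))"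
  let ?t1 = "tau ?b bd L 1 y ?p" and ?t2 = "tau ?b bd L (Suc n) (?y1 * H (int n)) ?q" and ?t3 = "tau ?b bd L ?d ?u ?q" and ?t4 = "tau ?b bd L n (?y2 * H (int n - 1)) ?q"
  have yH0: "y * H 0 = y" by simp
  have rec: "scal (rho (Suc n) (y\<^sup>2 * H (int (Suc n) + 1))) (?t1 * ?t2) = PR 1 ?p * ?t3 + scal G (PR 1 ?p * ?t4)"
    using tau_rec[OF d(1) u N(3) sites_ok_L N(4,5), of ?b bd, folded x_def] unfolding e ex d yH0 Gamma_dual[OF y] G_def .
  have F0: "Fp n ?y1 \<noteq> 0" "Fp (n - 1) ?y2 \<noteq> 0" "gg y 1 \<noteq> 0" "gg y 3 \<noteq> 0"
  proof -
    show 1: "Fp n ?y1 \<noteq> 0" "gg y 1 \<noteq> 0" "gg y 3 \<noteq> 0" using Fp_neq_0[OF F] by auto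
    show "Fp (n - 1) ?y2 \<noteq> 0" using Fp_neq_0(2)[of "n - 1" ?y1] 1(1) by (cases n) (auto simp: Fp_def)
  qed
  have f: "f_norm h 1 y = 1" "f_norm h (Suc n) (?y1 * H (int n)) = Fp n ?y1" "f_norm h ?d ?u = Fp (Suc n) y" "f_norm h n (?y2 * H (int n - 1)) = Fp (n - 1) ?y2"
  proof -
    show "f_norm h 1 y = 1" by (simp add: f_norm_def)
    show "f_norm h (Suc n) (?y1 * H (int n)) = Fp n ?y1" by (rule f_norm_Fp) (use y in simp)
    show "f_norm h ?d ?u = Fp (Suc n) y" using f_norm_Fp[OF y, of "Suc n"] by (simp add: add.commute)
    show "f_norm h n (?y2 * H (int n - 1)) = Fp (n - 1) ?y2"
    proof (cases n)
      case (Suc m)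
      then show ?thesis using f_norm_Fp[of ?y2 m] y by simp
    qed (simp add: f_norm_def Fp_def)
  qed
  have t: "?Pi * ?t1 = trmx 1 y * PR 1 ?p" "?Pi * ?t2 = scal (Fp n ?y1) (trmx (Suc n) (?y1 * H (int n)) * PR 1 ?q)"
    "?Pi * ?t3 = scal (Fp (Suc n) y) (trmx ?d ?u * PR 1 ?q)" "?Pi * ?t4 = scal (Fp (n - 1) ?y2) (trmx n (?y2 * H (int n - 1)) * PR 1 ?q)"
    using F F0 by (simp_all only: trmx_PR[OF N(1)] trmx_PR[OF N(2)] f) simp_all
  let ?A = "trmx 1 y" and ?B = "trmx (Suc n) (?y1 * H (int n))" and ?C = "trmx ?d ?u" and ?E = "trmx n (?y2 * H (int n - 1))"
  have c: "PR 1 ?p * trmx k w = trmx k w * PR 1 ?p" "PR 1 ?p * ?Pi = ?Pi * PR 1 ?p" "PR 1 ?q * PR 1 ?p = PR 1 ?p * PR 1 ?q" for k w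
    by (rule commute[where P = "{N}" and Q = "{..<N}"] commute[where P = "{?q}" and Q = "{N}"]; use on_legs_trm in \<open>auto intro: on_legs_one_leg\<close>)+
  have "?Pi * (?t1 * ?t2) = ?A * PR 1 ?p * ?t2" unfolding mx_assoc[symmetric] t(1) ..
  also have "\<dots> = ?A * PR 1 ?p * (?Pi * ?t2)" by (simp only: mx_assoc assoc_swap[OF c(2)] assoc_collapse[OF PI_trmx(2)])
  also have "\<dots> = scal (Fp n ?y1) (?A * ?B * (PR 1 ?p * PR 1 ?q))" unfolding t(2) by (simp only: mx_assoc scal_mult_right assoc_swap[OF c(1)])
  finally have l: "?Pi * (?t1 * ?t2) = scal (Fp n ?y1) (?A * ?B * (PR 1 ?p * PR 1 ?q))" .
  have r: "?Pi * (PR 1 ?p * ?t3) = scal (Fp (Suc n) y) (?C * (PR 1 ?p * PR 1 ?q))" "?Pi * (PR 1 ?p * ?t4) = scal (Fp (n - 1) ?y2) (?E * (PR 1 ?p * PR 1 ?q))"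
    by (simp_all only: assoc_swap[OF c(2)[symmetric]] t scal_mult_right assoc_swap[OF c(1)] mx_assoc)
  \<comment> \<open>The crossing scalar supplies exactly the factors by which f grows with the
    spin.\<close>
  have rF: "rho (Suc n) (y\<^sup>2 * H (int (Suc n) + 1)) * Fp n ?y1 = Fp (Suc n) y" unfolding rho_eq[OF y zero_less_Suc] Fp_rec ..
  \<comment> \<open>Apart from the two poles, the auxiliary determinants cancel against f. The minus
    sign lets the term of lower spin change sides with a plus.\<close>
  have GF: "G * Fp (n - 1) ?y2 = - (Fp (Suc n) y * rec_coef y)"
    unfolding Fp_del[OF y] G_def rec_coef_def using F0(3,4) by (simp add: field_simps)
  have "scal (Fp (Suc n) y) (?A * ?B * (PR 1 ?p * PR 1 ?q)) = scal (Fp (Suc n) y) (?C * (PR 1 ?p * PR 1 ?q)) + scal (- (Fp (Suc n) y * rec_coef y)) (?E * (PR 1 ?p * PR 1 ?q))"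
    using arg_cong[OF rec, of "\<lambda>A. ?Pi * A"] unfolding scal_mult_right distrib_left l r scal_scal rF GF .
  also have "\<dots> = scal (Fp (Suc n) y) ((?C + scal (- rec_coef y) ?E) * (PR 1 ?p * PR 1 ?q))"
    by (simp add: distrib_right scal_add_right)
  finally have "?A * ?B * (PR 1 ?p * PR 1 ?q) = (?C + scal (- rec_coef y) ?E) * (PR 1 ?p * PR 1 ?q)" by (rule scal_cancel[OF F])
  then have eq: "?A * ?B * PR 1 ?p * PR 1 ?q = (?C + scal (- rec_coef y) ?E) * PR 1 ?p * PR 1 ?q" by (simp only: mx_assoc)
  have lA: "on_legs {..<N} (?A * ?B)" "on_legs {..<N} (?C + scal (- rec_coef y) ?E)" by (intro on_legs_mult on_legs_add on_legs_scal on_legs_trm)+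
  \<comment> \<open>Both auxiliary legs still carry a projection onto index 0; they are stripped one
    after the other, each lying outside the support of what remains.\<close>
  have "?A * ?B * PR 1 ?p = (?C + scal (- rec_coef y) ?E) * PR 1 ?p"
  proof (rule cancel_leg[where P = "{..N}" and r = ?q])
    show "on_legs {..N} (?A * ?B * PR 1 ?p)" "on_legs {..N} ((?C + scal (- rec_coef y) ?E) * PR 1 ?p)"
      by (rule on_legs_mult[OF on_legs_mono[OF lA(1)]] on_legs_mult[OF on_legs_mono[OF lA(2)]]; auto intro: on_legs_one_leg)+
    then have "PR 1 ?q * (?A * ?B * PR 1 ?p) = (?A * ?B * PR 1 ?p) * PR 1 ?q"
      "PR 1 ?q * ((?C + scal (- rec_coef y) ?E) * PR 1 ?p) = ((?C + scal (- rec_coef y) ?E) * PR 1 ?p) * PR 1 ?q"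
      by (intro commute[where P = "{?q}" and Q = "{..N}"]; auto intro: on_legs_one_leg)+
    then show "PI [?q] [1] * (?A * ?B * PR 1 ?p) = PI [?q] [1] * ((?C + scal (- rec_coef y) ?E) * PR 1 ?p)" using eq by (simp add: PR_def)
  qed simp
  then have "?A * ?B = ?C + scal (- rec_coef y) ?E" by (rule cancel_PR[OF lA N(1)])
  then have "?C = ?A * ?B + scal (rec_coef y) ?E" using scal_add_left[of "- rec_coef y" "rec_coef y" ?E] by simp
  then show ?thesis unfolding Y_def by (simp add: add.commute One_nat_def[symmetric])
qed

text \<open>Even for auxiliary spin 0 the matrix \<open>R_mat\<close> of a site of spin 1 or more is
  built by fusion. That it acts as the identity is the first of the site relations, after which only
  projections remain.\<close>

lemma Y_0: "Y 0 y = PI ps ds"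
proof (rule cancel_PR[OF _ on_legs_trm(2)])
  show "on_legs {..<N} (Y 0 y)" unfolding Y_def by (rule on_legs_trm)
  let ?u = "y * H (int 0 - 1)"
  have K: "KK b 0 x N = PR 1 N" for b x by (simp add: KK_def PR_def PI_def One_nat_def)
  have P: "PR 1 N * PR 1 N = PR 1 N" by (simp add: PR_idem)
  have T: "PI ps ds * TT (LL ns w) 0 z N * PR 1 N = PI ps ds * PR 1 N" if "set ns \<subseteq> {1..N}" for ns w z
    using that
  proof (induction ns)
    case (Cons n ns)
    have n: "J n > 0" "N - n < N" "N - n \<noteq> N" using Cons.prems J[of n] by auto
    have "ds ! (N - n) = J n + 1" using Cons.prems by (auto simp: rev_nth)
    then have r: "t (N - n) < J n + 1" if "inr ps ds t" for t using that n(2) unfolding inr_def by (auto dest: spec[of _ "N - n"])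
    have 1: "PI ps ds * PR (J n + 1) (N - n) = PI ps ds"
      by (rule mx_eqI) (use r in \<open>auto simp: ent_PR_mult ent_PI\<close>)
    have 2: "PR 1 N * (TT (LL ns w) 0 z N * PR 1 N) = TT (LL ns w) 0 z N * PR 1 N"
    proof (cases ns)
      case Nil
      then show ?thesis using P by (simp add: LL_def)
    next
      case (Cons m ms)
      have a: "PR 1 N * S (J m) 0 (z * w m) (N - m) N = S (J m) 0 (z * w m) (N - m) N"
        using PR_absorb(10)[of "N - m" N 0 "J m"] Cons Cons.prems by (auto simp: One_nat_def)
      have b: "TT (LL ns w) 0 z N = S (J m) 0 (z * w m) (N - m) N * TT (LL ms w) 0 z N" by (simp add: Cons LL_def)
      show ?thesis unfolding b by (simp only: mx_assoc assoc_collapse[OF a])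
    qed
    have 3: "TT (LL (n # ns) w) 0 z N = PR (J n + 1) (N - n) * PR 1 N * TT (LL ns w) 0 z N"
      using site_relationsD(1)[OF site_relations[OF n(1)] n(3)] by (simp add: LL_def)
    have "PI ps ds * TT (LL (n # ns) w) 0 z N * PR 1 N = PI ps ds * TT (LL ns w) 0 z N * PR 1 N"
      unfolding 3 by (simp only: mx_assoc assoc_collapse[OF 1] 2)
    then show ?case using Cons by simp
  qed (simp add: LL_def)
  have si: "set (rev [1..<N + 1]) \<subseteq> {1..N}" "set [1..<N + 1] \<subseteq> {1..N}" by auto
  have c: "PR 1 N * PI ps ds = PI ps ds * PR 1 N" by (rule commute[where P = "{N}" and Q = "{..<N}"]; use on_legs_trm in \<open>auto intro: on_legs_one_leg\<close>)
  have "PI ps ds * tau (dual_bd bd') bd L 0 ?u N = PI ps ds * (PR 1 N * (PR 1 N * (TT L 0 ?u N * (PR 1 N * (TT (inv_sites L) 0 ?u N * PR 1 N)))))"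
    unfolding tau_def UU_def K trn_PR ptr_def by (simp add: ket_absorb(6,7) mx_assoc One_nat_def)
  also have "\<dots> = PR 1 N * ((PI ps ds * TT L 0 ?u N * PR 1 N) * (TT (inv_sites L) 0 ?u N * PR 1 N))" by (simp only: mx_assoc assoc_collapse[OF P] assoc_swap[OF c])
  also have "\<dots> = PR 1 N * (PR 1 N * (PI ps ds * TT (inv_sites L) 0 ?u N * PR 1 N))" unfolding T[OF si(1)] by (simp only: mx_assoc assoc_swap[OF c[symmetric]] c)
  also have "\<dots> = PI ps ds * PR 1 N" unfolding inv_sites_L T[OF si(2)] by (simp only: c mx_assoc assoc_collapse[OF P] assoc_swap[OF c] P)
  finally show "Y 0 y * PR 1 N = PI ps ds * PR 1 N"
    unfolding Y_def trmx_PR[OF order_refl] by (simp add: f_norm_def)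
qed simp

lemma PI_Y: "PI ps ds * Y n y = Y n y" "Y n y * PI ps ds = Y n y"
  unfolding Y_def by (rule PI_trmx)+

text \<open>A continuant can be expanded from either end; the operators need not commute.\<close>

lemma right_rec:
  assumes "y \<noteq> 0" and "Fp (Suc n) y \<noteq> 0"
  shows "Y (Suc (Suc n)) y = Y (Suc n) y * Y 1 (y * H (2 * int n + 2)) + scal (rec_coef (y * H (2 * int n))) (Y n y)"
  using assms
proof (induction n arbitrary: y rule: less_induct)
  case (less n y)
  note y = less.prems(1) and F = less.prems(2)
  have z: "y * h\<^sup>2 \<noteq> 0" "y * h\<^sup>2 * h\<^sup>2 \<noteq> 0" using y by auto
  have F1: "Fp n y \<noteq> 0" "Fp n (y * h\<^sup>2) \<noteq> 0" using Fp_neq_0[OF F] by auto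
  note LR = left_rec[OF y F]
  \<comment> \<open>In general the claim is used for n - 1 and n - 2. For n = 1 the second instance
    is replaced by \<open>Y 0\<close>, the identity on the sites, and for n = 0 the two expansions
    coincide.\<close>
  consider "n = 0" | "n = 1" | m where "n = Suc (Suc m)" by (metis One_nat_def not0_implies_Suc)
  then show ?case
  proof cases
    case 1
    then show ?thesis using LR by (simp add: Y_0 One_nat_def[symmetric])
  next
    case 2
    have IH: "Y 2 (y * h\<^sup>2) = Y 1 (y * h\<^sup>2) * Y 1 (y * h\<^sup>2 * h\<^sup>2) + scal (rec_coef (y * h\<^sup>2)) (PI ps ds)"
      using less.IH[of 0, OF _ z(1)] F1 2 by (simp add: Y_0 One_nat_def numeral_2_eq_2)
    have L2: "Y 2 y = Y 1 y * Y 1 (y * h\<^sup>2) + scal (rec_coef y) (PI ps ds)"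
      using left_rec[OF y, of 0] F1 2 by (simp add: Y_0 One_nat_def numeral_2_eq_2)
    have e: "y * H (2 * int n + 2) = y * h\<^sup>2 * h\<^sup>2" "y * H (2 * int n) = y * h\<^sup>2" unfolding 2 by (simp_all add: power2_eq_square power4_eq_xxxx mult.assoc)
    have s: "Suc (Suc n) = 3" "Suc n = 2" "n = 1" using 2 by auto
    have "Y 3 y = Y 1 y * Y 2 (y * h\<^sup>2) + scal (rec_coef y) (Y 1 (y * h\<^sup>2 * h\<^sup>2))" using LR unfolding s(1) unfolding s(2) unfolding s(3) .
    also have "\<dots> = Y 2 y * Y 1 (y * h\<^sup>2 * h\<^sup>2) + scal (rec_coef (y * h\<^sup>2)) (Y 1 y)"
      unfolding IH L2
      by (simp only: distrib_left distrib_right scal_mult_left scal_mult_right PI_Y mx_assoc) (simp only: add_ac)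
    finally show ?thesis unfolding e unfolding s(1) unfolding s(2) unfolding s(3) .
  next
    case (3 m)
    have e: "y * h\<^sup>2 * H (2 * int (Suc m) + 2) = y * H (2 * int n + 2)" "y * h\<^sup>2 * h\<^sup>2 * H (2 * int m + 2) = y * H (2 * int n + 2)"
      "y * h\<^sup>2 * H (2 * int (Suc m)) = y * H (2 * int n)" "y * h\<^sup>2 * h\<^sup>2 * H (2 * int m) = y * H (2 * int n)"
      unfolding mult_H_assoc 3 by (rule mult_H_cong, simp)+
    let ?A = "Y 1 (y * H (2 * int n + 2))" and ?c = "rec_coef (y * H (2 * int n))"
    have F2: "Fp (Suc m) (y * h\<^sup>2 * h\<^sup>2) \<noteq> 0" "Fp (Suc m) y \<noteq> 0" "Fp (Suc (Suc m)) (y * h\<^sup>2) \<noteq> 0" "Fp (Suc (Suc m)) y \<noteq> 0"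
      using Fp_neq_0[of "Suc m" "y * h\<^sup>2"] Fp_neq_0[of "Suc m" y] F1 3 by auto
    have I1: "Y (Suc n) (y * h\<^sup>2) = Y n (y * h\<^sup>2) * ?A + scal ?c (Y (Suc m) (y * h\<^sup>2))"
      using less.IH[of "Suc m", OF _ z(1) F2(3)] unfolding e using 3 by simp
    have I2: "Y n (y * h\<^sup>2 * h\<^sup>2) = Y (Suc m) (y * h\<^sup>2 * h\<^sup>2) * ?A + scal ?c (Y m (y * h\<^sup>2 * h\<^sup>2))"
      using less.IH[of m, OF _ z(2) F2(1)] unfolding e using 3 by simp
    have L1: "Y (Suc n) y = Y 1 y * Y n (y * h\<^sup>2) + scal (rec_coef y) (Y (Suc m) (y * h\<^sup>2 * h\<^sup>2))"
      using left_rec[OF y F2(4)] 3 by simp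
    have L2: "Y n y = Y 1 y * Y (Suc m) (y * h\<^sup>2) + scal (rec_coef y) (Y m (y * h\<^sup>2 * h\<^sup>2))"
      using left_rec[OF y F2(2)] 3 by simp
    \<comment> \<open>Both terms of the left expansion are expanded on the right. Collecting the
      terms with \<open>?A\<close> and those with \<open>?c\<close> leaves the left expansions of
      \<open>Y (Suc n) y\<close> and \<open>Y n y\<close>.\<close>
    show ?thesis unfolding LR I1 I2 unfolding L1 L2
      by (simp add: distrib_left distrib_right scal_add_right mx_assoc add_ac mult.commute)
  qed
qed

lemma transfer_0: "transfer h bd bd' N J v 0 u = 1\<^sub>m (site_dim N J)"
proof (rule mop_inj[OF len(2,1)])
  show "transfer h bd bd' N J v 0 u \<in> carrier_mat (prod_list ds) (prod_list ds)" by (rule transfer_carrier)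
  show "1\<^sub>m (site_dim N J) \<in> carrier_mat (prod_list ds) (prod_list ds)" unfolding prod_ds by simp
  have e: "u * h * H (int 0 - 1) = u" by (simp add: power_int_minus)
  have "trmx 0 u = PI ps ds" using Y_0[of "u * h", unfolded Y_def e] .
  then show "ent (mop ps ds ds (transfer h bd bd' N J v 0 u)) s t = ent (mop ps ds ds (1\<^sub>m (site_dim N J))) s t" for s t
    by (simp add: trmx_def PI_def prod_ds)
qed

lemma transfer_rec:
  assumes u: "u \<noteq> 0" and f: "f_norm h (Suc (Suc n)) u \<noteq> 0"
  shows "transfer h bd bd' N J v (int (Suc (Suc n))) u =
    transfer h bd bd' N J v (int (Suc n)) (u * inverse h) * transfer h bd bd' N J v 1 (u * H (int n + 1))
    + rec_coef (u * H (int n - 1)) \<cdot>\<^sub>m transfer h bd bd' N J v (int n) (u * inverse (h\<^sup>2))" (is "?l = ?a * ?b + ?c \<cdot>\<^sub>m ?d")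
proof (rule mop_inj[OF len(2,1)])
  note c = transfer_carrier
  show "?l \<in> carrier_mat (prod_list ds) (prod_list ds)" by (rule c)
  show "?a * ?b + ?c \<cdot>\<^sub>m ?d \<in> carrier_mat (prod_list ds) (prod_list ds)" by (intro add_carrier_mat smult_carrier_mat c)
  \<comment> \<open>Solves u = y q^((n+1)/2), the shift built into \<open>Y\<close> for spin
    (n+2)/2.\<close>
  define y where "y = u * H (- int n - 1)"
  have y: "y \<noteq> 0" using u by (simp add: y_def)
  have e: "y * H (int (Suc (Suc n)) - 1) = u * H 0" "y * H (int (Suc n) - 1) = u * H (- 1)" "y * H (int n - 1) = u * H (- 2)"
    "y * H (2 * int n + 2) * H (int 1 - 1) = u * H (int n + 1)" "y * H (2 * int n) = u * H (int n - 1)" "y * H (int (Suc n)) = u * H 0"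
    unfolding y_def mult_H_assoc by (rule mult_H_cong, simp)+
  have F: "Fp (Suc n) y \<noteq> 0" using f f_norm_Fp[OF y, of "Suc n"] unfolding e by simp
  have eq: "trmx (Suc (Suc n)) u = trmx (Suc n) (u * inverse h) * trmx 1 (u * H (int n + 1)) + scal ?c (trmx n (u * inverse (h\<^sup>2)))"
    using right_rec[OF y F] unfolding Y_def e by (simp add: power_int_minus)
  have "mop ps ds ds (?a * ?b + ?c \<cdot>\<^sub>m ?d) = mop ps ds ds ?a * mop ps ds ds ?b + scal ?c (mop ps ds ds ?d)"
    using len c by (subst mop_add) (auto simp: mop_smult mop_mult[symmetric] intro!: mult_carrier_mat)
  then show "ent (mop ps ds ds ?l) s t = ent (mop ps ds ds (?a * ?b + ?c \<cdot>\<^sub>m ?d)) s t" for s t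
    using eq by (simp add: trmx_def)
qed

lemma rec_coef_eq:
  assumes "d = Suc (Suc n)"
  shows "rec_coef (u * H (int n - 1)) = (\<Prod>n = 1..N. beta h (J n) (u * h powi (int d - 1) * v n) * beta h (J n) (u * h powi (int d - 1) * inverse (v n)))
    * (Gamma_minus h bd (u * h powi (int d - 3)) * Gamma_plus h bd' (u * h powi (int d - 3))
       / (qc (u^2 * (h\<^sup>2) powi int d) * qc (u^2 * (h\<^sup>2) powi (int d - 2))))"
proof -
  let ?y = "u * H (int n - 1)"
  have e: "?y * h\<^sup>2 = u * H (int d - 1)" "?y = u * H (int d - 3)" unfolding mult_H_assoc by (rule mult_H_cong, simp add: assms)+
  have p: "?y\<^sup>2 = u\<^sup>2 * H (2 * int n - 2)" using H_mult[of "int n - 1" "int n - 1"] by (simp add: power_mult_distrib power2_eq_square algebra_simps)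
  have g: "gg ?y 3 = qc (u^2 * (h\<^sup>2) powi int d)" "gg ?y 1 = qc (u^2 * (h\<^sup>2) powi (int d - 2))"
    unfolding gg_def cz_def p q_powi_H mult_H_assoc by (rule arg_cong[of _ _ qc], rule mult_H_cong, simp add: assms)+
  show ?thesis unfolding rec_coef_def site_del_beta e(1) g unfolding e(2) by (simp add: mult.commute)
qed

end

theorem proposition5p2:
  fixes q h :: complex
    and b b' :: boundary
    and N :: nat and J :: "nat \<Rightarrow> nat" and v :: "nat \<Rightarrow> complex"
  assumes "q \<noteq> 0" and "\<And>n::nat. n > 0 \<Longrightarrow> q ^ n \<noteq> 1" and "h^2 = q"
    and "k_plus b \<noteq> 0" and "k_minus b \<noteq> 0"
    and "N \<ge> 1"
    and "\<And>n. n \<in> {1..N} \<Longrightarrow> J n \<ge> 1"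
    and "\<And>n. n \<in> {1..N} \<Longrightarrow> v n \<noteq> 0"
  shows "(\<forall>d::nat. \<forall>u::complex. d \<ge> 1 \<longrightarrow> u \<noteq> 0 \<longrightarrow> f_norm h d u \<noteq> 0 \<longrightarrow>
      transfer h b b' N J v (int d) u =
        transfer h b b' N J v (int d - 1) (u * inverse h)
          * transfer h b b' N J v 1 (u * h powi (int d - 1))
        + ((\<Prod>n = 1..N. beta h (J n) (u * h powi (int d - 1) * v n)
                        * beta h (J n) (u * h powi (int d - 1) * inverse (v n)))
            * (Gamma_minus h b (u * h powi (int d - 3)) * Gamma_plus h b' (u * h powi (int d - 3))
               / (qc (u^2 * q powi int d) * qc (u^2 * q powi (int d - 2)))))
          \<cdot>\<^sub>m transfer h b b' N J v (int d - 2) (u * inverse q))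
    \<and> (\<forall>u. u \<noteq> 0 \<longrightarrow> transfer h b b' N J v 0 u = 1\<^sub>m (site_dim N J))
    \<and> (\<forall>u. transfer h b b' N J v (-1) u = 0\<^sub>m (site_dim N J) (site_dim N J))"
proof -
  have h: "h \<noteq> 0" "h ^ n \<noteq> 1" if "n > 0" for n :: nat
  proof -
    show "h \<noteq> 0" using assms(1,3) by auto
    have "q ^ n = (h ^ n)\<^sup>2" unfolding assms(3)[symmetric] by (simp only: power_mult[symmetric] mult.commute)
    then show "h ^ n \<noteq> 1" using assms(2)[OF that] by auto
  qed
  interpret chain h N J v b b' by unfold_locales (use h[of 1] h assms(7,8) in auto)
  have q: "q = h\<^sup>2" using assms(3) by simp
  have m1: "transfer h b b' N J v (-1) u = 0\<^sub>m (site_dim N J) (site_dim N J)" for u by (simp add: transfer_def Let_def)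
  have c: "transfer h b b' N J v a u \<in> carrier_mat (site_dim N J) (site_dim N J)" for a u using transfer_carrier unfolding prod_ds .
  show ?thesis
  proof (intro conjI allI impI)
    fix d :: nat and u assume d: "d \<ge> 1" and u: "u \<noteq> 0" and f: "f_norm h d u \<noteq> 0"
    show "transfer h b b' N J v (int d) u =
        transfer h b b' N J v (int d - 1) (u * inverse h)
          * transfer h b b' N J v 1 (u * h powi (int d - 1))
        + ((\<Prod>n = 1..N. beta h (J n) (u * h powi (int d - 1) * v n)
                        * beta h (J n) (u * h powi (int d - 1) * inverse (v n)))
            * (Gamma_minus h b (u * h powi (int d - 3)) * Gamma_plus h b' (u * h powi (int d - 3))
               / (qc (u^2 * q powi int d) * qc (u^2 * q powi (int d - 2)))))
          \<cdot>\<^sub>m transfer h b b' N J v (int d - 2) (u * inverse q)"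
    proof (cases "d = 1")
      case True
      \<comment> \<open>For spin 1/2 the last term is a multiple of the zero matrix and the spin 0
        factor is the identity.\<close>
      then show ?thesis using c[of 1 u] by (simp add: transfer_0 m1)
    next
      case False
      then obtain n where n: "d = Suc (Suc n)" using d by (intro that[of "d - 2"]) simp
      have i: "int d - 1 = int (Suc n)" "int d - 2 = int n" "int (Suc n) = int n + 1" using n by auto
      show ?thesis unfolding q unfolding rec_coef_eq[OF n, symmetric] unfolding i(1,2) using transfer_rec[OF u f[unfolded n]] unfolding n i(3) by simp
    qed
  qed (use transfer_0 m1 in auto)
qed

end
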